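(* Let $\mathcal G\rightrightarrows B$ be a Lie groupoid with source and target maps $\mathrm{src},\mathrm{trg}$, Lie algebroid $\mathcal A\to B$ and anchor $\#:\mathcal A\to TB$, endowed with a right-invariant source-fibre metric $\langle\cdot,\cdot\rangle$. Let $g\in\mathcal G$, $y=\mathrm{trg}(g)$, and let $\tilde X,\tilde Y\in T^{\mathrm{src}}_g\mathcal G$ be an orthonormal pair. Let $X,Y$ be local sections of $\mathcal A$, defined and orthonormal (at every point) near $y$, with $$X_y=dR_{g^{-1}}\tilde X,\qquad Y_y=dR_{g^{-1}}\tilde Y .$$ Define local sections $\alpha,\beta,\delta,B_X,B_Y$ of $\mathcal A$ by $$2\alpha=[X,Y]_{\mathcal A}=\mathrm{ad}_XY,\quad 2\delta=\mathrm{ad}^\dagger_XY+\mathrm{ad}^\dagger_YX,\quad 2\beta=\mathrm{ad}^\dagger_XY-\mathrm{ad}^\dagger_YX,\quad 2B_X=\mathrm{ad}^\dagger_XX,\quad 2B_Y=\mathrm{ad}^\dagger_YY .$$ Then the sectional curvature of $\mathcal G$ in the direction determined by $\tilde X,\tilde Y$ is $$C^{\mathcal G}(\tilde X,\tilde Y)=2\bigl(\#X\cdot\langle\alpha,Y\rangle-\#Y\cdot\langle\alpha,X\rangle\bigr)+\langle\delta,\delta\rangle+2\langle\alpha,\beta\rangle-3\langle\alpha,\alpha\rangle-4\langle B_X,B_Y\rangle ,$$ where the right-hand side is evaluated at $y$. Moreover the right-hand side is independent of the chosen local orthonormal extensions $X,Y$.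
   Context: Conventions. For a Lie groupoid $\mathcal G\rightrightarrows B$, products $hg$ are defined when $\mathrm{src}(h)=\mathrm{trg}(g)$; $\mathcal G_x=\mathrm{src}^{-1}(x)$ is the source fibre; $T^{\mathrm{src}}\mathcal G=\ker d\,\mathrm{src}$; for $g\in\mathcal G$ with $\mathrm{src}(g)=x$, $\mathrm{trg}(g)=y$, right multiplication is $R_g:\mathcal G_y\to\mathcal G_x$, $h\mapsto hg$. The Lie algebroid of $\mathcal G$ is the vector bundle $\mathcal A=\bigcup_{x}T_{\mathrm{id}_x}\mathcal G_x\to B$, with anchor $\#=d\,\mathrm{trg}$ restricted to $\mathcal A$, and bracket $[X,Y]_{\mathcal A}=[\tilde X,\tilde Y]_{T\mathcal G}\circ\mathrm{id}$, where $\tilde X_g=dR_gX_{\mathrm{trg}(g)}$ is the right-invariant extension of a section $X$. We write $\mathrm{ad}_XY=[X,Y]_{\mathcal A}$. A right-invariant source-fibre metric on $\mathcal G$ is a smooth metric on $T^{\mathrm{src}}\mathcal G$ with $\langle\tilde X,\tilde Y\rangle_{\mathcal G}(g)=\langle dR_{g^{-1}}\tilde X,dR_{g^{-1}}\tilde Y\rangle_{\mathcal A}(\mathrm{trg}(g))$; it is equivalent to a bundle metric on $\mathcal A$. Metric-adjoint: $\mathrm{ad}^\dagger_XZ$ is the section of $\mathcal A$ determined by $\langle Y,\mathrm{ad}^\dagger_XZ\rangle=\#X\cdot\langle Y,Z\rangle-\langle\mathrm{ad}_XY,Z\rangle$ for all sections $Y$. Curvature: on each source fibre, with Levi-Civita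 connection $\nabla$, $\mathcal R(X,Y)Z=\nabla_{[X,Y]}Z-\nabla_X\nabla_YZ+\nabla_Y\nabla_XZ$, and for an orthonormal pair the sectional curvature is $C(X,Y)=\langle\mathcal R(X,Y)X,Y\rangle$. $C^{\mathcal G}(\tilde X,\tilde Y)$ is the sectional curvature at $g$ of the source fibre through $g$. *)

theory Defs
  imports "HOL-Analysis.Analysis"
begin

section \<open>Smooth manifolds\<close>

(* C^n on an open set of a normed space, by iterated directional derivatives; in finite
   dimension this is the usual notion. *)
fun times_differentiable_on ::
    "nat \<Rightarrow> 'a::real_normed_vector set \<Rightarrow> ('a \<Rightarrow> 'b::real_normed_vector) \<Rightarrow> bool" where
  "times_differentiable_on 0 S f \<longleftrightarrow> continuous_on S f"
| "times_differentiable_on (Suc n) S f \<longleftrightarrow> (\<forall>x\<in>S. f differentiable (at x)) \<and>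
     (\<forall>v. times_differentiable_on n S (\<lambda>x. frechet_derivative f (at x) v))"

definition smooth_on :: "'a::real_normed_vector set \<Rightarrow> ('a \<Rightarrow> 'b::real_normed_vector) \<Rightarrow> bool" where
  "smooth_on S f \<longleftrightarrow> (\<forall>n. times_differentiable_on n S f)"

(* A chart is a domain U with a coordinate map; the carrier and the topology of a manifold
   are recovered from its atlas. *)
type_synonym ('p, 'e) atlas = "('p set \<times> ('p \<Rightarrow> 'e)) set"

definition mcarrier :: "('p, 'e) atlas \<Rightarrow> 'p set" where
  "mcarrier M = \<Union> (fst ` M)"

definition mtopology :: "('p, 'e::real_normed_vector) atlas \<Rightarrow> 'p topology" where
  "mtopology M = topology (\<lambda>W. W \<subseteq> mcarrier M \<and> (\<forall>(U, \<phi>)\<in>M. open (\<phi> ` (U \<inter> W))))"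

(* The model space is a finite-dimensional normed space rather than a euclidean_space, because
   the latter has positive dimension: a Lie group is a Lie groupoid over a point. *)
definition smooth_atlas :: "('p, 'e::real_normed_vector) atlas \<Rightarrow> bool" where
  "smooth_atlas M \<longleftrightarrow>
     (\<exists>K :: 'e set. finite K \<and> span K = UNIV) \<and>
     (\<forall>(U, \<phi>)\<in>M. inj_on \<phi> U \<and>
        (\<forall>(V, \<psi>)\<in>M. open (\<phi> ` (U \<inter> V)) \<and> smooth_on (\<phi> ` (U \<inter> V)) (\<psi> \<circ> inv_into U \<phi>)))"

definition smooth_manifold :: "('p, 'e::real_normed_vector) atlas \<Rightarrow> bool" where
  "smooth_manifold M \<longleftrightarrow>
     smooth_atlas M \<and> Hausdorff_space (mtopology M) \<and> second_countable (mtopology M)"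

definition vector_atlas :: "('e, 'e::real_normed_vector) atlas" where
  "vector_atlas = {(UNIV, \<lambda>x. x)}"

definition prod_atlas ::
    "('p, 'e) atlas \<Rightarrow> ('q, 'f) atlas \<Rightarrow> ('p \<times> 'q, 'e \<times> 'f) atlas" where
  "prod_atlas M N = {(U \<times> V, map_prod \<phi> \<psi>) | U \<phi> V \<psi>. (U, \<phi>) \<in> M \<and> (V, \<psi>) \<in> N}"

(* F is smooth on the open subset W of M. Openness of the chart domains of the coordinate
   expressions is continuity of F. *)
definition smooth_map_on ::
    "('p, 'e::real_normed_vector) atlas \<Rightarrow> ('q, 'f::real_normed_vector) atlas \<Rightarrow>
     'p set \<Rightarrow> ('p \<Rightarrow> 'q) \<Rightarrow> bool" where
  "smooth_map_on M N W F \<longleftrightarrow>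
     openin (mtopology M) W \<and> F ` W \<subseteq> mcarrier N \<and>
     (\<forall>(U, \<phi>)\<in>M. \<forall>(V, \<psi>)\<in>N.
        open (\<phi> ` {p \<in> U \<inter> W. F p \<in> V}) \<and>
        smooth_on (\<phi> ` {p \<in> U \<inter> W. F p \<in> V}) (\<psi> \<circ> F \<circ> inv_into U \<phi>))"

section \<open>Embedded submanifolds and tangent vectors\<close>

(* A subset S of M (here always M itself, a source fibre, or the manifold of composable pairs,
   all of them embedded submanifolds) carries the induced smooth structure: a map defined on S
   is smooth near p if it extends to a smooth map on a neighbourhood of p in M. *)
definition smooth_near ::
    "('p, 'e::real_normed_vector) atlas \<Rightarrow> ('q, 'f::real_normed_vector) atlas \<Rightarrow>
     'p set \<Rightarrow> 'p \<Rightarrow> ('p \<Rightarrow> 'q) \<Rightarrow> bool" where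
  "smooth_near M N S p F \<longleftrightarrow>
     (\<exists>W F'. p \<in> W \<and> smooth_map_on M N W F' \<and> (\<forall>q\<in>S \<inter> W. F q = F' q))"

abbreviation smooth_fun ::
    "('p, 'e::real_normed_vector) atlas \<Rightarrow> 'p set \<Rightarrow> 'p \<Rightarrow> ('p \<Rightarrow> real) \<Rightarrow> bool" where
  "smooth_fun M S p f \<equiv> smooth_near M (vector_atlas :: (real, real) atlas) S p f"

definition smooth_map ::
    "('p, 'e::real_normed_vector) atlas \<Rightarrow> 'p set \<Rightarrow>
     ('q, 'f::real_normed_vector) atlas \<Rightarrow> 'q set \<Rightarrow> ('p \<Rightarrow> 'q) \<Rightarrow> bool" where
  "smooth_map M S N T F \<longleftrightarrow> F ` S \<subseteq> T \<and> (\<forall>p\<in>S. smooth_near M N S p F)"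

(* Tangent vectors of S at p are the derivations f \<mapsto> (f \<circ> c)'(0) along smooth curves c in S
   through p. They act on functions smooth on S near p and are set to 0 on all other
   functions, so that equal tangent vectors are equal functionals. *)
type_synonym 'p tvec = "('p \<Rightarrow> real) \<Rightarrow> real"

definition smooth_curve ::
    "('p, 'e::real_normed_vector) atlas \<Rightarrow> 'p set \<Rightarrow> (real \<Rightarrow> 'p) \<Rightarrow> bool" where
  "smooth_curve M S c \<longleftrightarrow>
     (\<exists>\<epsilon>>0. smooth_map_on vector_atlas M {-\<epsilon><..<\<epsilon>} c \<and> c ` {-\<epsilon><..<\<epsilon>} \<subseteq> S)"

definition velocity ::
    "('p, 'e::real_normed_vector) atlas \<Rightarrow> 'p set \<Rightarrow> (real \<Rightarrow> 'p) \<Rightarrow> 'p tvec" where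
  "velocity M S c = (\<lambda>f. if smooth_fun M S (c 0) f then deriv (f \<circ> c) 0 else 0)"

definition tangent_space ::
    "('p, 'e::real_normed_vector) atlas \<Rightarrow> 'p set \<Rightarrow> 'p \<Rightarrow> 'p tvec set" where
  "tangent_space M S p = {velocity M S c | c. smooth_curve M S c \<and> c 0 = p}"

definition tadd :: "'p tvec \<Rightarrow> 'p tvec \<Rightarrow> 'p tvec" where
  "tadd u v = (\<lambda>f. u f + v f)"

definition tscale :: "real \<Rightarrow> 'p tvec \<Rightarrow> 'p tvec" where
  "tscale a v = (\<lambda>f. a * v f)"

abbreviation tdiff :: "'p tvec \<Rightarrow> 'p tvec \<Rightarrow> 'p tvec" where
  "tdiff u v \<equiv> tadd u (tscale (-1) v)"

(* The differential of F at p, where q = F p and F takes values in the subset T of N. *)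
definition pushforward ::
    "('q, 'f::real_normed_vector) atlas \<Rightarrow> 'q set \<Rightarrow> ('p \<Rightarrow> 'q) \<Rightarrow> 'q \<Rightarrow> 'p tvec \<Rightarrow> 'q tvec" where
  "pushforward N T F q v = (\<lambda>f. if smooth_fun N T q f then v (f \<circ> F) else 0)"

definition submersion ::
    "('p, 'e::real_normed_vector) atlas \<Rightarrow> ('q, 'f::real_normed_vector) atlas \<Rightarrow>
     ('p \<Rightarrow> 'q) \<Rightarrow> bool" where
  "submersion M N F \<longleftrightarrow> smooth_map M (mcarrier M) N (mcarrier N) F \<and>
     (\<forall>p\<in>mcarrier M. pushforward N (mcarrier N) F (F p) ` tangent_space M (mcarrier M) p
        = tangent_space N (mcarrier N) (F p))"

section \<open>Vector fields, Levi-Civita connection, sectional curvature\<close>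

definition smooth_funs_on ::
    "('p, 'e::real_normed_vector) atlas \<Rightarrow> 'p set \<Rightarrow> 'p set \<Rightarrow> ('p \<Rightarrow> real) \<Rightarrow> bool" where
  "smooth_funs_on M S W f \<longleftrightarrow> (\<forall>p\<in>W. smooth_fun M S p f)"

(* Smooth vector fields of S on its relatively open subset W. *)
definition vector_field ::
    "('p, 'e::real_normed_vector) atlas \<Rightarrow> 'p set \<Rightarrow> 'p set \<Rightarrow> ('p \<Rightarrow> 'p tvec) \<Rightarrow> bool" where
  "vector_field M S W V \<longleftrightarrow>
     openin (subtopology (mtopology M) S) W \<and>
     (\<forall>p\<in>W. V p \<in> tangent_space M S p) \<and>
     (\<forall>p\<in>W. \<forall>f. smooth_fun M S p f \<longrightarrow> smooth_fun M S p (\<lambda>q. V q f))"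

definition lie_bracket ::
    "('p, 'e::real_normed_vector) atlas \<Rightarrow> 'p set \<Rightarrow>
     ('p \<Rightarrow> 'p tvec) \<Rightarrow> ('p \<Rightarrow> 'p tvec) \<Rightarrow> 'p \<Rightarrow> 'p tvec" where
  "lie_bracket M S V W p =
     (\<lambda>f. if smooth_fun M S p f then V p (\<lambda>q. W q f) - W p (\<lambda>q. V q f) else 0)"

definition inner_product_on :: "'p tvec set \<Rightarrow> ('p tvec \<Rightarrow> 'p tvec \<Rightarrow> real) \<Rightarrow> bool" where
  "inner_product_on T ip \<longleftrightarrow>
     (\<forall>u\<in>T. \<forall>v\<in>T. ip u v = ip v u) \<and>
     (\<forall>u\<in>T. \<forall>v\<in>T. \<forall>w\<in>T. ip (tadd u v) w = ip u w + ip v w) \<and>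
     (\<forall>a. \<forall>u\<in>T. \<forall>w\<in>T. ip (tscale a u) w = a * ip u w) \<and>
     (\<forall>u\<in>T. u \<noteq> (\<lambda>f. 0) \<longrightarrow> ip u u > 0)"

(* A connection is a morphism of sheaves: it acts on vector fields over every open W \<subseteq> S,
   compatibly with restriction (first clause below). *)
definition affine_connection ::
    "('p, 'e::real_normed_vector) atlas \<Rightarrow> 'p set \<Rightarrow>
     (('p \<Rightarrow> 'p tvec) \<Rightarrow> ('p \<Rightarrow> 'p tvec) \<Rightarrow> ('p \<Rightarrow> 'p tvec)) \<Rightarrow> bool" where
  "affine_connection M S D \<longleftrightarrow> (\<forall>W X Y. vector_field M S W X \<and> vector_field M S W Y \<longrightarrow>
     (\<forall>X' Y'. (\<forall>p\<in>W. X' p = X p \<and> Y' p = Y p) \<longrightarrow> (\<forall>p\<in>W. D X' Y' p = D X Y p)) \<and>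
     vector_field M S W (D X Y) \<and>
     (\<forall>Z. vector_field M S W Z \<longrightarrow> (\<forall>p\<in>W.
        D (\<lambda>q. tadd (X q) (Z q)) Y p = tadd (D X Y p) (D Z Y p) \<and>
        D X (\<lambda>q. tadd (Y q) (Z q)) p = tadd (D X Y p) (D X Z p))) \<and>
     (\<forall>f. smooth_funs_on M S W f \<longrightarrow> (\<forall>p\<in>W.
        D (\<lambda>q. tscale (f q) (X q)) Y p = tscale (f p) (D X Y p) \<and>
        D X (\<lambda>q. tscale (f q) (Y q)) p
          = tadd (tscale (X p f) (Y p)) (tscale (f p) (D X Y p)))))"

definition is_levi_civita ::
    "('p, 'e::real_normed_vector) atlas \<Rightarrow> 'p set \<Rightarrow> ('p \<Rightarrow> 'p tvec \<Rightarrow> 'p tvec \<Rightarrow> real) \<Rightarrow>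
     (('p \<Rightarrow> 'p tvec) \<Rightarrow> ('p \<Rightarrow> 'p tvec) \<Rightarrow> ('p \<Rightarrow> 'p tvec)) \<Rightarrow> bool" where
  "is_levi_civita M S m D \<longleftrightarrow>
     affine_connection M S D \<and>
     (\<forall>W X Y Z. vector_field M S W X \<and> vector_field M S W Y \<and> vector_field M S W Z \<longrightarrow>
        (\<forall>p\<in>W. X p (\<lambda>q. m q (Y q) (Z q)) = m p (D X Y p) (Z p) + m p (Y p) (D X Z p))) \<and>
     (\<forall>W X Y. vector_field M S W X \<and> vector_field M S W Y \<longrightarrow>
        (\<forall>p\<in>W. tdiff (D X Y p) (D Y X p) = lie_bracket M S X Y p))"

(* Unique on smooth vector fields; its values on other arguments are irrelevant. *)
definition levi_civita ::
    "('p, 'e::real_normed_vector) atlas \<Rightarrow> 'p set \<Rightarrow> ('p \<Rightarrow> 'p tvec \<Rightarrow> 'p tvec \<Rightarrow> real) \<Rightarrow>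
     ('p \<Rightarrow> 'p tvec) \<Rightarrow> ('p \<Rightarrow> 'p tvec) \<Rightarrow> ('p \<Rightarrow> 'p tvec)" where
  "levi_civita M S m = (SOME D. is_levi_civita M S m D)"

(* Sign convention: R(X,Y)Z = \<nabla>_[X,Y] Z - \<nabla>_X \<nabla>_Y Z + \<nabla>_Y \<nabla>_X Z. *)
definition curvature ::
    "('p, 'e::real_normed_vector) atlas \<Rightarrow> 'p set \<Rightarrow> ('p \<Rightarrow> 'p tvec \<Rightarrow> 'p tvec \<Rightarrow> real) \<Rightarrow>
     ('p \<Rightarrow> 'p tvec) \<Rightarrow> ('p \<Rightarrow> 'p tvec) \<Rightarrow> ('p \<Rightarrow> 'p tvec) \<Rightarrow> 'p \<Rightarrow> 'p tvec" where
  "curvature M S m X Y Z p =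
     (let D = levi_civita M S m in
        tadd (tdiff (D (lie_bracket M S X Y) Z p) (D X (D Y Z) p)) (D Y (D X Z) p))"

(* The sectional curvature of the orthonormal pair u, v in T_p S. As the curvature is a tensor,
   the number does not depend on the local fields U, V extending u, v. *)
definition sectional_curvature ::
    "('p, 'e::real_normed_vector) atlas \<Rightarrow> 'p set \<Rightarrow> ('p \<Rightarrow> 'p tvec \<Rightarrow> 'p tvec \<Rightarrow> real) \<Rightarrow>
     'p \<Rightarrow> 'p tvec \<Rightarrow> 'p tvec \<Rightarrow> real" where
  "sectional_curvature M S m p u v =
     (THE c. \<exists>W U V. p \<in> W \<and> vector_field M S W U \<and> vector_field M S W V \<and>
        U p = u \<and> V p = v \<and> c = m p (curvature M S m U V U p) v)"

section \<open>Lie groupoids\<close>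

(* arr, obj: atlases of the manifolds of arrows and of objects; mul h g is the product hg,
   relevant only if src h = trg g. *)
record ('g, 'b, 'e, 'f) groupoid_data =
  arr :: "('g, 'e) atlas"
  obj :: "('b, 'f) atlas"
  src :: "'g \<Rightarrow> 'b"
  trg :: "'g \<Rightarrow> 'b"
  ident :: "'b \<Rightarrow> 'g"
  mul :: "'g \<Rightarrow> 'g \<Rightarrow> 'g"
  ginv :: "'g \<Rightarrow> 'g"

abbreviation arrows :: "('g, 'b, 'e, 'f) groupoid_data \<Rightarrow> 'g set" where
  "arrows \<G> \<equiv> mcarrier (arr \<G>)"

abbreviation objects :: "('g, 'b, 'e, 'f) groupoid_data \<Rightarrow> 'b set" where
  "objects \<G> \<equiv> mcarrier (obj \<G>)"

definition composable :: "('g, 'b, 'e, 'f) groupoid_data \<Rightarrow> ('g \<times> 'g) set" where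
  "composable \<G> = {(h, g). h \<in> arrows \<G> \<and> g \<in> arrows \<G> \<and> src \<G> h = trg \<G> g}"

definition src_fibre :: "('g, 'b, 'e, 'f) groupoid_data \<Rightarrow> 'b \<Rightarrow> 'g set" where
  "src_fibre \<G> x = {g \<in> arrows \<G>. src \<G> g = x}"

definition groupoid :: "('g, 'b, 'e, 'f) groupoid_data \<Rightarrow> bool" where
  "groupoid \<G> \<longleftrightarrow>
     (\<forall>g\<in>arrows \<G>. src \<G> g \<in> objects \<G> \<and> trg \<G> g \<in> objects \<G>) \<and>
     (\<forall>x\<in>objects \<G>. ident \<G> x \<in> arrows \<G> \<and> src \<G> (ident \<G> x) = x \<and> trg \<G> (ident \<G> x) = x) \<and>
     (\<forall>(h, g)\<in>composable \<G>. mul \<G> h g \<in> arrows \<G> \<and>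
        src \<G> (mul \<G> h g) = src \<G> g \<and> trg \<G> (mul \<G> h g) = trg \<G> h) \<and>
     (\<forall>k h g. (k, h) \<in> composable \<G> \<and> (h, g) \<in> composable \<G> \<longrightarrow>
        mul \<G> (mul \<G> k h) g = mul \<G> k (mul \<G> h g)) \<and>
     (\<forall>g\<in>arrows \<G>. mul \<G> g (ident \<G> (src \<G> g)) = g \<and> mul \<G> (ident \<G> (trg \<G> g)) g = g) \<and>
     (\<forall>g\<in>arrows \<G>. ginv \<G> g \<in> arrows \<G> \<and>
        src \<G> (ginv \<G> g) = trg \<G> g \<and> trg \<G> (ginv \<G> g) = src \<G> g \<and>
        mul \<G> (ginv \<G> g) g = ident \<G> (src \<G> g) \<and> mul \<G> g (ginv \<G> g) = ident \<G> (trg \<G> g))"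

(* As usual for Lie groupoids, only the base and the source fibres are required to be
   Hausdorff; the manifold of arrows may or may not be. *)
definition lie_groupoid ::
    "('g, 'b, 'e::real_normed_vector, 'f::real_normed_vector) groupoid_data \<Rightarrow> bool" where
  "lie_groupoid \<G> \<longleftrightarrow>
     groupoid \<G> \<and>
     smooth_manifold (obj \<G>) \<and> smooth_atlas (arr \<G>) \<and>
     (\<forall>x\<in>objects \<G>. Hausdorff_space (subtopology (mtopology (arr \<G>)) (src_fibre \<G> x))) \<and>
     submersion (arr \<G>) (obj \<G>) (src \<G>) \<and>
     submersion (arr \<G>) (obj \<G>) (trg \<G>) \<and>
     smooth_map (obj \<G>) (objects \<G>) (arr \<G>) (arrows \<G>) (ident \<G>) \<and>
     smooth_map (arr \<G>) (arrows \<G>) (arr \<G>) (arrows \<G>) (ginv \<G>) \<and>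
     smooth_map (prod_atlas (arr \<G>) (arr \<G>)) (composable \<G>) (arr \<G>) (arrows \<G>)
       (\<lambda>(h, g). mul \<G> h g)"

(* The fibre at g of ker (d src), realised as the tangent space at g of the source fibre. *)
definition src_tangent ::
    "('g, 'b, 'e::real_normed_vector, 'f) groupoid_data \<Rightarrow> 'g \<Rightarrow> 'g tvec set" where
  "src_tangent \<G> g = tangent_space (arr \<G>) (src_fibre \<G> (src \<G> g)) g"

(* The differential at h of right multiplication by g, from the tangent space at h of the
   source fibre over trg g to the tangent space at hg of the source fibre over src g. *)
definition dR ::
    "('g, 'b, 'e::real_normed_vector, 'f) groupoid_data \<Rightarrow> 'g \<Rightarrow> 'g \<Rightarrow> 'g tvec \<Rightarrow> 'g tvec" where
  "dR \<G> g h = pushforward (arr \<G>) (src_fibre \<G> (src \<G> g)) (\<lambda>k. mul \<G> k g) (mul \<G> h g)"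

section \<open>The Lie algebroid\<close>

definition algebroid_fibre ::
    "('g, 'b, 'e::real_normed_vector, 'f) groupoid_data \<Rightarrow> 'b \<Rightarrow> 'g tvec set" where
  "algebroid_fibre \<G> x = src_tangent \<G> (ident \<G> x)"

definition algebroid_section ::
    "('g, 'b, 'e::real_normed_vector, 'f::real_normed_vector) groupoid_data \<Rightarrow>
     'b set \<Rightarrow> ('b \<Rightarrow> 'g tvec) \<Rightarrow> bool" where
  "algebroid_section \<G> U X \<longleftrightarrow>
     openin (mtopology (obj \<G>)) U \<and>
     (\<forall>x\<in>U. X x \<in> algebroid_fibre \<G> x) \<and>
     (\<forall>x\<in>U. \<forall>f. smooth_fun (arr \<G>) (arrows \<G>) (ident \<G> x) f \<longrightarrow>
        smooth_fun (obj \<G>) (objects \<G>) x (\<lambda>z. X z f))"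

definition anchor ::
    "('g, 'b, 'e::real_normed_vector, 'f::real_normed_vector) groupoid_data \<Rightarrow>
     ('b \<Rightarrow> 'g tvec) \<Rightarrow> 'b \<Rightarrow> 'b tvec" where
  "anchor \<G> X x = pushforward (obj \<G>) (objects \<G>) (trg \<G>) x (X x)"

definition right_inv_ext ::
    "('g, 'b, 'e::real_normed_vector, 'f) groupoid_data \<Rightarrow> ('b \<Rightarrow> 'g tvec) \<Rightarrow> 'g \<Rightarrow> 'g tvec" where
  "right_inv_ext \<G> X g = dR \<G> g (ident \<G> (trg \<G> g)) (X (trg \<G> g))"

(* [X,Y] = ad_X Y. The right-invariant extensions are tangent to the source fibres, so their
   bracket at ident x is computed in the source fibre over x. *)
definition ad ::
    "('g, 'b, 'e::real_normed_vector, 'f) groupoid_data \<Rightarrow>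
     ('b \<Rightarrow> 'g tvec) \<Rightarrow> ('b \<Rightarrow> 'g tvec) \<Rightarrow> 'b \<Rightarrow> 'g tvec" where
  "ad \<G> X Y x = lie_bracket (arr \<G>) (src_fibre \<G> x)
                  (right_inv_ext \<G> X) (right_inv_ext \<G> Y) (ident \<G> x)"

(* m g is the inner product on src_tangent g. *)
definition src_fibre_metric ::
    "('g, 'b, 'e::real_normed_vector, 'f) groupoid_data \<Rightarrow>
     ('g \<Rightarrow> 'g tvec \<Rightarrow> 'g tvec \<Rightarrow> real) \<Rightarrow> bool" where
  "src_fibre_metric \<G> m \<longleftrightarrow>
     (\<forall>g\<in>arrows \<G>. inner_product_on (src_tangent \<G> g) (m g)) \<and>
     (\<forall>W V V'.
        openin (mtopology (arr \<G>)) W \<and>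
        (\<forall>g\<in>W. V g \<in> src_tangent \<G> g \<and> V' g \<in> src_tangent \<G> g) \<and>
        (\<forall>g\<in>W. \<forall>f. smooth_fun (arr \<G>) (arrows \<G>) g f \<longrightarrow>
           smooth_fun (arr \<G>) (arrows \<G>) g (\<lambda>h. V h f) \<and>
           smooth_fun (arr \<G>) (arrows \<G>) g (\<lambda>h. V' h f))
        \<longrightarrow> (\<forall>g\<in>W. smooth_fun (arr \<G>) (arrows \<G>) g (\<lambda>h. m h (V h) (V' h))))"

definition right_invariant_metric ::
    "('g, 'b, 'e::real_normed_vector, 'f) groupoid_data \<Rightarrow>
     ('g \<Rightarrow> 'g tvec \<Rightarrow> 'g tvec \<Rightarrow> real) \<Rightarrow> bool" where
  "right_invariant_metric \<G> m \<longleftrightarrow> src_fibre_metric \<G> m \<and>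
     (\<forall>g\<in>arrows \<G>. \<forall>u\<in>src_tangent \<G> g. \<forall>v\<in>src_tangent \<G> g.
        m g u v = m (ident \<G> (trg \<G> g)) (dR \<G> (ginv \<G> g) g u) (dR \<G> (ginv \<G> g) g v))"

definition algebroid_inner ::
    "('g, 'b, 'e, 'f) groupoid_data \<Rightarrow> ('g \<Rightarrow> 'g tvec \<Rightarrow> 'g tvec \<Rightarrow> real) \<Rightarrow>
     ('b \<Rightarrow> 'g tvec) \<Rightarrow> ('b \<Rightarrow> 'g tvec) \<Rightarrow> 'b \<Rightarrow> real" where
  "algebroid_inner \<G> m X Y x = m (ident \<G> x) (X x) (Y x)"

(* The metric adjoint, determined pointwise by testing against all local sections Y. *)
definition ad_dagger ::
    "('g, 'b, 'e::real_normed_vector, 'f::real_normed_vector) groupoid_data \<Rightarrow>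
     ('g \<Rightarrow> 'g tvec \<Rightarrow> 'g tvec \<Rightarrow> real) \<Rightarrow>
     ('b \<Rightarrow> 'g tvec) \<Rightarrow> ('b \<Rightarrow> 'g tvec) \<Rightarrow> 'b \<Rightarrow> 'g tvec" where
  "ad_dagger \<G> m X Z x =
     (THE w. w \<in> algebroid_fibre \<G> x \<and>
        (\<forall>U Y. x \<in> U \<and> algebroid_section \<G> U Y \<longrightarrow>
           m (ident \<G> x) (Y x) w =
             anchor \<G> X x (algebroid_inner \<G> m Y Z) - algebroid_inner \<G> m (ad \<G> X Y) Z x))"

definition orthonormal_extension ::
    "('g, 'b, 'e::real_normed_vector, 'f::real_normed_vector) groupoid_data \<Rightarrow>
     ('g \<Rightarrow> 'g tvec \<Rightarrow> 'g tvec \<Rightarrow> real) \<Rightarrow> 'g \<Rightarrow> 'g tvec \<Rightarrow> 'g tvec \<Rightarrow>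
     ('b \<Rightarrow> 'g tvec) \<Rightarrow> ('b \<Rightarrow> 'g tvec) \<Rightarrow> bool" where
  "orthonormal_extension \<G> m g u v X Y \<longleftrightarrow>
     (\<exists>U. trg \<G> g \<in> U \<and> algebroid_section \<G> U X \<and> algebroid_section \<G> U Y \<and>
        (\<forall>x\<in>U. algebroid_inner \<G> m X X x = 1 \<and> algebroid_inner \<G> m Y Y x = 1 \<and>
               algebroid_inner \<G> m X Y x = 0)) \<and>
     X (trg \<G> g) = dR \<G> (ginv \<G> g) g u \<and> Y (trg \<G> g) = dR \<G> (ginv \<G> g) g v"

definition curvature_formula ::
    "('g, 'b, 'e::real_normed_vector, 'f::real_normed_vector) groupoid_data \<Rightarrow>
     ('g \<Rightarrow> 'g tvec \<Rightarrow> 'g tvec \<Rightarrow> real) \<Rightarrow>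
     ('b \<Rightarrow> 'g tvec) \<Rightarrow> ('b \<Rightarrow> 'g tvec) \<Rightarrow> 'b \<Rightarrow> real" where
  "curvature_formula \<G> m X Y y =
     (let ip = algebroid_inner \<G> m;
          ad\<^sub>m = ad_dagger \<G> m;
          \<alpha> = (\<lambda>x. tscale (1/2) (ad \<G> X Y x));
          \<delta> = (\<lambda>x. tscale (1/2) (tadd (ad\<^sub>m X Y x) (ad\<^sub>m Y X x)));
          \<beta> = (\<lambda>x. tscale (1/2) (tdiff (ad\<^sub>m X Y x) (ad\<^sub>m Y X x)));
          B\<^sub>X = (\<lambda>x. tscale (1/2) (ad\<^sub>m X X x));
          B\<^sub>Y = (\<lambda>x. tscale (1/2) (ad\<^sub>m Y Y x))
      in 2 * (anchor \<G> X y (ip \<alpha> Y) - anchor \<G> Y y (ip \<alpha> X))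
         + ip \<delta> \<delta> y + 2 * ip \<alpha> \<beta> y - 3 * ip \<alpha> \<alpha> y - 4 * ip B\<^sub>X B\<^sub>Y y)"

end

theory Submission
  imports Defs
begin

text \<open>
  Near every arrow a slice chart \<open>\<kappa>\<close> straightens the source map: \<open>src q = src r\<close> iff \<open>A (\<kappa> q) = A (\<kappa> r)\<close>
  for a linear \<open>A\<close>. The coordinate fields along a basis of the kernel of \<open>A\<close> are commuting frames of all
  source fibres at once, so on each fibre the Koszul formula defines the Levi-Civita connection, and
  its curvature is a tensor that can be computed with any local fields, in particular with the
  right-invariant extensions of \<open>X\<close> and \<open>Y\<close>.

  Right translation identifies brackets and inner products of right-invariant fields with those of
  sections at the target, and derivatives of functions of the target with the anchor. For sections
  \<open>X\<close>, \<open>Z\<close> with constant inner product, the Koszul formula then reads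
  \<open>2 \<nabla>_X Z = ad_dagger X Z + ad_dagger Z X + ad X Z\<close>. So \<open>\<nabla>_X Y = \<delta> + \<alpha>\<close>, \<open>\<nabla>_Y X = \<delta> - \<alpha>\<close>, \<open>\<nabla>_X X = 2 B_X\<close>,
  \<open>\<nabla>_Y Y = 2 B_Y\<close>; and \<open>\<langle>\<nabla>_[X,Y] X, Y\<rangle>\<close> comes from one more application of the Koszul formula, the
  brackets with \<open>\<alpha>\<close> being absorbed by the defining property of \<open>ad_dagger\<close>.
\<close>

section \<open>Iterated differentiability\<close>

text \<open>Source fibres have no atlas of their own: smoothness along a fibre means local extension
  to the manifold of arrows, and tangent vectors are bare functionals, so even closure of a tangent
  space under addition has to be read off from a frame. One frame must serve all fibres because the
  metric is assumed smooth only on vertical fields over open sets of arrows.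
  \<open>levi_civita\<close>, \<open>sectional_curvature\<close> and \<open>ad_dagger\<close> are
  given by choice or description. Each becomes usable once some expression is shown to be linear
  over functions: a Riesz argument gives existence for the first and the third, tensoriality makes
  the second well defined. Right-invariant extensions must be shown smooth although multiplication
  is smooth only along composable pairs. The constants arise as follows. The curvature identity has
  3/2 before the derivatives of \<open>[X,Y]\<close>, and absorbing two iterated brackets removes
  1/2; the rest, 1, is 2 for \<alpha>. The square of \<open>[X,Y]\<close> collects -1/2 from the
  curvature identity and -1/4 from the product of \<delta> + \<alpha> and \<delta> - \<alpha>; in
  total -3/4, which is -3 for \<alpha>.\<close>

lemma td_cong:
  assumes "open S" "\<And>x. x \<in> S \<Longrightarrow> f x = g x" "times_differentiable_on n S f"
  shows "times_differentiable_on n S g"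
  using assms
proof (induction n arbitrary: f g)
  case 0
  then show ?case by (simp cong: continuous_on_cong)
next
  case (Suc n)
  have d: "(g has_derivative frechet_derivative f (at x)) (at x)" if "x \<in> S" for x
  proof (rule has_derivative_transform_within_open[of f _ _ _ S])
    show "(f has_derivative frechet_derivative f (at x)) (at x)"
      using Suc.prems(3) that frechet_derivative_works by auto
  qed (use Suc.prems that in blast)+
  then have e: "frechet_derivative f (at x) = frechet_derivative g (at x)" if "x \<in> S" for x
    using that frechet_derivative_at by blast
  have "times_differentiable_on n S (\<lambda>x. frechet_derivative g (at x) v)" for v
  proof (rule Suc.IH[where f="\<lambda>x. frechet_derivative f (at x) v"])
    show "times_differentiable_on n S (\<lambda>x. frechet_derivative f (at x) v)"
      using Suc.prems(3) by simp
  qed (use Suc.prems(1) e in simp_all)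
  with d show ?case
    by (auto simp: differentiable_def)
qed

text \<open>Derivatives are unique, so any explicit derivative may replace
  \<open>frechet_derivative\<close>; on an open set this also preserves the higher orders. The
  closure rules below are inductions through this rule.\<close>

lemma td_SucI:
  assumes "open S" "\<And>x. x \<in> S \<Longrightarrow> (f has_derivative f' x) (at x)"
    "\<And>v. times_differentiable_on n S (\<lambda>x. f' x v)"
  shows "times_differentiable_on (Suc n) S f"
proof -
  have e: "f' x = frechet_derivative f (at x)" if "x \<in> S" for x
    using that assms(2) frechet_derivative_at by blast
  have "times_differentiable_on n S (\<lambda>x. frechet_derivative f (at x) v)" for v
    by (rule td_cong[OF assms(1) _ assms(3)]) (simp add: e)
  then show ?thesis using assms(2) by (auto simp: differentiable_def)
qed

lemma td_SucD:
  assumes "times_differentiable_on (Suc n) S f" "x \<in> S"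
  shows "(f has_derivative frechet_derivative f (at x)) (at x)"
  using assms frechet_derivative_works by auto

lemma td_Suc_imp: "times_differentiable_on (Suc n) S f \<Longrightarrow> times_differentiable_on n S f"
proof (induction n arbitrary: f)
  case 0
  then have "f differentiable_on S"
    by (simp add: differentiable_on_def differentiable_at_withinI)
  then show ?case
    by (simp add: differentiable_imp_continuous_on)
next
  case (Suc n)
  then show ?case by (metis times_differentiable_on.simps(2))
qed

lemma td_subset:
  "times_differentiable_on n S f \<Longrightarrow> T \<subseteq> S \<Longrightarrow> times_differentiable_on n T f"
  by (induction n arbitrary: f) (auto intro: continuous_on_subset)

lemma td_local:
  assumes "\<And>x. x \<in> S \<Longrightarrow> \<exists>T. open T \<and> x \<in> T \<and> times_differentiable_on n T f"
  shows "times_differentiable_on n S f"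
  using assms
proof (induction n arbitrary: f)
  case 0
  have "continuous (at x) f" if "x \<in> S" for x
    using 0[OF that] by (auto simp: continuous_on_eq_continuous_at)
  then show ?case by (simp add: continuous_at_imp_continuous_on)
next
  case (Suc n)
  have "times_differentiable_on n S (\<lambda>x. frechet_derivative f (at x) v)" for v
  proof (rule Suc.IH)
    fix x assume "x \<in> S"
    then obtain T where "open T" "x \<in> T" "times_differentiable_on (Suc n) T f"
      using Suc.prems by blast
    then show "\<exists>T. open T \<and> x \<in> T \<and>
        times_differentiable_on n T (\<lambda>x. frechet_derivative f (at x) v)" by auto
  qed
  moreover have "f differentiable at x" if "x \<in> S" for x
    using Suc.prems[OF that] by auto
  ultimately show ?case by simp
qed

section \<open>Closure of iterated differentiability under algebraic operations\<close>

lemma td_const: "open S \<Longrightarrow> times_differentiable_on n S (\<lambda>x. c)"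
proof (induction n arbitrary: c)
  case (Suc n)
  then show ?case by (intro td_SucI[where f'="\<lambda>x v. 0"]) auto
qed simp

lemma td_bounded_linear_comp:
  assumes "open S" "bounded_linear L" "times_differentiable_on n S f"
  shows "times_differentiable_on n S (\<lambda>x. L (f x))"
  using assms(3)
proof (induction n arbitrary: f)
  case 0
  then show ?case using assms(2) by (auto intro: bounded_linear.continuous_on)
next
  case (Suc n)
  show ?case
  proof (rule td_SucI[OF assms(1)])
    fix x assume "x \<in> S"
    then show "((\<lambda>x. L (f x)) has_derivative (\<lambda>v. L (frechet_derivative f (at x) v))) (at x)"
      by (intro bounded_linear.has_derivative[OF assms(2)] td_SucD[OF Suc.prems])
  qed (use Suc in auto)
qed

lemma td_id: "open S \<Longrightarrow> times_differentiable_on n S (\<lambda>x. x)"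
proof (cases n)
  case (Suc m)
  assume "open S"
  then show ?thesis unfolding Suc
    by (intro td_SucI[where f'="\<lambda>x v. v"]) (auto intro: td_const)
qed auto

lemma td_bounded_linear:
  "open S \<Longrightarrow> bounded_linear L \<Longrightarrow> times_differentiable_on n S L"
  using td_bounded_linear_comp[OF _ _ td_id] by blast

lemma td_add:
  assumes "open S" "times_differentiable_on n S f" "times_differentiable_on n S g"
  shows "times_differentiable_on n S (\<lambda>x. f x + g x)"
  using assms(2,3)
proof (induction n arbitrary: f g)
  case 0
  then show ?case by (auto intro: continuous_on_add)
next
  case (Suc n)
  show ?case
  proof (rule td_SucI[OF assms(1)])
    fix x assume "x \<in> S"
    then show "((\<lambda>x. f x + g x) has_derivative
       (\<lambda>v. frechet_derivative f (at x) v + frechet_derivative g (at x) v)) (at x)"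
      by (intro has_derivative_add td_SucD[OF Suc.prems(1)] td_SucD[OF Suc.prems(2)])
  qed (use Suc in auto)
qed

lemma td_scaleR:
  assumes "open S" "times_differentiable_on n S f" "times_differentiable_on n S g"
  shows "times_differentiable_on n S (\<lambda>x. f x *\<^sub>R g x)"
  using assms(2,3)
proof (induction n arbitrary: f g)
  case 0
  then show ?case by (auto intro: continuous_on_scaleR)
next
  case (Suc n)
  show ?case
  proof (rule td_SucI[OF assms(1)])
    fix x assume "x \<in> S"
    then show "((\<lambda>x. f x *\<^sub>R g x) has_derivative
       (\<lambda>v. f x *\<^sub>R frechet_derivative g (at x) v + frechet_derivative f (at x) v *\<^sub>R g x)) (at x)"
      by (intro has_derivative_scaleR td_SucD[OF Suc.prems(1)] td_SucD[OF Suc.prems(2)])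
  next
    fix v
    show "times_differentiable_on n S
      (\<lambda>x. f x *\<^sub>R frechet_derivative g (at x) v + frechet_derivative f (at x) v *\<^sub>R g x)"
      by (intro td_add[OF assms(1)] Suc.IH td_Suc_imp[OF Suc.prems(1)] td_Suc_imp[OF Suc.prems(2)])
        (use Suc.prems in auto)
  qed
qed

lemma td_sum:
  assumes "open S" "\<And>i. i \<in> I \<Longrightarrow> times_differentiable_on n S (f i)"
  shows "times_differentiable_on n S (\<lambda>x. \<Sum>i\<in>I. f i x)"
  using assms(2)
  by (induction I rule: infinite_finite_induct) (auto intro: td_const td_add assms(1))

lemma td_inverse:
  fixes f :: "'a::real_normed_vector \<Rightarrow> real"
  assumes "open S" "times_differentiable_on n S f" "\<And>x. x \<in> S \<Longrightarrow> f x \<noteq> 0"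
  shows "times_differentiable_on n S (\<lambda>x. inverse (f x))"
  using assms(2)
proof (induction n)
  case 0
  then show ?case using assms(3) by (auto intro: continuous_on_inverse)
next
  case (Suc n)
  \<comment> \<open>The derivative of \<open>1/f\<close> contains \<open>1/f\<close> again;
    regularity of one order less for it comes from the induction hypothesis.\<close>
  have i: "times_differentiable_on n S (\<lambda>x. inverse (f x))"
    using Suc td_Suc_imp by blast
  show ?case
  proof (rule td_SucI[OF assms(1)])
    fix x assume "x \<in> S"
    then show "((\<lambda>x. inverse (f x)) has_derivative
       (\<lambda>v. (- inverse (f x)) *\<^sub>R inverse (f x) *\<^sub>R frechet_derivative f (at x) v)) (at x)"
      using Deriv.has_derivative_inverse[OF assms(3) td_SucD[OF Suc.prems]]
      by (auto simp: algebra_simps)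
  next
    fix v
    have m: "times_differentiable_on n S (\<lambda>x. - inverse (f x))"
      by (rule td_bounded_linear_comp[OF assms(1) bounded_linear_minus[OF bounded_linear_ident] i])
    show "times_differentiable_on n S
      (\<lambda>x. (- inverse (f x)) *\<^sub>R inverse (f x) *\<^sub>R frechet_derivative f (at x) v)"
      by (intro td_scaleR assms(1) i m) (use Suc.prems in auto)
  qed
qed

text \<open>Prepares the continuity of coordinates on finite-dimensional normed spaces. A new vector
  \<open>b\<close> has positive distance from the closed span reached so far; this bounds its
  coefficient, so the coefficients along a convergent sequence are Cauchy.\<close>

lemma closed_span_finite:
  fixes B :: "'a::real_normed_vector set"
  assumes "finite B" shows "closed (span B)"
  using assms
proof induction
  case (insert b B)
  show ?case
  proof (cases "b \<in> span B")
    case True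
    then show ?thesis using insert by (simp add: span_redundant)
  next
    case False
    define d where "d = infdist b (span B)"
    have d: "d > 0"
      unfolding d_def using False insert
      by (intro infdist_pos_not_in_closed) (use span_zero in auto)
    \<comment> \<open>After division by \<open>a\<close> the vector is the difference of
      \<open>b\<close> and an element of \<open>span B\<close>, so its norm is at least
      \<open>d\<close>.\<close>
    have bound: "\<bar>a\<bar> * d \<le> norm (a *\<^sub>R b + y)" if "y \<in> span B" for a y
    proof (cases "a = 0")
      case False
      have "- (inverse a *\<^sub>R y) \<in> span B" using that by (simp add: span_neg span_scale)
      then have "d \<le> dist b (- (inverse a *\<^sub>R y))" unfolding d_def by (rule infdist_le)
      then have "\<bar>a\<bar> * d \<le> \<bar>a\<bar> * norm (b + inverse a *\<^sub>R y)"
        by (simp add: dist_norm mult_left_mono)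
      also have "\<dots> = norm (a *\<^sub>R (b + inverse a *\<^sub>R y))" by simp
      also have "\<dots> = norm (a *\<^sub>R b + y)" using False by (simp add: scaleR_add_right)
      finally show ?thesis .
    qed auto
    show ?thesis unfolding closed_sequential_limits
    proof (intro allI impI, elim conjE)
      fix x l assume x: "\<forall>n. x n \<in> span (insert b B)" and l: "x \<longlonglongrightarrow> l"
      have "\<exists>k. x n - k *\<^sub>R b \<in> span B" for n using x span_breakdown_eq by blast
      then obtain k where k: "\<And>n. x n - k n *\<^sub>R b \<in> span B" by metis
      have kb: "\<bar>k m - k n\<bar> * d \<le> norm (x m - x n)" for m n
        using bound[OF span_diff[OF k[of m] k[of n]], of "k m - k n"]
        by (simp add: algebra_simps)
      have "Cauchy k"
      proof (rule metric_CauchyI)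
        fix e :: real assume "e > 0"
        then have "e * d > 0" using d by simp
        then obtain M where M: "\<And>m n. m \<ge> M \<Longrightarrow> n \<ge> M \<Longrightarrow> dist (x m) (x n) < e * d"
          using metric_CauchyD[OF LIMSEQ_imp_Cauchy[OF l]] by blast
        have "dist (k m) (k n) < e" if "m \<ge> M" "n \<ge> M" for m n
        proof -
          have "\<bar>k m - k n\<bar> * d < e * d"
            using kb[of m n] M[OF that] by (simp add: dist_norm)
          then show ?thesis using d by (simp add: dist_real_def)
        qed
        then show "\<exists>M. \<forall>m\<ge>M. \<forall>n\<ge>M. dist (k m) (k n) < e" by blast
      qed
      then obtain a where a: "k \<longlonglongrightarrow> a" using Cauchy_convergent_iff convergent_def by blast
      have "(\<lambda>n. x n - k n *\<^sub>R b) \<longlonglongrightarrow> l - a *\<^sub>R b"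
        by (intro tendsto_intros l a)
      then have "l - a *\<^sub>R b \<in> span B"
        by (rule closed_sequentially[OF insert.IH k])
      then show "l \<in> span (insert b B)" using span_breakdown_eq by blast
    qed
  qed
qed auto

text \<open>The coefficient of \<open>b\<close> is bounded by \<open>norm x / d\<close>, where
  \<open>d\<close> is the distance from \<open>b\<close> to the span of the other basis vectors;
  \<open>d\<close> is positive because that span is closed and misses \<open>b\<close>.\<close>

lemma bounded_linear_representation:
  fixes B :: "'a::real_normed_vector set"
  assumes "finite B" "independent B" "span B = UNIV" "b \<in> B"
  shows "bounded_linear (\<lambda>x. representation B x b)"
proof -
  have b: "b \<notin> span (B - {b})" using assms(2,4) unfolding dependent_def by blast
  define d where "d = infdist b (span (B - {b}))"
  have d: "d > 0"
    unfolding d_def using b closed_span_finite[of "B - {b}"] assms(1)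
    by (intro infdist_pos_not_in_closed) (use span_zero in auto)
  show ?thesis
  proof (rule bounded_linear_intro[where K="inverse d"])
    fix x y show "representation B (x + y) b = representation B x b + representation B y b"
      using representation_add[OF assms(2)] assms(3) by simp
  next
    fix r x show "representation B (r *\<^sub>R x) b = r *\<^sub>R representation B x b"
      using representation_scale[OF assms(2)] assms(3) by simp
  next
    fix x
    define a where "a = representation B x b"
    define y where "y = x - a *\<^sub>R b"
    have "x = (\<Sum>c\<in>B. representation B x c *\<^sub>R c)"
      using sum_representation_eq[OF assms(2), of x B] assms by simp
    also have "\<dots> = a *\<^sub>R b + (\<Sum>c\<in>B-{b}. representation B x c *\<^sub>R c)"
      using assms by (simp add: sum.remove a_def)
    finally have "y = (\<Sum>c\<in>B-{b}. representation B x c *\<^sub>R c)"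
      unfolding y_def by (metis add_diff_cancel_left')
    moreover have "(\<Sum>c\<in>B-{b}. representation B x c *\<^sub>R c) \<in> span (B - {b})"
      by (intro span_sum span_scale span_base)
    ultimately have y: "y \<in> span (B - {b})" by simp
    have "\<bar>a\<bar> * d \<le> norm x"
    proof (cases "a = 0")
      case False
      have "- (inverse a *\<^sub>R y) \<in> span (B - {b})" using y by (simp add: span_neg span_scale)
      then have "d \<le> dist b (- (inverse a *\<^sub>R y))" unfolding d_def by (rule infdist_le)
      then have "\<bar>a\<bar> * d \<le> \<bar>a\<bar> * norm (b + inverse a *\<^sub>R y)"
        by (simp add: dist_norm mult_left_mono)
      also have "\<dots> = norm (a *\<^sub>R (b + inverse a *\<^sub>R y))" by simp
      also have "\<dots> = norm x" using False by (simp add: scaleR_add_right y_def)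
      finally show ?thesis .
    qed auto
    then show "norm (representation B x b) \<le> norm x * inverse d"
      using d by (simp add: a_def field_simps)
  qed
qed

text \<open>The model space of the objects may be zero-dimensional, so finite dimension is a
  predicate on types here and not the class \<open>euclidean_space\<close>.\<close>

definition finite_dim :: "'a::real_normed_vector itself \<Rightarrow> bool" where
  "finite_dim _ \<longleftrightarrow> (\<exists>K :: 'a set. finite K \<and> span K = UNIV)"

lemma finite_dim_euclidean [simp]: "finite_dim TYPE('a::euclidean_space)"
  unfolding finite_dim_def by (intro exI[of _ Basis]) auto

lemma finite_dim_coordinates:
  fixes t :: "'a::real_normed_vector itself"
  assumes "finite_dim t"
  obtains B :: "'a set" and l where "finite B" "\<And>b. b \<in> B \<Longrightarrow> bounded_linear (l b)"
    "\<And>x. x = (\<Sum>b\<in>B. l b x *\<^sub>R b)"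
proof -
  obtain K :: "'a set" where K: "finite K" "span K = UNIV" using assms unfolding finite_dim_def by auto
  obtain B where B: "B \<subseteq> K" "independent B" "K \<subseteq> span B"
    using maximal_independent_subset[of K] by blast
  have f: "finite B" using B K finite_subset by blast
  have s: "span B = UNIV" using B(3) K(2) by (metis span_mono span_span top.extremum_uniqueI)
  have "x = (\<Sum>b\<in>B. representation B x b *\<^sub>R b)" for x
    using sum_representation_eq[OF B(2), of x B] f s by simp
  then show ?thesis
    using bounded_linear_representation[OF f B(2) s] f
    by (intro that[of B "\<lambda>b x. representation B x b"])
qed

lemma finite_dim_linear_bounded:
  fixes f :: "'a::real_normed_vector \<Rightarrow> 'b::real_normed_vector"
  assumes "finite_dim TYPE('a)" "linear f"
  shows "bounded_linear f"
proof -
  obtain B :: "'a set" and l where B: "finite B" "\<And>b. b \<in> B \<Longrightarrow> bounded_linear (l b)"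
    "\<And>x. x = (\<Sum>b\<in>B. l b x *\<^sub>R b)" using finite_dim_coordinates[OF assms(1)] by blast
  have e: "f x = (\<Sum>b\<in>B. l b x *\<^sub>R f b)" for x
    using arg_cong[OF B(3)[of x], of f]
    by (simp only: linear_sum[OF assms(2)] linear_scale[OF assms(2)])
  have "bounded_linear (\<lambda>x. \<Sum>b\<in>B. l b x *\<^sub>R f b)"
    by (intro bounded_linear_sum bounded_linear_scaleR_const B(2))
  then show ?thesis by (simp only: e[symmetric])
qed

text \<open>The chain rule differentiates \<open>g\<close> in the direction \<open>f'(x) v\<close>,
  which varies with \<open>x\<close>, while iterated derivatives are known only in fixed directions.
  Expanding the direction in a finite basis of the middle space gives a sum of products; hence the
  dimension hypothesis on \<open>'b\<close>.\<close>

lemma td_compose: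
  fixes f :: "'a::real_normed_vector \<Rightarrow> 'b::real_normed_vector"
    and g :: "'b \<Rightarrow> 'c::real_normed_vector"
  assumes "finite_dim TYPE('b)" "open S" "open T" "f ` S \<subseteq> T"
    "times_differentiable_on n S f" "times_differentiable_on n T g"
  shows "times_differentiable_on n S (\<lambda>x. g (f x))"
  using assms(5,6)
proof (induction n arbitrary: g)
  case 0
  then show ?case using continuous_on_compose2[of T g S f] assms(4) by simp
next
  case (Suc n)
  obtain B :: "'b set" and l where B: "finite B" "\<And>b. b \<in> B \<Longrightarrow> bounded_linear (l b)"
    "\<And>x. x = (\<Sum>b\<in>B. l b x *\<^sub>R b)" using finite_dim_coordinates[OF assms(1)] by blast
  show ?case
  proof (rule td_SucI[OF assms(2)])
    fix x assume x: "x \<in> S"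
    have fx: "f x \<in> T" using x assms(4) by auto
    have lg: "linear (frechet_derivative g (at (f x)))"
      using td_SucD[OF Suc.prems(2) fx] has_derivative_linear by blast
    have "((\<lambda>x. g (f x)) has_derivative
        (\<lambda>v. frechet_derivative g (at (f x)) (frechet_derivative f (at x) v))) (at x)"
      by (rule has_derivative_compose[OF td_SucD[OF Suc.prems(1) x] td_SucD[OF Suc.prems(2) fx]])
    moreover have "frechet_derivative g (at (f x)) (frechet_derivative f (at x) v) =
       (\<Sum>b\<in>B. l b (frechet_derivative f (at x) v) *\<^sub>R frechet_derivative g (at (f x)) b)" for v
      using arg_cong[OF B(3)[of "frechet_derivative f (at x) v"],
          of "frechet_derivative g (at (f x))"]
      by (simp only: linear_sum[OF lg] linear_scale[OF lg])
    ultimately show "((\<lambda>x. g (f x)) has_derivative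
       (\<lambda>v. \<Sum>b\<in>B. l b (frechet_derivative f (at x) v) *\<^sub>R frechet_derivative g (at (f x)) b)) (at x)"
      by simp
  next
    fix v
    have 1: "times_differentiable_on n S (\<lambda>x. frechet_derivative g (at (f x)) b)" for b
      by (rule Suc.IH[OF td_Suc_imp[OF Suc.prems(1)], of "\<lambda>y. frechet_derivative g (at y) b"])
        (use Suc.prems(2) in simp)
    have 2: "times_differentiable_on n S (\<lambda>x. frechet_derivative f (at x) v)"
      using Suc.prems(1) by simp
    show "times_differentiable_on n S
      (\<lambda>x. \<Sum>b\<in>B. l b (frechet_derivative f (at x) v) *\<^sub>R frechet_derivative g (at (f x)) b)"
      by (intro td_sum td_scaleR[OF assms(2)] assms(2) td_bounded_linear_comp[OF assms(2) B(2) 2] 1)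
  qed
qed

section \<open>Symmetry of second derivatives and the smooth inverse function theorem\<close>

lemma td_continuous: "times_differentiable_on n S f \<Longrightarrow> continuous_on S f"
proof (induction n)
  case (Suc n)
  then show ?case using td_Suc_imp by blast
qed simp

section \<open>Calculus of \<open>smooth_on\<close>\<close>

lemma smooth_on_cong:
  "open S \<Longrightarrow> smooth_on S f \<Longrightarrow> (\<And>x. x \<in> S \<Longrightarrow> f x = g x) \<Longrightarrow> smooth_on S g"
  unfolding smooth_on_def using td_cong by blast

lemma smooth_on_subset: "smooth_on S f \<Longrightarrow> T \<subseteq> S \<Longrightarrow> smooth_on T f"
  unfolding smooth_on_def using td_subset by blast

lemma smooth_on_local:
  assumes "\<And>x. x \<in> S \<Longrightarrow> \<exists>T. open T \<and> x \<in> T \<and> smooth_on T f"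
  shows "smooth_on S f"
  unfolding smooth_on_def
proof (intro allI td_local)
  fix n x assume "x \<in> S"
  then obtain T where "open T" "x \<in> T" "smooth_on T f" using assms by meson
  then show "\<exists>T. open T \<and> x \<in> T \<and> times_differentiable_on n T f"
    unfolding smooth_on_def by auto
qed

lemma smooth_on_const: "open S \<Longrightarrow> smooth_on S (\<lambda>x. c)"
  by (simp add: smooth_on_def td_const)

lemma smooth_on_id: "open S \<Longrightarrow> smooth_on S (\<lambda>x. x)"
  by (simp add: smooth_on_def td_id)

lemma smooth_on_bounded_linear_comp:
  "open S \<Longrightarrow> bounded_linear L \<Longrightarrow> smooth_on S f \<Longrightarrow> smooth_on S (\<lambda>x. L (f x))"
  by (simp add: smooth_on_def td_bounded_linear_comp)

lemma smooth_on_bounded_linear: "open S \<Longrightarrow> bounded_linear L \<Longrightarrow> smooth_on S L"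
  by (simp add: smooth_on_def td_bounded_linear)

lemma smooth_on_add:
  "open S \<Longrightarrow> smooth_on S f \<Longrightarrow> smooth_on S g \<Longrightarrow> smooth_on S (\<lambda>x. f x + g x)"
  by (simp add: smooth_on_def td_add)

lemma smooth_on_scaleR:
  "open S \<Longrightarrow> smooth_on S f \<Longrightarrow> smooth_on S g \<Longrightarrow> smooth_on S (\<lambda>x. f x *\<^sub>R g x)"
  by (simp add: smooth_on_def td_scaleR)

lemma smooth_on_mult:
  fixes f g :: "'a::real_normed_vector \<Rightarrow> real"
  shows "open S \<Longrightarrow> smooth_on S f \<Longrightarrow> smooth_on S g \<Longrightarrow> smooth_on S (\<lambda>x. f x * g x)"
  using smooth_on_scaleR[of S f g] by simp

lemma smooth_on_inverse:
  fixes f :: "'a::real_normed_vector \<Rightarrow> real"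
  shows "open S \<Longrightarrow> smooth_on S f \<Longrightarrow> (\<And>x. x \<in> S \<Longrightarrow> f x \<noteq> 0) \<Longrightarrow> smooth_on S (\<lambda>x. inverse (f x))"
  by (simp add: smooth_on_def td_inverse)

lemma smooth_on_Pair:
  assumes "open S" "smooth_on S f" "smooth_on S g"
  shows "smooth_on S (\<lambda>x. (f x, g x))"
proof -
  have "bounded_linear (\<lambda>x::'b. (x, 0::'c))" "bounded_linear (\<lambda>x::'c. (0::'b, x))"
    by (intro bounded_linear_Pair bounded_linear_ident bounded_linear_zero)+
  then have "smooth_on S (\<lambda>x. (f x, 0) + (0, g x))"
    by (intro smooth_on_add smooth_on_bounded_linear_comp[of S "\<lambda>x. (x, 0)"]
        smooth_on_bounded_linear_comp[of S "\<lambda>x. (0, x)"] assms)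
  then show ?thesis by simp
qed

lemma smooth_on_compose:
  fixes f :: "'a::real_normed_vector \<Rightarrow> 'b::real_normed_vector"
    and g :: "'b \<Rightarrow> 'c::real_normed_vector"
  assumes "finite_dim TYPE('b)" "open S" "open T" "f ` S \<subseteq> T" "smooth_on S f" "smooth_on T g"
  shows "smooth_on S (\<lambda>x. g (f x))"
  using assms unfolding smooth_on_def by (blast intro: td_compose)

lemma smooth_on_continuous: "smooth_on S f \<Longrightarrow> continuous_on S f"
  unfolding smooth_on_def by (metis times_differentiable_on.simps(1))

lemma smooth_on_has_derivative:
  "smooth_on S f \<Longrightarrow> x \<in> S \<Longrightarrow> (f has_derivative frechet_derivative f (at x)) (at x)"
  unfolding smooth_on_def using td_SucD by blast

lemma smooth_on_frechet_derivative:
  "smooth_on S f \<Longrightarrow> smooth_on S (\<lambda>x. frechet_derivative f (at x) v)"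
  unfolding smooth_on_def by (metis times_differentiable_on.simps(2))

text \<open>The mean value theorem is applied along \<open>v\<close> and then along
  \<open>w\<close>. The second difference is symmetric in \<open>v\<close> and \<open>w\<close>
  while the right side is not visibly so, and the symmetry of second derivatives rests on this
  contrast.\<close>

lemma second_difference_mean_value:
  fixes f :: "'a::real_normed_vector \<Rightarrow> real"
  assumes "smooth_on S f" "h > 0"
    and S: "\<And>s t. 0 \<le> s \<Longrightarrow> s \<le> h \<Longrightarrow> 0 \<le> t \<Longrightarrow> t \<le> h \<Longrightarrow> x + s *\<^sub>R v + t *\<^sub>R w \<in> S"
  obtains s t where "0 \<le> s" "s \<le> h" "0 \<le> t" "t \<le> h"
    "f (x + h *\<^sub>R v + h *\<^sub>R w) - f (x + h *\<^sub>R v) - f (x + h *\<^sub>R w) + f x =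
      h * h * frechet_derivative (\<lambda>y. frechet_derivative f (at y) v) (at (x + s *\<^sub>R v + t *\<^sub>R w)) w"
proof -
  have lin: "((\<lambda>s. F (p + s *\<^sub>R u)) has_derivative
      (\<lambda>r. r * frechet_derivative F (at (p + s *\<^sub>R u)) u)) (at s)"
    if F: "smooth_on S F" and p: "p + s *\<^sub>R u \<in> S" for F :: "'a \<Rightarrow> real" and p u s
  proof -
    have d: "(F has_derivative frechet_derivative F (at (p + s *\<^sub>R u))) (at (p + s *\<^sub>R u))"
      by (rule smooth_on_has_derivative[OF F p])
    have "((\<lambda>s. p + s *\<^sub>R u) has_derivative (\<lambda>r. r *\<^sub>R u)) (at s)"
      by (auto intro!: derivative_eq_intros)
    from has_derivative_compose[OF this d] show ?thesis
      by (simp add: linear_scale[OF has_derivative_linear[OF d]])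
  qed
  let ?D = "\<lambda>y. frechet_derivative f (at y) v"
  define \<phi> where "\<phi> s = f (x + h *\<^sub>R w + s *\<^sub>R v) - f (x + s *\<^sub>R v)" for s
  have "\<exists>s\<in>{0<..<h}. \<phi> h - \<phi> 0 = (h - 0) * (?D (x + h *\<^sub>R w + s *\<^sub>R v) - ?D (x + s *\<^sub>R v))"
  proof (rule mvt_simple[OF \<open>h > 0\<close>, of \<phi> "\<lambda>s r. r * (?D (x + h *\<^sub>R w + s *\<^sub>R v) - ?D (x + s *\<^sub>R v))"])
    fix s assume s: "0 \<le> s" "s \<le> h"
    have "x + h *\<^sub>R w + s *\<^sub>R v \<in> S" "x + s *\<^sub>R v \<in> S"
      using S[of s h] S[of s 0] s \<open>h > 0\<close> by (auto simp: algebra_simps)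
    then have "(\<phi> has_derivative
       (\<lambda>r. r * ?D (x + h *\<^sub>R w + s *\<^sub>R v) - r * ?D (x + s *\<^sub>R v))) (at s)"
      unfolding \<phi>_def by (intro has_derivative_diff lin[OF assms(1)])
    then show "(\<phi> has_derivative (\<lambda>r. r * (?D (x + h *\<^sub>R w + s *\<^sub>R v) - ?D (x + s *\<^sub>R v))))
        (at s within {0..h})"
      by (simp add: right_diff_distrib has_derivative_at_withinI)
  qed
  then obtain s where s: "0 \<le> s" "s \<le> h"
    "\<phi> h - \<phi> 0 = h * (?D (x + h *\<^sub>R w + s *\<^sub>R v) - ?D (x + s *\<^sub>R v))"
    by (metis diff_zero greaterThanLessThan_iff less_imp_le)
  have "\<exists>t\<in>{0<..<h}. ?D (x + s *\<^sub>R v + h *\<^sub>R w) - ?D (x + s *\<^sub>R v + 0 *\<^sub>R w)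
      = (h - 0) * frechet_derivative ?D (at (x + s *\<^sub>R v + t *\<^sub>R w)) w"
  proof (rule mvt_simple[OF \<open>h > 0\<close>, of "\<lambda>t. ?D (x + s *\<^sub>R v + t *\<^sub>R w)"
          "\<lambda>t r. r * frechet_derivative ?D (at (x + s *\<^sub>R v + t *\<^sub>R w)) w"])
    fix t assume t: "0 \<le> t" "t \<le> h"
    show "((\<lambda>t. ?D (x + s *\<^sub>R v + t *\<^sub>R w)) has_derivative
       (\<lambda>r. r * frechet_derivative ?D (at (x + s *\<^sub>R v + t *\<^sub>R w)) w)) (at t within {0..h})"
      by (rule has_derivative_at_withinI[OF lin[of ?D, OF smooth_on_frechet_derivative[OF assms(1)]]])
        (use S[of s t] s t in auto)
  qed
  then obtain t where t: "0 \<le> t" "t \<le> h" "?D (x + s *\<^sub>R v + h *\<^sub>R w) - ?D (x + s *\<^sub>R v)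
      = h * frechet_derivative ?D (at (x + s *\<^sub>R v + t *\<^sub>R w)) w"
    by (metis add_0_right diff_zero greaterThanLessThan_iff less_imp_le scaleR_zero_left)
  have "x + h *\<^sub>R w + s *\<^sub>R v = x + s *\<^sub>R v + h *\<^sub>R w" "x + h *\<^sub>R w + h *\<^sub>R v = x + h *\<^sub>R v + h *\<^sub>R w"
    by simp_all
  then show ?thesis using that[of s t] s t by (simp add: \<phi>_def algebra_simps)
qed

text \<open>The second difference makes the two mixed derivatives agree at suitable points as close
  to \<open>x\<close> as desired; continuity then excludes a gap between their values at
  \<open>x\<close>.\<close>

lemma second_derivative_symmetric:
  fixes f :: "'a::real_normed_vector \<Rightarrow> real"
  assumes "open S" "smooth_on S f" "x \<in> S"
  shows "frechet_derivative (\<lambda>y. frechet_derivative f (at y) v) (at x) w =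
    frechet_derivative (\<lambda>y. frechet_derivative f (at y) w) (at x) v" (is "?l = ?r")
proof (rule ccontr)
  assume ne: "?l \<noteq> ?r"
  \<comment> \<open>Half the gap: two values within \<open>e\<close> of a common number are less
    than \<open>2 * e\<close> apart.\<close>
  define e where "e = \<bar>?l - ?r\<bar> / 2"
  have e: "e > 0" using ne by (simp add: e_def)
  let ?L = "\<lambda>z. frechet_derivative (\<lambda>y. frechet_derivative f (at y) v) (at z) w"
  let ?R = "\<lambda>z. frechet_derivative (\<lambda>y. frechet_derivative f (at y) w) (at z) v"
  have "isCont ?L x" "isCont ?R x"
    using smooth_on_continuous[OF smooth_on_frechet_derivative[OF smooth_on_frechet_derivative[OF assms(2)]]]
      assms(1,3) continuous_on_eq_continuous_at by blast+
  then obtain d1 d2 where d: "d1 > 0" "d2 > 0" "\<And>z. dist z x < d1 \<Longrightarrow> dist (?L z) ?l < e"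
    "\<And>z. dist z x < d2 \<Longrightarrow> dist (?R z) ?r < e"
    unfolding continuous_at_eps_delta using e by (metis (no_types, lifting))
  obtain d3 where d3: "d3 > 0" "ball x d3 \<subseteq> S" using assms(1,3) openE by blast
  define d where "d = min d1 (min d2 d3)"
  \<comment> \<open>Keeps the parallelogram with sides \<open>h v\<close> and \<open>h w\<close>
    inside the ball of radius \<open>d\<close>; the summand 1 avoids a zero denominator.\<close>
  define h where "h = d / (2 * (norm v + norm w + 1))"
  have "d > 0" using d d3 by (simp add: d_def)
  have nn: "norm v + norm w + 1 > 0" by (smt (verit) norm_ge_zero)
  have h: "h > 0" "h * (norm v + norm w) < d"
  proof -
    show "h > 0" using \<open>d > 0\<close> nn by (simp add: h_def)
    have "h * (norm v + norm w) \<le> h * (norm v + norm w + 1)"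
      using \<open>h > 0\<close> by (simp add: mult_left_mono)
    also have "\<dots> = d / 2" using nn by (simp add: h_def field_simps)
    finally show "h * (norm v + norm w) < d" using \<open>d > 0\<close> by simp
  qed
  have near: "dist (x + s *\<^sub>R a + t *\<^sub>R b) x < d"
    if "0 \<le> s" "s \<le> h" "0 \<le> t" "t \<le> h" "norm a + norm b = norm v + norm w" for s t and a b :: 'a
  proof -
    have "dist (x + s *\<^sub>R a + t *\<^sub>R b) x = norm (s *\<^sub>R a + t *\<^sub>R b)"
      by (simp add: dist_norm algebra_simps)
    also have "\<dots> \<le> s * norm a + t * norm b"
      using norm_triangle_ineq[of "s *\<^sub>R a" "t *\<^sub>R b"] that by simp
    also have "\<dots> \<le> h * norm a + h * norm b"
      using that by (intro add_mono mult_right_mono) auto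
    also have "\<dots> = h * (norm v + norm w)" using that(5) by (simp only: distrib_left[symmetric])
    finally show ?thesis using h by simp
  qed
  have inS: "x + s *\<^sub>R a + t *\<^sub>R b \<in> S"
    if "0 \<le> s" "s \<le> h" "0 \<le> t" "t \<le> h" "norm a + norm b = norm v + norm w" for s t and a b :: 'a
    using near[OF that] d3 by (auto simp: d_def dist_commute)
  obtain s1 t1 where 1: "0 \<le> s1" "s1 \<le> h" "0 \<le> t1" "t1 \<le> h"
    "f (x + h *\<^sub>R v + h *\<^sub>R w) - f (x + h *\<^sub>R v) - f (x + h *\<^sub>R w) + f x =
      h * h * ?L (x + s1 *\<^sub>R v + t1 *\<^sub>R w)"
    by (rule second_difference_mean_value[OF assms(2) h(1), of x v w]) (use inS in auto)
  obtain s2 t2 where 2: "0 \<le> s2" "s2 \<le> h" "0 \<le> t2" "t2 \<le> h"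
    "f (x + h *\<^sub>R w + h *\<^sub>R v) - f (x + h *\<^sub>R w) - f (x + h *\<^sub>R v) + f x =
      h * h * ?R (x + s2 *\<^sub>R w + t2 *\<^sub>R v)"
    by (rule second_difference_mean_value[OF assms(2) h(1), of x w v]) (use inS in auto)
  have "f (x + h *\<^sub>R w + h *\<^sub>R v) = f (x + h *\<^sub>R v + h *\<^sub>R w)" by (simp add: algebra_simps)
  then have "h * h * ?L (x + s1 *\<^sub>R v + t1 *\<^sub>R w) = h * h * ?R (x + s2 *\<^sub>R w + t2 *\<^sub>R v)"
    using 1(5) 2(5) by linarith
  then have "?L (x + s1 *\<^sub>R v + t1 *\<^sub>R w) = ?R (x + s2 *\<^sub>R w + t2 *\<^sub>R v)"
    using h(1) by simp
  moreover have "dist (?L (x + s1 *\<^sub>R v + t1 *\<^sub>R w)) ?l < e"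
    using near[OF 1(1-4), of v w] by (intro d(3)) (simp add: d_def)
  moreover have "dist (?R (x + s2 *\<^sub>R w + t2 *\<^sub>R v)) ?r < e"
    using near[OF 2(1-4), of w v] by (intro d(4)) (simp add: d_def)
  ultimately have "dist ?l ?r < 2 * e"
    using dist_triangle3[of ?l ?r "?L (x + s1 *\<^sub>R v + t1 *\<^sub>R w)"] by simp
  then show False by (simp add: e_def dist_real_def)
qed

text \<open>Near \<open>x\<close>, \<open>J y v - J x v = J y (A x u - A y u)\<close> with \<open>u = J x v\<close>, and \<open>J\<close> is bounded.\<close>

lemma operator_inverse_continuous:
  fixes A :: "'a::t2_space \<Rightarrow> 'e::euclidean_space \<Rightarrow>\<^sub>L 'e"
  assumes "isCont A x" "eventually (\<lambda>y. \<forall>v. A y (J y v) = v) (nhds x)"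
    "\<And>v. J x (A x v) = v" "linear (J x)"
  obtains C where "C > 0" "eventually (\<lambda>y. \<forall>v. norm (J y v) \<le> C * norm v) (nhds x)"
proof -
  have "bounded_linear (J x)" using assms(4) linear_conv_bounded_linear by blast
  then obtain K where K: "K > 0" "\<And>v. norm (J x v) \<le> norm v * K"
    using bounded_linear.pos_bounded by blast
  have "(A \<longlongrightarrow> A x) (nhds x)" using assms(1) isCont_def tendsto_at_iff_tendsto_nhds by blast
  \<comment> \<open>At this distance the error \<open>(A y - A x) ?w\<close> contributes at most
    half of \<open>norm ?w\<close> after multiplication by \<open>K\<close>. The half is absorbed on
    the left, which gives the bound \<open>2 * K\<close>.\<close>
  then have "eventually (\<lambda>y. dist (A y) (A x) < 1 / (2 * K)) (nhds x)"
    using K(1) tendstoD by fastforce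
  then have "eventually (\<lambda>y. \<forall>v. norm (J y v) \<le> (2 * K) * norm v) (nhds x)"
    using assms(2)
  proof eventually_elim
    case (elim y)
    show ?case
    proof
      fix v
      let ?w = "J y v"
      have "norm ?w = norm (J x (A x ?w))" using assms(3) by simp
      also have "\<dots> \<le> norm (A x ?w) * K" by (rule K(2))
      also have "norm (A x ?w) \<le> norm (A y ?w) + norm ((A y - A x) ?w)"
        by (simp add: blinfun.diff_left) (metis norm_triangle_sub norm_minus_commute add.commute)
      also have "norm ((A y - A x) ?w) \<le> norm (A y - A x) * norm ?w" by (rule norm_blinfun)
      also have "norm (A y - A x) * norm ?w \<le> 1 / (2 * K) * norm ?w"
        using elim(1) by (intro mult_right_mono) (auto simp: dist_norm)
      finally have "norm ?w \<le> (norm (A y ?w) + 1 / (2 * K) * norm ?w) * K"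
        using K(1) by (simp add: mult_right_mono)
      then have "norm ?w \<le> norm v * K + norm ?w / 2"
        using elim(2) K(1) by (simp add: distrib_right)
      then show "norm ?w \<le> (2 * K) * norm v" by (simp add: algebra_simps)
    qed
  qed
  then show ?thesis using that[of "2 * K"] K(1) by simp
qed

text \<open>Differentiating \<open>A J v = v\<close> gives \<open>J' v = - J A' J v\<close>, in
  which \<open>J\<close> stands undifferentiated; so every order of regularity passes from
  \<open>A\<close> to \<open>J\<close> by induction.\<close>

lemma operator_inverse_td:
  fixes A :: "'a::real_normed_vector \<Rightarrow> 'e::euclidean_space \<Rightarrow>\<^sub>L 'e"
  assumes "open S" and AJ: "\<And>x v. x \<in> S \<Longrightarrow> A x (J x v) = v"
    and JA: "\<And>x v. x \<in> S \<Longrightarrow> J x (A x v) = v"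
    and lin: "\<And>x. x \<in> S \<Longrightarrow> linear (J x)"
    and "\<And>v. times_differentiable_on n S (\<lambda>x. A x v)"
  shows "times_differentiable_on n S (\<lambda>x. J x v)"
  using assms(5)
proof (induction n arbitrary: v)
  case 0
  have contA: "isCont A x" if "x \<in> S" for x
  proof -
    have "continuous_on S A"
      using 0 by (intro continuous_on_blinfun_componentwise) auto
    then show ?thesis using \<open>open S\<close> that continuous_on_eq_continuous_at by blast
  qed
  have "isCont (\<lambda>y. J y v) x" if x: "x \<in> S" for x
  proof -
    have ev: "eventually (\<lambda>y. y \<in> S) (nhds x)" using \<open>open S\<close> x eventually_nhds by blast
    then have "eventually (\<lambda>y. \<forall>v. A y (J y v) = v) (nhds x)"
      by eventually_elim (use AJ in auto)
    then obtain C where C: "C > 0" "eventually (\<lambda>y. \<forall>v. norm (J y v) \<le> C * norm v) (nhds x)"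
      using operator_inverse_continuous[where A=A and x=x and J=J, OF contA[OF x] _ JA[OF x] lin[OF x]] by blast
    define u where "u = J x v"
    have "((\<lambda>y. J y v - J x v) \<longlongrightarrow> 0) (nhds x)"
    proof (rule Lim_null_comparison)
      show "eventually (\<lambda>y. norm (J y v - J x v) \<le> C * norm (A x u - A y u)) (nhds x)"
        using C(2) ev
      proof eventually_elim
        case (elim y)
        have "J y v - J x v = J y (A x u - A y u)"
          using linear_diff[OF lin[OF elim(2)]] AJ[OF x] JA[OF elim(2)] by (simp add: u_def)
        then show ?case using elim(1) by simp
      qed
      have "(A \<longlongrightarrow> A x) (nhds x)"
        using contA[OF x] isCont_def tendsto_at_iff_tendsto_nhds by blast
      then have "((\<lambda>y. C * norm (A x u - A y u)) \<longlongrightarrow> C * norm (A x u - A x u)) (nhds x)"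
        by (intro tendsto_intros)
      then show "((\<lambda>y. C * norm (A x u - A y u)) \<longlongrightarrow> 0) (nhds x)" by simp
    qed
    then have "((\<lambda>y. J y v) \<longlongrightarrow> J x v) (nhds x)" by (simp add: Lim_null[symmetric])
    then show ?thesis unfolding isCont_def
      by (metis tendsto_mono at_within_le_nhds)
  qed
  then show ?case by (simp add: continuous_at_imp_continuous_on)
next
  case (Suc n)
  have tdA: "times_differentiable_on n S (\<lambda>x. A x v)" for v
    by (rule td_Suc_imp[OF Suc.prems])
  have tdJ: "times_differentiable_on n S (\<lambda>x. J x v)" for v
    by (rule Suc.IH[OF tdA])
  let ?F = "\<lambda>b x. frechet_derivative (\<lambda>y. A y b) (at x)"
  \<comment> \<open>The derivative at \<open>x\<close> of \<open>A y u\<close> with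
    \<open>u = J x v\<close> frozen. It is expanded in the basis because the derivatives of
    \<open>A\<close> are given only on fixed vectors.\<close>
  let ?D = "\<lambda>x w. \<Sum>b\<in>Basis. (J x v \<bullet> b) *\<^sub>R ?F b x w"
  have contA: "isCont A x" if "x \<in> S" for x
  proof -
    have "continuous_on S (\<lambda>x. A x i)" for i
      by (rule td_continuous[OF Suc.prems])
    then have "continuous_on S A"
      by (intro continuous_on_blinfun_componentwise) auto
    then show ?thesis using \<open>open S\<close> that continuous_on_eq_continuous_at by blast
  qed
  have der: "((\<lambda>y. J y v) has_derivative (\<lambda>w. - J x (?D x w))) (at x)" if x: "x \<in> S" for x
  proof -
    define u where "u = J x v"
    define D where "D = ?D x"
    have eqA: "A y u = (\<Sum>b\<in>Basis. (u \<bullet> b) *\<^sub>R A y b)" for y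
    proof -
      have "A y (\<Sum>b\<in>Basis. (u \<bullet> b) *\<^sub>R b) = (\<Sum>b\<in>Basis. (u \<bullet> b) *\<^sub>R A y b)"
        by (simp add: blinfun.sum_right blinfun.scaleR_right)
      then show ?thesis by (simp add: euclidean_representation)
    qed
    have dD: "((\<lambda>y. A y u) has_derivative D) (at x)"
      unfolding D_def u_def[symmetric] eqA
      by (intro has_derivative_sum has_derivative_scaleR_right td_SucD[OF Suc.prems x])
    have ev: "eventually (\<lambda>y. y \<in> S) (nhds x)" using \<open>open S\<close> x eventually_nhds by blast
    then have "eventually (\<lambda>y. \<forall>v. A y (J y v) = v) (nhds x)"
      by eventually_elim (use AJ in auto)
    then obtain C where C: "C > 0" "eventually (\<lambda>y. \<forall>v. norm (J y v) \<le> C * norm v) (nhds x)"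
      using operator_inverse_continuous[where A=A and x=x and J=J, OF contA[OF x] _ JA[OF x] lin[OF x]] by blast
    have bJ: "bounded_linear (J x)" using lin[OF x] linear_conv_bounded_linear by blast
    have bJD: "bounded_linear (\<lambda>w. J x (D w))"
      using bounded_linear_compose[OF bJ has_derivative_bounded_linear[OF dD]] by simp
    then obtain K where K: "\<And>w. norm (J x (D w)) \<le> norm w * K" "K > 0"
      using bounded_linear.pos_bounded by blast
    have "((\<lambda>y. J y v) has_derivative (\<lambda>w. - J x (D w))) (at x)"
    proof (rule has_derivativeI)
      show "bounded_linear (\<lambda>w. - J x (D w))" by (rule bounded_linear_minus[OF bJD])
      let ?q = "\<lambda>y. norm (A y u - A x u - D (y - x)) / norm (y - x)"
      show "((\<lambda>y. (J y v - J x v - - J x (D (y - x))) /\<^sub>R norm (y - x)) \<longlongrightarrow> 0) (at x)"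
      proof (rule Lim_null_comparison)
        show "eventually (\<lambda>y. norm ((J y v - J x v - - J x (D (y - x))) /\<^sub>R norm (y - x)) \<le>
            C * ?q y + C * norm (A x - A y) * K) (at x)"
          using filter_leD[OF at_within_le_nhds C(2)] filter_leD[OF at_within_le_nhds ev]
        proof eventually_elim
          case (elim y)
          let ?w = "y - x"
          let ?z = "J x (D ?w)"
          have a: "J y v - J x v + ?z = J y (- (A y u - A x u - D ?w)) - J y (A x ?z - A y ?z)"
            using lin[OF elim(2)] AJ[OF x] JA[OF elim(2)]
            by (simp add: linear_diff linear_neg u_def)
          have "norm (J y v - J x v + ?z) \<le> C * norm (A y u - A x u - D ?w) + C * norm (A x ?z - A y ?z)"
            unfolding a using elim(1)
            by (smt (verit, best) norm_triangle_ineq4 norm_minus_cancel)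
          also have "norm (A x ?z - A y ?z) \<le> norm (A x - A y) * norm ?z"
            using norm_blinfun[of "A x - A y" ?z] by (simp add: blinfun.diff_left)
          also have "norm (A x - A y) * norm ?z \<le> norm (A x - A y) * (norm ?w * K)"
            by (intro mult_left_mono K) auto
          finally have b: "norm (J y v - J x v + ?z)
              \<le> C * norm (A y u - A x u - D ?w) + C * (norm (A x - A y) * (norm ?w * K))"
            using C(1) by (simp add: mult_left_mono)
          show ?case
          proof (cases "y = x")
            case False
            then have "norm ?w > 0" by simp
            have "norm ((J y v - J x v - - ?z) /\<^sub>R norm ?w) = norm (J y v - J x v + ?z) / norm ?w"
              by (simp add: divide_inverse mult.commute)
            also have "\<dots> \<le> (C * norm (A y u - A x u - D ?w) + C * (norm (A x - A y) * (norm ?w * K))) / norm ?w"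
              by (rule divide_right_mono[OF b]) simp
            also have "\<dots> = C * ?q y + C * norm (A x - A y) * K"
              using \<open>norm ?w > 0\<close> by (simp add: add_divide_distrib)
            finally show ?thesis .
          next
            case True
            have "D 0 = 0" "J x 0 = 0"
              using lin[OF x] has_derivative_linear[OF dD] linear_0 by blast+
            then show ?thesis using True by simp
          qed
        qed
        have 1: "(?q \<longlongrightarrow> 0) (at x)"
          using dD unfolding has_derivative_iff_norm by blast
        have "(A \<longlongrightarrow> A x) (at x)" using contA[OF x] isCont_def by blast
        then have "((\<lambda>y. C * ?q y + C * norm (A x - A y) * K) \<longlongrightarrow>
            C * 0 + C * norm (A x - A x) * K) (at x)"
          by (intro tendsto_intros 1)
        then show "((\<lambda>y. C * ?q y + C * norm (A x - A y) * K) \<longlongrightarrow> 0) (at x)" by simp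
      qed
    qed
    then show ?thesis by (simp only: D_def)
  qed
  show ?case
  proof (rule td_SucI[OF \<open>open S\<close> der])
    fix w
    let ?G = "\<lambda>x. \<Sum>c\<in>Basis. (- ((\<Sum>b\<in>Basis. (J x v \<bullet> b) *\<^sub>R ?F b x w) \<bullet> c)) *\<^sub>R J x c"
    have F: "times_differentiable_on n S (\<lambda>x. ?F b x w)" for b
      using Suc.prems by simp
    have inn: "bounded_linear (\<lambda>y. y \<bullet> b)" "bounded_linear (\<lambda>y. - (y \<bullet> b))" for b :: 'e
      by (intro bounded_linear_minus bounded_linear_inner_left)+
    have "times_differentiable_on n S ?G"
      by (intro td_sum td_scaleR[OF \<open>open S\<close>] td_bounded_linear_comp[OF \<open>open S\<close> inn(1)]
          td_bounded_linear_comp[OF \<open>open S\<close> inn(2)] tdJ F \<open>open S\<close>)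
    then show "times_differentiable_on n S (\<lambda>x. - J x (?D x w))"
    proof (rule td_cong[OF \<open>open S\<close>, rotated])
      fix x assume x: "x \<in> S"
      have "J x (\<Sum>c\<in>Basis. (?D x w \<bullet> c) *\<^sub>R c) = (\<Sum>c\<in>Basis. (?D x w \<bullet> c) *\<^sub>R J x c)"
        by (simp only: linear_sum[OF lin[OF x]] linear_scale[OF lin[OF x]])
      then show "?G x = - J x (?D x w)"
        by (simp add: euclidean_representation sum_negf)
    qed
  qed
qed

text \<open>The C^1 theorem supplies a homeomorphism whose inverse \<open>g\<close> has derivative
  \<open>inv (A (g y))\<close>. Smoothness is a bootstrap: \<open>n\<close> orders for
  \<open>g\<close> give \<open>n\<close> orders for \<open>A (g y)\<close> on vectors, hence for its
  inverse, hence \<open>n + 1\<close> orders for \<open>g\<close>.\<close>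

theorem smooth_inverse_function_theorem:
  fixes f :: "'e::euclidean_space \<Rightarrow> 'e"
  assumes "open U" "smooth_on U f" "x0 \<in> U" "frechet_derivative f (at x0) = id"
  obtains U' V g where "open U'" "U' \<subseteq> U" "x0 \<in> U'" "open V" "homeomorphism U' V f g" "smooth_on V g"
proof -
  define A where "A x = Blinfun (frechet_derivative f (at x))" for x
  have A: "blinfun_apply (A x) = frechet_derivative f (at x)" if "x \<in> U" for x
    unfolding A_def
    using smooth_on_has_derivative[OF assms(2) that] has_derivative_bounded_linear
    by (intro bounded_linear_Blinfun_apply) blast
  have dA: "(f has_derivative A x) (at x)" if "x \<in> U" for x
    using smooth_on_has_derivative[OF assms(2) that] A[OF that] by simp
  have smA: "smooth_on U (\<lambda>x. A x v)" for v
    by (rule smooth_on_cong[OF assms(1) smooth_on_frechet_derivative[OF assms(2), of v]])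
      (simp add: A)
  have "continuous_on U A"
    by (intro continuous_on_blinfun_componentwise smooth_on_continuous smA)
  moreover have "id_blinfun o\<^sub>L A x0 = id_blinfun"
    by (rule blinfun_eqI) (simp add: A assms)
  ultimately obtain U' V g g' where U': "open U'" "U' \<subseteq> U" "x0 \<in> U'" "open V" "f x0 \<in> V"
    and hom: "homeomorphism U' V f g"
    and g: "\<And>y. y \<in> V \<Longrightarrow> (g has_derivative (g' y)) (at y)"
    and g': "\<And>y. y \<in> V \<Longrightarrow> g' y = inv (blinfun_apply (A (g y)))"
    and bij: "\<And>y. y \<in> V \<Longrightarrow> bij (blinfun_apply (A (g y)))"
    using inverse_function_theorem[OF assms(1) dA _ assms(3)] by metis
  have gV: "g ` V \<subseteq> U" using hom U'(2) by (auto simp: homeomorphism_def)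
  have "times_differentiable_on n V g" for n
  proof (induction n)
    case 0
    then show ?case using hom by (simp add: homeomorphism_def)
  next
    case (Suc n)
    show ?case
    proof (rule td_SucI[OF \<open>open V\<close> g])
      fix v
      have t: "times_differentiable_on n V (\<lambda>y. A (g y) v)" for v
        using smA[of v] unfolding smooth_on_def
        by (intro td_compose[OF finite_dim_euclidean \<open>open V\<close> assms(1) gV Suc.IH]) auto
      show "times_differentiable_on n V (\<lambda>y. g' y v)"
      proof (rule operator_inverse_td[OF \<open>open V\<close>, of "\<lambda>y. A (g y)" g'])
        fix y v assume y: "y \<in> V"
        show "A (g y) (g' y v) = v" "g' y (A (g y) v) = v"
          using g'[OF y] bij[OF y] by (simp_all add: bij_is_surj bij_is_inj surj_f_inv_f)
      next
        fix y assume y: "y \<in> V"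
        show "linear (g' y)" using g[OF y] has_derivative_linear by blast
      qed (rule t)
    qed
  qed
  then have "smooth_on V g" by (simp add: smooth_on_def)
  then show thesis using that U' hom by blast
qed

section \<open>Charts and smooth maps\<close>

text \<open>\<open>mtopology\<close> is built by \<open>topology\<close>, so the describing
  predicate has to be shown to be a topology; injectivity of charts makes images commute with
  intersections.\<close>

lemma openin_mtopology:
  assumes "smooth_atlas M"
  shows "openin (mtopology M) W \<longleftrightarrow> W \<subseteq> mcarrier M \<and> (\<forall>(U, \<phi>)\<in>M. open (\<phi> ` (U \<inter> W)))"
proof -
  have inj: "inj_on \<phi> U" if "(U, \<phi>) \<in> M" for U \<phi>
    using assms that unfolding smooth_atlas_def by fast
  have "istopology (\<lambda>W. W \<subseteq> mcarrier M \<and> (\<forall>(U, \<phi>)\<in>M. open (\<phi> ` (U \<inter> W))))"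
    unfolding istopology_def
  proof (intro conjI allI impI)
    fix S T
    assume S: "S \<subseteq> mcarrier M \<and> (\<forall>(U, \<phi>)\<in>M. open (\<phi> ` (U \<inter> S)))"
      and T: "T \<subseteq> mcarrier M \<and> (\<forall>(U, \<phi>)\<in>M. open (\<phi> ` (U \<inter> T)))"
    then show "S \<inter> T \<subseteq> mcarrier M" by auto
    have "open (\<phi> ` (U \<inter> (S \<inter> T)))" if U: "(U, \<phi>) \<in> M" for U \<phi>
    proof -
      have "\<phi> ` (U \<inter> (S \<inter> T)) = \<phi> ` (U \<inter> S) \<inter> \<phi> ` (U \<inter> T)"
        using inj[OF U] unfolding inj_on_def by blast
      then show ?thesis using S T U by auto
    qed
    then show "\<forall>(U, \<phi>)\<in>M. open (\<phi> ` (U \<inter> (S \<inter> T)))" by auto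
  next
    fix \<K> assume K: "\<forall>K\<in>\<K>. K \<subseteq> mcarrier M \<and> (\<forall>(U, \<phi>)\<in>M. open (\<phi> ` (U \<inter> K)))"
    then show "\<Union> \<K> \<subseteq> mcarrier M" by auto
    have "open (\<phi> ` (U \<inter> \<Union> \<K>))" if U: "(U, \<phi>) \<in> M" for U \<phi>
    proof -
      have "\<phi> ` (U \<inter> \<Union> \<K>) = (\<Union>K\<in>\<K>. \<phi> ` (U \<inter> K))" by auto
      moreover have "open (\<Union>K\<in>\<K>. \<phi> ` (U \<inter> K))" using K U by (intro open_UN) auto
      ultimately show ?thesis by simp
    qed
    then show "\<forall>(U, \<phi>)\<in>M. open (\<phi> ` (U \<inter> \<Union> \<K>))" by auto
  qed
  then show ?thesis unfolding mtopology_def by (simp add: topology_inverse')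
qed

lemma topspace_mtopology:
  assumes "smooth_atlas M" shows "topspace (mtopology M) = mcarrier M"
proof -
  have "openin (mtopology M) (mcarrier M)"
    unfolding openin_mtopology[OF assms]
  proof safe
    fix U \<phi> assume U: "(U, \<phi>) \<in> M"
    then have "U \<inter> mcarrier M = U \<inter> U" unfolding mcarrier_def by force
    moreover have "open (\<phi> ` (U \<inter> U))" using assms U unfolding smooth_atlas_def by fast
    ultimately show "open (\<phi> ` (U \<inter> mcarrier M))" by simp
  qed
  moreover have "W \<subseteq> mcarrier M" if "openin (mtopology M) W" for W
    using that openin_mtopology[OF assms] by blast
  ultimately show ?thesis by (metis openin_subset openin_topspace subset_antisym)
qed

lemma openin_mtopology_mcarrier:
  "smooth_atlas M \<Longrightarrow> openin (mtopology M) W \<Longrightarrow> p \<in> W \<Longrightarrow> p \<in> mcarrier M"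
  using openin_subset topspace_mtopology by fastforce

lemma smooth_map_on_domain: "smooth_map_on M N W F \<Longrightarrow> openin (mtopology M) W"
  and smooth_map_on_range: "smooth_map_on M N W F \<Longrightarrow> p \<in> W \<Longrightarrow> F p \<in> mcarrier N"
  unfolding smooth_map_on_def by blast+

lemma openin_mtopology_Int:
  "openin (mtopology M) U \<Longrightarrow> openin (mtopology M) V \<Longrightarrow> openin (mtopology M) (U \<inter> V)"
  by (rule openin_Int)

text \<open>The charts of the maximal atlas of \<open>M\<close>.\<close>

definition chart_of :: "('p, 'e::real_normed_vector) atlas \<Rightarrow> 'p set \<Rightarrow> ('p \<Rightarrow> 'e) \<Rightarrow> bool" where
  "chart_of M U \<kappa> \<longleftrightarrow> openin (mtopology M) U \<and> inj_on \<kappa> U \<and> (\<forall>(V, \<psi>)\<in>M. open (\<kappa> ` (U \<inter> V)) \<and>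
     smooth_on (\<kappa> ` (U \<inter> V)) (\<psi> \<circ> inv_into U \<kappa>) \<and> smooth_on (\<psi> ` (U \<inter> V)) (\<kappa> \<circ> inv_into V \<psi>))"

lemma smooth_atlas_finite_dim:
  fixes M :: "('p, 'e::real_normed_vector) atlas"
  shows "smooth_atlas M \<Longrightarrow> finite_dim TYPE('e)"
  unfolding smooth_atlas_def finite_dim_def by blast

lemma chart_of_atlas:
  assumes "smooth_atlas M" "(U, \<phi>) \<in> M" shows "chart_of M U \<phi>"
proof -
  have *: "inj_on \<phi> U \<and> open (\<phi> ` (U \<inter> V)) \<and> smooth_on (\<phi> ` (U \<inter> V)) (\<psi> \<circ> inv_into U \<phi>)"
    if "(U, \<phi>) \<in> M" "(V, \<psi>) \<in> M" for U V \<phi> \<psi>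
    using assms(1) that unfolding smooth_atlas_def by fast
  have "openin (mtopology M) U" unfolding openin_mtopology[OF assms(1)]
    using *[OF _ assms(2)] assms(2) unfolding mcarrier_def by force
  moreover have "smooth_on (\<psi> ` (U \<inter> V)) (\<phi> \<circ> inv_into V \<psi>)" if "(V, \<psi>) \<in> M" for V \<psi>
    using *[OF that assms(2)] by (simp add: Int_commute)
  ultimately show ?thesis unfolding chart_of_def using *[OF assms(2)] assms(2) by fast
qed

lemma chart_of_openin: "chart_of M U \<kappa> \<Longrightarrow> openin (mtopology M) U"
  and chart_of_inj: "chart_of M U \<kappa> \<Longrightarrow> inj_on \<kappa> U"
  by (simp_all add: chart_of_def)

lemma chart_of_inv: "chart_of M U \<kappa> \<Longrightarrow> p \<in> U \<Longrightarrow> inv_into U \<kappa> (\<kappa> p) = p"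
  by (simp add: chart_of_def)

lemma chart_of_atlasD:
  assumes "chart_of M U \<kappa>" "(V, \<psi>) \<in> M"
  shows "open (\<kappa> ` (U \<inter> V))" "smooth_on (\<kappa> ` (U \<inter> V)) (\<psi> \<circ> inv_into U \<kappa>)"
    "smooth_on (\<psi> ` (U \<inter> V)) (\<kappa> \<circ> inv_into V \<psi>)"
  using assms unfolding chart_of_def by auto

lemma atlas_chart_exists:
  assumes "p \<in> mcarrier M" obtains U \<phi> where "(U, \<phi>) \<in> M" "p \<in> U"
  using assms unfolding mcarrier_def by force

text \<open>Near each point the image is the preimage of an open set under the transition to an
  atlas chart.\<close>

lemma chart_of_image_open:
  assumes "smooth_atlas M" "chart_of M U \<kappa>" "openin (mtopology M) W"
  shows "open (\<kappa> ` (U \<inter> W))"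
proof (rule openI)
  fix e assume "e \<in> \<kappa> ` (U \<inter> W)"
  then obtain p where p: "p \<in> U" "p \<in> W" "e = \<kappa> p" by auto
  have "p \<in> mcarrier M" using openin_mtopology_mcarrier[OF assms(1,3) p(2)] .
  then obtain V \<psi> where V: "(V, \<psi>) \<in> M" "p \<in> V" by (rule atlas_chart_exists)
  note ch = chart_of_atlasD[OF assms(2) V(1)]
  have injp: "inj_on \<psi> V" using chart_of_inj[OF chart_of_atlas[OF assms(1) V(1)]] .
  have "open (\<psi> ` (V \<inter> W))" using assms(3) V openin_mtopology[OF assms(1)] by auto
  then have o: "open (\<kappa> ` (U \<inter> V) \<inter> (\<psi> \<circ> inv_into U \<kappa>) -` (\<psi> ` (V \<inter> W)))"
    using continuous_open_preimage[OF smooth_on_continuous[OF ch(2)] ch(1)] by blast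
  have "\<kappa> ` (U \<inter> V) \<inter> (\<psi> \<circ> inv_into U \<kappa>) -` (\<psi> ` (V \<inter> W)) = \<kappa> ` (U \<inter> V \<inter> W)" (is "?L = ?R")
  proof
    show "?L \<subseteq> ?R"
    proof
      fix x assume "x \<in> ?L"
      then obtain q r where q: "q \<in> U" "q \<in> V" "x = \<kappa> q" and r: "r \<in> V" "r \<in> W" "\<psi> q = \<psi> r"
        using chart_of_inv[OF assms(2)] by auto
      then have "q = r" using injp by (auto dest: inj_onD)
      then show "x \<in> ?R" using q r by auto
    qed
    show "?R \<subseteq> ?L" using chart_of_inv[OF assms(2)] by auto
  qed
  with o have o: "open (\<kappa> ` (U \<inter> V \<inter> W))" by simp
  then obtain d where "d > 0" "ball e d \<subseteq> \<kappa> ` (U \<inter> V \<inter> W)"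
    using openE[OF o, of e] p V by auto
  then show "\<exists>d>0. ball e d \<subseteq> \<kappa> ` (U \<inter> W)" by (intro exI[of _ d]) auto
qed

lemma chart_of_range_open:
  assumes "smooth_atlas M" "chart_of M U \<kappa>" shows "open (\<kappa> ` U)"
  using chart_of_image_open[OF assms chart_of_openin[OF assms(2)]] by simp

lemma chart_of_restrict:
  assumes "smooth_atlas M" "chart_of M U \<kappa>" "openin (mtopology M) W"
  shows "chart_of M (U \<inter> W) \<kappa>"
  unfolding chart_of_def
proof safe
  show "openin (mtopology M) (U \<inter> W)" using assms chart_of_openin by blast
  show "inj_on \<kappa> (U \<inter> W)" using chart_of_inj[OF assms(2)] inj_on_subset by blast
  fix V \<psi> assume V: "(V, \<psi>) \<in> M"
  note ch = chart_of_atlasD[OF assms(2) V]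
  have "openin (mtopology M) (V \<inter> W)"
    using chart_of_openin[OF chart_of_atlas[OF assms(1) V]] assms(3) by blast
  then show o: "open (\<kappa> ` (U \<inter> W \<inter> V))"
    using chart_of_image_open[OF assms(1,2)] by (metis Int_assoc Int_commute)
  have "smooth_on (\<kappa> ` (U \<inter> W \<inter> V)) (\<psi> \<circ> inv_into U \<kappa>)"
    by (rule smooth_on_subset[OF ch(2)]) auto
  then show "smooth_on (\<kappa> ` (U \<inter> W \<inter> V)) (\<psi> \<circ> inv_into (U \<inter> W) \<kappa>)"
  proof (rule smooth_on_cong[OF o])
    fix x assume "x \<in> \<kappa> ` (U \<inter> W \<inter> V)"
    then show "(\<psi> \<circ> inv_into U \<kappa>) x = (\<psi> \<circ> inv_into (U \<inter> W) \<kappa>) x"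
      using chart_of_inv[OF assms(2)] inv_into_f_f[OF \<open>inj_on \<kappa> (U \<inter> W)\<close>] by auto
  qed
  show "smooth_on (\<psi> ` (U \<inter> W \<inter> V)) (\<kappa> \<circ> inv_into V \<psi>)"
    by (rule smooth_on_subset[OF ch(3)]) auto
qed

text \<open>Converse to \<open>chart_of_image_open\<close>: inside the domain of a chart, openness
  can be tested in that chart alone.\<close>

lemma chart_of_openinI:
  assumes "smooth_atlas M" "chart_of M U \<kappa>" "Q \<subseteq> U" "open (\<kappa> ` Q)"
  shows "openin (mtopology M) Q"
  unfolding openin_mtopology[OF assms(1)]
proof safe
  show "p \<in> mcarrier M" if "p \<in> Q" for p
    using that assms(3) openin_mtopology_mcarrier[OF assms(1) chart_of_openin[OF assms(2)]] by blast
  fix V \<psi> assume V: "(V, \<psi>) \<in> M"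
  note ch = chart_of_atlasD[OF assms(2) V]
  note cV = chart_of_atlas[OF assms(1) V]
  have "open (\<psi> ` (V \<inter> U))"
    by (rule chart_of_image_open[OF assms(1) cV chart_of_openin[OF assms(2)]])
  then have "open (\<psi> ` (U \<inter> V) \<inter> (\<kappa> \<circ> inv_into V \<psi>) -` (\<kappa> ` Q))"
    using continuous_open_preimage[OF smooth_on_continuous[OF ch(3)] _ assms(4)]
    by (simp add: Int_commute)
  moreover have "\<psi> ` (U \<inter> V) \<inter> (\<kappa> \<circ> inv_into V \<psi>) -` (\<kappa> ` Q) = \<psi> ` (V \<inter> Q)" (is "?L = ?R")
  proof
    show "?L \<subseteq> ?R"
    proof
      fix x assume "x \<in> ?L"
      then obtain q r where q: "q \<in> U" "q \<in> V" "x = \<psi> q" and r: "r \<in> Q" "\<kappa> q = \<kappa> r"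
        using chart_of_inv[OF cV] by auto
      then have "q = r" using chart_of_inj[OF assms(2)] assms(3) by (auto dest: inj_onD)
      then show "x \<in> ?R" using q r by auto
    qed
    show "?R \<subseteq> ?L" using chart_of_inv[OF cV] assms(3) by auto
  qed
  ultimately show "open (\<psi> ` (V \<inter> Q))" by simp
qed

text \<open>\<open>chart_of\<close> compares a chart with the atlas only, so the transition is
  factored locally through an atlas chart.\<close>

lemma chart_of_transition:
  assumes "smooth_atlas M" "chart_of M U \<kappa>" "chart_of M V \<psi>"
  shows "smooth_on (\<kappa> ` (U \<inter> V)) (\<psi> \<circ> inv_into U \<kappa>)"
proof (rule smooth_on_local)
  fix e assume "e \<in> \<kappa> ` (U \<inter> V)"
  then obtain p where p: "p \<in> U" "p \<in> V" "e = \<kappa> p" by auto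
  have "p \<in> mcarrier M"
    using openin_mtopology_mcarrier[OF assms(1) chart_of_openin[OF assms(2)] p(1)] .
  then obtain V0 \<psi>0 where V0: "(V0, \<psi>0) \<in> M" "p \<in> V0" by (rule atlas_chart_exists)
  note c1 = chart_of_atlasD[OF assms(2) V0(1)] and c2 = chart_of_atlasD[OF assms(3) V0(1)]
  note cV = chart_of_atlas[OF assms(1) V0(1)]
  let ?T = "\<kappa> ` (U \<inter> (V \<inter> V0))"
  have oT: "open ?T"
    by (intro chart_of_image_open[OF assms(1,2)] openin_mtopology_Int
        chart_of_openin[OF assms(3)] chart_of_openin[OF cV])
  have s1: "smooth_on ?T (\<psi>0 \<circ> inv_into U \<kappa>)" by (rule smooth_on_subset[OF c1(2)]) auto
  have oV: "open (\<psi>0 ` (V \<inter> V0))"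
    using chart_of_image_open[OF assms(1) cV chart_of_openin[OF assms(3)]] by (simp add: Int_commute)
  have "smooth_on ?T (\<lambda>x. (\<psi> \<circ> inv_into V0 \<psi>0) ((\<psi>0 \<circ> inv_into U \<kappa>) x))"
    by (rule smooth_on_compose[OF smooth_atlas_finite_dim[OF assms(1)] oT oV _ s1 c2(3)])
      (use chart_of_inv[OF assms(2)] in auto)
  then have "smooth_on ?T (\<psi> \<circ> inv_into U \<kappa>)"
  proof (rule smooth_on_cong[OF oT])
    fix x assume "x \<in> ?T"
    then show "(\<psi> \<circ> inv_into V0 \<psi>0) ((\<psi>0 \<circ> inv_into U \<kappa>) x) = (\<psi> \<circ> inv_into U \<kappa>) x"
      using chart_of_inv[OF assms(2)] chart_of_inv[OF cV] by auto
  qed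
  then show "\<exists>T. open T \<and> e \<in> T \<and> smooth_on T (\<psi> \<circ> inv_into U \<kappa>)"
    using oT p V0 by blast
qed

lemma smooth_map_on_openin:
  assumes M: "smooth_atlas M" and N: "smooth_atlas N" and F: "smooth_map_on M N W F"
    and V: "openin (mtopology N) V"
  shows "openin (mtopology M) {p \<in> W. F p \<in> V}"
  unfolding openin_mtopology[OF M]
proof safe
  show "p \<in> mcarrier M" if "p \<in> W" for p
    by (rule openin_mtopology_mcarrier[OF M smooth_map_on_domain[OF F] that])
  fix U \<phi> assume U: "(U, \<phi>) \<in> M"
  note cU = chart_of_atlas[OF M U]
  show "open (\<phi> ` (U \<inter> {p \<in> W. F p \<in> V}))"
  proof (rule openI)
    fix e assume "e \<in> \<phi> ` (U \<inter> {p \<in> W. F p \<in> V})"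
    then obtain p where p: "p \<in> U" "p \<in> W" "F p \<in> V" "e = \<phi> p" by auto
    then have "F p \<in> mcarrier N" using smooth_map_on_range[OF F] by blast
    then obtain V0 \<psi> where V0: "(V0, \<psi>) \<in> N" "F p \<in> V0" by (rule atlas_chart_exists)
    note cV = chart_of_atlas[OF N V0(1)]
    let ?A = "\<phi> ` {p \<in> U \<inter> W. F p \<in> V0}"
    have A: "open ?A" "smooth_on ?A (\<psi> \<circ> F \<circ> inv_into U \<phi>)"
      using F U V0 unfolding smooth_map_on_def by auto
    have "open (\<psi> ` (V0 \<inter> V))" by (rule chart_of_image_open[OF N cV V])
    then have o: "open (?A \<inter> (\<psi> \<circ> F \<circ> inv_into U \<phi>) -` (\<psi> ` (V0 \<inter> V)))"
      using continuous_open_preimage[OF smooth_on_continuous[OF A(2)] A(1)] by blast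
    have "e \<in> ?A \<inter> (\<psi> \<circ> F \<circ> inv_into U \<phi>) -` (\<psi> ` (V0 \<inter> V))"
      using p V0 chart_of_inv[OF cU] by auto
    then obtain d where d: "d > 0" "ball e d \<subseteq> ?A \<inter> (\<psi> \<circ> F \<circ> inv_into U \<phi>) -` (\<psi> ` (V0 \<inter> V))"
      using openE[OF o] by blast
    have "?A \<inter> (\<psi> \<circ> F \<circ> inv_into U \<phi>) -` (\<psi> ` (V0 \<inter> V)) \<subseteq> \<phi> ` (U \<inter> {p \<in> W. F p \<in> V})"
    proof
      fix x assume "x \<in> ?A \<inter> (\<psi> \<circ> F \<circ> inv_into U \<phi>) -` (\<psi> ` (V0 \<inter> V))"
      then obtain q r where q: "q \<in> U" "q \<in> W" "F q \<in> V0" "x = \<phi> q"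
        and r: "r \<in> V0" "r \<in> V" "\<psi> (F q) = \<psi> r"
        using chart_of_inv[OF cU] by auto
      then have "F q = r" using chart_of_inj[OF cV] by (auto dest: inj_onD)
      then show "x \<in> \<phi> ` (U \<inter> {p \<in> W. F p \<in> V})" using q r by auto
    qed
    then show "\<exists>d>0. ball e d \<subseteq> \<phi> ` (U \<inter> {p \<in> W. F p \<in> V})"
      using d(1) order_trans[OF d(2)] by (intro exI[of _ d] conjI)
  qed
qed

text \<open>Carries the defining condition from atlas charts to all compatible charts; slice charts
  need not belong to the atlas.\<close>

lemma smooth_map_on_chart:
  assumes M: "smooth_atlas M" and N: "smooth_atlas N" and F: "smooth_map_on M N W F"
    and cU: "chart_of M U \<kappa>" and cV: "chart_of N V \<psi>"
  shows "open (\<kappa> ` {p \<in> U \<inter> W. F p \<in> V})"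
    and "smooth_on (\<kappa> ` {p \<in> U \<inter> W. F p \<in> V}) (\<psi> \<circ> F \<circ> inv_into U \<kappa>)"
proof -
  have oO: "openin (mtopology M) {p \<in> W. F p \<in> V}"
    by (rule smooth_map_on_openin[OF M N F chart_of_openin[OF cV]])
  have e: "{p \<in> U \<inter> W. F p \<in> V} = U \<inter> {p \<in> W. F p \<in> V}" by auto
  show "open (\<kappa> ` {p \<in> U \<inter> W. F p \<in> V})"
    unfolding e by (rule chart_of_image_open[OF M cU oO])
  show "smooth_on (\<kappa> ` {p \<in> U \<inter> W. F p \<in> V}) (\<psi> \<circ> F \<circ> inv_into U \<kappa>)"
  proof (rule smooth_on_local)
    fix x assume "x \<in> \<kappa> ` {p \<in> U \<inter> W. F p \<in> V}"
    then obtain p where p: "p \<in> U" "p \<in> W" "F p \<in> V" "x = \<kappa> p" by auto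
    have *: "p \<in> mcarrier M" "F p \<in> mcarrier N"
      using openin_mtopology_mcarrier[OF M chart_of_openin[OF cU]] p
        openin_mtopology_mcarrier[OF N chart_of_openin[OF cV]] by blast+
    obtain U0 \<phi> where U0: "(U0, \<phi>) \<in> M" "p \<in> U0" by (rule atlas_chart_exists[OF *(1)])
    obtain V0 \<psi>0 where V0: "(V0, \<psi>0) \<in> N" "F p \<in> V0" by (rule atlas_chart_exists[OF *(2)])
    note cU0 = chart_of_atlas[OF M U0(1)] and cV0 = chart_of_atlas[OF N V0(1)]
    let ?Q = "U0 \<inter> {q \<in> W. F q \<in> V \<inter> V0}"
    let ?T = "\<kappa> ` (U \<inter> ?Q)"
    have oQ: "openin (mtopology M) ?Q"
      by (intro openin_mtopology_Int chart_of_openin[OF cU0] smooth_map_on_openin[OF M N F]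
          chart_of_openin[OF cV] chart_of_openin[OF cV0])
    have oT: "open ?T" by (rule chart_of_image_open[OF M cU oQ])
    have A: "open (\<phi> ` {p \<in> U0 \<inter> W. F p \<in> V0})"
      "smooth_on (\<phi> ` {p \<in> U0 \<inter> W. F p \<in> V0}) (\<psi>0 \<circ> F \<circ> inv_into U0 \<phi>)"
      using F U0 V0 unfolding smooth_map_on_def by auto
    let ?B = "\<phi> ` ?Q"
    have oB: "open ?B"
      using chart_of_image_open[OF M cU0 oQ] by (simp add: Int_absorb1 Int_assoc[symmetric])
    have sB: "smooth_on ?B (\<psi>0 \<circ> F \<circ> inv_into U0 \<phi>)" by (rule smooth_on_subset[OF A(2)]) auto
    have s1: "smooth_on ?T (\<phi> \<circ> inv_into U \<kappa>)"
      by (rule smooth_on_subset[OF chart_of_transition[OF M cU cU0]]) auto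
    have s2: "smooth_on ?T (\<lambda>x. (\<psi>0 \<circ> F \<circ> inv_into U0 \<phi>) ((\<phi> \<circ> inv_into U \<kappa>) x))"
      by (rule smooth_on_compose[OF smooth_atlas_finite_dim[OF M] oT oB _ s1 sB])
        (use chart_of_inv[OF cU] in auto)
    have oV: "open (\<psi>0 ` (V0 \<inter> V))"
      by (rule chart_of_image_open[OF N cV0 chart_of_openin[OF cV]])
    have "smooth_on ?T (\<lambda>x. (\<psi> \<circ> inv_into V0 \<psi>0) ((\<psi>0 \<circ> F \<circ> inv_into U0 \<phi>) ((\<phi> \<circ> inv_into U \<kappa>) x)))"
      by (rule smooth_on_compose[OF smooth_atlas_finite_dim[OF N] oT oV _ s2
            chart_of_transition[OF N cV0 cV]])
        (use chart_of_inv[OF cU] chart_of_inv[OF cU0] in auto)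
    then have "smooth_on ?T (\<psi> \<circ> F \<circ> inv_into U \<kappa>)"
    proof (rule smooth_on_cong[OF oT])
      fix x assume "x \<in> ?T"
      then show "(\<psi> \<circ> inv_into V0 \<psi>0) ((\<psi>0 \<circ> F \<circ> inv_into U0 \<phi>) ((\<phi> \<circ> inv_into U \<kappa>) x))
          = (\<psi> \<circ> F \<circ> inv_into U \<kappa>) x"
        using chart_of_inv[OF cU] chart_of_inv[OF cU0] chart_of_inv[OF cV0] by auto
    qed
    then show "\<exists>T. open T \<and> x \<in> T \<and> smooth_on T (\<psi> \<circ> F \<circ> inv_into U \<kappa>)"
      using oT p U0 V0 by blast
  qed
qed

text \<open>One pair of compatible charts at each point suffices: the expressions in atlas charts
  arise by composing with transitions on both sides.\<close>

lemma smooth_map_onI: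
  assumes M: "smooth_atlas M" and N: "smooth_atlas N"
    and loc: "\<And>p. p \<in> W \<Longrightarrow> \<exists>U \<kappa> V \<psi>. chart_of M U \<kappa> \<and> chart_of N V \<psi> \<and> p \<in> U \<and> U \<subseteq> W \<and> F ` U \<subseteq> V \<and>
       smooth_on (\<kappa> ` U) (\<psi> \<circ> F \<circ> inv_into U \<kappa>)"
  shows "smooth_map_on M N W F"
proof -
  have "\<exists>T. openin (mtopology M) T \<and> p \<in> T \<and> T \<subseteq> W" if "p \<in> W" for p
    using loc[OF that] chart_of_openin by metis
  then have "openin (mtopology M) W"
    by (subst openin_subopen) blast
  moreover have "F ` W \<subseteq> mcarrier N"
  proof
    fix y assume "y \<in> F ` W"
    then obtain p where "p \<in> W" "y = F p" by auto
    then obtain V \<psi> where "chart_of N V \<psi>" "y \<in> V" using loc[of p] by fast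
    then show "y \<in> mcarrier N" using chart_of_openin openin_mtopology[OF N] by blast
  qed
  moreover have "open (\<phi> ` {p \<in> U0 \<inter> W. F p \<in> V0}) \<and>
      smooth_on (\<phi> ` {p \<in> U0 \<inter> W. F p \<in> V0}) (\<psi>0 \<circ> F \<circ> inv_into U0 \<phi>)"
    if U0: "(U0, \<phi>) \<in> M" and V0: "(V0, \<psi>0) \<in> N" for U0 \<phi> V0 \<psi>0
  proof -
    note cU0 = chart_of_atlas[OF M U0] and cV0 = chart_of_atlas[OF N V0]
    have *: "\<exists>T. open T \<and> e \<in> T \<and> T \<subseteq> \<phi> ` {p \<in> U0 \<inter> W. F p \<in> V0} \<and> smooth_on T (\<psi>0 \<circ> F \<circ> inv_into U0 \<phi>)"
      if e: "e \<in> \<phi> ` {p \<in> U0 \<inter> W. F p \<in> V0}" for e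
    proof -
      obtain p where p: "p \<in> U0" "p \<in> W" "F p \<in> V0" "e = \<phi> p" using e by blast
      obtain U \<kappa> V \<psi> where cU: "chart_of M U \<kappa>" and cV: "chart_of N V \<psi>" and U: "p \<in> U" "U \<subseteq> W" "F ` U \<subseteq> V"
        and s: "smooth_on (\<kappa> ` U) (\<psi> \<circ> F \<circ> inv_into U \<kappa>)" using loc[OF p(2)] by blast
      let ?Q = "{q \<in> U. F q \<in> V0}"
      have oc: "open (\<kappa> ` U)" by (rule chart_of_range_open[OF M cU])
      have "open (\<psi> ` (V \<inter> V0))"
        by (rule chart_of_image_open[OF N cV chart_of_openin[OF cV0]])
      then have "open (\<kappa> ` U \<inter> (\<psi> \<circ> F \<circ> inv_into U \<kappa>) -` (\<psi> ` (V \<inter> V0)))"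
        using continuous_open_preimage[OF smooth_on_continuous[OF s] oc] by blast
      moreover have "\<kappa> ` U \<inter> (\<psi> \<circ> F \<circ> inv_into U \<kappa>) -` (\<psi> ` (V \<inter> V0)) = \<kappa> ` ?Q" (is "?L = ?R")
      proof
        show "?L \<subseteq> ?R"
        proof
          fix x assume "x \<in> ?L"
          then obtain q r where q: "q \<in> U" "x = \<kappa> q" and r: "r \<in> V" "r \<in> V0" "\<psi> (F q) = \<psi> r"
            using chart_of_inv[OF cU] by auto
          then have "F q = r" using chart_of_inj[OF cV] U by (auto dest: inj_onD)
          then show "x \<in> ?R" using q r by auto
        qed
        show "?R \<subseteq> ?L" using chart_of_inv[OF cU] U by auto
      qed
      ultimately have "open (\<kappa> ` ?Q)" by simp
      then have oQ: "openin (mtopology M) ?Q" by (rule chart_of_openinI[OF M cU, rotated]) auto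
      let ?T = "\<phi> ` (U0 \<inter> ?Q)"
      have oT: "open ?T" by (rule chart_of_image_open[OF M cU0 oQ])
      have s1: "smooth_on ?T (\<kappa> \<circ> inv_into U0 \<phi>)"
        by (rule smooth_on_subset[OF chart_of_transition[OF M cU0 cU]]) auto
      have s2: "smooth_on ?T (\<lambda>x. (\<psi> \<circ> F \<circ> inv_into U \<kappa>) ((\<kappa> \<circ> inv_into U0 \<phi>) x))"
        by (rule smooth_on_compose[OF smooth_atlas_finite_dim[OF M] oT oc _ s1 s])
          (use chart_of_inv[OF cU0] in auto)
      have oV: "open (\<psi> ` (V \<inter> V0))"
        by (rule chart_of_image_open[OF N cV chart_of_openin[OF cV0]])
      have "smooth_on ?T (\<lambda>x. (\<psi>0 \<circ> inv_into V \<psi>) ((\<psi> \<circ> F \<circ> inv_into U \<kappa>) ((\<kappa> \<circ> inv_into U0 \<phi>) x)))"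
        by (rule smooth_on_compose[OF smooth_atlas_finite_dim[OF N] oT oV _ s2
              chart_of_transition[OF N cV cV0]])
          (use chart_of_inv[OF cU] chart_of_inv[OF cU0] U in auto)
      then have "smooth_on ?T (\<psi>0 \<circ> F \<circ> inv_into U0 \<phi>)"
      proof (rule smooth_on_cong[OF oT])
        fix x assume "x \<in> ?T"
        then obtain q where q: "q \<in> U0" "q \<in> U" "x = \<phi> q" by auto
        then show "(\<psi>0 \<circ> inv_into V \<psi>) ((\<psi> \<circ> F \<circ> inv_into U \<kappa>) ((\<kappa> \<circ> inv_into U0 \<phi>) x))
            = (\<psi>0 \<circ> F \<circ> inv_into U0 \<phi>) x"
          using chart_of_inv[OF cU, of q] chart_of_inv[OF cU0, of q] chart_of_inv[OF cV, of "F q"] U by auto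
      qed
      moreover have "e \<in> ?T" "?T \<subseteq> \<phi> ` {p \<in> U0 \<inter> W. F p \<in> V0}" using p U by auto
      ultimately show ?thesis using oT by blast
    qed
    have "open (\<phi> ` {p \<in> U0 \<inter> W. F p \<in> V0})"
      using * by (subst open_subopen) meson
    moreover have "smooth_on (\<phi> ` {p \<in> U0 \<inter> W. F p \<in> V0}) (\<psi>0 \<circ> F \<circ> inv_into U0 \<phi>)"
      by (rule smooth_on_local) (use * in meson)
    ultimately show ?thesis by blast
  qed
  ultimately show ?thesis unfolding smooth_map_on_def by auto
qed

lemma smooth_map_on_cong:
  assumes M: "smooth_atlas M" and N: "smooth_atlas N"
    and F: "smooth_map_on M N W F" and eq: "\<And>p. p \<in> W \<Longrightarrow> F p = G p"
  shows "smooth_map_on M N W G"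
  unfolding smooth_map_on_def
proof (intro conjI ballI, goal_cases)
  case 1
  then show ?case using F unfolding smooth_map_on_def by blast
next
  case 2
  then show ?case using smooth_map_on_range[OF F] eq by fastforce
next
  case (3 a)
  obtain U \<phi> where a: "a = (U, \<phi>)" "(U, \<phi>) \<in> M" using 3 by (cases a) auto
  have "open (\<phi> ` {p \<in> U \<inter> W. G p \<in> V}) \<and>
      smooth_on (\<phi> ` {p \<in> U \<inter> W. G p \<in> V}) (\<psi> \<circ> G \<circ> inv_into U \<phi>)" if V: "(V, \<psi>) \<in> N" for V \<psi>
  proof -
    have e: "{p \<in> U \<inter> W. G p \<in> V} = {p \<in> U \<inter> W. F p \<in> V}" using eq by auto
    have f: "open (\<phi> ` {p \<in> U \<inter> W. F p \<in> V})"
      "smooth_on (\<phi> ` {p \<in> U \<inter> W. F p \<in> V}) (\<psi> \<circ> F \<circ> inv_into U \<phi>)"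
      using F a V unfolding smooth_map_on_def by auto
    have "smooth_on (\<phi> ` {p \<in> U \<inter> W. F p \<in> V}) (\<psi> \<circ> G \<circ> inv_into U \<phi>)"
    proof (rule smooth_on_cong[OF f])
      fix x assume "x \<in> \<phi> ` {p \<in> U \<inter> W. F p \<in> V}"
      then show "(\<psi> \<circ> F \<circ> inv_into U \<phi>) x = (\<psi> \<circ> G \<circ> inv_into U \<phi>) x"
        using chart_of_inv[OF chart_of_atlas[OF M a(2)]] eq by auto
    qed
    then show ?thesis using f e by simp
  qed
  then show ?case using a by auto
qed

lemma smooth_map_on_subset:
  assumes M: "smooth_atlas M" and N: "smooth_atlas N"
    and F: "smooth_map_on M N W F" and W': "openin (mtopology M) W'" "W' \<subseteq> W"
  shows "smooth_map_on M N W' F"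
proof (rule smooth_map_onI[OF M N])
  fix p assume p: "p \<in> W'"
  then have *: "p \<in> mcarrier M" "F p \<in> mcarrier N"
    using W' openin_mtopology_mcarrier[OF M W'(1)] smooth_map_on_range[OF F] by blast+
  obtain U \<phi> where U: "(U, \<phi>) \<in> M" "p \<in> U" by (rule atlas_chart_exists[OF *(1)])
  obtain V \<psi> where V: "(V, \<psi>) \<in> N" "F p \<in> V" by (rule atlas_chart_exists[OF *(2)])
  note cU = chart_of_atlas[OF M U(1)] and cV = chart_of_atlas[OF N V(1)]
  let ?Q = "W' \<inter> {q \<in> W. F q \<in> V}"
  have c: "chart_of M (U \<inter> ?Q) \<phi>"
    by (intro chart_of_restrict[OF M cU] openin_mtopology_Int W'
        smooth_map_on_openin[OF M N F] chart_of_openin[OF cV])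
  have "smooth_on (\<phi> ` (U \<inter> ?Q)) (\<psi> \<circ> F \<circ> inv_into U \<phi>)"
    by (rule smooth_on_subset[OF smooth_map_on_chart(2)[OF M N F cU cV]]) auto
  then have "smooth_on (\<phi> ` (U \<inter> ?Q)) (\<psi> \<circ> F \<circ> inv_into (U \<inter> ?Q) \<phi>)"
  proof (rule smooth_on_cong[OF chart_of_range_open[OF M c]])
    fix x assume "x \<in> \<phi> ` (U \<inter> ?Q)"
    then show "(\<psi> \<circ> F \<circ> inv_into U \<phi>) x = (\<psi> \<circ> F \<circ> inv_into (U \<inter> ?Q) \<phi>) x"
      using chart_of_inv[OF cU] chart_of_inv[OF c] by auto
  qed
  then show "\<exists>U \<kappa> V \<psi>. chart_of M U \<kappa> \<and> chart_of N V \<psi> \<and> p \<in> U \<and> U \<subseteq> W' \<and> F ` U \<subseteq> V \<and>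
       smooth_on (\<kappa> ` U) (\<psi> \<circ> F \<circ> inv_into U \<kappa>)"
    using c cV p U V W' by (intro exI[of _ "U \<inter> ?Q"] exI[of _ \<phi>] exI[of _ V] exI[of _ \<psi>]) auto
qed

lemma smooth_map_on_compose:
  assumes M: "smooth_atlas M" and N: "smooth_atlas N" and P: "smooth_atlas P"
    and F: "smooth_map_on M N W F" and G: "smooth_map_on N P W' G"
  shows "smooth_map_on M P {p \<in> W. F p \<in> W'} (\<lambda>p. G (F p))"
proof (rule smooth_map_onI[OF M P])
  fix p assume p: "p \<in> {p \<in> W. F p \<in> W'}"
  then have *: "p \<in> mcarrier M" "F p \<in> mcarrier N" "G (F p) \<in> mcarrier P"
    using openin_mtopology_mcarrier[OF M smooth_map_on_domain[OF F]]
      smooth_map_on_range[OF F] smooth_map_on_range[OF G] by blast+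
  obtain U \<phi> where U: "(U, \<phi>) \<in> M" "p \<in> U" by (rule atlas_chart_exists[OF *(1)])
  obtain V \<psi> where V: "(V, \<psi>) \<in> N" "F p \<in> V" by (rule atlas_chart_exists[OF *(2)])
  obtain Z \<zeta> where Z: "(Z, \<zeta>) \<in> P" "G (F p) \<in> Z" by (rule atlas_chart_exists[OF *(3)])
  note cU = chart_of_atlas[OF M U(1)] and cV = chart_of_atlas[OF N V(1)] and cZ = chart_of_atlas[OF P Z(1)]
  let ?V = "{q \<in> V \<inter> W'. G q \<in> Z}"
  have oV: "openin (mtopology N) ?V"
    using openin_mtopology_Int[OF chart_of_openin[OF cV] smooth_map_on_openin[OF N P G chart_of_openin[OF cZ]]]
    by (simp add: Int_def conj_ac)
  let ?U = "U \<inter> {q \<in> W. F q \<in> ?V}"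
  have c: "chart_of M ?U \<phi>"
    by (intro chart_of_restrict[OF M cU] smooth_map_on_openin[OF M N F] oV)
  have oU: "open (\<phi> ` ?U)" by (rule chart_of_range_open[OF M c])
  have s1: "smooth_on (\<phi> ` ?U) (\<psi> \<circ> F \<circ> inv_into U \<phi>)"
    by (rule smooth_on_subset[OF smooth_map_on_chart(2)[OF M N F cU cV]]) auto
  have "smooth_on (\<phi> ` ?U) (\<lambda>x. (\<zeta> \<circ> G \<circ> inv_into V \<psi>) ((\<psi> \<circ> F \<circ> inv_into U \<phi>) x))"
    by (rule smooth_on_compose[OF smooth_atlas_finite_dim[OF N] oU smooth_map_on_chart(1)[OF N P G cV cZ]
          _ s1 smooth_map_on_chart(2)[OF N P G cV cZ]])
      (use chart_of_inv[OF cU] in auto)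
  then have "smooth_on (\<phi> ` ?U) (\<zeta> \<circ> (\<lambda>p. G (F p)) \<circ> inv_into ?U \<phi>)"
  proof (rule smooth_on_cong[OF oU])
    fix x assume "x \<in> \<phi> ` ?U"
    then obtain q where q: "x = \<phi> q" "q \<in> ?U" by auto
    then show "(\<zeta> \<circ> G \<circ> inv_into V \<psi>) ((\<psi> \<circ> F \<circ> inv_into U \<phi>) x) = (\<zeta> \<circ> (\<lambda>p. G (F p)) \<circ> inv_into ?U \<phi>) x"
      using chart_of_inv[OF cU, of q] chart_of_inv[OF c, of q] chart_of_inv[OF cV, of "F q"] by auto
  qed
  then show "\<exists>U \<kappa> V \<psi>. chart_of M U \<kappa> \<and> chart_of P V \<psi> \<and> p \<in> U \<and> U \<subseteq> {p \<in> W. F p \<in> W'} \<and>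
      (\<lambda>p. G (F p)) ` U \<subseteq> V \<and> smooth_on (\<kappa> ` U) (\<psi> \<circ> (\<lambda>p. G (F p)) \<circ> inv_into U \<kappa>)"
    using c cZ p U V Z by (intro exI[of _ ?U] exI[of _ \<phi>] exI[of _ Z] exI[of _ \<zeta>]) auto
qed

section \<open>Functions and tangent vectors\<close>

lemma inv_into_ident: "x \<in> A \<Longrightarrow> inv_into A (\<lambda>x. x) x = x"
  by (simp add: inv_into_f_f inj_on_def)

lemma inv_into_UNIV_ident: "inv_into UNIV (\<lambda>x. x) = (\<lambda>x. x)"
  by (simp add: fun_eq_iff inv_into_ident)

lemma smooth_atlas_vector:
  assumes "finite_dim TYPE('e::real_normed_vector)"
  shows "smooth_atlas (vector_atlas :: ('e, 'e) atlas)"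
proof -
  show ?thesis
    using assms smooth_on_id[of "UNIV :: 'e set"]
    unfolding smooth_atlas_def vector_atlas_def finite_dim_def
    by (auto simp: o_def inv_into_UNIV_ident)
qed

lemma smooth_atlas_real [simp]: "smooth_atlas (vector_atlas :: (real, real) atlas)"
  by (rule smooth_atlas_vector) simp

lemma mcarrier_vector [simp]: "mcarrier vector_atlas = UNIV"
  by (simp add: mcarrier_def vector_atlas_def)

lemma openin_vector_real: "openin (mtopology (vector_atlas :: (real, real) atlas)) W \<longleftrightarrow> open W"
  unfolding openin_mtopology[OF smooth_atlas_real] mcarrier_vector
  by (simp add: vector_atlas_def)

lemma chart_of_real: "open W \<Longrightarrow> chart_of (vector_atlas :: (real, real) atlas) W (\<lambda>x. x)"
  using chart_of_restrict[OF smooth_atlas_real chart_of_atlas[OF smooth_atlas_real, of UNIV "\<lambda>x. x"]]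
  by (simp add: openin_vector_real) (simp add: vector_atlas_def)

section \<open>Real-valued smooth functions\<close>

abbreviation smooth_real_on :: "('p, 'e::real_normed_vector) atlas \<Rightarrow> 'p set \<Rightarrow> ('p \<Rightarrow> real) \<Rightarrow> bool" where
  "smooth_real_on M W f \<equiv> smooth_map_on M (vector_atlas :: (real, real) atlas) W f"

lemma smooth_real_on_iff:
  assumes "smooth_atlas M"
  shows "smooth_real_on M W f \<longleftrightarrow>
    openin (mtopology M) W \<and> (\<forall>(U, \<phi>)\<in>M. smooth_on (\<phi> ` (U \<inter> W)) (f \<circ> inv_into U \<phi>))"
proof -
  have e: "{p \<in> U. p \<in> W} = U \<inter> W" "(\<lambda>x. x) \<circ> f \<circ> inv_into U \<phi> = f \<circ> inv_into U \<phi>" for U \<phi>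
    by auto
  show ?thesis
    unfolding smooth_map_on_def
    using openin_mtopology[OF assms, of W]
    by (auto simp: vector_atlas_def e mcarrier_def)
qed

lemma smooth_real_on_chart:
  assumes "smooth_atlas M" "smooth_real_on M W f" "chart_of M U \<kappa>"
  shows "smooth_on (\<kappa> ` (U \<inter> W)) (f \<circ> inv_into U \<kappa>)"
proof -
  have "{p \<in> U \<inter> W. f p \<in> UNIV} = U \<inter> W" by auto
  then show ?thesis
    using smooth_map_on_chart(2)[OF assms(1) smooth_atlas_real assms(2,3) chart_of_real[OF open_UNIV]]
    by (simp add: o_def)
qed

lemma smooth_real_on_chartI:
  assumes "smooth_atlas M" "chart_of M U \<kappa>" "smooth_on (\<kappa> ` U) h"
  shows "smooth_real_on M U (\<lambda>q. h (\<kappa> q))"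
proof (rule smooth_map_onI[OF assms(1) smooth_atlas_real])
  fix p assume p: "p \<in> U"
  have "smooth_on (\<kappa> ` U) ((\<lambda>x. x) \<circ> (\<lambda>q. h (\<kappa> q)) \<circ> inv_into U \<kappa>)"
    by (rule smooth_on_cong[OF chart_of_range_open[OF assms(1,2)] assms(3)])
      (use chart_of_inv[OF assms(2)] in auto)
  then show "\<exists>U' \<kappa>' V \<psi>. chart_of M U' \<kappa>' \<and> chart_of vector_atlas V \<psi> \<and> p \<in> U' \<and> U' \<subseteq> U \<and>
       (\<lambda>q. h (\<kappa> q)) ` U' \<subseteq> V \<and> smooth_on (\<kappa>' ` U') (\<psi> \<circ> (\<lambda>q. h (\<kappa> q)) \<circ> inv_into U' \<kappa>')"
    using assms(2) p chart_of_real[OF open_UNIV]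
    by (intro exI[of _ U] exI[of _ \<kappa>] exI[of _ UNIV] exI[of _ "\<lambda>x::real. x"]) auto
qed

lemma smooth_real_on_add:
  assumes "smooth_atlas M" "smooth_real_on M W f" "smooth_real_on M W g"
  shows "smooth_real_on M W (\<lambda>p. f p + g p)"
proof -
  have "smooth_on (\<phi> ` (U \<inter> W)) ((\<lambda>p. f p + g p) \<circ> inv_into U \<phi>)" if "(U, \<phi>) \<in> M" for U \<phi>
  proof -
    have "open (\<phi> ` (U \<inter> W))" "smooth_on (\<phi> ` (U \<inter> W)) (f \<circ> inv_into U \<phi>)"
      "smooth_on (\<phi> ` (U \<inter> W)) (g \<circ> inv_into U \<phi>)"
      using assms that smooth_real_on_iff[OF assms(1)] openin_mtopology[OF assms(1)] by auto
    then show ?thesis using smooth_on_add by (fastforce simp: o_def)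
  qed
  then show ?thesis using assms smooth_real_on_iff[OF assms(1)] by auto
qed

lemma smooth_real_on_mult:
  assumes "smooth_atlas M" "smooth_real_on M W f" "smooth_real_on M W g"
  shows "smooth_real_on M W (\<lambda>p. f p * g p)"
proof -
  have "smooth_on (\<phi> ` (U \<inter> W)) ((\<lambda>p. f p * g p) \<circ> inv_into U \<phi>)" if "(U, \<phi>) \<in> M" for U \<phi>
  proof -
    have "open (\<phi> ` (U \<inter> W))" "smooth_on (\<phi> ` (U \<inter> W)) (f \<circ> inv_into U \<phi>)"
      "smooth_on (\<phi> ` (U \<inter> W)) (g \<circ> inv_into U \<phi>)"
      using assms that smooth_real_on_iff[OF assms(1)] openin_mtopology[OF assms(1)] by auto
    then show ?thesis using smooth_on_mult by (fastforce simp: o_def)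
  qed
  then show ?thesis using assms smooth_real_on_iff[OF assms(1)] by auto
qed

lemma smooth_real_on_const:
  assumes "smooth_atlas M" "openin (mtopology M) W"
  shows "smooth_real_on M W (\<lambda>p. c)"
  using assms smooth_real_on_iff[OF assms(1)] openin_mtopology[OF assms(1), of W] smooth_on_const
  by (fastforce simp: o_def)

lemma smooth_real_on_inverse:
  assumes "smooth_atlas M" "smooth_real_on M W f" "\<And>p. p \<in> W \<Longrightarrow> f p \<noteq> 0"
  shows "smooth_real_on M W (\<lambda>p. inverse (f p))"
proof -
  have "smooth_on (\<phi> ` (U \<inter> W)) ((\<lambda>p. inverse (f p)) \<circ> inv_into U \<phi>)" if U: "(U, \<phi>) \<in> M" for U \<phi>
  proof -
    have "open (\<phi> ` (U \<inter> W))" "smooth_on (\<phi> ` (U \<inter> W)) (f \<circ> inv_into U \<phi>)"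
      using assms that smooth_real_on_iff[OF assms(1)] openin_mtopology[OF assms(1)] by auto
    moreover have "(f \<circ> inv_into U \<phi>) x \<noteq> 0" if "x \<in> \<phi> ` (U \<inter> W)" for x
      using that chart_of_inv[OF chart_of_atlas[OF assms(1) U]] assms(3) by auto
    ultimately show ?thesis using smooth_on_inverse by (fastforce simp: o_def)
  qed
  then show ?thesis using assms smooth_real_on_iff[OF assms(1)] by auto
qed

lemma smooth_real_on_Int:
  assumes "smooth_atlas M" "smooth_real_on M W f" "openin (mtopology M) W'"
  shows "smooth_real_on M (W \<inter> W') f"
  by (rule smooth_map_on_subset[OF assms(1) smooth_atlas_real assms(2)])
    (use smooth_map_on_domain[OF assms(2)] assms(3) in auto)

lemma smooth_real_on_openin:
  assumes "smooth_atlas M" "smooth_real_on M W f" "open V"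
  shows "openin (mtopology M) {p \<in> W. f p \<in> V}"
  using smooth_map_on_openin[OF assms(1) smooth_atlas_real assms(2)] assms(3)
  by (simp add: openin_vector_real)

section \<open>Germs of smooth maps along a subset\<close>

lemma smooth_nearI:
  "p \<in> W \<Longrightarrow> smooth_map_on M N W F' \<Longrightarrow> (\<And>q. q \<in> S \<Longrightarrow> q \<in> W \<Longrightarrow> F q = F' q) \<Longrightarrow> smooth_near M N S p F"
  unfolding smooth_near_def by blast

lemma smooth_near_obtain:
  assumes "smooth_near M N S p F"
  obtains W F' where "p \<in> W" "smooth_map_on M N W F'" "openin (mtopology M) W"
    "\<forall>q\<in>S \<inter> W. F q = F' q"
  using assms smooth_map_on_domain unfolding smooth_near_def by blast

lemma smooth_near_carrier:
  assumes "smooth_atlas M" "smooth_atlas N" "smooth_near M N (mcarrier M) p F"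
  obtains W where "p \<in> W" "openin (mtopology M) W" "smooth_map_on M N W F"
proof -
  obtain W F' where W: "p \<in> W" "smooth_map_on M N W F'" "openin (mtopology M) W"
    "\<forall>q\<in>mcarrier M \<inter> W. F q = F' q" by (rule smooth_near_obtain[OF assms(3)])
  have "smooth_map_on M N W F"
    by (rule smooth_map_on_cong[OF assms(1,2) W(2)])
      (use W(4) openin_mtopology_mcarrier[OF assms(1) W(3)] in auto)
  then show thesis using that W by blast
qed

lemma smooth_near_open:
  assumes "smooth_near M N S p F"
  obtains W where "p \<in> W" "openin (mtopology M) W" "\<And>q. q \<in> W \<Longrightarrow> smooth_near M N S q F"
proof -
  obtain W F' where W: "p \<in> W" "smooth_map_on M N W F'" "openin (mtopology M) W"
    "\<forall>q\<in>S \<inter> W. F q = F' q" by (rule smooth_near_obtain[OF assms])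
  have "smooth_near M N S q F" if "q \<in> W" for q
    by (rule smooth_nearI[OF that W(2)]) (use W(4) in auto)
  then show thesis using that W by blast
qed

lemma smooth_near_mono: "smooth_near M N S p F \<Longrightarrow> T \<subseteq> S \<Longrightarrow> smooth_near M N T p F"
  unfolding smooth_near_def by blast

lemma smooth_near_cong:
  assumes M: "smooth_atlas M" and N: "smooth_atlas N" and "smooth_near M N S p F"
    and W0: "openin (mtopology M) W0" "p \<in> W0" and eq: "\<And>q. q \<in> S \<Longrightarrow> q \<in> W0 \<Longrightarrow> F q = G q"
  shows "smooth_near M N S p G"
proof -
  obtain W F' where W: "p \<in> W" "smooth_map_on M N W F'" "openin (mtopology M) W"
    "\<forall>q\<in>S \<inter> W. F q = F' q" by (rule smooth_near_obtain[OF assms(3)])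
  show ?thesis
  proof (rule smooth_nearI)
    show "smooth_map_on M N (W \<inter> W0) F'"
      by (rule smooth_map_on_subset[OF M N W(2)]) (use W W0 in auto)
  qed (use W W0 eq[symmetric] in auto)
qed

lemma smooth_fun_const:
  "smooth_atlas M \<Longrightarrow> p \<in> mcarrier M \<Longrightarrow> smooth_fun M S p (\<lambda>q. c)"
  using topspace_mtopology[of M] openin_topspace[of "mtopology M"]
  by (intro smooth_nearI[OF _ smooth_real_on_const]) auto

lemma smooth_fun_add:
  assumes M: "smooth_atlas M" and f: "smooth_fun M S p f" and g: "smooth_fun M S p g"
  shows "smooth_fun M S p (\<lambda>q. f q + g q)"
proof -
  obtain W f' where W: "p \<in> W" "smooth_real_on M W f'" "openin (mtopology M) W"
    "\<forall>q\<in>S \<inter> W. f q = f' q" by (rule smooth_near_obtain[OF f])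
  obtain W2 g' where W2: "p \<in> W2" "smooth_real_on M W2 g'" "openin (mtopology M) W2"
    "\<forall>q\<in>S \<inter> W2. g q = g' q" by (rule smooth_near_obtain[OF g])
  show ?thesis
    by (rule smooth_nearI[of _ "W \<inter> W2", OF _ smooth_real_on_add[OF M smooth_real_on_Int[OF M W(2) W2(3)]]])
      (use W W2 smooth_real_on_Int[OF M W2(2) W(3)] in \<open>auto simp: Int_commute\<close>)
qed

lemma smooth_fun_mult:
  assumes M: "smooth_atlas M" and f: "smooth_fun M S p f" and g: "smooth_fun M S p g"
  shows "smooth_fun M S p (\<lambda>q. f q * g q)"
proof -
  obtain W f' where W: "p \<in> W" "smooth_real_on M W f'" "openin (mtopology M) W"
    "\<forall>q\<in>S \<inter> W. f q = f' q" by (rule smooth_near_obtain[OF f])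
  obtain W2 g' where W2: "p \<in> W2" "smooth_real_on M W2 g'" "openin (mtopology M) W2"
    "\<forall>q\<in>S \<inter> W2. g q = g' q" by (rule smooth_near_obtain[OF g])
  show ?thesis
    by (rule smooth_nearI[of _ "W \<inter> W2", OF _ smooth_real_on_mult[OF M smooth_real_on_Int[OF M W(2) W2(3)]]])
      (use W W2 smooth_real_on_Int[OF M W2(2) W(3)] in \<open>auto simp: Int_commute\<close>)
qed

lemma smooth_fun_carrier:
  assumes "smooth_atlas M" "smooth_fun M S p f" shows "p \<in> mcarrier M"
  using smooth_near_obtain[OF assms(2)] openin_mtopology_mcarrier[OF assms(1)] by metis

lemma smooth_fun_scale:
  "smooth_atlas M \<Longrightarrow> smooth_fun M S p f \<Longrightarrow> smooth_fun M S p (\<lambda>q. c * f q)"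
  by (rule smooth_fun_mult[OF _ smooth_fun_const]) (auto intro: smooth_fun_carrier)

lemma smooth_fun_uminus:
  "smooth_atlas M \<Longrightarrow> smooth_fun M S p f \<Longrightarrow> smooth_fun M S p (\<lambda>q. - f q)"
  using smooth_fun_scale[of M S p f "-1"] by simp

lemma smooth_fun_diff:
  "smooth_atlas M \<Longrightarrow> smooth_fun M S p f \<Longrightarrow> smooth_fun M S p g \<Longrightarrow> smooth_fun M S p (\<lambda>q. f q - g q)"
  using smooth_fun_add[of M S p f "\<lambda>q. - g q"] smooth_fun_uminus by fastforce

lemma smooth_fun_sum:
  assumes "smooth_atlas M" "p \<in> mcarrier M" "\<And>i. i \<in> I \<Longrightarrow> smooth_fun M S p (f i)"
  shows "smooth_fun M S p (\<lambda>q. \<Sum>i\<in>I. f i q)"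
  using assms(3)
proof (induction I rule: infinite_finite_induct)
  case (insert i I)
  then show ?case using smooth_fun_add[OF assms(1), of S p "f i" "\<lambda>q. \<Sum>i\<in>I. f i q"] by simp
qed (simp_all add: smooth_fun_const[OF assms(1,2)])

lemma smooth_fun_inverse:
  assumes M: "smooth_atlas M" and f: "smooth_fun M S p f" and nz: "f p \<noteq> 0" and p: "p \<in> S"
  shows "smooth_fun M S p (\<lambda>q. inverse (f q))"
proof -
  obtain W f' where W: "p \<in> W" "smooth_real_on M W f'" "openin (mtopology M) W"
    "\<forall>q\<in>S \<inter> W. f q = f' q" by (rule smooth_near_obtain[OF f])
  let ?W = "{q \<in> W. f' q \<in> - {0}}"
  have o: "openin (mtopology M) ?W" by (rule smooth_real_on_openin[OF M W(2)]) auto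
  have s: "smooth_real_on M ?W f'"
    by (rule smooth_map_on_subset[OF M smooth_atlas_real W(2) o]) auto
  show ?thesis
    by (rule smooth_nearI[OF _ smooth_real_on_inverse[OF M s]]) (use W nz p in auto)
qed

text \<open>\<open>v\<close> acts on functions smooth on \<open>S\<close> near \<open>p\<close> by extending them to \<open>M\<close> and differentiating the
  extension along \<open>\<xi>\<close> in the chart \<open>(U, \<kappa>)\<close>.\<close>

definition chart_direction ::
  "('p, 'e::real_normed_vector) atlas \<Rightarrow> 'p set \<Rightarrow> 'p set \<Rightarrow> ('p \<Rightarrow> 'e) \<Rightarrow> 'p \<Rightarrow> 'p tvec \<Rightarrow> 'e \<Rightarrow> bool" where
  "chart_direction M S U \<kappa> p v \<xi> \<longleftrightarrow>
     (\<forall>f W f'. p \<in> W \<longrightarrow> smooth_real_on M W f' \<longrightarrow> (\<forall>q\<in>S \<inter> W. f q = f' q) \<longrightarrow>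
        v f = frechet_derivative (f' \<circ> inv_into U \<kappa>) (at (\<kappa> p)) \<xi>) \<and>
     (\<forall>f. \<not> smooth_fun M S p f \<longrightarrow> v f = 0)"

lemma chart_directionD:
  assumes "chart_direction M S U \<kappa> p v \<xi>" "p \<in> W" "smooth_real_on M W f'"
    "\<And>q. q \<in> S \<Longrightarrow> q \<in> W \<Longrightarrow> f q = f' q"
  shows "v f = frechet_derivative (f' \<circ> inv_into U \<kappa>) (at (\<kappa> p)) \<xi>"
  using assms unfolding chart_direction_def by blast

text \<open>On a smooth germ the direction decides the value through any extension, and on all other
  functions both functionals vanish.\<close>

lemma chart_direction_unique:
  assumes "chart_direction M S U \<kappa> p v \<xi>" "chart_direction M S U \<kappa> p w \<xi>"
  shows "v = w"
proof
  fix f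
  show "v f = w f"
  proof (cases "smooth_fun M S p f")
    case True
    then obtain W f' where W: "p \<in> W" "smooth_real_on M W f'" "openin (mtopology M) W"
      "\<forall>q\<in>S \<inter> W. f q = f' q" by (rule smooth_near_obtain)
    then show ?thesis using chart_directionD[OF assms(1) W(1,2)] chart_directionD[OF assms(2) W(1,2)] by simp
  qed (use assms in \<open>auto simp: chart_direction_def\<close>)
qed

text \<open>The curve stays in \<open>S\<close>, so \<open>f\<close> and an ambient extension
  \<open>f'\<close> agree along it, and the chain rule in the chart applies to \<open>f'\<close>.
  This is why the value does not depend on the extension.\<close>

lemma velocity_chart_direction:
  assumes M: "smooth_atlas M" and c: "smooth_curve M S c" and cU: "chart_of M U \<kappa>" "c 0 \<in> U"
  obtains \<xi> where "((\<lambda>t. \<kappa> (c t)) has_vector_derivative \<xi>) (at 0)"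
    "chart_direction M S U \<kappa> (c 0) (velocity M S c) \<xi>"
proof -
  obtain \<epsilon> where e: "\<epsilon> > 0" and s: "smooth_map_on vector_atlas M {-\<epsilon><..<\<epsilon>} c"
    and cS: "c ` {-\<epsilon><..<\<epsilon>} \<subseteq> S" using c unfolding smooth_curve_def by blast
  let ?I = "{-\<epsilon><..<\<epsilon>}"
  have img: "(\<lambda>x. x) ` {t \<in> UNIV \<inter> ?I. c t \<in> U} = {t \<in> ?I. c t \<in> U}" by auto
  note inv = inv_into_UNIV_ident
  have oJ: "open {t \<in> ?I. c t \<in> U}" and sJ: "smooth_on {t \<in> ?I. c t \<in> U} (\<lambda>t. \<kappa> (c t))"
    using smooth_map_on_chart[OF smooth_atlas_real M s chart_of_real[OF open_UNIV] cU(1)]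
    unfolding img inv by (simp_all add: o_def)
  have 0: "0 \<in> {t \<in> ?I. c t \<in> U}" using e cU by auto
  define \<xi> where "\<xi> = frechet_derivative (\<lambda>t. \<kappa> (c t)) (at 0) 1"
  have d: "((\<lambda>t. \<kappa> (c t)) has_derivative frechet_derivative (\<lambda>t. \<kappa> (c t)) (at 0)) (at 0)"
    by (rule smooth_on_has_derivative[OF sJ 0])
  have "frechet_derivative (\<lambda>t. \<kappa> (c t)) (at 0) t = t *\<^sub>R \<xi>" for t
    using linear_scale[OF has_derivative_linear[OF d], of t 1] by (simp add: \<xi>_def)
  then have d: "((\<lambda>t. \<kappa> (c t)) has_vector_derivative \<xi>) (at 0)"
    using d unfolding has_vector_derivative_def by (metis (no_types, lifting) ext)
  have "velocity M S c f = frechet_derivative (f' \<circ> inv_into U \<kappa>) (at (\<kappa> (c 0))) \<xi>"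
    if W: "c 0 \<in> W" "smooth_real_on M W f'" and eq: "\<forall>q\<in>S \<inter> W. f q = f' q" for f W f'
  proof -
    have sf: "smooth_fun M S (c 0) f" using eq by (intro smooth_nearI[OF W]) auto
    have sm: "smooth_on (\<kappa> ` (U \<inter> W)) (f' \<circ> inv_into U \<kappa>)"
      by (rule smooth_real_on_chart[OF M W(2) cU(1)])
    have "((f' \<circ> inv_into U \<kappa>) has_derivative frechet_derivative (f' \<circ> inv_into U \<kappa>) (at (\<kappa> (c 0)))) (at (\<kappa> (c 0)))"
      by (rule smooth_on_has_derivative[OF sm]) (use W cU in auto)
    from vector_derivative_diff_chain_within[OF d[unfolded has_vector_derivative_def[symmetric]] has_derivative_at_withinI[OF this]]
    have v: "((\<lambda>t. (f' \<circ> inv_into U \<kappa>) (\<kappa> (c t))) has_vector_derivative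
        frechet_derivative (f' \<circ> inv_into U \<kappa>) (at (\<kappa> (c 0))) \<xi>) (at 0)"
      by (simp add: o_def)
    have oK: "open {t \<in> ?I. c t \<in> U \<inter> W}"
      using smooth_map_on_openin[OF smooth_atlas_real M s
          openin_mtopology_Int[OF chart_of_openin[OF cU(1)] smooth_map_on_domain[OF W(2)]]]
      by (simp add: openin_vector_real)
    have "((\<lambda>t. f (c t)) has_vector_derivative
        frechet_derivative (f' \<circ> inv_into U \<kappa>) (at (\<kappa> (c 0))) \<xi>) (at 0)"
    proof (rule has_vector_derivative_transform_within_open[OF v oK])
      fix t assume t: "t \<in> {t \<in> ?I. c t \<in> U \<inter> W}"
      then have "c t \<in> S" using cS by auto
      then show "(f' \<circ> inv_into U \<kappa>) (\<kappa> (c t)) = f (c t)"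
        using t chart_of_inv[OF cU(1)] eq by auto
    qed (use e cU W in auto)
    then have "deriv (f \<circ> c) 0 = frechet_derivative (f' \<circ> inv_into U \<kappa>) (at (\<kappa> (c 0))) \<xi>"
      by (intro DERIV_imp_deriv) (simp add: has_real_derivative_iff_has_vector_derivative o_def)
    then show ?thesis using sf by (simp add: velocity_def)
  qed
  then have "chart_direction M S U \<kappa> (c 0) (velocity M S c) \<xi>"
    unfolding chart_direction_def by (auto simp: velocity_def)
  with d show thesis using that by blast
qed

lemma tangent_chart_direction:
  assumes "smooth_atlas M" "v \<in> tangent_space M S p" "chart_of M U \<kappa>" "p \<in> U"
  obtains \<xi> where "chart_direction M S U \<kappa> p v \<xi>"
proof -
  obtain c where c: "smooth_curve M S c" "c 0 = p" "v = velocity M S c"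
    using assms(2) unfolding tangent_space_def by blast
  have "c 0 \<in> U" using assms(4) c(2) by simp
  then obtain \<xi> where "chart_direction M S U \<kappa> (c 0) (velocity M S c) \<xi>"
    using velocity_chart_direction[OF assms(1) c(1) assms(3)] by metis
  then show thesis using that c by simp
qed

section \<open>Tangent vectors as local derivations\<close>

lemma tangent_point:
  assumes "smooth_atlas M" "v \<in> tangent_space M S p" shows "p \<in> S" "p \<in> mcarrier M"
proof -
  obtain c where c: "smooth_curve M S c" "c 0 = p"
    using assms(2) unfolding tangent_space_def by blast
  obtain \<epsilon> where e: "\<epsilon> > 0" and s: "smooth_map_on vector_atlas M {-\<epsilon><..<\<epsilon>} c"
    and cS: "c ` {-\<epsilon><..<\<epsilon>} \<subseteq> S" using c unfolding smooth_curve_def by blast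
  have "0 \<in> {-\<epsilon><..<\<epsilon>}" using e by simp
  then show "p \<in> S" "p \<in> mcarrier M" using cS c(2) smooth_map_on_range[OF s] by auto
qed

lemma tangent_not_smooth:
  "v \<in> tangent_space M S p \<Longrightarrow> \<not> smooth_fun M S p f \<Longrightarrow> v f = 0"
  unfolding tangent_space_def velocity_def by auto

text \<open>In the smooth case one extension, restricted to a smaller neighbourhood, serves both
  functions. Otherwise neither is smooth at \<open>p\<close>, smoothness being local, and both
  values are 0 by convention.\<close>

lemma tangent_cong:
  assumes M: "smooth_atlas M" and v: "v \<in> tangent_space M S p"
    and W0: "openin (mtopology M) W0" "p \<in> W0" and eq: "\<And>q. q \<in> S \<Longrightarrow> q \<in> W0 \<Longrightarrow> f q = g q"
  shows "v f = v g"
proof (cases "smooth_fun M S p f")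
  case True
  obtain U \<phi> where U: "(U, \<phi>) \<in> M" "p \<in> U" using tangent_point(2)[OF M v] by (rule atlas_chart_exists)
  obtain \<xi> where x: "chart_direction M S U \<phi> p v \<xi>"
    by (rule tangent_chart_direction[OF M v chart_of_atlas[OF M U(1)] U(2)])
  obtain W f' where W: "p \<in> W" "smooth_real_on M W f'" "openin (mtopology M) W"
    "\<forall>q\<in>S \<inter> W. f q = f' q" by (rule smooth_near_obtain[OF True])
  have s: "smooth_real_on M (W \<inter> W0) f'" by (rule smooth_real_on_Int[OF M W(2) W0(1)])
  have "v f = frechet_derivative (f' \<circ> inv_into U \<phi>) (at (\<phi> p)) \<xi>"
    by (rule chart_directionD[OF x _ s]) (use W W0 in auto)
  moreover have "v g = frechet_derivative (f' \<circ> inv_into U \<phi>) (at (\<phi> p)) \<xi>"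
    by (rule chart_directionD[OF x _ s]) (use W W0 eq[symmetric] in auto)
  ultimately show ?thesis by simp
next
  case False
  moreover have "\<not> smooth_fun M S p g"
    using False smooth_near_cong[OF M smooth_atlas_real _ W0] eq by metis
  ultimately show ?thesis using tangent_not_smooth[OF v] by simp
qed

lemma tangent_common_extension:
  assumes M: "smooth_atlas M" and v: "v \<in> tangent_space M S p"
    and f: "smooth_fun M S p f" and g: "smooth_fun M S p g"
  obtains U \<phi> \<xi> W f' g' where "chart_of M U \<phi>" "p \<in> U" "chart_direction M S U \<phi> p v \<xi>" "p \<in> W"
    "smooth_real_on M W f'" "smooth_real_on M W g'" "\<And>q. q \<in> S \<Longrightarrow> q \<in> W \<Longrightarrow> f q = f' q"
    "\<And>q. q \<in> S \<Longrightarrow> q \<in> W \<Longrightarrow> g q = g' q"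
proof -
  obtain U \<phi> where U: "(U, \<phi>) \<in> M" "p \<in> U" using tangent_point(2)[OF M v] by (rule atlas_chart_exists)
  obtain \<xi> where x: "chart_direction M S U \<phi> p v \<xi>"
    by (rule tangent_chart_direction[OF M v chart_of_atlas[OF M U(1)] U(2)])
  obtain W f' where W: "p \<in> W" "smooth_real_on M W f'" "openin (mtopology M) W"
    "\<forall>q\<in>S \<inter> W. f q = f' q" by (rule smooth_near_obtain[OF f])
  obtain W2 g' where W2: "p \<in> W2" "smooth_real_on M W2 g'" "openin (mtopology M) W2"
    "\<forall>q\<in>S \<inter> W2. g q = g' q" by (rule smooth_near_obtain[OF g])
  show thesis
    by (rule that[OF chart_of_atlas[OF M U(1)] U(2) x, of "W \<inter> W2" f' g'])
      (use W W2 smooth_real_on_Int[OF M W(2) W2(3)] smooth_real_on_Int[OF M W2(2) W(3)] in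
        \<open>auto simp: Int_commute\<close>)
qed

lemma tangent_add:
  assumes M: "smooth_atlas M" and v: "v \<in> tangent_space M S p"
    and f: "smooth_fun M S p f" and g: "smooth_fun M S p g"
  shows "v (\<lambda>q. f q + g q) = v f + v g"
proof -
  obtain U \<phi> \<xi> W f' g' where U: "chart_of M U \<phi>" "p \<in> U" and x: "chart_direction M S U \<phi> p v \<xi>"
    and W: "p \<in> W" "smooth_real_on M W f'" "smooth_real_on M W g'"
    and eq: "\<And>q. q \<in> S \<Longrightarrow> q \<in> W \<Longrightarrow> f q = f' q" "\<And>q. q \<in> S \<Longrightarrow> q \<in> W \<Longrightarrow> g q = g' q"
    using tangent_common_extension[OF M v f g] by metis
  have pd: "\<phi> p \<in> \<phi> ` (U \<inter> W)" using U W by auto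
  note df = smooth_on_has_derivative[OF smooth_real_on_chart[OF M W(2) U(1)] pd]
    and dg = smooth_on_has_derivative[OF smooth_real_on_chart[OF M W(3) U(1)] pd]
  have "v (\<lambda>q. f q + g q) = frechet_derivative ((\<lambda>q. f' q + g' q) \<circ> inv_into U \<phi>) (at (\<phi> p)) \<xi>"
    by (rule chart_directionD[OF x W(1) smooth_real_on_add[OF M W(2,3)]]) (use eq in auto)
  also have "frechet_derivative ((\<lambda>q. f' q + g' q) \<circ> inv_into U \<phi>) (at (\<phi> p)) =
      (\<lambda>\<xi>. frechet_derivative (f' \<circ> inv_into U \<phi>) (at (\<phi> p)) \<xi> + frechet_derivative (g' \<circ> inv_into U \<phi>) (at (\<phi> p)) \<xi>)"
    using has_derivative_add[OF df dg] by (intro frechet_derivative_at[symmetric]) (simp add: o_def)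
  finally show ?thesis
    using chart_directionD[OF x W(1,2) eq(1)] chart_directionD[OF x W(1,3) eq(2)] by simp
qed

lemma tangent_mult:
  assumes M: "smooth_atlas M" and v: "v \<in> tangent_space M S p"
    and f: "smooth_fun M S p f" and g: "smooth_fun M S p g"
  shows "v (\<lambda>q. f q * g q) = f p * v g + v f * g p"
proof -
  obtain U \<phi> \<xi> W f' g' where U: "chart_of M U \<phi>" "p \<in> U" and x: "chart_direction M S U \<phi> p v \<xi>"
    and W: "p \<in> W" "smooth_real_on M W f'" "smooth_real_on M W g'"
    and eq: "\<And>q. q \<in> S \<Longrightarrow> q \<in> W \<Longrightarrow> f q = f' q" "\<And>q. q \<in> S \<Longrightarrow> q \<in> W \<Longrightarrow> g q = g' q"
    using tangent_common_extension[OF M v f g] by metis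
  have pd: "\<phi> p \<in> \<phi> ` (U \<inter> W)" using U W by auto
  have pS: "p \<in> S" by (rule tangent_point[OF M v])
  note df = smooth_on_has_derivative[OF smooth_real_on_chart[OF M W(2) U(1)] pd]
    and dg = smooth_on_has_derivative[OF smooth_real_on_chart[OF M W(3) U(1)] pd]
  have "v (\<lambda>q. f q * g q) = frechet_derivative ((\<lambda>q. f' q * g' q) \<circ> inv_into U \<phi>) (at (\<phi> p)) \<xi>"
    by (rule chart_directionD[OF x W(1) smooth_real_on_mult[OF M W(2,3)]]) (use eq in auto)
  also have "frechet_derivative ((\<lambda>q. f' q * g' q) \<circ> inv_into U \<phi>) (at (\<phi> p)) =
      (\<lambda>\<xi>. f p * frechet_derivative (g' \<circ> inv_into U \<phi>) (at (\<phi> p)) \<xi> + frechet_derivative (f' \<circ> inv_into U \<phi>) (at (\<phi> p)) \<xi> * g p)"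
    using has_derivative_mult[OF df dg] chart_of_inv[OF U] eq[OF pS W(1)]
    by (intro frechet_derivative_at[symmetric]) (simp add: o_def)
  finally show ?thesis
    using chart_directionD[OF x W(1,2) eq(1)] chart_directionD[OF x W(1,3) eq(2)] by simp
qed

lemma tangent_const:
  assumes M: "smooth_atlas M" and v: "v \<in> tangent_space M S p"
  shows "v (\<lambda>q. c) = 0"
proof -
  have p: "p \<in> mcarrier M" by (rule tangent_point[OF M v])
  obtain U \<phi> where U: "(U, \<phi>) \<in> M" "p \<in> U" using p by (rule atlas_chart_exists)
  note cU = chart_of_atlas[OF M U(1)]
  obtain \<xi> where x: "chart_direction M S U \<phi> p v \<xi>"
    by (rule tangent_chart_direction[OF M v cU U(2)])
  have "v (\<lambda>q. c) = frechet_derivative ((\<lambda>q. c) \<circ> inv_into U \<phi>) (at (\<phi> p)) \<xi>"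
    by (rule chart_directionD[OF x U(2) smooth_real_on_const[OF M chart_of_openin[OF cU]]]) auto
  then show ?thesis by (simp add: o_def)
qed

lemma tangent_scale:
  assumes M: "smooth_atlas M" and v: "v \<in> tangent_space M S p" and f: "smooth_fun M S p f"
  shows "v (\<lambda>q. c * f q) = c * v f"
  using tangent_mult[OF M v smooth_fun_const[OF M tangent_point(2)[OF M v]] f, of c]
    tangent_const[OF M v] by simp

lemma tangent_sum:
  assumes M: "smooth_atlas M" and v: "v \<in> tangent_space M S p"
    and f: "\<And>i. i \<in> I \<Longrightarrow> smooth_fun M S p (f i)"
  shows "v (\<lambda>q. \<Sum>i\<in>I. f i q) = (\<Sum>i\<in>I. v (f i))"
  using f
proof (induction I rule: infinite_finite_induct)
  case (insert i I)
  have "smooth_fun M S p (\<lambda>q. \<Sum>i\<in>I. f i q)"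
    by (rule smooth_fun_sum[OF M tangent_point(2)[OF M v]]) (use insert in auto)
  then show ?case using insert tangent_add[OF M v, of "f i" "\<lambda>q. \<Sum>i\<in>I. f i q"] by simp
qed (simp_all add: tangent_const[OF M v])

text \<open>The source of tangent vectors of \<open>S\<close> with a prescribed direction: it
  suffices that a short coordinate segment stays in \<open>S\<close>, which in a slice chart holds
  for the kernel directions.\<close>

lemma line_velocity:
  assumes M: "smooth_atlas M" and cU: "chart_of M U \<kappa>" and q: "q \<in> U" and e: "\<epsilon> > 0"
    and line: "\<And>t. \<bar>t\<bar> < \<epsilon> \<Longrightarrow> \<kappa> q + t *\<^sub>R \<xi> \<in> \<kappa> ` U \<and> inv_into U \<kappa> (\<kappa> q + t *\<^sub>R \<xi>) \<in> S"
  defines "v \<equiv> velocity M S (\<lambda>t. inv_into U \<kappa> (\<kappa> q + t *\<^sub>R \<xi>))"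
  shows "v \<in> tangent_space M S q" "chart_direction M S U \<kappa> q v \<xi>"
proof -
  let ?c = "\<lambda>t. inv_into U \<kappa> (\<kappa> q + t *\<^sub>R \<xi>)"
  let ?I = "{-\<epsilon><..<\<epsilon>}"
  have "smooth_map_on vector_atlas M ?I ?c"
  proof (rule smooth_map_onI[OF smooth_atlas_real M])
    fix t assume t: "t \<in> ?I"
    have "smooth_on ?I (\<lambda>t. \<kappa> q + t *\<^sub>R \<xi>)"
      by (intro smooth_on_add smooth_on_const smooth_on_bounded_linear bounded_linear_scaleR_left) auto
    then have "smooth_on ?I (\<kappa> \<circ> ?c \<circ> inv_into ?I (\<lambda>x. x))"
    proof (rule smooth_on_cong[rotated])
      fix s assume s: "s \<in> ?I"
      then show "\<kappa> q + s *\<^sub>R \<xi> = (\<kappa> \<circ> ?c \<circ> inv_into ?I (\<lambda>x. x)) s"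
        using line[of s] f_inv_into_f[of _ \<kappa> U] by (auto simp: inv_into_ident)
    qed auto
    then have "smooth_on ((\<lambda>x. x) ` ?I) (\<kappa> \<circ> ?c \<circ> inv_into ?I (\<lambda>x. x))" by simp
    then show "\<exists>U' \<kappa>' V \<psi>. chart_of vector_atlas U' \<kappa>' \<and> chart_of M V \<psi> \<and> t \<in> U' \<and> U' \<subseteq> ?I \<and>
       ?c ` U' \<subseteq> V \<and> smooth_on (\<kappa>' ` U') (\<psi> \<circ> ?c \<circ> inv_into U' \<kappa>')"
      using cU t chart_of_real[of ?I] line inv_into_into[of _ \<kappa> U]
      by (intro exI[of _ ?I] exI[of _ "\<lambda>x::real. x"] exI[of _ U] exI[of _ \<kappa>]) auto
  qed
  then have c: "smooth_curve M S ?c"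
    unfolding smooth_curve_def using e line by (intro exI[of _ \<epsilon>]) auto
  have c0: "?c 0 = q" using chart_of_inv[OF cU q] by simp
  show "v \<in> tangent_space M S q"
    unfolding tangent_space_def v_def using c c0 by blast
  obtain \<eta> where \<eta>: "((\<lambda>t. \<kappa> (?c t)) has_vector_derivative \<eta>) (at 0)"
    "chart_direction M S U \<kappa> (?c 0) (velocity M S ?c) \<eta>"
    by (rule velocity_chart_direction[OF M c cU]) (use c0 q in auto)
  have "((\<lambda>t. \<kappa> q + t *\<^sub>R \<xi>) has_vector_derivative \<xi>) (at 0)"
    by (auto intro!: derivative_eq_intros)
  then have "((\<lambda>t. \<kappa> (?c t)) has_vector_derivative \<xi>) (at 0)"
    by (rule has_vector_derivative_transform_within_open[of _ _ _ ?I])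
      (use e line f_inv_into_f[of _ \<kappa> U] in auto)
  then have "\<eta> = \<xi>" using \<eta>(1) vector_derivative_unique_at by blast
  then show "chart_direction M S U \<kappa> q v \<xi>" using \<eta>(2) c0 by (simp add: v_def)
qed

section \<open>Slice charts of submersions\<close>

text \<open>Charts may be composed with a diffeomorphism of part of their range; this is how the
  straightening map becomes a chart.\<close>

lemma chart_of_diffeo:
  assumes M: "smooth_atlas M" and c: "chart_of M U \<phi>"
    and h: "homeomorphism O' V' \<Psi> g" "open O'" "O' \<subseteq> \<phi> ` U" "open V'"
    and s: "smooth_on O' \<Psi>" "smooth_on V' g"
  shows "chart_of M {q \<in> U. \<phi> q \<in> O'} (\<lambda>q. \<Psi> (\<phi> q))" (is "chart_of M ?U ?\<kappa>")
  unfolding chart_of_def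
proof (intro conjI)
  have g: "g (\<Psi> e) = e" "\<Psi> e \<in> V'" if "e \<in> O'" for e
    using h(1) that by (auto simp: homeomorphism_def)
  have \<Psi>: "\<Psi> (g y) = y" "g y \<in> O'" if "y \<in> V'" for y
    using h(1) that by (auto simp: homeomorphism_def)
  have im: "\<phi> ` ?U = O'" using h(3) by auto
  show oU: "openin (mtopology M) ?U"
    by (rule chart_of_openinI[OF M c]) (use im h in auto)
  show inj: "inj_on ?\<kappa> ?U"
  proof (rule inj_onI)
    fix p q assume a: "p \<in> ?U" "q \<in> ?U" "\<Psi> (\<phi> p) = \<Psi> (\<phi> q)"
    then have "\<phi> p \<in> O'" "\<phi> q \<in> O'" by auto
    then have "\<phi> p = \<phi> q" using g(1) a(3) by metis
    then show "p = q" using chart_of_inj[OF c] a by (auto dest: inj_onD)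
  qed
  show "\<forall>(V, \<psi>)\<in>M. open (?\<kappa> ` (?U \<inter> V)) \<and> smooth_on (?\<kappa> ` (?U \<inter> V)) (\<psi> \<circ> inv_into ?U ?\<kappa>) \<and>
      smooth_on (\<psi> ` (?U \<inter> V)) (?\<kappa> \<circ> inv_into V \<psi>)"
  proof safe
    fix V \<psi> assume V: "(V, \<psi>) \<in> M"
    note cV = chart_of_atlas[OF M V]
    note ch = chart_of_atlasD[OF c V]
    have o1: "open (\<phi> ` (U \<inter> (?U \<inter> V)))"
      by (rule chart_of_image_open[OF M c openin_mtopology_Int[OF oU chart_of_openin[OF cV]]])
    have e1: "U \<inter> (?U \<inter> V) = ?U \<inter> V" by auto
    have "open (V' \<inter> g -` (\<phi> ` (?U \<inter> V)))"
      using continuous_open_preimage[OF smooth_on_continuous[OF s(2)] h(4)] o1 unfolding e1 by blast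
    moreover have "V' \<inter> g -` (\<phi> ` (?U \<inter> V)) = ?\<kappa> ` (?U \<inter> V)" (is "?L = ?R")
    proof
      show "?L \<subseteq> ?R"
      proof
        fix y assume "y \<in> ?L"
        then obtain q where q: "y \<in> V'" "g y = \<phi> q" "q \<in> ?U \<inter> V" by auto
        then have "y = ?\<kappa> q" using \<Psi>(1)[of y] by simp
        then show "y \<in> ?R" using q by blast
      qed
      show "?R \<subseteq> ?L" using g by auto
    qed
    ultimately show o: "open (?\<kappa> ` (?U \<inter> V))" by simp
    have "smooth_on (?\<kappa> ` (?U \<inter> V)) (\<lambda>y. (\<psi> \<circ> inv_into U \<phi>) (g y))"
      by (rule smooth_on_compose[OF smooth_atlas_finite_dim[OF M] o ch(1) _ smooth_on_subset[OF s(2)] ch(2)])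
        (use g in auto)
    then show "smooth_on (?\<kappa> ` (?U \<inter> V)) (\<psi> \<circ> inv_into ?U ?\<kappa>)"
    proof (rule smooth_on_cong[OF o])
      fix x assume "x \<in> ?\<kappa> ` (?U \<inter> V)"
      then obtain q where q: "q \<in> ?U" "x = ?\<kappa> q" by auto
      then show "(\<psi> \<circ> inv_into U \<phi>) (g x) = (\<psi> \<circ> inv_into ?U ?\<kappa>) x"
        using inv_into_f_f[OF inj q(1)] g(1) chart_of_inv[OF c] by simp
    qed
    have o2: "open (\<psi> ` (?U \<inter> V))"
      using chart_of_image_open[OF M cV oU] by (simp add: Int_commute)
    have s2: "smooth_on (\<psi> ` (?U \<inter> V)) (\<phi> \<circ> inv_into V \<psi>)"
      by (rule smooth_on_subset[OF ch(3)]) auto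
    have "smooth_on (\<psi> ` (?U \<inter> V)) (\<lambda>x. \<Psi> ((\<phi> \<circ> inv_into V \<psi>) x))"
      by (rule smooth_on_compose[OF smooth_atlas_finite_dim[OF M] o2 h(2) _ s2 s(1)])
        (use chart_of_inv[OF cV] in auto)
    then show "smooth_on (\<psi> ` (?U \<inter> V)) (?\<kappa> \<circ> inv_into V \<psi>)" by (simp add: o_def)
  qed
qed

lemma frechet_derivative_linear_comp:
  assumes "bounded_linear L" "(f has_derivative f') (at x)"
  shows "frechet_derivative (\<lambda>x. L (f x)) (at x) = (\<lambda>v. L (f' v))"
  using frechet_derivative_at[OF bounded_linear.has_derivative[OF assms]] by simp

lemma small_line:
  fixes x :: "'a::real_normed_vector"
  assumes "open A" "x \<in> A"
  obtains \<epsilon> where "\<epsilon> > 0" "\<And>t. \<bar>t\<bar> < \<epsilon> \<Longrightarrow> x + t *\<^sub>R \<xi> \<in> A"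
proof -
  obtain r where r: "r > 0" "ball x r \<subseteq> A" using assms openE by blast
  have nn: "norm \<xi> + 1 > 0" by (smt (verit) norm_ge_zero)
  show thesis
  proof (rule that[of "r / (norm \<xi> + 1)"])
    show "r / (norm \<xi> + 1) > 0" using r nn by simp
    fix t assume t: "\<bar>t\<bar> < r / (norm \<xi> + 1)"
    have "\<bar>t\<bar> * norm \<xi> \<le> \<bar>t\<bar> * (norm \<xi> + 1)" by (simp add: mult_left_mono)
    also have "\<dots> < r / (norm \<xi> + 1) * (norm \<xi> + 1)" using t nn by (intro mult_strict_right_mono)
    also have "\<dots> = r" using nn by simp
    finally have "x + t *\<^sub>R \<xi> \<in> ball x r" by (simp add: dist_norm)
    then show "x + t *\<^sub>R \<xi> \<in> A" using r by blast
  qed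
qed

text \<open>Only the tangent map of \<open>F\<close> at \<open>p\<close> enters; its surjectivity is read off from the linear
  functionals of the target chart.\<close>

lemma submersion_derivative_surj:
  fixes M :: "('p, 'e::real_normed_vector) atlas" and N :: "('q, 'f::real_normed_vector) atlas"
  assumes M: "smooth_atlas M" and N: "smooth_atlas N" and F: "smooth_map_on M N W F"
    and p: "p \<in> W" and cU: "chart_of M U \<phi>" "p \<in> U" and cV: "chart_of N V \<psi>" "F p \<in> V"
    and surj: "pushforward N (mcarrier N) F (F p) ` tangent_space M (mcarrier M) p
        = tangent_space N (mcarrier N) (F p)"
  shows "surj (frechet_derivative (\<psi> \<circ> F \<circ> inv_into U \<phi>) (at (\<phi> p)))"
proof (rule surjI[of _ "\<lambda>\<xi>. SOME \<eta>. frechet_derivative (\<psi> \<circ> F \<circ> inv_into U \<phi>) (at (\<phi> p)) \<eta> = \<xi>"],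
    rule someI_ex)
  fix \<xi> :: 'f
  let ?\<sigma> = "\<psi> \<circ> F \<circ> inv_into U \<phi>"
  let ?O = "\<phi> ` {q \<in> U \<inter> W. F q \<in> V}"
  have \<sigma>: "open ?O" "smooth_on ?O ?\<sigma>" using smooth_map_on_chart[OF M N F cU(1) cV(1)] .
  have e0: "\<phi> p \<in> ?O" using p cU cV by auto
  note d\<sigma> = smooth_on_has_derivative[OF \<sigma>(2) e0]
  have oV: "open (\<psi> ` V)" by (rule chart_of_range_open[OF N cV(1)])
  then obtain \<epsilon> where "\<epsilon> > 0" and \<epsilon>: "\<And>t. \<bar>t\<bar> < \<epsilon> \<Longrightarrow> \<psi> (F p) + t *\<^sub>R \<xi> \<in> \<psi> ` V"
    by (rule small_line[of "\<psi> ` V" "\<psi> (F p)" \<xi>]) (use cV in auto)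
  have line: "\<psi> (F p) + t *\<^sub>R \<xi> \<in> \<psi> ` V \<and> inv_into V \<psi> (\<psi> (F p) + t *\<^sub>R \<xi>) \<in> mcarrier N" if t: "\<bar>t\<bar> < \<epsilon>" for t
    using \<epsilon>[OF t] openin_mtopology_mcarrier[OF N chart_of_openin[OF cV(1)] inv_into_into[OF \<epsilon>[OF t]]] by blast
  define w where "w = velocity N (mcarrier N) (\<lambda>t. inv_into V \<psi> (\<psi> (F p) + t *\<^sub>R \<xi>))"
  have w: "w \<in> tangent_space N (mcarrier N) (F p)" "chart_direction N (mcarrier N) V \<psi> (F p) w \<xi>"
    using line_velocity[OF N cV \<open>\<epsilon> > 0\<close>, of \<xi> "mcarrier N"] line unfolding w_def by blast+
  then obtain v where v: "v \<in> tangent_space M (mcarrier M) p" "w = pushforward N (mcarrier N) F (F p) v"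
    using surj by blast
  obtain \<eta> where \<eta>: "chart_direction M (mcarrier M) U \<phi> p v \<eta>"
    by (rule tangent_chart_direction[OF M v(1) cU])
  \<comment> \<open>The vector \<open>w\<close> is evaluated on the composite of \<open>l\<close>
    with \<open>\<psi>\<close>, once directly and once as a pushforward. Coordinate functionals
    \<open>l\<close> separate points, so the two directions agree.\<close>
  have key: "l (frechet_derivative ?\<sigma> (at (\<phi> p)) \<eta>) = l \<xi>" if l: "bounded_linear l" for l :: "'f \<Rightarrow> real"
  proof -
    have sl: "smooth_real_on N V (\<lambda>q. l (\<psi> q))"
      by (rule smooth_real_on_chartI[OF N cV(1) smooth_on_bounded_linear[OF oV l]])
    have d1: "(((\<lambda>q. l (\<psi> q)) \<circ> inv_into V \<psi>) has_derivative l) (at (\<psi> (F p)))"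
      by (rule has_derivative_transform_within_open[OF bounded_linear_imp_has_derivative[OF l] oV])
        (use cV chart_of_inv[OF cV(1)] in auto)
    have "w (\<lambda>q. l (\<psi> q)) = frechet_derivative ((\<lambda>q. l (\<psi> q)) \<circ> inv_into V \<psi>) (at (\<psi> (F p))) \<xi>"
      by (rule chart_directionD[OF w(2) cV(2) sl]) simp
    also have "\<dots> = l \<xi>" using frechet_derivative_at[OF d1] by simp
    finally have 1: "w (\<lambda>q. l (\<psi> q)) = l \<xi>" .
    have "smooth_fun N (mcarrier N) (F p) (\<lambda>q. l (\<psi> q))" by (rule smooth_nearI[OF cV(2) sl]) simp
    then have 2: "w (\<lambda>q. l (\<psi> q)) = v ((\<lambda>q. l (\<psi> q)) \<circ> F)" using v(2) by (simp add: pushforward_def)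
    have sF: "smooth_real_on M {q \<in> W. F q \<in> V} (\<lambda>q. l (\<psi> (F q)))"
      by (rule smooth_map_on_compose[OF M N smooth_atlas_real F sl])
    have "v ((\<lambda>q. l (\<psi> q)) \<circ> F) = frechet_derivative ((\<lambda>q. l (\<psi> (F q))) \<circ> inv_into U \<phi>) (at (\<phi> p)) \<eta>"
      by (rule chart_directionD[OF \<eta> _ sF]) (use p cV in auto)
    also have "\<dots> = l (frechet_derivative ?\<sigma> (at (\<phi> p)) \<eta>)"
      using frechet_derivative_linear_comp[OF l d\<sigma>] by (simp add: o_def)
    finally show ?thesis using 1 2 by simp
  qed
  obtain B :: "'f set" and l where B: "finite B" "\<And>b. b \<in> B \<Longrightarrow> bounded_linear (l b)"
    "\<And>x. x = (\<Sum>b\<in>B. l b x *\<^sub>R b)" using finite_dim_coordinates[OF smooth_atlas_finite_dim[OF N]] by blast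
  have "frechet_derivative ?\<sigma> (at (\<phi> p)) \<eta> = (\<Sum>b\<in>B. l b (frechet_derivative ?\<sigma> (at (\<phi> p)) \<eta>) *\<^sub>R b)"
    by (rule B(3))
  also have "\<dots> = (\<Sum>b\<in>B. l b \<xi> *\<^sub>R b)" by (rule sum.cong) (simp_all add: key B(2))
  also have "\<dots> = \<xi>" by (rule B(3)[symmetric])
  finally show "\<exists>\<eta>. frechet_derivative ?\<sigma> (at (\<phi> p)) \<eta> = \<xi>" by blast
qed

text \<open>With a right inverse \<open>B\<close> of the derivative \<open>A\<close> of \<open>\<sigma>\<close> at \<open>e0\<close>, the map
  \<open>\<Psi> e = (e - e0) + B (\<sigma> e - \<sigma> e0 - A (e - e0))\<close> is tangent to the identity at \<open>e0\<close>
  and satisfies \<open>A (\<Psi> e) = \<sigma> e - \<sigma> e0\<close>.\<close>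

theorem submersion_slice_chart:
  fixes M :: "('p, 'e::euclidean_space) atlas" and N :: "('q, 'f::real_normed_vector) atlas"
  assumes M: "smooth_atlas M" and N: "smooth_atlas N" and F: "submersion M N F"
    and p: "p \<in> mcarrier M"
  obtains U \<kappa> and A :: "'e \<Rightarrow> 'f" where "chart_of M U \<kappa>" "p \<in> U" "linear A"
    "\<And>q r. q \<in> U \<Longrightarrow> r \<in> U \<Longrightarrow> F q = F r \<longleftrightarrow> A (\<kappa> q) = A (\<kappa> r)"
proof -
  have "smooth_near M N (mcarrier M) p F" using F p unfolding submersion_def smooth_map_def by blast
  then obtain W where W: "p \<in> W" "openin (mtopology M) W" and FW: "smooth_map_on M N W F"
    by (rule smooth_near_carrier[OF M N])
  obtain U \<phi> where U: "(U, \<phi>) \<in> M" "p \<in> U" by (rule atlas_chart_exists[OF p])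
  obtain V \<psi> where V: "(V, \<psi>) \<in> N" "F p \<in> V"
    by (rule atlas_chart_exists[OF smooth_map_on_range[OF FW W(1)]])
  note cU = chart_of_atlas[OF M U(1)] and cV = chart_of_atlas[OF N V(1)]
  let ?\<sigma> = "\<psi> \<circ> F \<circ> inv_into U \<phi>"
  let ?O = "\<phi> ` {q \<in> U \<inter> W. F q \<in> V}"
  let ?e0 = "\<phi> p"
  have \<sigma>: "open ?O" "smooth_on ?O ?\<sigma>" using smooth_map_on_chart[OF M N FW cU cV] .
  have e0: "?e0 \<in> ?O" using W U V by auto
  define A where "A = frechet_derivative ?\<sigma> (at ?e0)"
  have dA: "(?\<sigma> has_derivative A) (at ?e0)"
    unfolding A_def by (rule smooth_on_has_derivative[OF \<sigma>(2) e0])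
  have blA: "bounded_linear A" using dA has_derivative_bounded_linear by blast
  have lA: "linear A" using dA has_derivative_linear by blast
  have "surj A"
    unfolding A_def
    by (rule submersion_derivative_surj[OF M N FW W(1) cU U(2) cV V(2)])
      (use F p in \<open>auto simp: submersion_def\<close>)
  then obtain B where B: "linear B" "A \<circ> B = id"
    using linear_surjective_right_inverse[OF lA] by blast
  have AB: "A (B y) = y" for y using B(2) by (metis comp_apply id_apply)
  have blB: "bounded_linear B"
    by (rule finite_dim_linear_bounded[OF smooth_atlas_finite_dim[OF N] B(1)])
  define \<Psi> where "\<Psi> e = (e - ?e0) + B (?\<sigma> e - ?\<sigma> ?e0 - A (e - ?e0))" for e
  have A\<Psi>: "A (\<Psi> e) = ?\<sigma> e - ?\<sigma> ?e0" for e
    by (simp add: \<Psi>_def linear_add[OF lA] AB)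
  have s\<Psi>: "smooth_on ?O \<Psi>"
  proof -
    have t: "smooth_on ?O (\<lambda>e. e + (- ?e0))"
      by (intro smooth_on_add smooth_on_id smooth_on_const \<sigma>(1))
    have m: "bounded_linear (\<lambda>e. - A e)" by (rule bounded_linear_minus[OF blA])
    have "smooth_on ?O (\<lambda>e. (e + (- ?e0)) + B ((?\<sigma> e + (- ?\<sigma> ?e0)) + - A (e + (- ?e0))))"
      by (intro smooth_on_add[OF \<sigma>(1)] t smooth_on_bounded_linear_comp[OF \<sigma>(1) blB]
          smooth_on_bounded_linear_comp[OF \<sigma>(1) m] \<sigma>(2) smooth_on_const[OF \<sigma>(1)])
    then show ?thesis unfolding \<Psi>_def by simp
  qed
  have "(\<Psi> has_derivative (\<lambda>h. h)) (at ?e0)"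
  proof -
    have "(\<Psi> has_derivative (\<lambda>h. h + B (A h - A h))) (at ?e0)"
      unfolding \<Psi>_def
      by (rule derivative_eq_intros bounded_linear.has_derivative[OF blB]
          bounded_linear.has_derivative[OF blA] dA refl | simp)+
    then show ?thesis using linear_0[OF B(1)] by simp
  qed
  then have id: "frechet_derivative \<Psi> (at ?e0) = id"
    using frechet_derivative_at by (metis eq_id_iff)
  obtain O' V' g where O': "open O'" "O' \<subseteq> ?O" "?e0 \<in> O'" "open V'" and
    hom: "homeomorphism O' V' \<Psi> g" and sg: "smooth_on V' g"
    by (rule smooth_inverse_function_theorem[OF \<sigma>(1) s\<Psi> e0 id])
  have sub: "O' \<subseteq> \<phi> ` U" using O'(2) by auto
  show thesis
  proof (rule that)
    show "chart_of M {q \<in> U. \<phi> q \<in> O'} (\<lambda>q. \<Psi> (\<phi> q))"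
      by (rule chart_of_diffeo[OF M cU hom O'(1) sub O'(4) smooth_on_subset[OF s\<Psi> O'(2)] sg])
    show "p \<in> {q \<in> U. \<phi> q \<in> O'}" using U O' by simp
    show "linear A" by (rule lA)
    fix q r assume qr: "q \<in> {q \<in> U. \<phi> q \<in> O'}" "r \<in> {q \<in> U. \<phi> q \<in> O'}"
    \<comment> \<open>\<open>\<psi>\<close> is injective only on \<open>V\<close>, so
      \<open>F q\<close> must be known to lie there before \<open>\<psi>\<close> can be
      cancelled.\<close>
    have FV: "F q \<in> V" if q: "q \<in> {q \<in> U. \<phi> q \<in> O'}" for q
    proof -
      obtain q' where "q' \<in> U" "F q' \<in> V" "\<phi> q = \<phi> q'" using q O'(2) by fastforce
      then show ?thesis using q chart_of_inj[OF cU] by (auto dest: inj_onD)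
    qed
    have "A (\<Psi> (\<phi> q)) = A (\<Psi> (\<phi> r)) \<longleftrightarrow> \<psi> (F q) = \<psi> (F r)"
      unfolding A\<Psi> using qr chart_of_inv[OF cU] by simp
    also have "\<dots> \<longleftrightarrow> F q = F r"
      using FV qr chart_of_inj[OF cV] by (auto dest: inj_onD)
    finally show "F q = F r \<longleftrightarrow> A (\<Psi> (\<phi> q)) = A (\<Psi> (\<phi> r))" by simp
  qed
qed

section \<open>Local frames and metrics\<close>

text \<open>The functions \<open>x\<close> are dual to the fields \<open>E\<close>, so the
  coefficients of \<open>v\<close> are its values on them. Closure under combinations is demanded
  explicitly since a tangent space is just a set of velocities; commutation makes the second-order
  parts of brackets cancel.\<close>

definition local_frame ::
  "('p, 'e::real_normed_vector) atlas \<Rightarrow> 'p set \<Rightarrow> 'p set \<Rightarrow> 'i set \<Rightarrow> ('i \<Rightarrow> 'p \<Rightarrow> 'p tvec) \<Rightarrow>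
     ('i \<Rightarrow> 'p \<Rightarrow> real) \<Rightarrow> bool" where
  "local_frame M S W I E x \<longleftrightarrow> finite I \<and>
     (\<forall>i\<in>I. vector_field M S W (E i) \<and> smooth_funs_on M S W (x i)) \<and>
     (\<forall>q\<in>W. (\<forall>a. (\<lambda>f. \<Sum>i\<in>I. a i * E i q f) \<in> tangent_space M S q) \<and>
        (\<forall>v\<in>tangent_space M S q. \<forall>f. v f = (\<Sum>i\<in>I. v (x i) * E i q f)) \<and>
        (\<forall>i\<in>I. \<forall>j\<in>I. E i q (x j) = (if i = j then 1 else 0) \<and>
           (\<forall>f. smooth_fun M S q f \<longrightarrow> E i q (\<lambda>r. E j r f) = E j q (\<lambda>r. E i r f))))"

text \<open>Isolates what the geometry of a source fibre takes from the groupoid. The index sets lie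
  in the model space because the indices will be basis vectors of a kernel.\<close>

locale framed =
  fixes M :: "('p, 'e::real_normed_vector) atlas" and S :: "'p set"
  assumes atlas: "smooth_atlas M"
    and frames: "\<And>p. p \<in> S \<Longrightarrow> \<exists>W (I :: 'e set) E x. p \<in> W \<and> openin (subtopology (mtopology M) S) W \<and>
      local_frame M S W I E x"
begin

abbreviation T :: "'p \<Rightarrow> 'p tvec set" where "T p \<equiv> tangent_space M S p"
abbreviation C :: "'p \<Rightarrow> ('p \<Rightarrow> real) \<Rightarrow> bool" where "C p f \<equiv> smooth_fun M S p f"
abbreviation opn :: "'p set \<Rightarrow> bool" where "opn W \<equiv> openin (subtopology (mtopology M) S) W"
abbreviation VF :: "'p set \<Rightarrow> ('p \<Rightarrow> 'p tvec) \<Rightarrow> bool" where "VF W X \<equiv> vector_field M S W X"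
abbreviation SF :: "'p set \<Rightarrow> ('p \<Rightarrow> real) \<Rightarrow> bool" where "SF W f \<equiv> smooth_funs_on M S W f"
abbreviation br :: "('p \<Rightarrow> 'p tvec) \<Rightarrow> ('p \<Rightarrow> 'p tvec) \<Rightarrow> 'p \<Rightarrow> 'p tvec" where
  "br X Y \<equiv> lie_bracket M S X Y"

section \<open>Linear algebra of tangent spaces and vector fields with frames\<close>

lemma opn_obtain:
  assumes "opn W" obtains W0 where "openin (mtopology M) W0" "W = W0 \<inter> S"
  using assms unfolding openin_subtopology by blast

lemma opn_Int: "opn V \<Longrightarrow> opn W \<Longrightarrow> opn (V \<inter> W)" by (rule openin_Int)

lemma opn_subset: "opn W \<Longrightarrow> W \<subseteq> S" using opn_obtain by blast

lemma C_cong: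
  assumes "C p f" "opn W" "p \<in> W" "\<And>q. q \<in> W \<Longrightarrow> f q = g q" shows "C p g"
proof -
  obtain W0 where "openin (mtopology M) W0" "W = W0 \<inter> S" by (rule opn_obtain[OF assms(2)])
  then show ?thesis
    using smooth_near_cong[OF atlas smooth_atlas_real assms(1), of W0 g] assms(3,4) by auto
qed

lemma C_open:
  assumes "C p f" "p \<in> S" obtains W where "opn W" "p \<in> W" "\<And>q. q \<in> W \<Longrightarrow> C q f"
proof -
  obtain W where W: "p \<in> W" "openin (mtopology M) W" "\<And>q. q \<in> W \<Longrightarrow> C q f"
    using smooth_near_open[OF assms(1)] by metis
  have "opn (W \<inter> S)" using W(2) unfolding openin_subtopology by blast
  then show thesis using that[of "W \<inter> S"] W assms(2) by auto
qed

lemma T_cong: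
  assumes "v \<in> T p" "opn W" "p \<in> W" "\<And>q. q \<in> W \<Longrightarrow> f q = g q" shows "v f = v g"
proof -
  obtain W0 where "openin (mtopology M) W0" "W = W0 \<inter> S" by (rule opn_obtain[OF assms(2)])
  then show ?thesis
    using tangent_cong[OF atlas assms(1), of W0 f g] assms(3,4) by auto
qed

lemmas T_S = tangent_point(1)[OF atlas]
lemmas T_plus = tangent_add[OF atlas] and T_times = tangent_mult[OF atlas] and T_const = tangent_const[OF atlas]
  and T_sum = tangent_sum[OF atlas] and T_cmult = tangent_scale[OF atlas]
lemmas C_plus = smooth_fun_add[OF atlas] and C_times = smooth_fun_mult[OF atlas]
  and C_minus = smooth_fun_diff[OF atlas] and C_sum = smooth_fun_sum[OF atlas]
  and C_const = smooth_fun_const[OF atlas]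
  and C_inverse = smooth_fun_inverse[OF atlas] and C_carrier = smooth_fun_carrier[OF atlas]

lemma frame_obtain:
  assumes "p \<in> S"
  obtains W and I :: "'e set" and E x where "p \<in> W" "opn W" "local_frame M S W I E x"
  using frames[OF assms] by blast

text \<open>Expanding each \<open>u j\<close> in a frame turns the sum into a combination of frame
  vectors, and these are tangent by the definition of a frame.\<close>

lemma T_combination:
  assumes "finite J" "\<And>j. j \<in> J \<Longrightarrow> u j \<in> T p" "p \<in> S"
  shows "(\<lambda>f. \<Sum>j\<in>J. c j * u j f) \<in> T p"
proof -
  obtain W and I :: "'e set" and E x where W: "p \<in> W" "opn W" and fr: "local_frame M S W I E x"
    by (rule frame_obtain[OF assms(3)])
  have "(\<Sum>j\<in>J. c j * u j f) = (\<Sum>i\<in>I. (\<Sum>j\<in>J. c j * u j (x i)) * E i p f)" for f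
  proof -
    have "(\<Sum>j\<in>J. c j * u j f) = (\<Sum>j\<in>J. \<Sum>i\<in>I. c j * (u j (x i) * E i p f))"
    proof (rule sum.cong[OF refl])
      fix j assume "j \<in> J"
      then have "u j f = (\<Sum>i\<in>I. u j (x i) * E i p f)"
        using assms(2) fr W unfolding local_frame_def by blast
      then show "c j * u j f = (\<Sum>i\<in>I. c j * (u j (x i) * E i p f))" by (simp only: sum_distrib_left)
    qed
    also have "\<dots> = (\<Sum>i\<in>I. \<Sum>j\<in>J. c j * (u j (x i) * E i p f))" by (rule sum.swap)
    finally show ?thesis by (simp add: sum_distrib_right mult.assoc)
  qed
  then have e: "(\<lambda>f. \<Sum>j\<in>J. c j * u j f) = (\<lambda>f. \<Sum>i\<in>I. (\<Sum>j\<in>J. c j * u j (x i)) * E i p f)" by blast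
  have "(\<lambda>f. \<Sum>i\<in>I. a i * E i p f) \<in> T p" for a using fr W unfolding local_frame_def by blast
  then show ?thesis unfolding e .
qed

lemma T_linear:
  assumes "u \<in> T p" "v \<in> T p" shows "(\<lambda>f. a * u f + b * v f) \<in> T p"
proof -
  have "(\<lambda>f. \<Sum>j\<in>{True,False}. (if j then a else b) * (if j then u else v) f) \<in> T p"
    by (rule T_combination) (use assms T_S in auto)
  then show ?thesis by simp
qed

lemma T_tadd: "u \<in> T p \<Longrightarrow> v \<in> T p \<Longrightarrow> tadd u v \<in> T p"
  using T_linear[of u p v 1 1] by (simp add: tadd_def)

lemma T_tscale: "u \<in> T p \<Longrightarrow> tscale a u \<in> T p"
  using T_linear[of u p u a 0] by (simp add: tscale_def)

lemma VF_open: "VF W X \<Longrightarrow> opn W"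
  and VF_T: "VF W X \<Longrightarrow> p \<in> W \<Longrightarrow> X p \<in> T p"
  and VF_C: "VF W X \<Longrightarrow> p \<in> W \<Longrightarrow> C p f \<Longrightarrow> C p (\<lambda>q. X q f)"
  unfolding vector_field_def by blast+

lemma VF_S: "VF W X \<Longrightarrow> p \<in> W \<Longrightarrow> p \<in> S"
  using VF_open opn_subset by blast

lemma VF_cong:
  assumes "VF W X" "\<And>q. q \<in> W \<Longrightarrow> X q = Y q" shows "VF W Y"
proof -
  have "C p (\<lambda>q. Y q f)" if "p \<in> W" "C p f" for p f
    by (rule C_cong[OF VF_C[OF assms(1) that] VF_open[OF assms(1)] that(1)]) (simp add: assms(2))
  then show ?thesis using assms unfolding vector_field_def by auto
qed

lemma VF_restrict: "VF W X \<Longrightarrow> opn V \<Longrightarrow> V \<subseteq> W \<Longrightarrow> VF V X"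
  unfolding vector_field_def by blast

lemma SF_restrict: "SF W f \<Longrightarrow> V \<subseteq> W \<Longrightarrow> SF V f"
  unfolding smooth_funs_on_def by blast

lemma VF_combination:
  assumes "finite J" "opn W" "\<And>j. j \<in> J \<Longrightarrow> VF W (u j)" "\<And>j. j \<in> J \<Longrightarrow> SF W (c j)"
  shows "VF W (\<lambda>q f. \<Sum>j\<in>J. c j q * u j q f)"
  unfolding vector_field_def
proof (intro conjI ballI allI impI)
  fix p assume p: "p \<in> W"
  show "(\<lambda>f. \<Sum>j\<in>J. c j p * u j p f) \<in> T p"
    using assms p opn_subset by (intro T_combination[of J "\<lambda>j. u j p"]) (auto intro: VF_T)
  fix f assume f: "C p f"
  show "C p (\<lambda>q. \<Sum>j\<in>J. c j q * u j q f)"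
  proof (rule C_sum[OF C_carrier[OF f]])
    fix j assume "j \<in> J"
    then show "C p (\<lambda>q. c j q * u j q f)"
      using assms(4) p by (intro C_times VF_C[OF assms(3) p f]) (auto simp: smooth_funs_on_def)
  qed
qed (rule assms(2))

lemma VF_tadd:
  assumes "VF W X" "VF W Y" shows "VF W (\<lambda>q. tadd (X q) (Y q))"
  unfolding vector_field_def
proof (intro conjI ballI allI impI)
  fix p f assume "p \<in> W" "C p f"
  then show "C p (\<lambda>q. tadd (X q) (Y q) f)"
    unfolding tadd_def by (intro C_plus VF_C[OF assms(1)] VF_C[OF assms(2)])
qed (use assms VF_open VF_T T_tadd in auto)

lemma VF_tscale:
  assumes "VF W X" "SF W f" shows "VF W (\<lambda>q. tscale (f q) (X q))"
  unfolding vector_field_def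
proof (intro conjI ballI allI impI)
  fix p h assume "p \<in> W" "C p h"
  then show "C p (\<lambda>q. tscale (f q) (X q) h)"
    using assms(2) unfolding tscale_def smooth_funs_on_def by (intro C_times VF_C[OF assms(1)]) auto
qed (use assms VF_open VF_T T_tscale in auto)

lemma SF_const: "opn W \<Longrightarrow> SF W (\<lambda>q. c)"
  using C_const opn_subset openin_subset topspace_mtopology[OF atlas]
  unfolding smooth_funs_on_def by fastforce

lemma VF_tdiff:
  assumes "VF W X" "VF W Y" shows "VF W (\<lambda>q. tdiff (X q) (Y q))"
  by (intro VF_tadd VF_tscale assms SF_const VF_open[OF assms(1)])

lemma SF_VF: "VF W X \<Longrightarrow> SF W f \<Longrightarrow> SF W (\<lambda>q. X q f)"
  unfolding smooth_funs_on_def using VF_C by blast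

lemma frame_expansion:
  "local_frame M S W I E x \<Longrightarrow> q \<in> W \<Longrightarrow> v \<in> T q \<Longrightarrow> v f = (\<Sum>i\<in>I. v (x i) * E i q f)"
  unfolding local_frame_def by blast

lemma local_frame_finite: "local_frame M S W I E x \<Longrightarrow> finite I"
  and local_frame_VF: "local_frame M S W I E x \<Longrightarrow> i \<in> I \<Longrightarrow> VF W (E i)"
  and local_frame_SF: "local_frame M S W I E x \<Longrightarrow> i \<in> I \<Longrightarrow> SF W (x i)"
  unfolding local_frame_def by blast+

text \<open>In a commuting frame \<open>X Y f\<close> and \<open>Y X f\<close> have the same
  second-order part. Its cancellation leaves a frame combination whose coefficients are the values
  of the bracket on the coordinates \<open>x i\<close>, hence a tangent vector.\<close>

lemma br_T:
  assumes X: "VF W X" and Y: "VF W Y" and p: "p \<in> W"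
  shows "br X Y p \<in> T p"
proof -
  have pS: "p \<in> S" by (rule VF_S[OF X p])
  obtain W1 and I :: "'e set" and E x where W1: "p \<in> W1" "opn W1" and fr: "local_frame M S W1 I E x"
    by (rule frame_obtain[OF pS])
  note E = local_frame_VF[OF fr] local_frame_SF[OF fr]
  note XT = VF_T[OF X p] and YT = VF_T[OF Y p]
  have xC: "C p (x i)" if "i \<in> I" for i
    using E(2)[OF that] W1 unfolding smooth_funs_on_def by blast
  have comm: "E i p (\<lambda>r. E j r f) = E j p (\<lambda>r. E i r f)" if "i \<in> I" "j \<in> I" "C p f" for i j f
    using fr W1 that unfolding local_frame_def by blast
  \<comment> \<open>First-order part plus second-order part; the latter is symmetric in
    \<open>A\<close> and \<open>B\<close> once the frame fields commute.\<close>
  have key: "A p (\<lambda>q. B q f) = (\<Sum>i\<in>I. A p (\<lambda>q. B q (x i)) * E i p f) +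
      (\<Sum>i\<in>I. \<Sum>j\<in>I. B p (x i) * A p (x j) * E j p (\<lambda>q. E i q f))"
    if A: "VF W A" and B: "VF W B" and f: "C p f" for A B f
  proof -
    have AT: "A p \<in> T p" by (rule VF_T[OF A p])
    have "A p (\<lambda>q. B q f) = A p (\<lambda>q. \<Sum>i\<in>I. B q (x i) * E i q f)"
    proof (rule T_cong[OF AT opn_Int[OF VF_open[OF X] W1(2)]])
      fix q assume "q \<in> W \<inter> W1"
      then show "B q f = (\<Sum>i\<in>I. B q (x i) * E i q f)"
        using frame_expansion[OF fr] VF_T[OF B] by blast
    qed (use p W1 in auto)
    also have "\<dots> = (\<Sum>i\<in>I. A p (\<lambda>q. B q (x i) * E i q f))"
      by (intro T_sum[OF AT] C_times VF_C[OF B p] xC VF_C[OF E(1) W1(1) f])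
    also have "\<dots> = (\<Sum>i\<in>I. A p (\<lambda>q. B q (x i)) * E i p f +
        (\<Sum>j\<in>I. B p (x i) * A p (x j) * E j p (\<lambda>q. E i q f)))"
    proof (rule sum.cong[OF refl])
      fix i assume i: "i \<in> I"
      have "A p (\<lambda>q. B q (x i) * E i q f) = B p (x i) * A p (\<lambda>q. E i q f) + A p (\<lambda>q. B q (x i)) * E i p f"
        by (rule T_times[OF AT VF_C[OF B p xC[OF i]] VF_C[OF E(1)[OF i] W1(1) f]])
      also have "A p (\<lambda>q. E i q f) = (\<Sum>j\<in>I. A p (x j) * E j p (\<lambda>q. E i q f))"
        by (rule frame_expansion[OF fr W1(1) AT])
      finally show "A p (\<lambda>q. B q (x i) * E i q f) = A p (\<lambda>q. B q (x i)) * E i p f +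
        (\<Sum>j\<in>I. B p (x i) * A p (x j) * E j p (\<lambda>q. E i q f))"
        by (simp add: sum_distrib_left mult.assoc)
    qed
    finally show ?thesis by (simp add: sum.distrib)
  qed
  have "br X Y p f = (\<Sum>i\<in>I. (X p (\<lambda>q. Y q (x i)) - Y p (\<lambda>q. X q (x i))) * E i p f)" for f
  proof (cases "C p f")
    case True
    have "(\<Sum>i\<in>I. \<Sum>j\<in>I. Y p (x i) * X p (x j) * E j p (\<lambda>q. E i q f)) =
        (\<Sum>j\<in>I. \<Sum>i\<in>I. Y p (x i) * X p (x j) * E j p (\<lambda>q. E i q f))" by (rule sum.swap)
    also have "\<dots> = (\<Sum>i\<in>I. \<Sum>j\<in>I. X p (x i) * Y p (x j) * E j p (\<lambda>q. E i q f))"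
      by (intro sum.cong refl) (simp add: comm[OF _ _ True] mult.commute)
    finally show ?thesis
      using key[OF X Y True] key[OF Y X True] True
      by (simp add: lie_bracket_def sum_subtractf left_diff_distrib)
  next
    case False
    have "E i p f = 0" if "i \<in> I" for i
      by (rule tangent_not_smooth[OF VF_T[OF E(1)[OF that] W1(1)] False])
    then show ?thesis using False by (simp add: lie_bracket_def)
  qed
  then have e: "br X Y p = (\<lambda>f. \<Sum>i\<in>I. (X p (\<lambda>q. Y q (x i)) - Y p (\<lambda>q. X q (x i))) * E i p f)" by blast
  have "(\<lambda>f. \<Sum>i\<in>I. a i * E i p f) \<in> T p" for a using fr W1 unfolding local_frame_def by blast
  then show ?thesis unfolding e .
qed

lemma VF_br:
  assumes X: "VF W X" and Y: "VF W Y" shows "VF W (br X Y)"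
  unfolding vector_field_def
proof (intro conjI ballI allI impI)
  show "opn W" by (rule VF_open[OF X])
  fix p assume p: "p \<in> W"
  show "br X Y p \<in> T p" by (rule br_T[OF X Y p])
  fix f assume f: "C p f"
  \<comment> \<open>\<open>lie_bracket\<close> is the commutator only at points where
    \<open>f\<close> is smooth; these include a neighbourhood of \<open>p\<close>.\<close>
  obtain V where V: "opn V" "p \<in> V" "\<And>q. q \<in> V \<Longrightarrow> C q f" using C_open[OF f VF_S[OF X p]] by metis
  have "C p (\<lambda>q. X q (\<lambda>q. Y q f) - Y q (\<lambda>q. X q f))"
    by (intro C_minus VF_C[OF X p] VF_C[OF Y p] f)
  then show "C p (\<lambda>q. br X Y q f)"
    by (rule C_cong[OF _ V(1,2)]) (simp add: lie_bracket_def V(3))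
qed

lemma br_cong:
  assumes "VF W X" "VF W Y" "p \<in> W" "\<And>q. q \<in> W \<Longrightarrow> X q = X' q" "\<And>q. q \<in> W \<Longrightarrow> Y q = Y' q"
  shows "br X Y p = br X' Y' p"
proof -
  have "X p (\<lambda>q. Y q f) = X p (\<lambda>q. Y' q f)" "Y p (\<lambda>q. X q f) = Y p (\<lambda>q. X' q f)" for f
    using assms(5) assms(4)
    by (intro T_cong[OF VF_T[OF assms(1,3)] VF_open[OF assms(1)] assms(3)]
        T_cong[OF VF_T[OF assms(2,3)] VF_open[OF assms(2)] assms(3)]; simp)+
  then show ?thesis using assms(3-5) by (auto simp: lie_bracket_def fun_eq_iff)
qed

lemma br_swap: "br X Y p = tscale (-1) (br Y X p)"
  by (simp add: lie_bracket_def tscale_def fun_eq_iff)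

lemma br_tadd:
  assumes X: "VF W X" and X': "VF W X'" and Y: "VF W Y" and p: "p \<in> W"
  shows "br (\<lambda>q. tadd (X q) (X' q)) Y p = tadd (br X Y p) (br X' Y p)"
proof
  fix f
  show "br (\<lambda>q. tadd (X q) (X' q)) Y p f = tadd (br X Y p) (br X' Y p) f"
  proof (cases "C p f")
    case True
    have "Y p (\<lambda>q. X q f + X' q f) = Y p (\<lambda>q. X q f) + Y p (\<lambda>q. X' q f)"
      by (rule T_plus[OF VF_T[OF Y p] VF_C[OF X p True] VF_C[OF X' p True]])
    then show ?thesis by (simp add: lie_bracket_def tadd_def)
  qed (simp add: lie_bracket_def tadd_def)
qed

lemma br_tscale:
  assumes X: "VF W X" and Y: "VF W Y" and h: "SF W h" and p: "p \<in> W"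
  shows "br (\<lambda>q. tscale (h q) (X q)) Y p = tdiff (tscale (h p) (br X Y p)) (tscale (Y p h) (X p))"
proof
  fix f
  show "br (\<lambda>q. tscale (h q) (X q)) Y p f = tdiff (tscale (h p) (br X Y p)) (tscale (Y p h) (X p)) f"
  proof (cases "C p f")
    case True
    have "Y p (\<lambda>q. h q * X q f) = h p * Y p (\<lambda>q. X q f) + Y p h * X p f"
      using h p by (intro T_times[OF VF_T[OF Y p] _ VF_C[OF X p True]]) (simp add: smooth_funs_on_def)
    then show ?thesis using True by (simp add: lie_bracket_def tadd_def tscale_def algebra_simps)
  next
    case False
    then show ?thesis using tangent_not_smooth[OF VF_T[OF X p]]
      by (simp add: lie_bracket_def tadd_def tscale_def)
  qed
qed

lemma vector_extension:
  assumes "v \<in> T p" obtains W Z where "p \<in> W" "VF W Z" "Z p = v"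
proof -
  obtain W and I :: "'e set" and E x where W: "p \<in> W" "opn W" and fr: "local_frame M S W I E x"
    by (rule frame_obtain[OF T_S[OF assms]])
  show thesis
  proof (rule that[OF W(1)])
    show "VF W (\<lambda>q f. \<Sum>i\<in>I. v (x i) * E i q f)"
      by (rule VF_combination[of I W E "\<lambda>i _. v (x i)"])
        (use local_frame_finite[OF fr] local_frame_VF[OF fr] SF_const[OF W(2)] W(2) in blast)+
    show "(\<lambda>f. \<Sum>i\<in>I. v (x i) * E i p f) = v"
      by (rule ext) (rule frame_expansion[OF fr W(1) assms, symmetric])
  qed
qed

text \<open>Linearity is assumed only for fields on open sets inside \<open>W0\<close>, so the
  passage to finite sums has to carry the smoothness of every partial sum along.\<close>

lemma tensor_sum:
  assumes add: "\<And>W X Y. p \<in> W \<Longrightarrow> W \<subseteq> W0 \<Longrightarrow> VF W X \<Longrightarrow> VF W Y \<Longrightarrow> \<Phi> (\<lambda>q. tadd (X q) (Y q)) = \<Phi> X + (\<Phi> Y :: real)"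
    and hom: "\<And>W X f. p \<in> W \<Longrightarrow> W \<subseteq> W0 \<Longrightarrow> VF W X \<Longrightarrow> SF W f \<Longrightarrow> \<Phi> (\<lambda>q. tscale (f q) (X q)) = f p * \<Phi> X"
    and p: "p \<in> W" "W \<subseteq> W0" "VF W X0" and J: "finite J"
    and E: "\<And>j. j \<in> J \<Longrightarrow> VF W (E j)" and a: "\<And>j. j \<in> J \<Longrightarrow> SF W (a j)"
  shows "\<Phi> (\<lambda>q f. \<Sum>j\<in>J. a j q * E j q f) = (\<Sum>j\<in>J. a j p * \<Phi> (E j))"
  using J E a
proof (induction J)
  case empty
  \<comment> \<open>The field \<open>X0\<close> serves to write the zero field as a multiple of
    something smooth.\<close>
  have "\<Phi> (\<lambda>q. tscale 0 (X0 q)) = 0 * \<Phi> X0"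
    by (rule hom[OF p SF_const[OF VF_open[OF p(3)]]])
  then show ?case by (simp add: tscale_def)
next
  case (insert i J)
  have 1: "VF W (\<lambda>q. tscale (a i q) (E i q))" by (rule VF_tscale) (use insert.prems in auto)
  have 2: "VF W (\<lambda>q f. \<Sum>j\<in>J. a j q * E j q f)"
    by (rule VF_combination[OF insert.hyps(1) VF_open[OF p(3)]]) (use insert.prems in auto)
  have "\<Phi> (\<lambda>q. tadd (tscale (a i q) (E i q)) (\<lambda>f. \<Sum>j\<in>J. a j q * E j q f)) =
      \<Phi> (\<lambda>q. tscale (a i q) (E i q)) + \<Phi> (\<lambda>q f. \<Sum>j\<in>J. a j q * E j q f)"
    by (rule add[OF p(1,2) 1 2])
  also have "\<Phi> (\<lambda>q. tscale (a i q) (E i q)) = a i p * \<Phi> (E i)"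
    by (rule hom[OF p(1,2)]) (use insert.prems in auto)
  also have "\<Phi> (\<lambda>q f. \<Sum>j\<in>J. a j q * E j q f) = (\<Sum>j\<in>J. a j p * \<Phi> (E j))"
    by (rule insert.IH) (use insert.prems in auto)
  finally show ?case using insert.hyps by (simp add: tadd_def tscale_def)
qed

text \<open>The difference of the fields vanishes at \<open>p\<close>, so its frame coefficients do,
  and linearity over functions gives 0. The expansion holds only on a smaller set; locality of
  \<open>\<Phi>\<close>, assumed on all \<open>W\<close> between \<open>p\<close> and
  \<open>W0\<close>, takes the place of bump functions.\<close>

lemma tensorial:
  assumes add: "\<And>W X Y. p \<in> W \<Longrightarrow> W \<subseteq> W0 \<Longrightarrow> VF W X \<Longrightarrow> VF W Y \<Longrightarrow> \<Phi> (\<lambda>q. tadd (X q) (Y q)) = \<Phi> X + (\<Phi> Y :: real)"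
    and hom: "\<And>W X f. p \<in> W \<Longrightarrow> W \<subseteq> W0 \<Longrightarrow> VF W X \<Longrightarrow> SF W f \<Longrightarrow> \<Phi> (\<lambda>q. tscale (f q) (X q)) = f p * \<Phi> X"
    and loc: "\<And>W X Y. p \<in> W \<Longrightarrow> W \<subseteq> W0 \<Longrightarrow> VF W X \<Longrightarrow> (\<And>q. q \<in> W \<Longrightarrow> X q = Y q) \<Longrightarrow> \<Phi> X = \<Phi> Y"
    and X: "VF W X" and Y: "VF W Y" and p: "p \<in> W" "W \<subseteq> W0" and eq: "X p = Y p"
  shows "\<Phi> X = \<Phi> Y"
proof -
  let ?Z = "\<lambda>q. tdiff (X q) (Y q)"
  have Z: "VF W ?Z" by (rule VF_tdiff[OF X Y])
  obtain V and I :: "'e set" and E x where V: "p \<in> V" "opn V" and fr: "local_frame M S V I E x"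
    by (rule frame_obtain[OF VF_S[OF X p(1)]])
  let ?V = "W \<inter> V"
  have oV: "opn ?V" by (rule opn_Int[OF VF_open[OF X] V(2)])
  have pV: "p \<in> ?V" "?V \<subseteq> W0" using p V by auto
  have E: "VF ?V (E i)" "SF ?V (x i)" if "i \<in> I" for i
    using VF_restrict[OF local_frame_VF[OF fr that] oV] SF_restrict[OF local_frame_SF[OF fr that]]
    by auto
  have ZE: "SF ?V (\<lambda>q. ?Z q (x i))" if "i \<in> I" for i
    by (rule SF_VF[OF VF_restrict[OF Z oV] E(2)[OF that]]) auto
  have "?Z p f = 0" for f using eq by (simp add: tadd_def tscale_def)
  then have "\<Phi> (\<lambda>q f. \<Sum>i\<in>I. ?Z q (x i) * E i q f) = 0"
    using tensor_sum[where \<Phi>=\<Phi> and p=p and ?W0.0=W0 and a="\<lambda>i q. ?Z q (x i)" and E=E,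
        OF add hom pV VF_restrict[OF X oV Int_lower1] local_frame_finite[OF fr] E(1) ZE] by simp
  moreover have "\<Phi> (\<lambda>q f. \<Sum>i\<in>I. ?Z q (x i) * E i q f) = \<Phi> ?Z"
  proof (rule loc[OF pV])
    show "VF ?V (\<lambda>q f. \<Sum>i\<in>I. ?Z q (x i) * E i q f)"
      by (intro VF_combination local_frame_finite[OF fr] oV E(1) ZE)
    fix q assume q: "q \<in> ?V"
    show "(\<lambda>f. \<Sum>i\<in>I. ?Z q (x i) * E i q f) = ?Z q"
      by (rule ext) (rule frame_expansion[OF fr _ VF_T[OF Z], symmetric]; use q in simp)
  qed
  moreover have "\<Phi> (\<lambda>q. tadd (Y q) (?Z q)) = \<Phi> Y + \<Phi> ?Z" by (rule add[OF p Y Z])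
  moreover have "(\<lambda>q. tadd (Y q) (?Z q)) = X" by (simp add: fun_eq_iff tadd_def tscale_def)
  ultimately show ?thesis by simp
qed

end

locale fibre_metric = framed M S for M :: "('p, 'e::real_normed_vector) atlas" and S +
  fixes m :: "'p \<Rightarrow> 'p tvec \<Rightarrow> 'p tvec \<Rightarrow> real"
  assumes inner: "\<And>p. p \<in> S \<Longrightarrow> inner_product_on (tangent_space M S p) (m p)"
begin

lemma m_sym: "u \<in> T p \<Longrightarrow> v \<in> T p \<Longrightarrow> m p u v = m p v u"
  and m_add_left: "u \<in> T p \<Longrightarrow> v \<in> T p \<Longrightarrow> w \<in> T p \<Longrightarrow> m p (tadd u v) w = m p u w + m p v w"
  and m_scale_left: "u \<in> T p \<Longrightarrow> w \<in> T p \<Longrightarrow> m p (tscale a u) w = a * m p u w"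
  and m_pos: "u \<in> T p \<Longrightarrow> u \<noteq> (\<lambda>f. 0) \<Longrightarrow> m p u u > 0"
  using inner[OF T_S] unfolding inner_product_on_def by blast+

lemma m_add_right: "u \<in> T p \<Longrightarrow> v \<in> T p \<Longrightarrow> w \<in> T p \<Longrightarrow> m p w (tadd u v) = m p w u + m p w v"
  using m_sym m_add_left T_tadd by metis

lemma m_scale_right: "u \<in> T p \<Longrightarrow> w \<in> T p \<Longrightarrow> m p w (tscale a u) = a * m p w u"
  using m_sym m_scale_left T_tscale by metis

lemma m_sum_left:
  assumes "finite J" "\<And>j. j \<in> J \<Longrightarrow> u j \<in> T p" "w \<in> T p"
  shows "m p (\<lambda>f. \<Sum>j\<in>J. c j * u j f) w = (\<Sum>j\<in>J. c j * m p (u j) w)"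
  using assms(1,2)
proof (induction J)
  case empty
  have "m p (tscale 0 w) w = 0" using m_scale_left assms(3) by simp
  then show ?case by (simp add: tscale_def)
next
  case (insert i J)
  have 1: "(\<lambda>f. \<Sum>j\<in>J. c j * u j f) \<in> T p"
    by (rule T_combination) (use insert T_S[OF assms(3)] in auto)
  have 2: "u i \<in> T p" using insert by blast
  have "(\<lambda>f. \<Sum>j\<in>insert i J. c j * u j f) = tadd (tscale (c i) (u i)) (\<lambda>f. \<Sum>j\<in>J. c j * u j f)"
    using insert by (simp add: tadd_def tscale_def)
  then show ?case
    using insert m_add_left[OF T_tscale[OF 2] 1 assms(3)] m_scale_left[OF 2 assms(3)] by simp
qed

lemma m_nondegenerate:
  assumes "u \<in> T p" "v \<in> T p" "\<And>w. w \<in> T p \<Longrightarrow> m p u w = m p v w" shows "u = v"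
proof (rule ccontr)
  assume "u \<noteq> v"
  let ?d = "tdiff u v"
  have d: "?d \<in> T p" by (intro T_tadd T_tscale assms)
  have "?d \<noteq> (\<lambda>f. 0)" using \<open>u \<noteq> v\<close> by (auto simp: tadd_def tscale_def fun_eq_iff)
  then have "m p ?d ?d > 0" by (rule m_pos[OF d])
  moreover have "m p ?d ?d = m p u ?d - m p v ?d"
    using m_add_left[OF assms(1) T_tscale[OF assms(2)] d] m_scale_left[OF assms(2) d] by simp
  ultimately show False using assms(3)[OF d] by simp
qed

end

text \<open>Smoothness is split off from \<open>fibre_metric\<close> because on source fibres it is
  derived with the pointwise algebra of that locale already in hand.\<close>

locale riemannian = fibre_metric M S m
  for M :: "('p, 'e::real_normed_vector) atlas" and S m +
  assumes metric_smooth: "\<And>W Y Z. vector_field M S W Y \<Longrightarrow> vector_field M S W Z \<Longrightarrow>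
      smooth_funs_on M S W (\<lambda>q. m q (Y q) (Z q))"
begin

text \<open>Gram-Schmidt without normalisation, so that no square root has to be shown smooth. The
  invariant \<open>F j q (x k) = 0\<close> outside \<open>J\<close> ensures that the new vector
  takes the value 1 on \<open>x i\<close>; it is thus nonzero and has positive norm.\<close>

lemma orthogonal_frame:
  assumes W: "opn W" and fr: "local_frame M S W I E x" and J: "finite J" "J \<subseteq> I"
  shows "\<exists>F. (\<forall>j\<in>J. VF W (F j)) \<and> (\<forall>q\<in>W. \<forall>j\<in>J. m q (F j q) (F j q) > 0 \<and>
      (\<forall>k\<in>J. j \<noteq> k \<longrightarrow> m q (F j q) (F k q) = 0) \<and> (\<forall>k\<in>I - J. F j q (x k) = 0) \<and>
      (\<exists>a. \<forall>f. E j q f = (\<Sum>k\<in>J. a k * F k q f)))"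
  using J
proof (induction J)
  case (insert i J)
  obtain F where F: "\<And>j. j \<in> J \<Longrightarrow> VF W (F j)"
    and Fq: "\<And>q j. q \<in> W \<Longrightarrow> j \<in> J \<Longrightarrow> m q (F j q) (F j q) > 0"
    "\<And>q j k. q \<in> W \<Longrightarrow> j \<in> J \<Longrightarrow> k \<in> J \<Longrightarrow> j \<noteq> k \<Longrightarrow> m q (F j q) (F k q) = 0"
    "\<And>q j k. q \<in> W \<Longrightarrow> j \<in> J \<Longrightarrow> k \<in> I - J \<Longrightarrow> F j q (x k) = 0"
    "\<And>q j. q \<in> W \<Longrightarrow> j \<in> J \<Longrightarrow> \<exists>a. \<forall>f. E j q f = (\<Sum>k\<in>J. a k * F k q f)"
  proof -
    have "J \<subseteq> I" using insert.prems by blast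
    from insert.IH[OF this] obtain F where F: "\<forall>j\<in>J. VF W (F j)" and
      Fq: "\<forall>q\<in>W. \<forall>j\<in>J. m q (F j q) (F j q) > 0 \<and>
      (\<forall>k\<in>J. j \<noteq> k \<longrightarrow> m q (F j q) (F k q) = 0) \<and> (\<forall>k\<in>I - J. F j q (x k) = 0) \<and>
      (\<exists>a. \<forall>f. E j q f = (\<Sum>k\<in>J. a k * F k q f))" by (elim exE conjE)
    show thesis by (rule that[of F]) (use F Fq in blast)+
  qed
  have i: "i \<in> I" "i \<notin> J" "finite J" "J \<subseteq> I" using insert by auto
  have Ei: "VF W (E i)" using fr i unfolding local_frame_def by blast
  define c where "c k q = m q (E i q) (F k q) * inverse (m q (F k q) (F k q))" for k q
  have c: "SF W (\<lambda>q. - c k q)" if "k \<in> J" for k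
  proof -
    have "C q (\<lambda>q. - (m q (E i q) (F k q) * inverse (m q (F k q) (F k q))))" if q: "q \<in> W" for q
      using metric_smooth[OF Ei F[OF \<open>k \<in> J\<close>]] metric_smooth[OF F F, OF \<open>k \<in> J\<close> \<open>k \<in> J\<close>] q
        Fq(1)[OF q \<open>k \<in> J\<close>] VF_S[OF Ei q]
      by (intro smooth_fun_uminus[OF atlas] C_times C_inverse) (auto simp: smooth_funs_on_def)
    then show ?thesis by (simp add: smooth_funs_on_def c_def)
  qed
  define G where "G q = tadd (E i q) (\<lambda>f. \<Sum>k\<in>J. - c k q * F k q f)" for q
  have G: "VF W G"
    unfolding G_def by (intro VF_tadd Ei VF_combination i W F c)
  have G_F: "m q (G q) (F l q) = 0" if q: "q \<in> W" and l: "l \<in> J" for q l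
  proof -
    have FT: "F k q \<in> T q" if "k \<in> J" for k by (rule VF_T[OF F[OF that] q])
    have s: "(\<lambda>f. \<Sum>k\<in>J. - c k q * F k q f) \<in> T q"
      by (rule T_combination) (use i FT VF_S[OF Ei q] in auto)
    have "m q (\<lambda>f. \<Sum>k\<in>J. - c k q * F k q f) (F l q) = (\<Sum>k\<in>J. - c k q * m q (F k q) (F l q))"
      by (rule m_sum_left) (use i FT l in auto)
    also have "\<dots> = (\<Sum>k\<in>J. if k = l then - m q (E i q) (F l q) else 0)"
      by (rule sum.cong) (use Fq(1,2)[OF q] l in \<open>fastforce simp: c_def field_simps\<close>)+
    also have "\<dots> = - m q (E i q) (F l q)" using i l by simp
    finally show ?thesis
      unfolding G_def using m_add_left[OF VF_T[OF Ei q] s FT[OF l]] by simp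
  qed
  have G_x: "G q (x k) = (if k = i then 1 else 0)" if q: "q \<in> W" and k: "k \<in> I - J" for q k
  proof -
    have "E i q (x k) = (if i = k then 1 else 0)" using fr q i k unfolding local_frame_def by blast
    then show ?thesis using Fq(3)[OF q _ k] by (simp add: G_def tadd_def)
  qed
  have G_pos: "m q (G q) (G q) > 0" if q: "q \<in> W" for q
    by (rule m_pos[OF VF_T[OF G q]]) (use G_x[OF q, of i] i in auto)
  let ?F = "F(i := G)"
  have FJ: "?F j = F j" if "j \<in> J" for j using that i by auto
  show ?case
  proof (intro exI[of _ ?F] conjI ballI impI)
    show "VF W (?F j)" if "j \<in> insert i J" for j using that G F i by auto
    fix q j assume q: "q \<in> W" and j: "j \<in> insert i J"
    show "m q (?F j q) (?F j q) > 0" using j G_pos[OF q] Fq(1)[OF q] i by auto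
    show "m q (?F j q) (?F k q) = 0" if "k \<in> insert i J" "j \<noteq> k" for k
    proof (cases "j = i")
      case True
      then show ?thesis using that G_F[OF q] by auto
    next
      case jn: False
      then have jJ: "j \<in> J" using j by auto
      show ?thesis
      proof (cases "k = i")
        case True
        then show ?thesis
          using jn G_F[OF q jJ] m_sym[OF VF_T[OF G q] VF_T[OF F[OF jJ] q]] by simp
      next
        case False
        then show ?thesis using jn jJ that Fq(2)[OF q jJ] by auto
      qed
    qed
    show "?F j q (x k) = 0" if "k \<in> I - insert i J" for k
      using j that G_x[OF q, of k] Fq(3)[OF q, of j k] by auto
    show "\<exists>a. \<forall>f. E j q f = (\<Sum>k\<in>insert i J. a k * ?F k q f)"
    proof (cases "j = i")
      case True
      have "E i q f = (\<Sum>k\<in>insert i J. (if k = i then 1 else c k q) * ?F k q f)" for f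
      proof -
        have "(\<Sum>k\<in>J. (if k = i then 1 else c k q) * ?F k q f) = (\<Sum>k\<in>J. c k q * F k q f)"
          by (rule sum.cong) (use i in auto)
        then show ?thesis using i by (simp add: G_def tadd_def sum_negf)
      qed
      then show ?thesis using True by (intro exI[of _ "\<lambda>k. if k = i then 1 else c k q"]) auto
    next
      case False
      then obtain a where a: "\<And>f. E j q f = (\<Sum>k\<in>J. a k * F k q f)" using j Fq(4)[OF q] by blast
      have "E j q f = (\<Sum>k\<in>insert i J. (if k = i then 0 else a k) * ?F k q f)" for f
      proof -
        have "(\<Sum>k\<in>J. (if k = i then 0 else a k) * ?F k q f) = (\<Sum>k\<in>J. a k * F k q f)"
          by (rule sum.cong) (use i in auto)
        then show ?thesis using i a by simp
      qed
      then show ?thesis by (intro exI[of _ "\<lambda>k. if k = i then 0 else a k"]) auto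
    qed
  qed
qed simp

text \<open>Rescaling by \<open>1 / m q (F i q) (F i q)\<close> makes the frame biorthogonal. A
  vector is then rebuilt from its products with the \<open>F i\<close>, which are exactly what the
  Koszul formula supplies.\<close>

lemma dual_frame:
  assumes "p \<in> S"
  obtains W and I :: "'e set" and F \<Phi> where "p \<in> W" "opn W" "finite I"
    "\<And>i. i \<in> I \<Longrightarrow> VF W (F i)" "\<And>i. i \<in> I \<Longrightarrow> VF W (\<Phi> i)"
    "\<And>q i j. q \<in> W \<Longrightarrow> i \<in> I \<Longrightarrow> j \<in> I \<Longrightarrow> m q (\<Phi> i q) (F j q) = (if i = j then 1 else 0)"
    "\<And>q v f. q \<in> W \<Longrightarrow> v \<in> T q \<Longrightarrow> v f = (\<Sum>i\<in>I. m q v (F i q) * \<Phi> i q f)"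
proof -
  obtain W and I :: "'e set" and E x where W: "p \<in> W" "opn W" and fr: "local_frame M S W I E x"
    by (rule frame_obtain[OF assms])
  have I: "finite I" using fr unfolding local_frame_def by blast
  obtain F where F: "\<And>j. j \<in> I \<Longrightarrow> VF W (F j)"
    and Fq: "\<And>q j. q \<in> W \<Longrightarrow> j \<in> I \<Longrightarrow> m q (F j q) (F j q) > 0"
    "\<And>q j k. q \<in> W \<Longrightarrow> j \<in> I \<Longrightarrow> k \<in> I \<Longrightarrow> j \<noteq> k \<Longrightarrow> m q (F j q) (F k q) = 0"
    "\<And>q j. q \<in> W \<Longrightarrow> j \<in> I \<Longrightarrow> \<exists>a. \<forall>f. E j q f = (\<Sum>k\<in>I. a k * F k q f)"
  proof -
    from orthogonal_frame[OF W(2) fr I order_refl] obtain F where F: "\<forall>j\<in>I. VF W (F j)" and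
      Fq: "\<forall>q\<in>W. \<forall>j\<in>I. m q (F j q) (F j q) > 0 \<and>
      (\<forall>k\<in>I. j \<noteq> k \<longrightarrow> m q (F j q) (F k q) = 0) \<and> (\<forall>k\<in>I - I. F j q (x k) = 0) \<and>
      (\<exists>a. \<forall>f. E j q f = (\<Sum>k\<in>I. a k * F k q f))" by (elim exE conjE)
    show thesis by (rule that[of F]) (use F Fq in blast)+
  qed
  define \<Phi> where "\<Phi> i q = tscale (inverse (m q (F i q) (F i q))) (F i q)" for i q
  show thesis
  proof (rule that[OF W I F])
    fix i assume i: "i \<in> I"
    have "C q (\<lambda>q. inverse (m q (F i q) (F i q)))" if q: "q \<in> W" for q
      using metric_smooth[OF F F, OF i i] q Fq(1)[OF q i] VF_S[OF F[OF i] q]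
      by (intro C_inverse) (auto simp: smooth_funs_on_def)
    then show "VF W (\<Phi> i)" unfolding \<Phi>_def by (intro VF_tscale F i) (simp add: smooth_funs_on_def)
  next
    fix q i j assume q: "q \<in> W" and i: "i \<in> I" and j: "j \<in> I"
    show "m q (\<Phi> i q) (F j q) = (if i = j then 1 else 0)"
      unfolding \<Phi>_def m_scale_left[OF VF_T[OF F[OF i] q] VF_T[OF F[OF j] q]]
      using Fq(1)[OF q i] Fq(2)[OF q i j] by auto
  next
    fix q v f assume q: "q \<in> W" and v: "v \<in> T q"
    have FT: "F i q \<in> T q" if "i \<in> I" for i by (rule VF_T[OF F[OF that] q])
    obtain a where a: "\<And>j f. j \<in> I \<Longrightarrow> E j q f = (\<Sum>k\<in>I. a j k * F k q f)" using Fq(3)[OF q] by metis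
    define b where "b k = (\<Sum>j\<in>I. v (x j) * a j k)" for k
    have vb: "v f = (\<Sum>k\<in>I. b k * F k q f)" for f
    proof -
      have "v f = (\<Sum>j\<in>I. v (x j) * E j q f)" by (rule frame_expansion[OF fr q v])
      also have "\<dots> = (\<Sum>j\<in>I. \<Sum>k\<in>I. v (x j) * (a j k * F k q f))"
        by (rule sum.cong) (simp_all only: a sum_distrib_left)
      also have "\<dots> = (\<Sum>k\<in>I. \<Sum>j\<in>I. v (x j) * (a j k * F k q f))" by (rule sum.swap)
      finally show ?thesis by (simp add: b_def sum_distrib_right mult.assoc)
    qed
    have mv: "m q v (F j q) = b j * m q (F j q) (F j q)" if j: "j \<in> I" for j
    proof -
      have "v = (\<lambda>f. \<Sum>k\<in>I. b k * F k q f)" by (rule ext) (rule vb)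
      from arg_cong[OF this, of "\<lambda>u. m q u (F j q)"]
      have "m q v (F j q) = (\<Sum>k\<in>I. b k * m q (F k q) (F j q))"
        by (rule trans) (rule m_sum_left[OF I FT FT[OF j]])
      also have "\<dots> = (\<Sum>k\<in>I. if k = j then b j * m q (F j q) (F j q) else 0)"
        by (rule sum.cong) (use Fq(2)[OF q _ j] in auto)
      finally show ?thesis using I j by simp
    qed
    show "v f = (\<Sum>i\<in>I. m q v (F i q) * \<Phi> i q f)"
      unfolding vb[of f]
    proof (rule sum.cong[OF refl])
      fix i assume i: "i \<in> I"
      show "b i * F i q f = m q v (F i q) * \<Phi> i q f"
        using Fq(1)[OF q i] by (simp add: mv[OF i] \<Phi>_def tscale_def)
    qed
  qed
qed

end

section \<open>Existence of the Levi-Civita connection\<close>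

context riemannian
begin

text \<open>Exchanges the roles of \<open>F\<close> and \<open>\<Phi>\<close>: a test field has to
  be expanded in the fields on which a functional is sampled. Pairing with an arbitrary
  \<open>w\<close> reduces this to the given expansion of \<open>w\<close>.\<close>

lemma dual_frame_swap:
  assumes I: "finite I" and F: "\<And>i. i \<in> I \<Longrightarrow> F i \<in> T q" "\<And>i. i \<in> I \<Longrightarrow> \<Phi> i \<in> T q"
    and dual: "\<And>v f. v \<in> T q \<Longrightarrow> v f = (\<Sum>i\<in>I. m q v (F i) * \<Phi> i f)" and v: "v \<in> T q"
  shows "v = (\<lambda>f. \<Sum>i\<in>I. m q v (\<Phi> i) * F i f)"
proof (rule m_nondegenerate[OF v])
  show "(\<lambda>f. \<Sum>i\<in>I. m q v (\<Phi> i) * F i f) \<in> T q"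
    by (rule T_combination) (use I F T_S[OF v] in auto)
  fix w assume w: "w \<in> T q"
  have "w = (\<lambda>f. \<Sum>i\<in>I. m q w (F i) * \<Phi> i f)" by (rule ext) (rule dual[OF w])
  from arg_cong[OF this, of "\<lambda>u. m q u v"]
  have "m q w v = (\<Sum>i\<in>I. m q w (F i) * m q (\<Phi> i) v)"
    by (rule trans) (rule m_sum_left[OF I F(2) v])
  also have "\<dots> = (\<Sum>i\<in>I. m q v (\<Phi> i) * m q (F i) w)"
    by (rule sum.cong) (use m_sym F w v in \<open>auto simp: mult.commute\<close>)
  also have "\<dots> = m q (\<lambda>f. \<Sum>i\<in>I. m q v (\<Phi> i) * F i f) w"
    by (rule m_sum_left[OF I F(1) w, symmetric])
  finally show "m q v w = m q (\<lambda>f. \<Sum>i\<in>I. m q v (\<Phi> i) * F i f) w" using m_sym[OF v w] by simp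
qed

text \<open>The representing vector is the sum of \<open>\<Phi> (F i)\<close> times the dual frame.
  It yields existence both of the Levi-Civita connection and of the metric adjoint.\<close>

lemma tensor_riesz:
  assumes add: "\<And>W X Y. p \<in> W \<Longrightarrow> W \<subseteq> W0 \<Longrightarrow> VF W X \<Longrightarrow> VF W Y \<Longrightarrow> \<Phi> (\<lambda>q. tadd (X q) (Y q)) = \<Phi> X + (\<Phi> Y :: real)"
    and hom: "\<And>W X f. p \<in> W \<Longrightarrow> W \<subseteq> W0 \<Longrightarrow> VF W X \<Longrightarrow> SF W f \<Longrightarrow> \<Phi> (\<lambda>q. tscale (f q) (X q)) = f p * \<Phi> X"
    and loc: "\<And>W X Y. p \<in> W \<Longrightarrow> W \<subseteq> W0 \<Longrightarrow> VF W X \<Longrightarrow> (\<And>q. q \<in> W \<Longrightarrow> X q = Y q) \<Longrightarrow> \<Phi> X = \<Phi> Y"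
    and W0: "opn W0" "p \<in> W0"
  shows "\<exists>w. w \<in> T p \<and> (\<forall>V Z. p \<in> V \<longrightarrow> V \<subseteq> W0 \<longrightarrow> VF V Z \<longrightarrow> \<Phi> Z = m p w (Z p))"
proof -
  have pS: "p \<in> S" using W0 opn_subset by blast
  obtain V and I :: "'e set" and F \<Psi> where V: "p \<in> V" "opn V" and I: "finite I"
    and F: "\<And>i. i \<in> I \<Longrightarrow> VF V (F i)" and \<Psi>: "\<And>i. i \<in> I \<Longrightarrow> VF V (\<Psi> i)"
    and dual: "\<And>q v f. q \<in> V \<Longrightarrow> v \<in> T q \<Longrightarrow> v f = (\<Sum>i\<in>I. m q v (F i q) * \<Psi> i q f)"
    by (rule dual_frame[OF pS], rule that)
  define w where "w = (\<lambda>f. \<Sum>i\<in>I. \<Phi> (F i) * \<Psi> i p f)"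
  have w: "w \<in> T p"
    unfolding w_def by (rule T_combination[of I "\<lambda>i. \<Psi> i p"]) (use I VF_T[OF \<Psi> V(1)] pS in auto)
  have "\<Phi> Z = m p w (Z p)" if a: "p \<in> U" "U \<subseteq> W0" "VF U Z" for U Z
  proof -
    let ?V = "U \<inter> V"
    have o: "opn ?V" by (rule opn_Int[OF VF_open[OF a(3)] V(2)])
    have pV: "p \<in> ?V" "?V \<subseteq> W0" using a V by auto
    note Z' = VF_restrict[OF a(3) o Int_lower1]
    have F': "VF ?V (F i)" "VF ?V (\<Psi> i)" if "i \<in> I" for i
      using VF_restrict[OF _ o Int_lower2] F \<Psi> that by blast+
    have "\<Phi> Z = \<Phi> (\<lambda>q f. \<Sum>i\<in>I. m q (Z q) (\<Psi> i q) * F i q f)"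
    proof (rule loc[OF pV Z'])
      fix q assume q: "q \<in> ?V"
      show "Z q = (\<lambda>f. \<Sum>i\<in>I. m q (Z q) (\<Psi> i q) * F i q f)"
        by (rule dual_frame_swap[OF I VF_T[OF F'(1) q] VF_T[OF F'(2) q] dual VF_T[OF Z' q]])
          (use q in auto)
    qed
    also have "\<dots> = (\<Sum>i\<in>I. m p (Z p) (\<Psi> i p) * \<Phi> (F i))"
      by (rule tensor_sum[where \<Phi>=\<Phi> and p=p and ?W0.0=W0 and a="\<lambda>i q. m q (Z q) (\<Psi> i q)" and E=F,
            OF add hom pV Z' I F'(1) metric_smooth[OF Z' F'(2)]])
    also have "\<dots> = (\<Sum>i\<in>I. \<Phi> (F i) * m p (\<Psi> i p) (Z p))"
      by (rule sum.cong) (use m_sym VF_T[OF Z' pV(1)] VF_T[OF F'(2) pV(1)] in \<open>auto simp: mult.commute\<close>)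
    also have "\<dots> = m p w (Z p)"
      unfolding w_def by (rule m_sum_left[OF I VF_T[OF \<Psi> V(1)] VF_T[OF a(3,1)], symmetric])
    finally show ?thesis .
  qed
  with w show ?thesis by blast
qed

abbreviation ip :: "('p \<Rightarrow> 'p tvec) \<Rightarrow> ('p \<Rightarrow> 'p tvec) \<Rightarrow> 'p \<Rightarrow> real" where
  "ip Y Z \<equiv> (\<lambda>q. m q (Y q) (Z q))"

section \<open>The Koszul expression and its behaviour in each slot\<close>

lemma ip_C: "VF W Y \<Longrightarrow> VF W Z \<Longrightarrow> p \<in> W \<Longrightarrow> C p (ip Y Z)"
  using metric_smooth unfolding smooth_funs_on_def by blast

lemma d_ip_swap:
  assumes "VF W X" "VF W Y" "VF W Z" "p \<in> W" shows "X p (ip Y Z) = X p (ip Z Y)"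
  by (rule T_cong[OF VF_T[OF assms(1,4)] VF_open[OF assms(1)] assms(4)])
    (rule m_sym[OF VF_T[OF assms(2)] VF_T[OF assms(3)]])

lemma d_ip_add:
  assumes "VF W X" "VF W Y" "VF W Z" "VF W Z'" "p \<in> W"
  shows "X p (ip Y (\<lambda>q. tadd (Z q) (Z' q))) = X p (ip Y Z) + X p (ip Y Z')"
proof -
  have "X p (ip Y (\<lambda>q. tadd (Z q) (Z' q))) = X p (\<lambda>q. ip Y Z q + ip Y Z' q)"
    by (rule T_cong[OF VF_T[OF assms(1,5)] VF_open[OF assms(1)] assms(5)])
      (rule m_add_right[OF VF_T[OF assms(3)] VF_T[OF assms(4)] VF_T[OF assms(2)]])
  also have "\<dots> = X p (ip Y Z) + X p (ip Y Z')"
    by (rule T_plus[OF VF_T[OF assms(1,5)] ip_C[OF assms(2,3,5)] ip_C[OF assms(2,4,5)]])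
  finally show ?thesis .
qed

lemma d_ip_scale:
  assumes "VF W X" "VF W Y" "VF W Z" "SF W h" "p \<in> W"
  shows "X p (ip Y (\<lambda>q. tscale (h q) (Z q))) = h p * X p (ip Y Z) + X p h * m p (Y p) (Z p)"
proof -
  have "X p (ip Y (\<lambda>q. tscale (h q) (Z q))) = X p (\<lambda>q. h q * ip Y Z q)"
    by (rule T_cong[OF VF_T[OF assms(1,5)] VF_open[OF assms(1)] assms(5)])
      (rule m_scale_right[OF VF_T[OF assms(3)] VF_T[OF assms(2)]])
  also have "\<dots> = h p * X p (ip Y Z) + X p h * m p (Y p) (Z p)"
    by (rule T_times[OF VF_T[OF assms(1,5)] _ ip_C[OF assms(2,3,5)]])
      (use assms(4,5) in \<open>simp add: smooth_funs_on_def\<close>)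
  finally show ?thesis .
qed

lemma m_br_swap:
  assumes "VF W X" "VF W Y" "p \<in> W" "w \<in> T p" shows "m p (br X Y p) w = - m p (br Y X p) w"
  unfolding br_swap[of X Y] using m_scale_left[OF br_T[OF assms(2,1,3)] assms(4), of "-1"] by simp

text \<open>Normalised to be twice the inner product of \<nabla>_X Y with \<open>Z\<close>.\<close>

definition koszul :: "('p \<Rightarrow> 'p tvec) \<Rightarrow> ('p \<Rightarrow> 'p tvec) \<Rightarrow> ('p \<Rightarrow> 'p tvec) \<Rightarrow> 'p \<Rightarrow> real" where
  "koszul X Y Z p = X p (ip Y Z) + Y p (ip Z X) - Z p (ip X Y)
     + m p (br X Y p) (Z p) - m p (br Y Z p) (X p) + m p (br Z X p) (Y p)"

lemma koszul_cong:
  assumes V: "VF W X" "VF W Y" "VF W Z" and p: "p \<in> W"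
    and eq: "\<And>q. q \<in> W \<Longrightarrow> X q = X' q" "\<And>q. q \<in> W \<Longrightarrow> Y q = Y' q" "\<And>q. q \<in> W \<Longrightarrow> Z q = Z' q"
  shows "koszul X Y Z p = koszul X' Y' Z' p"
proof -
  have 1: "A p (ip B D) = A p (ip B' D')" if "VF W A" "\<And>q. q \<in> W \<Longrightarrow> B q = B' q" "\<And>q. q \<in> W \<Longrightarrow> D q = D' q"
    for A B D B' D'
    by (rule T_cong[OF VF_T[OF that(1) p] VF_open[OF that(1)] p]) (simp add: that)
  show ?thesis
    unfolding koszul_def
    using 1[OF V(1) eq(2,3)] 1[OF V(2) eq(3,1)] 1[OF V(3) eq(1,2)]
      br_cong[OF V(1,2) p eq(1,2)] br_cong[OF V(2,3) p eq(2,3)] br_cong[OF V(3,1) p eq(3,1)]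
    by (simp add: eq[OF p])
qed

text \<open>Metric compatibility in disguise. It also carries the rules for the third slot over to
  the second.\<close>

lemma koszul_swap23:
  assumes X: "VF W X" and Y: "VF W Y" and Z: "VF W Z" and p: "p \<in> W"
  shows "koszul X Y Z p = 2 * X p (ip Y Z) - koszul X Z Y p"
  using d_ip_swap[OF X Y Z p] d_ip_swap[OF Y X Z p] d_ip_swap[OF Z X Y p]
    m_br_swap[OF X Z p VF_T[OF Y p]] m_br_swap[OF Z Y p VF_T[OF X p]] m_br_swap[OF Y X p VF_T[OF Z p]]
  unfolding koszul_def by linarith

text \<open>Vanishing torsion in disguise. It also carries the rules for the second slot over to the
  first.\<close>

lemma koszul_swap12:
  assumes X: "VF W X" and Y: "VF W Y" and Z: "VF W Z" and p: "p \<in> W"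
  shows "koszul X Y Z p = koszul Y X Z p + 2 * m p (br X Y p) (Z p)"
  using d_ip_swap[OF X Y Z p] d_ip_swap[OF Y X Z p] d_ip_swap[OF Z X Y p]
    m_br_swap[OF X Z p VF_T[OF Y p]] m_br_swap[OF Z Y p VF_T[OF X p]] m_br_swap[OF Y X p VF_T[OF Z p]]
  unfolding koszul_def by linarith

lemma koszul_add3:
  assumes X: "VF W X" and Y: "VF W Y" and Z: "VF W Z" and Z': "VF W Z'" and p: "p \<in> W"
  shows "koszul X Y (\<lambda>q. tadd (Z q) (Z' q)) p = koszul X Y Z p + koszul X Y Z' p"
proof -
  let ?S = "\<lambda>q. tadd (Z q) (Z' q)"
  have S: "VF W ?S" by (rule VF_tadd[OF Z Z'])
  note XT = VF_T[OF X p] and YT = VF_T[OF Y p] and ZT = VF_T[OF Z p] and ZT' = VF_T[OF Z' p]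
  have b: "m p (br ?S A p) w = m p (br Z A p) w + m p (br Z' A p) w" if A: "VF W A" and w: "w \<in> T p" for A w
    unfolding br_tadd[OF Z Z' A p] by (rule m_add_left[OF br_T[OF Z A p] br_T[OF Z' A p] w])
  have "Y p (ip ?S X) = Y p (ip Z X) + Y p (ip Z' X)"
    using d_ip_swap[OF Y S X p] d_ip_swap[OF Y Z X p] d_ip_swap[OF Y Z' X p] d_ip_add[OF Y X Z Z' p] by simp
  moreover have "?S p f = Z p f + Z' p f" for f by (simp add: tadd_def)
  ultimately show ?thesis
    unfolding koszul_def
    using d_ip_add[OF X Y Z Z' p] b[OF X YT] b[OF Y XT] m_add_right[OF ZT ZT' br_T[OF X Y p]]
      m_br_swap[OF Y S p XT] m_br_swap[OF Y Z p XT] m_br_swap[OF Y Z' p XT]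
    by simp
qed

text \<open>The Leibniz terms \<open>X p h\<close> and \<open>Y p h\<close> from differentiating
  inner products cancel those from the brackets with \<open>h Z\<close>; so the expression is
  tensorial in \<open>Z\<close> and represents a vector.\<close>

lemma koszul_scale3:
  assumes X: "VF W X" and Y: "VF W Y" and Z: "VF W Z" and h: "SF W h" and p: "p \<in> W"
  shows "koszul X Y (\<lambda>q. tscale (h q) (Z q)) p = h p * koszul X Y Z p"
proof -
  let ?S = "\<lambda>q. tscale (h q) (Z q)"
  have S: "VF W ?S" by (rule VF_tscale[OF Z h])
  note XT = VF_T[OF X p] and YT = VF_T[OF Y p] and ZT = VF_T[OF Z p]
  have b: "m p (br ?S A p) w = h p * m p (br Z A p) w - A p h * m p (Z p) w"
    if A: "VF W A" and w: "w \<in> T p" for A w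
  proof -
    have "m p (br ?S A p) w = m p (tscale (h p) (br Z A p)) w + m p (tscale (-1) (tscale (A p h) (Z p))) w"
      unfolding br_tscale[OF Z A h p]
      by (intro m_add_left T_tscale br_T[OF Z A p] ZT w)
    then show ?thesis
      using m_scale_left[OF br_T[OF Z A p] w] m_scale_left[OF T_tscale[OF ZT] w, of "-1"]
        m_scale_left[OF ZT w] by simp
  qed
  have Yd: "Y p (ip ?S X) = h p * Y p (ip Z X) + Y p h * m p (X p) (Z p)"
    using d_ip_swap[OF Y S X p] d_ip_swap[OF Y Z X p] d_ip_scale[OF Y X Z h p] by simp
  have Sp: "?S p (ip X Y) = h p * Z p (ip X Y)" by (simp add: tscale_def)
  have "koszul X Y ?S p = (h p * X p (ip Y Z) + X p h * m p (Y p) (Z p))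
      + (h p * Y p (ip Z X) + Y p h * m p (X p) (Z p)) - h p * Z p (ip X Y)
      + h p * m p (br X Y p) (Z p) - (- (h p * m p (br Z Y p) (X p) - Y p h * m p (Z p) (X p)))
      + (h p * m p (br Z X p) (Y p) - X p h * m p (Z p) (Y p))"
    unfolding koszul_def Yd Sp d_ip_scale[OF X Y Z h p] b[OF X YT] m_br_swap[OF Y S p XT] b[OF Y XT]
      m_scale_right[OF ZT br_T[OF X Y p]] by simp
  moreover have "m p (br Z Y p) (X p) = - m p (br Y Z p) (X p)" by (rule m_br_swap[OF Z Y p XT])
  moreover have "m p (Z p) (X p) = m p (X p) (Z p)" "m p (Z p) (Y p) = m p (Y p) (Z p)"
    using m_sym XT YT ZT by blast+
  ultimately show ?thesis unfolding koszul_def by (simp add: algebra_simps)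
qed

lemma koszul_add2:
  assumes X: "VF W X" and Y: "VF W Y" and Y': "VF W Y'" and Z: "VF W Z" and p: "p \<in> W"
  shows "koszul X (\<lambda>q. tadd (Y q) (Y' q)) Z p = koszul X Y Z p + koszul X Y' Z p"
  using koszul_swap23[OF X VF_tadd[OF Y Y'] Z p] koszul_swap23[OF X Y Z p] koszul_swap23[OF X Y' Z p]
    koszul_add3[OF X Z Y Y' p] d_ip_add[OF X Z Y Y' p] d_ip_swap[OF X VF_tadd[OF Y Y'] Z p]
    d_ip_swap[OF X Y Z p] d_ip_swap[OF X Y' Z p] by simp

lemma koszul_scale2:
  assumes X: "VF W X" and Y: "VF W Y" and Z: "VF W Z" and h: "SF W h" and p: "p \<in> W"
  shows "koszul X (\<lambda>q. tscale (h q) (Y q)) Z p = h p * koszul X Y Z p + 2 * X p h * m p (Y p) (Z p)"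
proof -
  have "koszul X (\<lambda>q. tscale (h q) (Y q)) Z p
      = 2 * (h p * X p (ip Z Y) + X p h * m p (Z p) (Y p)) - h p * koszul X Z Y p"
    using koszul_swap23[OF X VF_tscale[OF Y h] Z p] koszul_scale3[OF X Z Y h p]
      d_ip_scale[OF X Z Y h p] d_ip_swap[OF X VF_tscale[OF Y h] Z p] by simp
  moreover have "koszul X Z Y p = 2 * X p (ip Z Y) - koszul X Y Z p"
    by (rule koszul_swap23[OF X Z Y p])
  moreover have "m p (Y p) (Z p) = m p (Z p) (Y p)" by (rule m_sym[OF VF_T[OF Y p] VF_T[OF Z p]])
  ultimately show ?thesis by (simp add: algebra_simps)
qed

lemma koszul_add1:
  assumes X: "VF W X" and X': "VF W X'" and Y: "VF W Y" and Z: "VF W Z" and p: "p \<in> W"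
  shows "koszul (\<lambda>q. tadd (X q) (X' q)) Y Z p = koszul X Y Z p + koszul X' Y Z p"
  using koszul_swap12[OF VF_tadd[OF X X'] Y Z p] koszul_swap12[OF X Y Z p] koszul_swap12[OF X' Y Z p]
    koszul_add2[OF Y X X' Z p] br_tadd[OF X X' Y p]
    m_add_left[OF br_T[OF X Y p] br_T[OF X' Y p] VF_T[OF Z p]] by simp

lemma koszul_scale1:
  assumes X: "VF W X" and Y: "VF W Y" and Z: "VF W Z" and h: "SF W h" and p: "p \<in> W"
  shows "koszul (\<lambda>q. tscale (h q) (X q)) Y Z p = h p * koszul X Y Z p"
proof -
  note ZT = VF_T[OF Z p] and XT = VF_T[OF X p]
  have "m p (br (\<lambda>q. tscale (h q) (X q)) Y p) (Z p)
      = m p (tscale (h p) (br X Y p)) (Z p) + m p (tscale (-1) (tscale (Y p h) (X p))) (Z p)"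
    unfolding br_tscale[OF X Y h p] by (intro m_add_left T_tscale br_T[OF X Y p] ZT XT)
  then have "m p (br (\<lambda>q. tscale (h q) (X q)) Y p) (Z p) = h p * m p (br X Y p) (Z p) - Y p h * m p (X p) (Z p)"
    using m_scale_left[OF br_T[OF X Y p] ZT] m_scale_left[OF T_tscale[OF XT] ZT, of "-1"]
      m_scale_left[OF XT ZT] by simp
  then show ?thesis
    using koszul_swap12[OF VF_tscale[OF X h] Y Z p] koszul_swap12[OF X Y Z p] koszul_scale2[OF Y X Z h p]
    by (simp add: algebra_simps)
qed

lemma koszul_C:
  assumes X: "VF W X" and Y: "VF W Y" and Z: "VF W Z" shows "SF W (koszul X Y Z)"
  unfolding smooth_funs_on_def koszul_def
proof (intro ballI)
  fix p assume p: "p \<in> W"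
  show "C p (\<lambda>p. X p (ip Y Z) + Y p (ip Z X) - Z p (ip X Y)
     + m p (br X Y p) (Z p) - m p (br Y Z p) (X p) + m p (br Z X p) (Y p))"
    by (intro C_plus C_minus VF_C[OF X p] VF_C[OF Y p] VF_C[OF Z p]
        ip_C[OF Y Z p] ip_C[OF Z X p] ip_C[OF X Y p] ip_C[OF VF_br[OF X Y] Z p]
        ip_C[OF VF_br[OF Y Z] X p] ip_C[OF VF_br[OF Z X] Y p])
qed

text \<open>Testing over every open set on which the three fields are smooth makes the vector
  independent of the neighbourhood from which it is viewed, as the sheaf clause of
  \<open>affine_connection\<close> demands.\<close>

definition lc :: "('p \<Rightarrow> 'p tvec) \<Rightarrow> ('p \<Rightarrow> 'p tvec) \<Rightarrow> 'p \<Rightarrow> 'p tvec" where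
  "lc X Y p = (THE w. w \<in> T p \<and> (\<forall>W Z. p \<in> W \<longrightarrow> VF W X \<longrightarrow> VF W Y \<longrightarrow> VF W Z \<longrightarrow>
      2 * m p w (Z p) = koszul X Y Z p))"

lemma lc_spec:
  assumes X: "VF W X" and Y: "VF W Y" and p: "p \<in> W"
  shows "lc X Y p \<in> T p \<and> (\<forall>W Z. p \<in> W \<longrightarrow> VF W X \<longrightarrow> VF W Y \<longrightarrow> VF W Z \<longrightarrow>
      2 * m p (lc X Y p) (Z p) = koszul X Y Z p)"
proof -
  let ?P = "\<lambda>w. w \<in> T p \<and> (\<forall>W Z. p \<in> W \<longrightarrow> VF W X \<longrightarrow> VF W Y \<longrightarrow> VF W Z \<longrightarrow>
      2 * m p w (Z p) = koszul X Y Z p)"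
  have "\<exists>w. w \<in> T p \<and> (\<forall>V Z. p \<in> V \<longrightarrow> V \<subseteq> W \<longrightarrow> VF V Z \<longrightarrow> koszul X Y Z p = m p w (Z p))"
  proof (rule tensor_riesz[where \<Phi>="\<lambda>Z. koszul X Y Z p", OF _ _ _ VF_open[OF X] p])
    fix V A B assume a: "p \<in> V" "V \<subseteq> W" "VF V A" "VF V B"
    note r = VF_restrict[OF _ VF_open[OF a(3)] a(2)]
    show "koszul X Y (\<lambda>q. tadd (A q) (B q)) p = koszul X Y A p + koszul X Y B p"
      by (rule koszul_add3[OF r[OF X] r[OF Y] a(3,4,1)])
  next
    fix V A h assume a: "p \<in> V" "V \<subseteq> W" "VF V A" "SF V h"
    note r = VF_restrict[OF _ VF_open[OF a(3)] a(2)]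
    show "koszul X Y (\<lambda>q. tscale (h q) (A q)) p = h p * koszul X Y A p"
      by (rule koszul_scale3[OF r[OF X] r[OF Y] a(3,4,1)])
  next
    fix V A B assume a: "p \<in> V" "V \<subseteq> W" "VF V A" and e: "\<And>q. q \<in> V \<Longrightarrow> A q = B q"
    note r = VF_restrict[OF _ VF_open[OF a(3)] a(2)]
    show "koszul X Y A p = koszul X Y B p"
      by (rule koszul_cong[OF r[OF X] r[OF Y] a(3,1) refl refl e])
  qed
  then obtain w where w: "w \<in> T p"
    "\<And>V Z. p \<in> V \<Longrightarrow> V \<subseteq> W \<Longrightarrow> VF V Z \<Longrightarrow> koszul X Y Z p = m p w (Z p)" by blast
  have eq: "2 * m p (tscale (1/2) w) (Z p) = koszul X Y Z p" if a: "p \<in> W'" "VF W' Z" for W' Z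
  proof -
    have "VF (W \<inter> W') Z" by (rule VF_restrict[OF a(2) opn_Int[OF VF_open[OF X] VF_open[OF a(2)]] Int_lower2])
    then have "koszul X Y Z p = m p w (Z p)" using w(2)[of "W \<inter> W'" Z] a p by simp
    then show ?thesis using m_scale_left[OF w(1) VF_T[OF a(2,1)]] by simp
  qed
  have "\<exists>!w. ?P w"
  proof (rule ex1I[of _ "tscale (1/2) w"])
    show "?P (tscale (1/2) w)" using T_tscale[OF w(1)] eq by blast
    fix w' assume w': "?P w'"
    show "w' = tscale (1/2) w"
    proof (rule m_nondegenerate)
      fix u assume u: "u \<in> T p"
      obtain V Z where Z: "p \<in> V" "VF V Z" "Z p = u" by (rule vector_extension[OF u])
      have o: "opn (W \<inter> V)" by (rule opn_Int[OF VF_open[OF X] VF_open[OF Z(2)]])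
      have r: "VF (W \<inter> V) X" "VF (W \<inter> V) Y" "VF (W \<inter> V) Z" "p \<in> W \<inter> V"
        using VF_restrict[OF _ o Int_lower1] VF_restrict[OF _ o Int_lower2] X Y Z p by blast+
      have "2 * m p w' (Z p) = koszul X Y Z p" using w' r by blast
      then show "m p w' u = m p (tscale (1/2) w) u" using eq[OF r(4,3)] Z(3) by simp
    qed (use w w' T_tscale in auto)
  qed
  from theI'[OF this] show ?thesis unfolding lc_def .
qed

lemma lc_T: "VF W X \<Longrightarrow> VF W Y \<Longrightarrow> p \<in> W \<Longrightarrow> lc X Y p \<in> T p"
  using lc_spec by blast

lemma lc_koszul:
  "VF W X \<Longrightarrow> VF W Y \<Longrightarrow> p \<in> W \<Longrightarrow> VF W Z \<Longrightarrow> 2 * m p (lc X Y p) (Z p) = koszul X Y Z p"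
  using lc_spec by blast

text \<open>Small neighbourhoods suffice, because every tangent vector extends to a field near
  \<open>p\<close> and the metric is nondegenerate.\<close>

lemma lc_unique:
  assumes X: "VF W X" and Y: "VF W Y" and p: "p \<in> W" and w: "w \<in> T p"
    and eq: "\<And>V Z. p \<in> V \<Longrightarrow> V \<subseteq> W \<Longrightarrow> VF V Z \<Longrightarrow> 2 * m p w (Z p) = koszul X Y Z p"
  shows "lc X Y p = w"
proof (rule m_nondegenerate[OF lc_T[OF X Y p] w])
  fix u assume u: "u \<in> T p"
  obtain V Z where Z: "p \<in> V" "VF V Z" "Z p = u" by (rule vector_extension[OF u])
  have o: "opn (W \<inter> V)" by (rule opn_Int[OF VF_open[OF X] VF_open[OF Z(2)]])
  have r: "VF (W \<inter> V) X" "VF (W \<inter> V) Y" "VF (W \<inter> V) Z" "p \<in> W \<inter> V"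
    using VF_restrict[OF _ o Int_lower1] VF_restrict[OF _ o Int_lower2] X Y Z p by blast+
  show "m p (lc X Y p) u = m p w u"
    using lc_koszul[OF r(1,2,4,3)] eq[OF r(4) Int_lower1 r(3)] Z(3) by simp
qed

text \<open>Against a dual frame the components are half the Koszul expressions, which are
  smooth.\<close>

lemma VF_lc:
  assumes X: "VF W X" and Y: "VF W Y" shows "VF W (lc X Y)"
  unfolding vector_field_def
proof (intro conjI ballI allI impI)
  show "opn W" by (rule VF_open[OF X])
  fix p assume p: "p \<in> W"
  show "lc X Y p \<in> T p" by (rule lc_T[OF X Y p])
  fix f assume f: "C p f"
  obtain V and I :: "'e set" and F \<Phi> where V: "p \<in> V" "opn V" and I: "finite I"
    and F: "\<And>i. i \<in> I \<Longrightarrow> VF V (F i)" and \<Phi>: "\<And>i. i \<in> I \<Longrightarrow> VF V (\<Phi> i)"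
    and dual: "\<And>q v f. q \<in> V \<Longrightarrow> v \<in> T q \<Longrightarrow> v f = (\<Sum>i\<in>I. m q v (F i q) * \<Phi> i q f)"
    by (rule dual_frame[OF VF_S[OF X p]], rule that)
  let ?V = "W \<inter> V"
  have o: "opn ?V" by (rule opn_Int[OF VF_open[OF X] V(2)])
  have pV: "p \<in> ?V" using p V by simp
  note X' = VF_restrict[OF X o Int_lower1] and Y' = VF_restrict[OF Y o Int_lower1]
  have F': "VF ?V (F i)" "VF ?V (\<Phi> i)" if "i \<in> I" for i
    using VF_restrict[OF _ o Int_lower2] F \<Phi> that by blast+
  have "C p (\<lambda>q. \<Sum>i\<in>I. (1/2 * koszul X Y (F i) q) * \<Phi> i q f)"
    using koszul_C[OF X' Y' F'(1)] pV
    by (intro C_sum C_carrier[OF f] C_times VF_C[OF F'(2) pV f] C_const)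
      (auto simp: smooth_funs_on_def)
  then show "C p (\<lambda>q. lc X Y q f)"
  proof (rule C_cong[OF _ o pV])
    fix q assume q: "q \<in> ?V"
    have "lc X Y q f = (\<Sum>i\<in>I. m q (lc X Y q) (F i q) * \<Phi> i q f)"
      by (rule dual) (use q lc_T[OF X' Y' q] in auto)
    also have "\<dots> = (\<Sum>i\<in>I. (1/2 * koszul X Y (F i) q) * \<Phi> i q f)"
      by (rule sum.cong[OF refl]) (simp add: lc_koszul[OF X' Y' q F'(1), symmetric])
    finally show "(\<Sum>i\<in>I. (1/2 * koszul X Y (F i) q) * \<Phi> i q f) = lc X Y q f" by simp
  qed
qed

lemma lc_affine: "affine_connection M S lc"
  unfolding affine_connection_def
proof (intro allI impI conjI ballI; elim conjE)
  fix W X Y assume X: "VF W X" and Y: "VF W Y"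
  show "VF W (lc X Y)" by (rule VF_lc[OF X Y])
  show "lc X' Y' p = lc X Y p" if e: "\<forall>p\<in>W. X' p = X p \<and> Y' p = Y p" and p: "p \<in> W" for X' Y' p
  proof -
    have X': "VF W X'" and Y': "VF W Y'" using VF_cong[OF X] VF_cong[OF Y] e by metis+
    show ?thesis
    proof (rule lc_unique[OF X' Y' p lc_T[OF X Y p]])
      fix V Z assume Z: "p \<in> V" "V \<subseteq> W" "VF V Z"
      note o = VF_open[OF Z(3)]
      have "koszul X Y Z p = koszul X' Y' Z p"
        by (rule koszul_cong[OF VF_restrict[OF X o Z(2)] VF_restrict[OF Y o Z(2)] Z(3) Z(1)]) (use e Z in auto)
      then show "2 * m p (lc X Y p) (Z p) = koszul X' Y' Z p"
        using lc_koszul[OF VF_restrict[OF X o Z(2)] VF_restrict[OF Y o Z(2)] Z(1,3)] by simp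
    qed
  qed
next
  fix W X Y Z p assume X: "VF W X" and Y: "VF W Y" and Z: "VF W Z" and p: "p \<in> W"
  show "lc (\<lambda>q. tadd (X q) (Z q)) Y p = tadd (lc X Y p) (lc Z Y p)"
  proof (rule lc_unique[OF VF_tadd[OF X Z] Y p T_tadd[OF lc_T[OF X Y p] lc_T[OF Z Y p]]])
    fix V A assume A: "p \<in> V" "V \<subseteq> W" "VF V A"
    note o = VF_open[OF A(3)]
    note X' = VF_restrict[OF X o A(2)] and Y' = VF_restrict[OF Y o A(2)] and Z' = VF_restrict[OF Z o A(2)]
    show "2 * m p (tadd (lc X Y p) (lc Z Y p)) (A p) = koszul (\<lambda>q. tadd (X q) (Z q)) Y A p"
      using koszul_add1[OF X' Z' Y' A(3,1)] lc_koszul[OF X' Y' A(1,3)] lc_koszul[OF Z' Y' A(1,3)]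
        m_add_left[OF lc_T[OF X Y p] lc_T[OF Z Y p] VF_T[OF A(3,1)]] by simp
  qed
  show "lc X (\<lambda>q. tadd (Y q) (Z q)) p = tadd (lc X Y p) (lc X Z p)"
  proof (rule lc_unique[OF X VF_tadd[OF Y Z] p T_tadd[OF lc_T[OF X Y p] lc_T[OF X Z p]]])
    fix V A assume A: "p \<in> V" "V \<subseteq> W" "VF V A"
    note o = VF_open[OF A(3)]
    note X' = VF_restrict[OF X o A(2)] and Y' = VF_restrict[OF Y o A(2)] and Z' = VF_restrict[OF Z o A(2)]
    show "2 * m p (tadd (lc X Y p) (lc X Z p)) (A p) = koszul X (\<lambda>q. tadd (Y q) (Z q)) A p"
      using koszul_add2[OF X' Y' Z' A(3,1)] lc_koszul[OF X' Y' A(1,3)] lc_koszul[OF X' Z' A(1,3)]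
        m_add_left[OF lc_T[OF X Y p] lc_T[OF X Z p] VF_T[OF A(3,1)]] by simp
  qed
next
  fix W X Y h p assume X: "VF W X" and Y: "VF W Y" and h: "SF W h" and p: "p \<in> W"
  show "lc (\<lambda>q. tscale (h q) (X q)) Y p = tscale (h p) (lc X Y p)"
  proof (rule lc_unique[OF VF_tscale[OF X h] Y p T_tscale[OF lc_T[OF X Y p]]])
    fix V A assume A: "p \<in> V" "V \<subseteq> W" "VF V A"
    note o = VF_open[OF A(3)]
    note X' = VF_restrict[OF X o A(2)] and Y' = VF_restrict[OF Y o A(2)]
    show "2 * m p (tscale (h p) (lc X Y p)) (A p) = koszul (\<lambda>q. tscale (h q) (X q)) Y A p"
      using koszul_scale1[OF X' Y' A(3) SF_restrict[OF h A(2)] A(1)] lc_koszul[OF X' Y' A(1,3)]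
        m_scale_left[OF lc_T[OF X Y p] VF_T[OF A(3,1)]] by simp
  qed
  show "lc X (\<lambda>q. tscale (h q) (Y q)) p = tadd (tscale (X p h) (Y p)) (tscale (h p) (lc X Y p))"
  proof (rule lc_unique[OF X VF_tscale[OF Y h] p T_tadd[OF T_tscale[OF VF_T[OF Y p]] T_tscale[OF lc_T[OF X Y p]]]])
    fix V A assume A: "p \<in> V" "V \<subseteq> W" "VF V A"
    note o = VF_open[OF A(3)]
    note X' = VF_restrict[OF X o A(2)] and Y' = VF_restrict[OF Y o A(2)]
    show "2 * m p (tadd (tscale (X p h) (Y p)) (tscale (h p) (lc X Y p))) (A p)
        = koszul X (\<lambda>q. tscale (h q) (Y q)) A p"
      using koszul_scale2[OF X' Y' A(3) SF_restrict[OF h A(2)] A(1)] lc_koszul[OF X' Y' A(1,3)]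
        m_scale_left[OF lc_T[OF X Y p] VF_T[OF A(3,1)]] m_scale_left[OF VF_T[OF Y p] VF_T[OF A(3,1)]]
        m_add_left[OF T_tscale[OF VF_T[OF Y p]] T_tscale[OF lc_T[OF X Y p]] VF_T[OF A(3,1)]]
      by (simp add: algebra_simps)
  qed
qed

lemma lc_levi_civita: "is_levi_civita M S m lc"
  unfolding is_levi_civita_def
proof (intro conjI allI impI ballI lc_affine; elim conjE)
  fix W X Y Z p assume X: "VF W X" and Y: "VF W Y" and Z: "VF W Z" and p: "p \<in> W"
  show "X p (ip Y Z) = m p (lc X Y p) (Z p) + m p (Y p) (lc X Z p)"
    using lc_koszul[OF X Y p Z] lc_koszul[OF X Z p Y] koszul_swap23[OF X Y Z p]
      m_sym[OF VF_T[OF Y p] lc_T[OF X Z p]] by simp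
next
  fix W X Y p assume X: "VF W X" and Y: "VF W Y" and p: "p \<in> W"
  show "tdiff (lc X Y p) (lc Y X p) = br X Y p"
  proof (rule m_nondegenerate[OF T_tadd[OF lc_T[OF X Y p] T_tscale[OF lc_T[OF Y X p]]] br_T[OF X Y p]])
    fix u assume u: "u \<in> T p"
    obtain V Z where Z: "p \<in> V" "VF V Z" "Z p = u" by (rule vector_extension[OF u])
    have o: "opn (W \<inter> V)" by (rule opn_Int[OF VF_open[OF X] VF_open[OF Z(2)]])
    have r: "VF (W \<inter> V) X" "VF (W \<inter> V) Y" "VF (W \<inter> V) Z" "p \<in> W \<inter> V"
      using VF_restrict[OF _ o Int_lower1] VF_restrict[OF _ o Int_lower2] X Y Z p by blast+
    show "m p (tdiff (lc X Y p) (lc Y X p)) u = m p (br X Y p) u"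
      using lc_koszul[OF r(1,2,4,3)] lc_koszul[OF r(2,1,4,3)] koszul_swap12[OF r(1,2,3,4)] Z(3)
        m_add_left[OF lc_T[OF X Y p] T_tscale[OF lc_T[OF Y X p]] u] m_scale_left[OF lc_T[OF Y X p] u]
      by simp
  qed
qed

text \<open>The choice may differ from \<open>lc\<close> outside smooth fields; everything later
  relies only on the axioms of a Levi-Civita connection.\<close>

lemma levi_civita: "is_levi_civita M S m (levi_civita M S m)"
  unfolding levi_civita_def by (rule someI[where P="is_levi_civita M S m", OF lc_levi_civita])

end

section \<open>Tensoriality of the curvature\<close>

context riemannian
begin

text \<open>The curvature with the connection as a parameter, so that its identities can be derived
  for any Levi-Civita connection.\<close>

definition curv :: "(('p \<Rightarrow> 'p tvec) \<Rightarrow> ('p \<Rightarrow> 'p tvec) \<Rightarrow> ('p \<Rightarrow> 'p tvec)) \<Rightarrow>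
    ('p \<Rightarrow> 'p tvec) \<Rightarrow> ('p \<Rightarrow> 'p tvec) \<Rightarrow> ('p \<Rightarrow> 'p tvec) \<Rightarrow> 'p \<Rightarrow> 'p tvec" where
  "curv D X Y Z p = tadd (tdiff (D (br X Y) Z p) (D X (D Y Z) p)) (D Y (D X Z) p)"

context
  fixes D assumes D: "is_levi_civita M S m D"
begin

section \<open>Curvature identities for a fixed Levi-Civita connection\<close>

lemma D_affine: "affine_connection M S D" using D unfolding is_levi_civita_def by blast

lemma D_VF: "VF W X \<Longrightarrow> VF W Y \<Longrightarrow> VF W (D X Y)"
  using D_affine unfolding affine_connection_def by blast

lemma D_cong:
  assumes "VF W X" "VF W Y" "p \<in> W" "\<And>q. q \<in> W \<Longrightarrow> X' q = X q" "\<And>q. q \<in> W \<Longrightarrow> Y' q = Y q"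
  shows "D X' Y' p = D X Y p"
proof -
  have "\<forall>X' Y'. (\<forall>p\<in>W. X' p = X p \<and> Y' p = Y p) \<longrightarrow> (\<forall>p\<in>W. D X' Y' p = D X Y p)"
    using D_affine assms(1,2) unfolding affine_connection_def by blast
  then show ?thesis using assms(3-5) by blast
qed

lemma D_add1: "VF W X \<Longrightarrow> VF W X' \<Longrightarrow> VF W Y \<Longrightarrow> p \<in> W \<Longrightarrow>
    D (\<lambda>q. tadd (X q) (X' q)) Y p = tadd (D X Y p) (D X' Y p)"
  and D_add2: "VF W X \<Longrightarrow> VF W Y \<Longrightarrow> VF W Y' \<Longrightarrow> p \<in> W \<Longrightarrow>
    D X (\<lambda>q. tadd (Y q) (Y' q)) p = tadd (D X Y p) (D X Y' p)"
  and D_scale1: "VF W X \<Longrightarrow> VF W Y \<Longrightarrow> SF W h \<Longrightarrow> p \<in> W \<Longrightarrow>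
    D (\<lambda>q. tscale (h q) (X q)) Y p = tscale (h p) (D X Y p)"
  and D_scale2: "VF W X \<Longrightarrow> VF W Y \<Longrightarrow> SF W h \<Longrightarrow> p \<in> W \<Longrightarrow>
    D X (\<lambda>q. tscale (h q) (Y q)) p = tadd (tscale (X p h) (Y p)) (tscale (h p) (D X Y p))"
  using D_affine unfolding affine_connection_def by blast+

lemma D_metric: "VF W X \<Longrightarrow> VF W Y \<Longrightarrow> VF W Z \<Longrightarrow> p \<in> W \<Longrightarrow>
    X p (ip Y Z) = m p (D X Y p) (Z p) + m p (Y p) (D X Z p)"
  and D_torsion: "VF W X \<Longrightarrow> VF W Y \<Longrightarrow> p \<in> W \<Longrightarrow> br X Y p = tdiff (D X Y p) (D Y X p)"
  using D unfolding is_levi_civita_def by (blast, metis)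

lemma D_T: "VF W X \<Longrightarrow> VF W Y \<Longrightarrow> p \<in> W \<Longrightarrow> D X Y p \<in> T p"
  using VF_T[OF D_VF] .

lemma m_torsion:
  assumes "VF W X" "VF W Y" "p \<in> W" "w \<in> T p"
  shows "m p (br X Y p) w = m p (D X Y p) w - m p (D Y X p) w"
  unfolding D_torsion[OF assms(1-3)]
  using m_add_left[OF D_T[OF assms(1-3)] T_tscale[OF D_T[OF assms(2,1,3)]] assms(4)]
    m_scale_left[OF D_T[OF assms(2,1,3)] assms(4)] by simp

lemma koszul_formula:
  assumes X: "VF W X" and Y: "VF W Y" and Z: "VF W Z" and p: "p \<in> W"
  shows "2 * m p (D X Y p) (Z p) = koszul X Y Z p"
  unfolding koszul_def
  using D_metric[OF X Y Z p] D_metric[OF Y Z X p] D_metric[OF Z X Y p]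
    m_torsion[OF X Y p VF_T[OF Z p]] m_torsion[OF Y Z p VF_T[OF X p]] m_torsion[OF Z X p VF_T[OF Y p]]
    m_sym[OF VF_T[OF Y p] D_T[OF X Z p]] m_sym[OF VF_T[OF Z p] D_T[OF Y X p]]
    m_sym[OF VF_T[OF X p] D_T[OF Z Y p]] by simp

lemma D_minus1:
  assumes "VF W X" "VF W Y" "p \<in> W" shows "D (\<lambda>q. tscale (-1) (X q)) Y p = tscale (-1) (D X Y p)"
  by (rule D_scale1[OF assms(1,2) SF_const[OF VF_open[OF assms(1)]] assms(3)])

lemma curv_swap:
  assumes X: "VF W X" and Y: "VF W Y" and Z: "VF W Z" and p: "p \<in> W"
  shows "curv D X Y Z p = tscale (-1) (curv D Y X Z p)"
proof -
  have "D (br X Y) Z p = D (\<lambda>q. tscale (-1) (br Y X q)) Z p"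
    by (rule D_cong[OF VF_tscale[OF VF_br[OF Y X] SF_const[OF VF_open[OF X]]] Z p])
      (simp_all add: br_swap[of X Y])
  also have "\<dots> = tscale (-1) (D (br Y X) Z p)" by (rule D_minus1[OF VF_br[OF Y X] Z p])
  finally show ?thesis by (simp add: curv_def tadd_def tscale_def algebra_simps)
qed

lemma curv_add1:
  assumes X: "VF W X" and X': "VF W X'" and Y: "VF W Y" and Z: "VF W Z" and p: "p \<in> W"
  shows "curv D (\<lambda>q. tadd (X q) (X' q)) Y Z p f = curv D X Y Z p f + curv D X' Y Z p f"
proof -
  let ?S = "\<lambda>q. tadd (X q) (X' q)"
  have S: "VF W ?S" by (rule VF_tadd[OF X X'])
  have "D (br ?S Y) Z p = D (\<lambda>q. tadd (br X Y q) (br X' Y q)) Z p"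
    by (rule D_cong[OF VF_tadd[OF VF_br[OF X Y] VF_br[OF X' Y]] Z p]) (simp_all add: br_tadd[OF X X' Y])
  also have "\<dots> = tadd (D (br X Y) Z p) (D (br X' Y) Z p)"
    by (rule D_add1[OF VF_br[OF X Y] VF_br[OF X' Y] Z p])
  finally have 1: "D (br ?S Y) Z p = \<dots>" .
  have "D Y (D ?S Z) p = D Y (\<lambda>q. tadd (D X Z q) (D X' Z q)) p"
    by (rule D_cong[OF Y VF_tadd[OF D_VF[OF X Z] D_VF[OF X' Z]] p]) (simp_all add: D_add1[OF X X' Z])
  also have "\<dots> = tadd (D Y (D X Z) p) (D Y (D X' Z) p)"
    by (rule D_add2[OF Y D_VF[OF X Z] D_VF[OF X' Z] p])
  finally have 2: "D Y (D ?S Z) p = \<dots>" .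
  show ?thesis
    unfolding curv_def 1 2 D_add1[OF X X' D_VF[OF Y Z] p] by (simp add: tadd_def tscale_def)
qed

text \<open>The term \<open>(Y h) D_X Z\<close> occurs in \<open>D_[hX,Y] Z\<close> and in
  \<open>D_Y (h D_X Z)\<close> with opposite signs.\<close>

lemma curv_scale1:
  assumes X: "VF W X" and Y: "VF W Y" and Z: "VF W Z" and h: "SF W h" and p: "p \<in> W"
  shows "curv D (\<lambda>q. tscale (h q) (X q)) Y Z p f = h p * curv D X Y Z p f"
proof -
  let ?S = "\<lambda>q. tscale (h q) (X q)"
  let ?Yh = "\<lambda>q. Y q h"
  have S: "VF W ?S" by (rule VF_tscale[OF X h])
  have Yh: "SF W ?Yh" by (rule SF_VF[OF Y h])
  have a: "VF W (\<lambda>q. tscale (h q) (br X Y q))" by (rule VF_tscale[OF VF_br[OF X Y] h])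
  have b: "VF W (\<lambda>q. tscale (?Yh q) (X q))" by (rule VF_tscale[OF X Yh])
  have c: "VF W (\<lambda>q. tscale (-1) (tscale (?Yh q) (X q)))"
    by (rule VF_tscale[OF b SF_const[OF VF_open[OF X]]])
  have "D (br ?S Y) Z p = D (\<lambda>q. tdiff (tscale (h q) (br X Y q)) (tscale (?Yh q) (X q))) Z p"
    by (rule D_cong[OF VF_tadd[OF a c] Z p]) (simp_all add: br_tscale[OF X Y h])
  also have "\<dots> = tdiff (tscale (h p) (D (br X Y) Z p)) (tscale (?Yh p) (D X Z p))"
    unfolding D_add1[OF a c Z p] D_minus1[OF b Z p] D_scale1[OF VF_br[OF X Y] Z h p]
      D_scale1[OF X Z Yh p] ..
  finally have 1: "D (br ?S Y) Z p = \<dots>" .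
  have "D Y (D ?S Z) p = D Y (\<lambda>q. tscale (h q) (D X Z q)) p"
    by (rule D_cong[OF Y VF_tscale[OF D_VF[OF X Z] h] p]) (simp_all add: D_scale1[OF X Z h])
  also have "\<dots> = tadd (tscale (Y p h) (D X Z p)) (tscale (h p) (D Y (D X Z) p))"
    by (rule D_scale2[OF Y D_VF[OF X Z] h p])
  finally have 2: "D Y (D ?S Z) p = \<dots>" .
  show ?thesis
    unfolding curv_def 1 2 D_scale1[OF X D_VF[OF Y Z] h p] by (simp add: tadd_def tscale_def algebra_simps)
qed

lemma curv_add3:
  assumes X: "VF W X" and Y: "VF W Y" and Z: "VF W Z" and Z': "VF W Z'" and p: "p \<in> W"
  shows "curv D X Y (\<lambda>q. tadd (Z q) (Z' q)) p f = curv D X Y Z p f + curv D X Y Z' p f"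
proof -
  let ?S = "\<lambda>q. tadd (Z q) (Z' q)"
  have 2: "D A (D B ?S) p = tadd (D A (D B Z) p) (D A (D B Z') p)" if A: "VF W A" and B: "VF W B" for A B
  proof -
    have "D A (D B ?S) p = D A (\<lambda>q. tadd (D B Z q) (D B Z' q)) p"
      by (rule D_cong[OF A VF_tadd[OF D_VF[OF B Z] D_VF[OF B Z']] p]) (simp_all add: D_add2[OF B Z Z'])
    also have "\<dots> = tadd (D A (D B Z) p) (D A (D B Z') p)"
      by (rule D_add2[OF A D_VF[OF B Z] D_VF[OF B Z'] p])
    finally show ?thesis .
  qed
  show ?thesis
    unfolding curv_def 2[OF X Y] 2[OF Y X] D_add2[OF VF_br[OF X Y] Z Z' p] by (simp add: tadd_def tscale_def)
qed

text \<open>The second derivatives of \<open>h\<close> combine to \<open>[X,Y] h\<close> and cancel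
  the Leibniz term of \<open>D_[X,Y] (h Z)\<close>; the mixed first-order terms cancel in
  pairs.\<close>

lemma curv_scale3:
  assumes X: "VF W X" and Y: "VF W Y" and Z: "VF W Z" and h: "SF W h" and p: "p \<in> W"
  shows "curv D X Y (\<lambda>q. tscale (h q) (Z q)) p f = h p * curv D X Y Z p f"
proof -
  let ?S = "\<lambda>q. tscale (h q) (Z q)"
  have 2: "D A (D B ?S) p = tadd (tadd (tscale (A p (\<lambda>q. B q h)) (Z p)) (tscale (B p h) (D A Z p)))
      (tadd (tscale (A p h) (D B Z p)) (tscale (h p) (D A (D B Z) p)))"
    if A: "VF W A" and B: "VF W B" for A B
  proof -
    note Bh = SF_VF[OF B h]
    have a: "VF W (\<lambda>q. tscale (B q h) (Z q))" "VF W (\<lambda>q. tscale (h q) (D B Z q))"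
      by (rule VF_tscale[OF Z Bh], rule VF_tscale[OF D_VF[OF B Z] h])
    have "D A (D B ?S) p = D A (\<lambda>q. tadd (tscale (B q h) (Z q)) (tscale (h q) (D B Z q))) p"
      by (rule D_cong[OF A VF_tadd[OF a] p]) (simp_all add: D_scale2[OF B Z h])
    then show ?thesis
      unfolding D_add2[OF A a p] D_scale2[OF A Z Bh p] D_scale2[OF A D_VF[OF B Z] h p] .
  qed
  have "C p h" using h p unfolding smooth_funs_on_def by blast
  then have e: "br X Y p h = X p (\<lambda>q. Y q h) - Y p (\<lambda>q. X q h)" by (simp add: lie_bracket_def)
  show ?thesis
    unfolding curv_def e 2[OF X Y] 2[OF Y X] D_scale2[OF VF_br[OF X Y] Z h p] e
    by (simp add: tadd_def tscale_def algebra_simps)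
qed

lemma curv_cong:
  assumes X: "VF W X" and Y: "VF W Y" and Z: "VF W Z" and p: "p \<in> W"
    and eq: "\<And>q. q \<in> W \<Longrightarrow> X' q = X q" "\<And>q. q \<in> W \<Longrightarrow> Z' q = Z q"
  shows "curv D X' Y Z' p = curv D X Y Z p"
proof -
  have e1: "br X' Y q = br X Y q" and e2: "D Y Z' q = D Y Z q" and e3: "D X' Z' q = D X Z q"
    if q: "q \<in> W" for q
    using br_cong[OF X Y q, of X' Y] D_cong[OF Y Z q, of Y Z'] D_cong[OF X Z q, of X' Z'] eq by simp_all
  have "D (br X' Y) Z' p = D (br X Y) Z p"
    by (rule D_cong[OF VF_br[OF X Y] Z p]) (simp_all add: e1 eq)
  moreover have "D X' (D Y Z') p = D X (D Y Z) p"
    by (rule D_cong[OF X D_VF[OF Y Z] p]) (simp_all add: e2 eq)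
  moreover have "D Y (D X' Z') p = D Y (D X Z) p"
    by (rule D_cong[OF Y D_VF[OF X Z] p]) (simp_all add: e3)
  ultimately show ?thesis by (simp add: curv_def)
qed

lemma curv_tensor1:
  assumes X: "VF W X" and X': "VF W X'" and Y: "VF W Y" and Z: "VF W Z" and p: "p \<in> W" and eq: "X p = X' p"
  shows "curv D X Y Z p = curv D X' Y Z p"
proof
  fix f
  show "curv D X Y Z p f = curv D X' Y Z p f"
  proof (rule tensorial[where \<Phi>="\<lambda>X. curv D X Y Z p f" and ?W0.0=W, OF _ _ _ X X' p order_refl eq])
    fix V A B assume a: "p \<in> V" "V \<subseteq> W" "VF V A" "VF V B"
    note r = VF_restrict[OF _ VF_open[OF a(3)] a(2)]
    show "curv D (\<lambda>q. tadd (A q) (B q)) Y Z p f = curv D A Y Z p f + curv D B Y Z p f"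
      by (rule curv_add1[OF a(3,4) r[OF Y] r[OF Z] a(1)])
  next
    fix V A h assume a: "p \<in> V" "V \<subseteq> W" "VF V A" "SF V h"
    note r = VF_restrict[OF _ VF_open[OF a(3)] a(2)]
    show "curv D (\<lambda>q. tscale (h q) (A q)) Y Z p f = h p * curv D A Y Z p f"
      by (rule curv_scale1[OF a(3) r[OF Y] r[OF Z] a(4,1)])
  next
    fix V A B assume a: "p \<in> V" "V \<subseteq> W" "VF V A" and e: "\<And>q. q \<in> V \<Longrightarrow> A q = B q"
    note r = VF_restrict[OF _ VF_open[OF a(3)] a(2)]
    show "curv D A Y Z p f = curv D B Y Z p f"
      using curv_cong[OF a(3) r[OF Y] r[OF Z] a(1) e[symmetric] refl] by simp
  qed
qed

lemma curv_tensor3: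
  assumes X: "VF W X" and Y: "VF W Y" and Z: "VF W Z" and Z': "VF W Z'" and p: "p \<in> W" and eq: "Z p = Z' p"
  shows "curv D X Y Z p = curv D X Y Z' p"
proof
  fix f
  show "curv D X Y Z p f = curv D X Y Z' p f"
  proof (rule tensorial[where \<Phi>="\<lambda>Z. curv D X Y Z p f" and ?W0.0=W, OF _ _ _ Z Z' p order_refl eq])
    fix V A B assume a: "p \<in> V" "V \<subseteq> W" "VF V A" "VF V B"
    note r = VF_restrict[OF _ VF_open[OF a(3)] a(2)]
    show "curv D X Y (\<lambda>q. tadd (A q) (B q)) p f = curv D X Y A p f + curv D X Y B p f"
      by (rule curv_add3[OF r[OF X] r[OF Y] a(3,4,1)])
  next
    fix V A h assume a: "p \<in> V" "V \<subseteq> W" "VF V A" "SF V h"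
    note r = VF_restrict[OF _ VF_open[OF a(3)] a(2)]
    show "curv D X Y (\<lambda>q. tscale (h q) (A q)) p f = h p * curv D X Y A p f"
      by (rule curv_scale3[OF r[OF X] r[OF Y] a(3,4,1)])
  next
    fix V A B assume a: "p \<in> V" "V \<subseteq> W" "VF V A" and e: "\<And>q. q \<in> V \<Longrightarrow> A q = B q"
    note r = VF_restrict[OF _ VF_open[OF a(3)] a(2)]
    show "curv D X Y A p f = curv D X Y B p f"
      using curv_cong[OF r[OF X] r[OF Y] a(3,1) refl e[symmetric]] by simp
  qed
qed

text \<open>The three slots are replaced one at a time; the second is reached through
  antisymmetry.\<close>

lemma curv_tensor:
  assumes V: "VF W X" "VF W Y" "VF W X'" "VF W Y'" and p: "p \<in> W" and eq: "X p = X' p" "Y p = Y' p"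
  shows "curv D X Y X p = curv D X' Y' X' p"
proof -
  have "curv D X Y X p = curv D X' Y X p" by (rule curv_tensor1[OF V(1,3,2,1) p eq(1)])
  also have "\<dots> = tscale (-1) (curv D Y X' X p)" by (rule curv_swap[OF V(3,2,1) p])
  also have "curv D Y X' X p = curv D Y' X' X p" by (rule curv_tensor1[OF V(2,4,3,1) p eq(2)])
  also have "tscale (-1) (curv D Y' X' X p) = curv D X' Y' X p" by (rule curv_swap[OF V(3,4,1) p, symmetric])
  also have "\<dots> = curv D X' Y' X' p" by (rule curv_tensor3[OF V(3,4,1,3) p eq(1)])
  finally show ?thesis .
qed

text \<open>For an orthonormal pair, \<open>\<langle>D_Y X, Y\<rangle> = - \<langle>[X,Y], Y\<rangle>\<close> and \<open>\<langle>D_X X, Y\<rangle> = - \<langle>[X,Y], X\<rangle>\<close>,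
  and these functions are then differentiated along \<open>X\<close> and \<open>Y\<close>.\<close>

lemma curv_orthonormal:
  assumes X: "VF W X" and Y: "VF W Y" and p: "p \<in> W"
    and on: "\<And>q. q \<in> W \<Longrightarrow> m q (X q) (X q) = 1" "\<And>q. q \<in> W \<Longrightarrow> m q (Y q) (Y q) = 1"
      "\<And>q. q \<in> W \<Longrightarrow> m q (X q) (Y q) = 0"
  shows "m p (curv D X Y X p) (Y p) =
    3/2 * (X p (ip (br X Y) Y) - Y p (ip (br X Y) X)) - 1/2 * m p (br X Y p) (br X Y p)
    - 1/2 * m p (br X (br X Y) p) (Y p) + 1/2 * m p (br Y (br X Y) p) (X p)
    + m p (D X Y p) (D Y X p) - m p (D X X p) (D Y Y p)"
proof -
  let ?A = "br X Y"
  have A: "VF W ?A" by (rule VF_br[OF X Y])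
  note o = VF_open[OF X]
  have const: "Z q (ip B E) = 0"
    if Z: "VF W Z" and q: "q \<in> W" and c: "\<And>r. r \<in> W \<Longrightarrow> m r (B r) (E r) = c" for Z q B E c
  proof -
    have "Z q (ip B E) = Z q (\<lambda>r. c)" by (rule T_cong[OF VF_T[OF Z q] o q c])
    then show ?thesis using T_const[OF VF_T[OF Z q]] by simp
  qed
  have yx: "m q (D Y X q) (Y q) = - m q (?A q) (Y q)" and xx: "m q (D X X q) (Y q) = - m q (?A q) (X q)"
    if q: "q \<in> W" for q
  proof -
    note XT = VF_T[OF X q] and YT = VF_T[OF Y q]
    show "m q (D Y X q) (Y q) = - m q (?A q) (Y q)"
      using const[OF X q on(2)] D_metric[OF X Y Y q] m_sym[OF YT D_T[OF X Y q]] m_torsion[OF X Y q YT] by simp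
    show "m q (D X X q) (Y q) = - m q (?A q) (X q)"
      using const[OF X q on(3)] D_metric[OF X X Y q] const[OF Y q on(1)] D_metric[OF Y X X q]
        m_sym[OF XT D_T[OF X Y q]] m_sym[OF XT D_T[OF Y X q]] m_torsion[OF X Y q XT] by simp
  qed
  note XT = VF_T[OF X p] and YT = VF_T[OF Y p]
  have dT: "D ?A X p \<in> T p" "D X (D Y X) p \<in> T p" "D Y (D X X) p \<in> T p"
    using D_T[OF A X p] D_T[OF X D_VF[OF Y X] p] D_T[OF Y D_VF[OF X X] p] .
  have "m p (curv D X Y X p) (Y p) = m p (D ?A X p) (Y p) - m p (D X (D Y X) p) (Y p) + m p (D Y (D X X) p) (Y p)"
    unfolding curv_def
    using m_add_left[OF T_tadd[OF dT(1) T_tscale[OF dT(2)]] dT(3) YT] m_add_left[OF dT(1) T_tscale[OF dT(2)] YT]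
      m_scale_left[OF dT(2) YT] by simp
  moreover have "m p (D X (D Y X) p) (Y p) = - X p (ip ?A Y) - m p (D X Y p) (D Y X p)"
  proof -
    have "X p (ip (D Y X) Y) = X p (\<lambda>q. -1 * ip ?A Y q)"
      by (rule T_cong[OF XT o p]) (simp add: yx)
    also have "\<dots> = - X p (ip ?A Y)" using T_cmult[OF XT ip_C[OF A Y p], of "-1"] by simp
    finally show ?thesis
      using D_metric[OF X D_VF[OF Y X] Y p] m_sym[OF D_T[OF Y X p] D_T[OF X Y p]] by simp
  qed
  moreover have "m p (D Y (D X X) p) (Y p) = - Y p (ip ?A X) - m p (D X X p) (D Y Y p)"
  proof -
    have "Y p (ip (D X X) Y) = Y p (\<lambda>q. -1 * ip ?A X q)"
      by (rule T_cong[OF YT o p]) (simp add: xx)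
    also have "\<dots> = - Y p (ip ?A X)" using T_cmult[OF YT ip_C[OF A X p], of "-1"] by simp
    finally show ?thesis using D_metric[OF Y D_VF[OF X X] Y p] by simp
  qed
  \<comment> \<open>One of the three Koszul brackets is \<open>[X,Y]\<close> again, which produces
    its square; the derivative of the constant \<open>m q (X q) (Y q)\<close> vanishes. Half of this
    line raises the coefficient of the derivative terms from 1 to 3/2.\<close>
  moreover have "2 * m p (D ?A X p) (Y p) = X p (ip ?A Y) - Y p (ip ?A X)
      - m p (br X ?A p) (Y p) - m p (?A p) (?A p) + m p (br Y ?A p) (X p)"
    using koszul_formula[OF A X Y p] const[OF A p on(3)] d_ip_swap[OF X Y A p]
      m_br_swap[OF A X p YT]
    unfolding koszul_def by simp
  ultimately show ?thesis by argo
qed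

end

lemma curvature_eq: "curvature M S m X Y Z p = curv (levi_civita M S m) X Y Z p"
  by (simp add: curvature_def curv_def Let_def)

text \<open>Two competing pairs of extensions are compared on the intersection of their domains,
  where tensoriality equates the curvatures; so the description has a unique solution.\<close>

lemma sectional_curvature_eq:
  assumes U: "VF W U" and V: "VF W V" and p: "p \<in> W"
  shows "sectional_curvature M S m p (U p) (V p) = m p (curv (levi_civita M S m) U V U p) (V p)"
  unfolding sectional_curvature_def curvature_eq
proof (rule the_equality)
  show "\<exists>W' U' V'. p \<in> W' \<and> VF W' U' \<and> VF W' V' \<and> U' p = U p \<and> V' p = V p \<and>
      m p (curv (levi_civita M S m) U V U p) (V p) = m p (curv (levi_civita M S m) U' V' U' p) (V p)"
    using assms by blast
  fix c assume "\<exists>W' U' V'. p \<in> W' \<and> VF W' U' \<and> VF W' V' \<and> U' p = U p \<and> V' p = V p \<and>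
      c = m p (curv (levi_civita M S m) U' V' U' p) (V p)"
  then obtain W' U' V' where a: "p \<in> W'" "VF W' U'" "VF W' V'" "U' p = U p" "V' p = V p"
    "c = m p (curv (levi_civita M S m) U' V' U' p) (V p)" by (elim exE conjE)
  have o: "opn (W \<inter> W')" by (rule opn_Int[OF VF_open[OF U] VF_open[OF a(2)]])
  have "curv (levi_civita M S m) U' V' U' p = curv (levi_civita M S m) U V U p"
    by (rule curv_tensor[OF levi_civita VF_restrict[OF a(2) o Int_lower2] VF_restrict[OF a(3) o Int_lower2]
          VF_restrict[OF U o Int_lower1] VF_restrict[OF V o Int_lower1] _ a(4,5)])
      (use a p in simp)
  then show "c = m p (curv (levi_civita M S m) U V U p) (V p)" using a(6) by simp
qed

end

section \<open>Frames of the source fibres\<close>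

lemma smooth_on_Times:
  fixes f :: "'a::real_normed_vector \<Rightarrow> 'c::real_normed_vector" and g :: "'b::real_normed_vector \<Rightarrow> 'd::real_normed_vector"
  assumes "finite_dim TYPE('a)" "finite_dim TYPE('b)" "open A" "open B" "smooth_on A f" "smooth_on B g"
  shows "smooth_on (A \<times> B) (\<lambda>x. (f (fst x), g (snd x)))"
proof -
  have o: "open (A \<times> B)" by (rule open_Times[OF assms(3,4)])
  have 1: "smooth_on (A \<times> B) (\<lambda>x. f (fst x))"
    by (rule smooth_on_compose[OF assms(1) o assms(3) _ smooth_on_bounded_linear[OF o bounded_linear_fst] assms(5)]) auto
  have 2: "smooth_on (A \<times> B) (\<lambda>x. g (snd x))"
    by (rule smooth_on_compose[OF assms(2) o assms(4) _ smooth_on_bounded_linear[OF o bounded_linear_snd] assms(6)]) auto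
  show ?thesis by (rule smooth_on_Pair[OF o 1 2])
qed

lemma finite_dim_prod:
  assumes "finite_dim TYPE('a::real_normed_vector)" "finite_dim TYPE('b::real_normed_vector)"
  shows "finite_dim TYPE('a \<times> 'b)"
proof -
  obtain K :: "'a set" and L :: "'b set" where K: "finite K" "span K = UNIV" and L: "finite L" "span L = UNIV"
    using assms unfolding finite_dim_def by blast
  let ?P = "(\<lambda>x. (x, 0)) ` K \<union> (\<lambda>y. (0, y)) ` L :: ('a \<times> 'b) set"
  have l: "linear (\<lambda>x::'a. (x, 0::'b))" "linear (\<lambda>y::'b. (0::'a, y))"
    by (auto intro!: linearI)
  have "z \<in> span ?P" for z
  proof -
    have "(fst z, 0::'b) \<in> span ((\<lambda>x. (x, 0)) ` K)" "(0::'a, snd z) \<in> span ((\<lambda>y. (0, y)) ` L)"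
      using linear_span_image[OF l(1), of K] linear_span_image[OF l(2), of L] K L by auto
    then have "(fst z, 0) \<in> span ?P" "(0, snd z) \<in> span ?P"
      using span_mono[of "(\<lambda>x. (x, 0)) ` K" ?P] span_mono[of "(\<lambda>y. (0, y)) ` L" ?P] by blast+
    then have "(fst z, 0) + (0, snd z) \<in> span ?P" by (rule span_add)
    then show ?thesis by simp
  qed
  then have "span ?P = UNIV" by blast
  then show ?thesis unfolding finite_dim_def using K L by (intro exI[of _ ?P]) auto
qed

lemma prod_atlas_iff:
  "(P, \<pi>) \<in> prod_atlas M N \<longleftrightarrow> (\<exists>U \<phi> V \<psi>. P = U \<times> V \<and> \<pi> = map_prod \<phi> \<psi> \<and> (U, \<phi>) \<in> M \<and> (V, \<psi>) \<in> N)"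
  unfolding prod_atlas_def by blast

lemma inv_into_map_prod:
  assumes "inj_on \<phi> U" "inj_on \<psi> V" "p \<in> U" "q \<in> V"
  shows "inv_into (U \<times> V) (map_prod \<phi> \<psi>) (\<phi> p, \<psi> q) = (p, q)"
proof -
  have "inj_on (map_prod \<phi> \<psi>) (U \<times> V)" using assms by (simp add: map_prod_inj_on)
  then show ?thesis using inv_into_f_f[of "map_prod \<phi> \<psi>" "U \<times> V" "(p, q)"] assms by simp
qed

lemma smooth_atlas_prod:
  fixes M :: "('p, 'e::real_normed_vector) atlas" and N :: "('q, 'f::real_normed_vector) atlas"
  assumes M: "smooth_atlas M" and N: "smooth_atlas N"
  shows "smooth_atlas (prod_atlas M N)"
  unfolding smooth_atlas_def
proof (intro conjI)
  show "\<exists>K :: ('e \<times> 'f) set. finite K \<and> span K = UNIV"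
    using finite_dim_prod[OF smooth_atlas_finite_dim[OF M] smooth_atlas_finite_dim[OF N]]
    unfolding finite_dim_def .
  show "\<forall>(P, \<pi>)\<in>prod_atlas M N. inj_on \<pi> P \<and> (\<forall>(Q, \<rho>)\<in>prod_atlas M N. open (\<pi> ` (P \<inter> Q)) \<and>
      smooth_on (\<pi> ` (P \<inter> Q)) (\<rho> \<circ> inv_into P \<pi>))"
  proof safe
    fix P \<pi> assume P: "(P, \<pi>) \<in> prod_atlas M N"
    obtain U \<phi> V \<psi> where U: "P = U \<times> V" "\<pi> = map_prod \<phi> \<psi>" "(U, \<phi>) \<in> M" "(V, \<psi>) \<in> N"
      using P unfolding prod_atlas_iff by blast
    note cU = chart_of_atlas[OF M U(3)] and cV = chart_of_atlas[OF N U(4)]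
    show "inj_on \<pi> P" unfolding U by (rule map_prod_inj_on[OF chart_of_inj[OF cU] chart_of_inj[OF cV]])
    fix Q \<rho> assume Q: "(Q, \<rho>) \<in> prod_atlas M N"
    obtain U' \<phi>' V' \<psi>' where U': "Q = U' \<times> V'" "\<rho> = map_prod \<phi>' \<psi>'" "(U', \<phi>') \<in> M" "(V', \<psi>') \<in> N"
      using Q unfolding prod_atlas_iff by blast
    note a = chart_of_atlasD[OF cU U'(3)] and b = chart_of_atlasD[OF cV U'(4)]
    have e: "\<pi> ` (P \<inter> Q) = \<phi> ` (U \<inter> U') \<times> \<psi> ` (V \<inter> V')" unfolding U U' by auto
    show o: "open (\<pi> ` (P \<inter> Q))" unfolding e by (rule open_Times[OF a(1) b(1)])
    have "smooth_on (\<pi> ` (P \<inter> Q)) (\<lambda>x. ((\<phi>' \<circ> inv_into U \<phi>) (fst x), (\<psi>' \<circ> inv_into V \<psi>) (snd x)))"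
      unfolding e by (rule smooth_on_Times[OF smooth_atlas_finite_dim[OF M] smooth_atlas_finite_dim[OF N] a(1) b(1) a(2) b(2)])
    then show "smooth_on (\<pi> ` (P \<inter> Q)) (\<rho> \<circ> inv_into P \<pi>)"
    proof (rule smooth_on_cong[OF o])
      fix x assume "x \<in> \<pi> ` (P \<inter> Q)"
      then obtain p q where x: "x = (\<phi> p, \<psi> q)" "p \<in> U" "q \<in> V" unfolding e by auto
      show "((\<phi>' \<circ> inv_into U \<phi>) (fst x), (\<psi>' \<circ> inv_into V \<psi>) (snd x)) = (\<rho> \<circ> inv_into P \<pi>) x"
        unfolding U U' x(1) using x inv_into_map_prod[OF chart_of_inj[OF cU] chart_of_inj[OF cV] x(2,3)]
          chart_of_inv[OF cU x(2)] chart_of_inv[OF cV x(3)] by simp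
    qed
  qed
qed

lemma smooth_map_on_Pair:
  assumes M: "smooth_atlas M" and N: "smooth_atlas N" and P: "smooth_atlas P"
    and F: "smooth_map_on M N W F" and G: "smooth_map_on M P W G"
  shows "smooth_map_on M (prod_atlas N P) W (\<lambda>p. (F p, G p))"
proof (rule smooth_map_onI[OF M smooth_atlas_prod[OF N P]])
  fix p assume p: "p \<in> W"
  obtain U \<phi> where U: "(U, \<phi>) \<in> M" "p \<in> U"
    by (rule atlas_chart_exists[OF openin_mtopology_mcarrier[OF M smooth_map_on_domain[OF F] p]])
  obtain V \<psi> where V: "(V, \<psi>) \<in> N" "F p \<in> V" by (rule atlas_chart_exists[OF smooth_map_on_range[OF F p]])
  obtain Z \<zeta> where Z: "(Z, \<zeta>) \<in> P" "G p \<in> Z" by (rule atlas_chart_exists[OF smooth_map_on_range[OF G p]])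
  note cU = chart_of_atlas[OF M U(1)] and cV = chart_of_atlas[OF N V(1)] and cZ = chart_of_atlas[OF P Z(1)]
  let ?Q = "U \<inter> ({q \<in> W. F q \<in> V} \<inter> {q \<in> W. G q \<in> Z})"
  have c: "chart_of M ?Q \<phi>"
    by (intro chart_of_restrict[OF M cU] openin_mtopology_Int smooth_map_on_openin[OF M N F chart_of_openin[OF cV]]
        smooth_map_on_openin[OF M P G chart_of_openin[OF cZ]])
  have o: "open (\<phi> ` ?Q)" by (rule chart_of_range_open[OF M c])
  have s: "smooth_on (\<phi> ` ?Q) (\<psi> \<circ> F \<circ> inv_into U \<phi>)" "smooth_on (\<phi> ` ?Q) (\<zeta> \<circ> G \<circ> inv_into U \<phi>)"
    by (rule smooth_on_subset[OF smooth_map_on_chart(2)[OF M N F cU cV]], force,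
        rule smooth_on_subset[OF smooth_map_on_chart(2)[OF M P G cU cZ]], force)
  have "smooth_on (\<phi> ` ?Q) (map_prod \<psi> \<zeta> \<circ> (\<lambda>p. (F p, G p)) \<circ> inv_into ?Q \<phi>)"
  proof (rule smooth_on_cong[OF o smooth_on_Pair[OF o s]])
    fix x assume "x \<in> \<phi> ` ?Q"
    then obtain q where q: "q \<in> ?Q" "x = \<phi> q" by auto
    then show "((\<psi> \<circ> F \<circ> inv_into U \<phi>) x, (\<zeta> \<circ> G \<circ> inv_into U \<phi>) x)
        = (map_prod \<psi> \<zeta> \<circ> (\<lambda>p. (F p, G p)) \<circ> inv_into ?Q \<phi>) x"
      using chart_of_inv[OF cU, of q] chart_of_inv[OF c q(1)] by simp
  qed
  moreover have "chart_of (prod_atlas N P) (V \<times> Z) (map_prod \<psi> \<zeta>)"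
    by (rule chart_of_atlas[OF smooth_atlas_prod[OF N P]]) (use V Z in \<open>auto simp: prod_atlas_iff\<close>)
  ultimately show "\<exists>U \<kappa> V \<psi>. chart_of M U \<kappa> \<and> chart_of (prod_atlas N P) V \<psi> \<and> p \<in> U \<and> U \<subseteq> W \<and>
      (\<lambda>p. (F p, G p)) ` U \<subseteq> V \<and> smooth_on (\<kappa> ` U) (\<psi> \<circ> (\<lambda>p. (F p, G p)) \<circ> inv_into U \<kappa>)"
    using c p U V Z
    by (intro exI[of _ ?Q] exI[of _ \<phi>] exI[of _ "V \<times> Z"] exI[of _ "map_prod \<psi> \<zeta>"]) auto
qed

lemma smooth_map_on_const:
  assumes M: "smooth_atlas M" and N: "smooth_atlas N" and W: "openin (mtopology M) W" and q: "q \<in> mcarrier N"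
  shows "smooth_map_on M N W (\<lambda>p. q)"
proof (rule smooth_map_onI[OF M N])
  fix p assume p: "p \<in> W"
  obtain U \<phi> where U: "(U, \<phi>) \<in> M" "p \<in> U"
    by (rule atlas_chart_exists[OF openin_mtopology_mcarrier[OF M W p]])
  obtain V \<psi> where V: "(V, \<psi>) \<in> N" "q \<in> V" by (rule atlas_chart_exists[OF q])
  note cU = chart_of_restrict[OF M chart_of_atlas[OF M U(1)] W]
  have "smooth_on (\<phi> ` (U \<inter> W)) (\<psi> \<circ> (\<lambda>p. q) \<circ> inv_into (U \<inter> W) \<phi>)"
    using smooth_on_const[OF chart_of_range_open[OF M cU]] by (simp add: o_def)
  then show "\<exists>U \<kappa> V \<psi>. chart_of M U \<kappa> \<and> chart_of N V \<psi> \<and> p \<in> U \<and> U \<subseteq> W \<and>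
      (\<lambda>p. q) ` U \<subseteq> V \<and> smooth_on (\<kappa> ` U) (\<psi> \<circ> (\<lambda>p. q) \<circ> inv_into U \<kappa>)"
    using cU p U V chart_of_atlas[OF N V(1)]
    by (intro exI[of _ "U \<inter> W"] exI[of _ \<phi>] exI[of _ V] exI[of _ \<psi>]) auto
qed

lemma smooth_map_on_ident:
  assumes M: "smooth_atlas M" and W: "openin (mtopology M) W"
  shows "smooth_map_on M M W (\<lambda>p. p)"
proof (rule smooth_map_onI[OF M M])
  fix p assume p: "p \<in> W"
  obtain U \<phi> where U: "(U, \<phi>) \<in> M" "p \<in> U"
    by (rule atlas_chart_exists[OF openin_mtopology_mcarrier[OF M W p]])
  note cU = chart_of_restrict[OF M chart_of_atlas[OF M U(1)] W]
  have "smooth_on (\<phi> ` (U \<inter> W)) (\<phi> \<circ> (\<lambda>p. p) \<circ> inv_into (U \<inter> W) \<phi>)"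
    by (rule smooth_on_cong[OF chart_of_range_open[OF M cU] smooth_on_id[OF chart_of_range_open[OF M cU]]])
      (use chart_of_inv[OF cU] in auto)
  then show "\<exists>U \<kappa> V \<psi>. chart_of M U \<kappa> \<and> chart_of M V \<psi> \<and> p \<in> U \<and> U \<subseteq> W \<and>
      (\<lambda>p. p) ` U \<subseteq> V \<and> smooth_on (\<kappa> ` U) (\<psi> \<circ> (\<lambda>p. p) \<circ> inv_into U \<kappa>)"
    using cU p U by (intro exI[of _ "U \<inter> W"] exI[of _ \<phi>] exI[of _ "U \<inter> W"] exI[of _ \<phi>]) auto
qed

lemma smooth_near_compose:
  assumes M: "smooth_atlas M" and N: "smooth_atlas N" and P: "smooth_atlas P"
    and F: "smooth_near M N S p F" and G: "smooth_near N P T (F p) G" and ST: "F ` S \<subseteq> T" "p \<in> S"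
  shows "smooth_near M P S p (\<lambda>q. G (F q))"
proof -
  obtain W F' where W: "p \<in> W" "smooth_map_on M N W F'" "openin (mtopology M) W"
    "\<forall>q\<in>S \<inter> W. F q = F' q" by (rule smooth_near_obtain[OF F])
  obtain V G' where V: "F p \<in> V" "smooth_map_on N P V G'" "openin (mtopology N) V"
    "\<forall>q\<in>T \<inter> V. G q = G' q" by (rule smooth_near_obtain[OF G])
  show ?thesis
  proof (rule smooth_nearI[OF _ smooth_map_on_compose[OF M N P W(2) V(2)]])
    show "p \<in> {p \<in> W. F' p \<in> V}" using W V ST by auto
    fix q assume q: "q \<in> S" "q \<in> {p \<in> W. F' p \<in> V}"
    then have "F q = F' q" "F q \<in> T" using W ST by auto
    then show "G (F q) = G' (F' q)" using V q by auto
  qed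
qed

lemma chart_direction_sum:
  assumes M: "smooth_atlas M" and U: "chart_of M U \<kappa>" "q \<in> U"
    and b: "\<And>b. b \<in> B \<Longrightarrow> chart_direction M S U \<kappa> q (u b) (\<xi> b)"
  shows "chart_direction M S U \<kappa> q (\<lambda>f. \<Sum>b\<in>B. a b * u b f) (\<Sum>b\<in>B. a b *\<^sub>R \<xi> b)"
  unfolding chart_direction_def
proof (intro conjI allI impI)
  fix f W f' assume W: "q \<in> W" "smooth_real_on M W f'" and e: "\<forall>q\<in>S \<inter> W. f q = f' q"
  let ?D = "frechet_derivative (f' \<circ> inv_into U \<kappa>) (at (\<kappa> q))"
  have l: "linear ?D"
    by (rule has_derivative_linear[OF smooth_on_has_derivative[OF smooth_real_on_chart[OF M W(2) U(1)]]])
      (use U W in auto)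
  have "u b f = ?D (\<xi> b)" if "b \<in> B" for b
    by (rule chart_directionD[OF b[OF that] W]) (use e in auto)
  then show "(\<Sum>b\<in>B. a b * u b f) = ?D (\<Sum>b\<in>B. a b *\<^sub>R \<xi> b)"
    by (simp add: linear_sum[OF l] linear_scale[OF l])
next
  fix f assume f: "\<not> smooth_fun M S q f"
  have "u b f = 0" if "b \<in> B" for b using b[OF that] f unfolding chart_direction_def by blast
  then show "(\<Sum>b\<in>B. a b * u b f) = 0" by simp
qed

lemma frechet_derivative_cong:
  assumes "(f has_derivative f') (at x)" "open S" "x \<in> S" "\<And>y. y \<in> S \<Longrightarrow> f y = g y"
  shows "frechet_derivative g (at x) = frechet_derivative f (at x)"
  using frechet_derivative_at[OF assms(1)]
    frechet_derivative_at[OF has_derivative_transform_within_open[OF assms]] by simp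

lemma smooth_coordinate:
  fixes M :: "('p, 'e::real_inner) atlas"
  assumes "smooth_atlas M" "chart_of M U \<kappa>"
  shows "smooth_real_on M U (\<lambda>q. \<kappa> q \<bullet> b)"
  by (rule smooth_real_on_chartI[OF assms
        smooth_on_bounded_linear[OF chart_of_range_open[OF assms] bounded_linear_inner_left]])

lemma chart_direction_coordinate:
  fixes M :: "('p, 'e::real_inner) atlas"
  assumes M: "smooth_atlas M" and cU: "chart_of M U \<kappa>" and d: "chart_direction M S U \<kappa> q v \<xi>" and q: "q \<in> U"
  shows "v (\<lambda>r. \<kappa> r \<bullet> b) = \<xi> \<bullet> b"
proof -
  have "v (\<lambda>r. \<kappa> r \<bullet> b) = frechet_derivative ((\<lambda>r. \<kappa> r \<bullet> b) \<circ> inv_into U \<kappa>) (at (\<kappa> q)) \<xi>"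
    by (rule chart_directionD[OF d q smooth_coordinate[OF M cU]]) simp
  moreover have "((\<lambda>e. e \<bullet> b) has_derivative (\<lambda>e. e \<bullet> b)) (at (\<kappa> q))"
    by (rule bounded_linear_imp_has_derivative[OF bounded_linear_inner_left])
  then have "(((\<lambda>r. \<kappa> r \<bullet> b) \<circ> inv_into U \<kappa>) has_derivative (\<lambda>e. e \<bullet> b)) (at (\<kappa> q))"
    by (rule has_derivative_transform_within_open[OF _ chart_of_range_open[OF M cU]])
      (use q chart_of_inv[OF cU] in auto)
  ultimately show ?thesis using frechet_derivative_at by metis
qed

text \<open>Smoothness is meant in the manifold of arrows, across fibres and not only along one;
  this is the class of fields on which \<open>src_fibre_metric\<close> controls the metric.\<close>

definition vertical_field ::
  "('g, 'b, 'e::real_normed_vector, 'f) groupoid_data \<Rightarrow> 'g set \<Rightarrow> ('g \<Rightarrow> 'g tvec) \<Rightarrow> bool" where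
  "vertical_field \<G> W V \<longleftrightarrow> openin (mtopology (arr \<G>)) W \<and> (\<forall>g\<in>W. V g \<in> src_tangent \<G> g \<and>
     (\<forall>f. smooth_fun (arr \<G>) (arrows \<G>) g f \<longrightarrow> smooth_fun (arr \<G>) (arrows \<G>) g (\<lambda>h. V h f)))"

lemma lie_groupoid_atlas:
  assumes "lie_groupoid \<G>" shows "smooth_atlas (arr \<G>)" "smooth_atlas (obj \<G>)" "groupoid \<G>"
  using assms unfolding lie_groupoid_def smooth_manifold_def by auto

lemma src_fibre_subset: "src_fibre \<G> x \<subseteq> arrows \<G>"
  unfolding src_fibre_def by blast

text \<open>A function smooth along the fibre is extended to \<open>f'\<close> on an open set of
  arrows, differentiated there, and restricted. Nothing depends on the extension, since
  \<open>V q\<close> sees only values on the fibre.\<close>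

lemma vertical_field_vector_field:
  assumes M: "smooth_atlas (arr \<G>)" and V: "vertical_field \<G> W V"
  shows "vector_field (arr \<G>) (src_fibre \<G> x) (W \<inter> src_fibre \<G> x) V"
  unfolding vector_field_def
proof (intro conjI ballI allI impI)
  let ?S = "src_fibre \<G> x"
  have W: "openin (mtopology (arr \<G>)) W" using V unfolding vertical_field_def by blast
  then show "openin (subtopology (mtopology (arr \<G>)) ?S) (W \<inter> ?S)" unfolding openin_subtopology by blast
  have VT: "V q \<in> tangent_space (arr \<G>) ?S q" if "q \<in> W \<inter> ?S" for q
    using V that unfolding vertical_field_def src_tangent_def src_fibre_def by auto
  fix p assume p: "p \<in> W \<inter> ?S"
  show "V p \<in> tangent_space (arr \<G>) ?S p" by (rule VT[OF p])
  fix f assume f: "smooth_fun (arr \<G>) ?S p f"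
  obtain W' f' where W': "p \<in> W'" "smooth_real_on (arr \<G>) W' f'" "openin (mtopology (arr \<G>)) W'"
    "\<forall>q\<in>?S \<inter> W'. f q = f' q" by (rule smooth_near_obtain[OF f])
  have "smooth_fun (arr \<G>) (arrows \<G>) p f'" by (rule smooth_nearI[OF W'(1,2)]) simp
  then have "smooth_fun (arr \<G>) (arrows \<G>) p (\<lambda>h. V h f')" using V p unfolding vertical_field_def by blast
  then have "smooth_fun (arr \<G>) ?S p (\<lambda>h. V h f')" by (rule smooth_near_mono[OF _ src_fibre_subset])
  then show "smooth_fun (arr \<G>) ?S p (\<lambda>q. V q f)"
  proof (rule smooth_near_cong[OF M smooth_atlas_real _ openin_mtopology_Int[OF W W'(3)]])
    fix q assume q: "q \<in> ?S" "q \<in> W \<inter> W'"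
    show "V q f' = V q f"
      by (rule tangent_cong[OF M VT W'(3)]) (use q W' in auto)
  qed (use p W' in auto)
qed

text \<open>The indices form an orthonormal basis of the kernel of \<open>A\<close>; orthonormality
  makes the functions \<open>\<kappa> q \<bullet> b\<close> dual to the coordinate fields. The frame
  does not depend on the fibre, so that it is smooth on an open set of arrows.\<close>

theorem vertical_frame:
  fixes \<G> :: "('g, 'b, 'e::euclidean_space, 'f::real_normed_vector) groupoid_data"
  assumes G: "lie_groupoid \<G>" and p: "p \<in> arrows \<G>"
  obtains W and I :: "'e set" and E x where "p \<in> W" "openin (mtopology (arr \<G>)) W"
    "\<forall>i\<in>I. vertical_field \<G> W (E i)"
    "\<forall>y. local_frame (arr \<G>) (src_fibre \<G> y) (W \<inter> src_fibre \<G> y) I E x"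
proof -
  let ?M = "arr \<G>"
  note M = lie_groupoid_atlas(1)[OF G] and N = lie_groupoid_atlas(2)[OF G]
  have "submersion ?M (obj \<G>) (src \<G>)" using G unfolding lie_groupoid_def by blast
  from submersion_slice_chart[OF M N this p] obtain U \<kappa> and A :: "'e \<Rightarrow> 'f" where
    cU: "chart_of ?M U \<kappa>" and pU: "p \<in> U" and lA: "linear A"
    and sA: "\<And>q r. q \<in> U \<Longrightarrow> r \<in> U \<Longrightarrow> src \<G> q = src \<G> r \<longleftrightarrow> A (\<kappa> q) = A (\<kappa> r)" by metis
  note oU = chart_of_openin[OF cU]
  have oK: "open (\<kappa> ` U)" by (rule chart_of_range_open[OF M cU])
  have UM: "q \<in> arrows \<G>" if "q \<in> U" for q by (rule openin_mtopology_mcarrier[OF M oU that])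
  let ?L = "{\<xi>. A \<xi> = 0}"
  have subL: "subspace ?L" by (auto simp: subspace_def linear_0[OF lA] linear_add[OF lA] linear_scale[OF lA])
  obtain I where I: "I \<subseteq> ?L" "pairwise orthogonal I" "\<And>x. x \<in> I \<Longrightarrow> norm x = 1" "independent I" "span I = ?L"
    using orthonormal_basis_subspace[OF subL] by metis
  have fI: "finite I" using I(4) by (rule independent_imp_finite)
  define E where "E b q = velocity ?M (src_fibre \<G> (src \<G> q)) (\<lambda>t. inv_into U \<kappa> (\<kappa> q + t *\<^sub>R b))" for b q
  define x where "x b q = \<kappa> q \<bullet> b" for b q
  have line: "velocity ?M (src_fibre \<G> y) (\<lambda>t. inv_into U \<kappa> (\<kappa> q + t *\<^sub>R \<xi>)) \<in> tangent_space ?M (src_fibre \<G> y) q"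
     "chart_direction ?M (src_fibre \<G> y) U \<kappa> q (velocity ?M (src_fibre \<G> y) (\<lambda>t. inv_into U \<kappa> (\<kappa> q + t *\<^sub>R \<xi>))) \<xi>"
    if q: "q \<in> U" "src \<G> q = y" and \<xi>: "A \<xi> = 0" for q y \<xi>
  proof -
    obtain \<epsilon> where e: "\<epsilon> > 0" "\<And>t. \<bar>t\<bar> < \<epsilon> \<Longrightarrow> \<kappa> q + t *\<^sub>R \<xi> \<in> \<kappa> ` U"
      by (rule small_line[OF oK, of "\<kappa> q" \<xi>]) (use q in auto)
    have "\<kappa> q + t *\<^sub>R \<xi> \<in> \<kappa> ` U \<and> inv_into U \<kappa> (\<kappa> q + t *\<^sub>R \<xi>) \<in> src_fibre \<G> y" if t: "\<bar>t\<bar> < \<epsilon>" for t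
    proof -
      let ?r = "inv_into U \<kappa> (\<kappa> q + t *\<^sub>R \<xi>)"
      have r: "?r \<in> U" "\<kappa> ?r = \<kappa> q + t *\<^sub>R \<xi>"
        using inv_into_into[OF e(2)[OF t]] f_inv_into_f[OF e(2)[OF t]] .
      have "A (\<kappa> ?r) = A (\<kappa> q)" unfolding r(2) using \<xi> by (simp add: linear_add[OF lA] linear_scale[OF lA])
      then have "src \<G> ?r = y" using sA[OF r(1) q(1)] q(2) by simp
      then show ?thesis using e(2)[OF t] UM[OF r(1)] by (simp add: src_fibre_def)
    qed
    then show "velocity ?M (src_fibre \<G> y) (\<lambda>t. inv_into U \<kappa> (\<kappa> q + t *\<^sub>R \<xi>)) \<in> tangent_space ?M (src_fibre \<G> y) q"
      "chart_direction ?M (src_fibre \<G> y) U \<kappa> q (velocity ?M (src_fibre \<G> y) (\<lambda>t. inv_into U \<kappa> (\<kappa> q + t *\<^sub>R \<xi>))) \<xi>"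
      using line_velocity[OF M cU q(1) e(1)] by blast+
  qed
  have ET: "E b q \<in> tangent_space ?M (src_fibre \<G> y) q" and Ed: "chart_direction ?M (src_fibre \<G> y) U \<kappa> q (E b q) b"
    if "q \<in> U" "src \<G> q = y" "b \<in> I" for b q y
    using line[OF that(1,2), of b] that I(1) unfolding E_def by auto
  have E_eval: "E b r f = frechet_derivative (f' \<circ> inv_into U \<kappa>) (at (\<kappa> r)) b"
    if "r \<in> U" "src \<G> r = y" "b \<in> I" "r \<in> W" "smooth_real_on ?M W f'" "\<And>q. q \<in> src_fibre \<G> y \<Longrightarrow> q \<in> W \<Longrightarrow> f q = f' q"
    for b r f f' W y
    by (rule chart_directionD[OF Ed[OF that(1-3)] that(4,5)]) (rule that(6))
  have deriv_smooth: "smooth_real_on ?M (U \<inter> W) (\<lambda>r. frechet_derivative (f' \<circ> inv_into U \<kappa>) (at (\<kappa> r)) b)"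
    if f': "smooth_real_on ?M W f'" for W f' b
    by (rule smooth_real_on_chartI[OF M chart_of_restrict[OF M cU smooth_map_on_domain[OF f']]
          smooth_on_frechet_derivative[OF smooth_real_on_chart[OF M f' cU]]])
  have vert: "vertical_field \<G> U (E b)" if b: "b \<in> I" for b
    unfolding vertical_field_def
  proof (intro conjI ballI allI impI)
    show "openin (mtopology ?M) U" by (rule oU)
    fix q assume q: "q \<in> U"
    show "E b q \<in> src_tangent \<G> q" unfolding src_tangent_def by (rule ET[OF q refl b])
    fix f assume f: "smooth_fun ?M (arrows \<G>) q f"
    obtain W where W: "q \<in> W" "openin (mtopology ?M) W" "smooth_real_on ?M W f"
      by (rule smooth_near_carrier[OF M smooth_atlas_real f])
    show "smooth_fun ?M (arrows \<G>) q (\<lambda>h. E b h f)"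
      by (rule smooth_nearI[OF _ deriv_smooth[OF W(3)]]) (use q W E_eval[OF _ refl b _ W(3)] in auto)
  qed
  have xs: "smooth_real_on ?M U (x b)" for b
    unfolding x_def by (rule smooth_coordinate[OF M cU])
  have x_eval: "v (x b) = \<xi> \<bullet> b" if "chart_direction ?M S U \<kappa> q v \<xi>" "q \<in> U" for v b \<xi> q S
    unfolding x_def by (rule chart_direction_coordinate[OF M cU that])
  \<comment> \<open>Along a curve in a fibre \<open>A (\<kappa> (c t))\<close> is constant, so its
    derivative \<open>A \<xi>\<close> is 0.\<close>
  have dirL: "\<exists>\<xi>. A \<xi> = 0 \<and> chart_direction ?M (src_fibre \<G> y) U \<kappa> q v \<xi>"
    if q: "q \<in> U" and v: "v \<in> tangent_space ?M (src_fibre \<G> y) q" for q y v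
  proof -
    obtain c where c: "smooth_curve ?M (src_fibre \<G> y) c" "c 0 = q" "v = velocity ?M (src_fibre \<G> y) c"
      using v unfolding tangent_space_def by blast
    have c0: "c 0 \<in> U" using c q by simp
    obtain \<xi> where \<xi>: "((\<lambda>t. \<kappa> (c t)) has_vector_derivative \<xi>) (at 0)"
      "chart_direction ?M (src_fibre \<G> y) U \<kappa> (c 0) (velocity ?M (src_fibre \<G> y) c) \<xi>"
      by (rule velocity_chart_direction[OF M c(1) cU c0])
    obtain \<epsilon> where e: "\<epsilon> > 0" and s: "smooth_map_on vector_atlas ?M {-\<epsilon><..<\<epsilon>} c"
      and cS: "c ` {-\<epsilon><..<\<epsilon>} \<subseteq> src_fibre \<G> y" using c unfolding smooth_curve_def by blast
    have o: "open {t \<in> {-\<epsilon><..<\<epsilon>}. c t \<in> U}"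
      using smooth_map_on_openin[OF smooth_atlas_real M s oU] by (simp add: openin_vector_real)
    have blA: "bounded_linear A" by (rule finite_dim_linear_bounded[OF finite_dim_euclidean lA])
    have "((\<lambda>t. A (\<kappa> (c t))) has_vector_derivative A \<xi>) (at 0)"
      by (rule bounded_linear.has_vector_derivative[OF blA \<xi>(1)])
    moreover have "((\<lambda>t. A (\<kappa> (c t))) has_vector_derivative 0) (at 0)"
    proof (rule has_vector_derivative_transform_within_open[OF has_vector_derivative_const o])
      fix t assume t: "t \<in> {t \<in> {-\<epsilon><..<\<epsilon>}. c t \<in> U}"
      then have "src \<G> (c t) = src \<G> (c 0)" using cS e by (auto simp: src_fibre_def image_subset_iff)
      then show "A (\<kappa> (c 0)) = A (\<kappa> (c t))" using sA[of "c t" "c 0"] t c0 by auto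
    qed (use e c0 in auto)
    ultimately have "A \<xi> = 0" using vector_derivative_unique_at by blast
    then show ?thesis using \<xi>(2) c by auto
  qed
  have frame: "local_frame ?M (src_fibre \<G> y) (U \<inter> src_fibre \<G> y) I E x" for y
    unfolding local_frame_def
  proof (intro conjI ballI allI impI)
    let ?S = "src_fibre \<G> y"
    show "finite I" by (rule fI)
    show "vector_field ?M ?S (U \<inter> ?S) (E i)" if "i \<in> I" for i
      by (rule vertical_field_vector_field[OF M vert[OF that]])
    show "smooth_funs_on ?M ?S (U \<inter> ?S) (x i)" for i
      unfolding smooth_funs_on_def by (intro ballI smooth_nearI[OF _ xs]) auto
    fix q assume "q \<in> U \<inter> ?S"
    then have q: "q \<in> U" "src \<G> q = y" "q \<in> ?S" unfolding src_fibre_def by auto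
    show "(\<lambda>f. \<Sum>i\<in>I. a i * E i q f) \<in> tangent_space ?M ?S q" for a
    proof -
      let ?\<xi> = "\<Sum>i\<in>I. a i *\<^sub>R i"
      have "?\<xi> \<in> span I" by (intro span_sum span_scale span_base)
      then have "A ?\<xi> = 0" using I(5) by blast
      note l = line[OF q(1,2) this]
      \<comment> \<open>The combination and the coordinate line along \<open>?\<xi>\<close> have the
        same direction, hence are the same functional; the line stays in the fibre because
        \<open>?\<xi>\<close> lies in the kernel of \<open>A\<close>.\<close>
      have "chart_direction ?M ?S U \<kappa> q (\<lambda>f. \<Sum>i\<in>I. a i * E i q f) ?\<xi>"
        by (rule chart_direction_sum[OF M cU q(1) Ed[OF q(1,2)]])
      then have "(\<lambda>f. \<Sum>i\<in>I. a i * E i q f) = velocity ?M ?S (\<lambda>t. inv_into U \<kappa> (\<kappa> q + t *\<^sub>R ?\<xi>))"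
        by (rule chart_direction_unique[OF _ l(2)])
      then show ?thesis using l(1) by simp
    qed
    show "v f = (\<Sum>i\<in>I. v (x i) * E i q f)" if v: "v \<in> tangent_space ?M ?S q" for v f
    proof -
      obtain \<xi> where \<xi>: "A \<xi> = 0" "chart_direction ?M ?S U \<kappa> q v \<xi>" using dirL[OF q(1) v] by blast
      have "\<xi> \<in> span I" using \<xi>(1) I(5) by blast
      then have "(\<Sum>b\<in>I. (\<xi> \<bullet> b) *\<^sub>R b) = \<xi>" by (intro orthonormal_basis_expand I(2,3) fI)
      then have "chart_direction ?M ?S U \<kappa> q (\<lambda>f. \<Sum>i\<in>I. (\<xi> \<bullet> i) * E i q f) \<xi>"
        using chart_direction_sum[OF M cU q(1) Ed[OF q(1,2)], of I "\<lambda>i. i" "\<lambda>i. \<xi> \<bullet> i"] by simp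
      from chart_direction_unique[OF \<xi>(2) this] have "v f = (\<Sum>i\<in>I. (\<xi> \<bullet> i) * E i q f)" by simp
      then show ?thesis by (simp only: x_eval[OF \<xi>(2) q(1)])
    qed
    fix i j assume i: "i \<in> I" and j: "j \<in> I"
    show "E i q (x j) = (if i = j then 1 else 0)"
      unfolding x_eval[OF Ed[OF q(1,2) i] q(1)]
      using I(2) I(3)[OF i] i j by (auto simp: pairwise_def orthogonal_def norm_eq_1)
    fix f assume f: "smooth_fun ?M ?S q f"
    obtain W f' where W: "q \<in> W" "smooth_real_on ?M W f'" "openin (mtopology ?M) W"
      "\<forall>q\<in>?S \<inter> W. f q = f' q" by (rule smooth_near_obtain[OF f])
    let ?F = "f' \<circ> inv_into U \<kappa>"
    have sF: "smooth_on (\<kappa> ` (U \<inter> W)) ?F" by (rule smooth_real_on_chart[OF M W(2) cU])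
    have oF: "open (\<kappa> ` (U \<inter> W))" by (rule chart_of_image_open[OF M cU W(3)])
    have qF: "\<kappa> q \<in> \<kappa> ` (U \<inter> W)" using q W by auto
    \<comment> \<open>In the chart both iterated derivatives are second directional derivatives of
      one function, so symmetry of second derivatives gives commutation.\<close>
    have second: "E k q (\<lambda>r. E l r f) = frechet_derivative (\<lambda>e. frechet_derivative ?F (at e) l) (at (\<kappa> q)) k"
      if k: "k \<in> I" and l: "l \<in> I" for k l
    proof -
      let ?h = "\<lambda>e. frechet_derivative ?F (at e) l"
      have "E k q (\<lambda>r. E l r f) = frechet_derivative ((\<lambda>r. ?h (\<kappa> r)) \<circ> inv_into U \<kappa>) (at (\<kappa> q)) k"
      proof (rule E_eval[OF q(1,2) k _ deriv_smooth[OF W(2)]])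
        fix r assume r: "r \<in> ?S" "r \<in> U \<inter> W"
        then have "src \<G> r = y" unfolding src_fibre_def by simp
        then show "E l r f = ?h (\<kappa> r)" using r W by (intro E_eval[OF _ _ l _ W(2)]) auto
      qed (use q W in auto)
      also have "frechet_derivative ((\<lambda>r. ?h (\<kappa> r)) \<circ> inv_into U \<kappa>) (at (\<kappa> q)) = frechet_derivative ?h (at (\<kappa> q))"
        by (rule frechet_derivative_cong[OF smooth_on_has_derivative[OF smooth_on_frechet_derivative[OF sF] qF] oF qF])
          (use chart_of_inv[OF cU] in auto)
      finally show ?thesis .
    qed
    show "E i q (\<lambda>r. E j r f) = E j q (\<lambda>r. E i r f)"
      unfolding second[OF i j] second[OF j i] by (rule second_derivative_symmetric[OF oF sF qF])
  qed
  show thesis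
    by (rule that[OF pU oU, of I E x]) (use vert frame in blast)+
qed

lemma src_fibre_framed:
  fixes \<G> :: "('g, 'b, 'e::euclidean_space, 'f::real_normed_vector) groupoid_data"
  assumes G: "lie_groupoid \<G>" shows "framed (arr \<G>) (src_fibre \<G> y)"
proof
  show "smooth_atlas (arr \<G>)" by (rule lie_groupoid_atlas(1)[OF G])
  fix p assume p: "p \<in> src_fibre \<G> y"
  then have "p \<in> arrows \<G>" unfolding src_fibre_def by blast
  then obtain W and I :: "'e set" and E x where W: "p \<in> W" "openin (mtopology (arr \<G>)) W"
    "\<forall>y. local_frame (arr \<G>) (src_fibre \<G> y) (W \<inter> src_fibre \<G> y) I E x"
    by (rule vertical_frame[OF G])
  have "openin (subtopology (mtopology (arr \<G>)) (src_fibre \<G> y)) (W \<inter> src_fibre \<G> y)"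
    using W(2) unfolding openin_subtopology by blast
  then show "\<exists>W (I :: 'e set) E x. p \<in> W \<and>
      openin (subtopology (mtopology (arr \<G>)) (src_fibre \<G> y)) W \<and> local_frame (arr \<G>) (src_fibre \<G> y) W I E x"
    using W p by (intro exI[of _ "W \<inter> src_fibre \<G> y"] exI[of _ I] exI[of _ E] exI[of _ x]) auto
qed

lemma src_fibre_metric_inner:
  assumes "src_fibre_metric \<G> m" "p \<in> src_fibre \<G> y"
  shows "inner_product_on (tangent_space (arr \<G>) (src_fibre \<G> y) p) (m p)"
  using assms unfolding src_fibre_metric_def src_fibre_def src_tangent_def by auto

lemma src_fibre_metric_smooth:
  assumes "src_fibre_metric \<G> m" "vertical_field \<G> W V" "vertical_field \<G> W V'" "g \<in> W"
  shows "smooth_fun (arr \<G>) (arrows \<G>) g (\<lambda>h. m h (V h) (V' h))"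
proof -
  have "openin (mtopology (arr \<G>)) W \<and> (\<forall>g\<in>W. V g \<in> src_tangent \<G> g \<and> V' g \<in> src_tangent \<G> g) \<and>
      (\<forall>g\<in>W. \<forall>f. smooth_fun (arr \<G>) (arrows \<G>) g f \<longrightarrow>
         smooth_fun (arr \<G>) (arrows \<G>) g (\<lambda>h. V h f) \<and> smooth_fun (arr \<G>) (arrows \<G>) g (\<lambda>h. V' h f))"
    using assms(2,3) unfolding vertical_field_def by simp
  with assms(1) have "\<forall>g\<in>W. smooth_fun (arr \<G>) (arrows \<G>) g (\<lambda>h. m h (V h) (V' h))"
    unfolding src_fibre_metric_def by (elim conjE allE[of _ W] allE[of _ V] allE[of _ V'] impE) simp_all
  then show ?thesis using assms(4) by blast
qed

text \<open>The assumption on the metric concerns vertical fields on open sets of arrows. Fields of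
  a single fibre are expanded in a vertical frame: the Gram matrix of the frame is smooth across
  fibres, and the coefficients are smooth along this one.\<close>

lemma src_fibre_riemannian:
  fixes \<G> :: "('g, 'b, 'e::euclidean_space, 'f::real_normed_vector) groupoid_data"
  assumes G: "lie_groupoid \<G>" and m: "src_fibre_metric \<G> m"
  shows "riemannian (arr \<G>) (src_fibre \<G> y) m"
proof -
  let ?M = "arr \<G>" and ?S = "src_fibre \<G> y"
  interpret framed ?M ?S by (rule src_fibre_framed[OF G])
  interpret fibre_metric ?M ?S m by unfold_locales (rule src_fibre_metric_inner[OF m])
  show ?thesis
  proof
    fix W Y Z assume Y: "VF W Y" and Z: "VF W Z"
    show "SF W (\<lambda>q. m q (Y q) (Z q))"
      unfolding smooth_funs_on_def
    proof
      fix p assume p: "p \<in> W"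
      have pS: "p \<in> ?S" by (rule VF_S[OF Y p])
      have pM: "p \<in> arrows \<G>" using pS unfolding src_fibre_def by blast
      obtain V and I :: "'e set" and E x where V: "p \<in> V" "openin (mtopology ?M) V"
        "\<forall>i\<in>I. vertical_field \<G> V (E i)"
        "\<forall>y. local_frame ?M (src_fibre \<G> y) (V \<inter> src_fibre \<G> y) I E x"
        by (rule vertical_frame[OF G pM])
      have fr: "local_frame ?M ?S (V \<inter> ?S) I E x" using V(4) by blast
      have o: "opn (W \<inter> (V \<inter> ?S))"
        using V(2) by (intro opn_Int[OF VF_open[OF Y]]) (auto simp: openin_subtopology)
      have pV: "p \<in> W \<inter> (V \<inter> ?S)" using p pS V by auto
      have fI: "finite I" by (rule local_frame_finite[OF fr])
      have xC: "C p (x i)" if "i \<in> I" for i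
        using local_frame_SF[OF fr that] pV unfolding smooth_funs_on_def by blast
      have mE: "C p (\<lambda>q. m q (E i q) (E j q))" if "i \<in> I" "j \<in> I" for i j
        by (rule smooth_near_mono[OF src_fibre_metric_smooth[OF m _ _ V(1)] src_fibre_subset])
          (use V(3) that in auto)
      have "C p (\<lambda>q. \<Sum>i\<in>I. Y q (x i) * (\<Sum>j\<in>I. Z q (x j) * m q (E i q) (E j q)))"
        by (intro C_sum[OF pM] C_times VF_C[OF Y p] VF_C[OF Z p] xC mE)
      then show "C p (\<lambda>q. m q (Y q) (Z q))"
      proof (rule C_cong[OF _ o pV])
        fix q assume q: "q \<in> W \<inter> (V \<inter> ?S)"
        then have qW: "q \<in> W" and qV: "q \<in> V \<inter> ?S" by auto
        have ET: "E i q \<in> T q" if "i \<in> I" for i by (rule VF_T[OF local_frame_VF[OF fr that] qV])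
        note YT = VF_T[OF Y qW] and ZT = VF_T[OF Z qW]
        have Ye: "Y q = (\<lambda>f. \<Sum>i\<in>I. Y q (x i) * E i q f)" by (rule ext) (rule frame_expansion[OF fr qV YT])
        have Ze: "Z q = (\<lambda>f. \<Sum>i\<in>I. Z q (x i) * E i q f)" by (rule ext) (rule frame_expansion[OF fr qV ZT])
        have mZ: "m q w (Z q) = (\<Sum>j\<in>I. Z q (x j) * m q w (E j q))" if w: "w \<in> T q" for w
        proof -
          from arg_cong[OF Ze, of "\<lambda>u. m q u w"]
          have "m q (Z q) w = (\<Sum>j\<in>I. Z q (x j) * m q (E j q) w)"
            by (rule trans) (rule m_sum_left[OF fI ET w])
          then show ?thesis using m_sym[OF ZT w] m_sym[OF ET w] by simp
        qed
        from arg_cong[OF Ye, of "\<lambda>u. m q u (Z q)"]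
        have "m q (Y q) (Z q) = (\<Sum>i\<in>I. Y q (x i) * m q (E i q) (Z q))"
          by (rule trans) (rule m_sum_left[OF fI ET ZT])
        then show "(\<Sum>i\<in>I. Y q (x i) * (\<Sum>j\<in>I. Z q (x j) * m q (E i q) (E j q))) = m q (Y q) (Z q)"
          by (simp add: mZ[OF ET])
      qed
    qed
  qed
qed

section \<open>Right translation\<close>

context riemannian
begin

text \<open>The Leibniz term of \<open>[X, h A]\<close> cancels the one from differentiating
  \<open>m q (h A) Z\<close>, so the expression is tensorial in \<open>A\<close> and the Riesz
  argument applies.\<close>

lemma adjoint_exists:
  assumes X: "VF W X" and Z: "VF W Z" and p: "p \<in> W"
  shows "\<exists>w. w \<in> T p \<and> (\<forall>V A. p \<in> V \<longrightarrow> V \<subseteq> W \<longrightarrow> VF V A \<longrightarrow>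
      X p (ip A Z) - m p (br X A p) (Z p) = m p w (A p))"
proof (rule tensor_riesz[where \<Phi>="\<lambda>A. X p (ip A Z) - m p (br X A p) (Z p)", OF _ _ _ VF_open[OF X] p])
  fix V A B assume a: "p \<in> V" "V \<subseteq> W" "VF V A" "VF V B"
  note X' = VF_restrict[OF X VF_open[OF a(3)] a(2)] and Z' = VF_restrict[OF Z VF_open[OF a(3)] a(2)]
  note ZT = VF_T[OF Z' a(1)] and S = VF_tadd[OF a(3,4)]
  have "m p (br (\<lambda>q. tadd (A q) (B q)) X p) (Z p) = m p (br A X p) (Z p) + m p (br B X p) (Z p)"
    unfolding br_tadd[OF a(3,4) X' a(1)] by (rule m_add_left[OF br_T[OF a(3) X' a(1)] br_T[OF a(4) X' a(1)] ZT])
  then have "m p (br X (\<lambda>q. tadd (A q) (B q)) p) (Z p) = m p (br X A p) (Z p) + m p (br X B p) (Z p)"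
    using m_br_swap[OF X' S a(1) ZT] m_br_swap[OF X' a(3,1) ZT] m_br_swap[OF X' a(4,1) ZT] by simp
  moreover have "X p (ip (\<lambda>q. tadd (A q) (B q)) Z) = X p (ip A Z) + X p (ip B Z)"
    using d_ip_add[OF X' Z' a(3,4,1)] d_ip_swap[OF X' S Z' a(1)] d_ip_swap[OF X' a(3) Z' a(1)]
      d_ip_swap[OF X' a(4) Z' a(1)] by simp
  ultimately show "X p (ip (\<lambda>q. tadd (A q) (B q)) Z) - m p (br X (\<lambda>q. tadd (A q) (B q)) p) (Z p) =
      (X p (ip A Z) - m p (br X A p) (Z p)) + (X p (ip B Z) - m p (br X B p) (Z p))" by simp
next
  fix V A h assume a: "p \<in> V" "V \<subseteq> W" "VF V A" "SF V h"
  note X' = VF_restrict[OF X VF_open[OF a(3)] a(2)] and Z' = VF_restrict[OF Z VF_open[OF a(3)] a(2)]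
  note ZT = VF_T[OF Z' a(1)] and S = VF_tscale[OF a(3,4)] and AT = VF_T[OF a(3,1)]
  have "m p (br (\<lambda>q. tscale (h q) (A q)) X p) (Z p)
      = m p (tscale (h p) (br A X p)) (Z p) + m p (tscale (-1) (tscale (X p h) (A p))) (Z p)"
    unfolding br_tscale[OF a(3) X' a(4,1)] by (intro m_add_left T_tscale br_T[OF a(3) X' a(1)] AT ZT)
  then have "m p (br X (\<lambda>q. tscale (h q) (A q)) p) (Z p)
      = h p * m p (br X A p) (Z p) + X p h * m p (A p) (Z p)"
    using m_br_swap[OF X' S a(1) ZT] m_br_swap[OF X' a(3,1) ZT] m_scale_left[OF br_T[OF a(3) X' a(1)] ZT]
      m_scale_left[OF T_tscale[OF AT] ZT, of "-1"] m_scale_left[OF AT ZT] by simp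
  moreover have "X p (ip (\<lambda>q. tscale (h q) (A q)) Z) = h p * X p (ip A Z) + X p h * m p (A p) (Z p)"
    using d_ip_scale[OF X' Z' a(3,4,1)] d_ip_swap[OF X' S Z' a(1)] d_ip_swap[OF X' a(3) Z' a(1)]
      m_sym[OF AT ZT] by simp
  ultimately show "X p (ip (\<lambda>q. tscale (h q) (A q)) Z) - m p (br X (\<lambda>q. tscale (h q) (A q)) p) (Z p) =
      h p * (X p (ip A Z) - m p (br X A p) (Z p))" by (simp add: algebra_simps)
next
  fix V A B assume a: "p \<in> V" "V \<subseteq> W" "VF V A" and e: "\<And>q. q \<in> V \<Longrightarrow> A q = B q"
  note X' = VF_restrict[OF X VF_open[OF a(3)] a(2)]
  have "X p (ip A Z) = X p (ip B Z)"
    by (rule T_cong[OF VF_T[OF X' a(1)] VF_open[OF a(3)] a(1)]) (simp add: e)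
  moreover have "br X A p = br X B p" by (rule br_cong[OF X' a(3,1) refl e])
  ultimately show "X p (ip A Z) - m p (br X A p) (Z p) = X p (ip B Z) - m p (br X B p) (Z p)" by simp
qed

end

text \<open>The image of a curve is again a curve once its interval is shrunk to where a smooth
  extension of \<open>F\<close> is available.\<close>

lemma tangent_pushforward:
  assumes M: "smooth_atlas M" and P: "smooth_atlas P" and F: "smooth_near M P S p F" and ST: "F ` S \<subseteq> T"
    and v: "v \<in> tangent_space M S p"
  shows "pushforward P T F (F p) v \<in> tangent_space P T (F p)"
proof -
  obtain c where c: "smooth_curve M S c" "c 0 = p" "v = velocity M S c"
    using v unfolding tangent_space_def by blast
  obtain \<epsilon> where e: "\<epsilon> > 0" and s: "smooth_map_on vector_atlas M {-\<epsilon><..<\<epsilon>} c"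
    and cS: "c ` {-\<epsilon><..<\<epsilon>} \<subseteq> S" using c unfolding smooth_curve_def by blast
  obtain W F' where W: "p \<in> W" "smooth_map_on M P W F'" "openin (mtopology M) W"
    "\<forall>q\<in>S \<inter> W. F q = F' q" by (rule smooth_near_obtain[OF F])
  let ?J = "{t \<in> {-\<epsilon><..<\<epsilon>}. c t \<in> W}"
  have s': "smooth_map_on vector_atlas P ?J (\<lambda>t. F' (c t))"
    by (rule smooth_map_on_compose[OF smooth_atlas_real M P s W(2)])
  then have "open ?J" using smooth_map_on_domain openin_vector_real by blast
  moreover have "0 \<in> ?J" using e c W by auto
  ultimately obtain \<delta> where d: "\<delta> > 0" "ball 0 \<delta> \<subseteq> ?J" using openE by blast
  have b: "ball 0 \<delta> = {-\<delta><..<\<delta>}" by (auto simp: dist_real_def)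
  have "smooth_map_on vector_atlas P {-\<delta><..<\<delta>} (\<lambda>t. F' (c t))"
    by (rule smooth_map_on_subset[OF smooth_atlas_real P s']) (use d b in \<open>auto simp: openin_vector_real\<close>)
  then have "smooth_map_on vector_atlas P {-\<delta><..<\<delta>} (\<lambda>t. F (c t))"
  proof (rule smooth_map_on_cong[OF smooth_atlas_real P])
    fix t assume "t \<in> {-\<delta><..<\<delta>}"
    then have "c t \<in> S \<inter> W" using cS d b by blast
    then show "F' (c t) = F (c t)" using W(4) by simp
  qed
  moreover have "c ` {-\<delta><..<\<delta>} \<subseteq> S" using cS d b by blast
  then have "(\<lambda>t. F (c t)) ` {-\<delta><..<\<delta>} \<subseteq> T" using ST by blast
  ultimately have curve: "smooth_curve P T (\<lambda>t. F (c t))" unfolding smooth_curve_def using d(1) by blast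
  have "pushforward P T F (F p) v = velocity P T (\<lambda>t. F (c t))"
  proof
    fix f
    show "pushforward P T F (F p) v f = velocity P T (\<lambda>t. F (c t)) f"
    proof (cases "smooth_fun P T (F p) f")
      case True
      have "smooth_fun M S p (\<lambda>q. f (F q))"
        by (rule smooth_near_compose[OF M P smooth_atlas_real F True ST tangent_point(1)[OF M v]])
      then show ?thesis using True c by (simp add: pushforward_def velocity_def o_def)
    qed (use c in \<open>simp add: pushforward_def velocity_def\<close>)
  qed
  then show ?thesis unfolding tangent_space_def using curve c(2) by blast
qed

lemma frechet_derivative_partial:
  fixes \<Phi> :: "'a::real_normed_vector \<times> 'b::real_normed_vector \<Rightarrow> 'c::real_normed_vector"
  assumes "(\<Phi> has_derivative \<Phi>') (at (a, b))"
  shows "((\<lambda>e. \<Phi> (e, b)) has_derivative (\<lambda>\<eta>. \<Phi>' (\<eta>, 0))) (at a)"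
proof -
  have "((\<lambda>e. (e, b)) has_derivative (\<lambda>\<eta>. (\<eta>, 0))) (at a)"
    by (intro derivative_intros)
  from has_derivative_compose[OF this assms] show ?thesis .
qed

locale lie_groupoid_locale =
  fixes \<G> :: "('g, 'b, 'e::euclidean_space, 'f::real_normed_vector) groupoid_data"
  assumes lie: "lie_groupoid \<G>"
begin

abbreviation M where "M \<equiv> arr \<G>"
abbreviation N where "N \<equiv> obj \<G>"
abbreviation S where "S \<equiv> src_fibre \<G>"
abbreviation rext where "rext \<equiv> right_inv_ext \<G>"

lemmas M = lie_groupoid_atlas(1)[OF lie] and N = lie_groupoid_atlas(2)[OF lie]
  and gpd = lie_groupoid_atlas(3)[OF lie]

section \<open>Groupoid identities and right multiplication\<close>

lemma S_iff: "k \<in> S x \<longleftrightarrow> k \<in> arrows \<G> \<and> src \<G> k = x"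
  unfolding src_fibre_def by blast

lemma src_obj: "g \<in> arrows \<G> \<Longrightarrow> src \<G> g \<in> objects \<G>"
  and trg_obj: "g \<in> arrows \<G> \<Longrightarrow> trg \<G> g \<in> objects \<G>"
  and id_arr: "x \<in> objects \<G> \<Longrightarrow> ident \<G> x \<in> arrows \<G>"
  and src_id: "x \<in> objects \<G> \<Longrightarrow> src \<G> (ident \<G> x) = x"
  and trg_id: "x \<in> objects \<G> \<Longrightarrow> trg \<G> (ident \<G> x) = x"
  and mul_idr: "g \<in> arrows \<G> \<Longrightarrow> mul \<G> g (ident \<G> (src \<G> g)) = g"
  and mul_idl: "g \<in> arrows \<G> \<Longrightarrow> mul \<G> (ident \<G> (trg \<G> g)) g = g"
  and inv_arr: "g \<in> arrows \<G> \<Longrightarrow> ginv \<G> g \<in> arrows \<G>"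
  and src_inv: "g \<in> arrows \<G> \<Longrightarrow> src \<G> (ginv \<G> g) = trg \<G> g"
  and trg_inv: "g \<in> arrows \<G> \<Longrightarrow> trg \<G> (ginv \<G> g) = src \<G> g"
  and mul_invl: "g \<in> arrows \<G> \<Longrightarrow> mul \<G> (ginv \<G> g) g = ident \<G> (src \<G> g)"
  and mul_invr: "g \<in> arrows \<G> \<Longrightarrow> mul \<G> g (ginv \<G> g) = ident \<G> (trg \<G> g)"
  using gpd unfolding groupoid_def by blast+

lemma mul_S: "h \<in> arrows \<G> \<Longrightarrow> k \<in> S (trg \<G> h) \<Longrightarrow> mul \<G> k h \<in> S (src \<G> h)"
  and trg_mul: "h \<in> arrows \<G> \<Longrightarrow> k \<in> S (trg \<G> h) \<Longrightarrow> trg \<G> (mul \<G> k h) = trg \<G> k"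
  using gpd unfolding groupoid_def composable_def S_iff by blast+

lemma mul_assoc:
  "h2 \<in> arrows \<G> \<Longrightarrow> h1 \<in> S (trg \<G> h2) \<Longrightarrow> k \<in> S (trg \<G> h1) \<Longrightarrow>
    mul \<G> (mul \<G> k h1) h2 = mul \<G> k (mul \<G> h1 h2)"
  using gpd unfolding groupoid_def composable_def S_iff by blast

lemma id_S: "x \<in> objects \<G> \<Longrightarrow> ident \<G> x \<in> S x"
  by (simp add: S_iff id_arr src_id)

lemma trg_near: "h \<in> arrows \<G> \<Longrightarrow> smooth_near M N (arrows \<G>) h (trg \<G>)"
proof -
  assume h: "h \<in> arrows \<G>"
  have "submersion M N (trg \<G>)" using lie unfolding lie_groupoid_def by (elim conjE)
  then show ?thesis using h unfolding submersion_def smooth_map_def by (elim conjE) (erule bspec)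
qed

lemma ident_near: "x \<in> objects \<G> \<Longrightarrow> smooth_near N M (objects \<G>) x (ident \<G>)"
proof -
  assume x: "x \<in> objects \<G>"
  have "smooth_map N (objects \<G>) M (arrows \<G>) (ident \<G>)" using lie unfolding lie_groupoid_def by (elim conjE)
  then show ?thesis using x unfolding smooth_map_def by (elim conjE) (erule bspec)
qed

lemma arrows_open: "openin (mtopology M) (arrows \<G>)"
  using topspace_mtopology[OF M] openin_topspace by metis

text \<open>Smoothness of multiplication on composable pairs means a local smooth map
  \<open>F\<close> on the product manifold. Away from composable pairs \<open>F\<close> is
  arbitrary, so it may replace the product only where the product is defined.\<close>

lemma mul_extension:
  assumes "h \<in> arrows \<G>" "k \<in> S (trg \<G> h)"
  obtains W F where "(k, h) \<in> W" "smooth_map_on (prod_atlas M M) M W F"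
    "\<And>k' h'. (k', h') \<in> W \<Longrightarrow> h' \<in> arrows \<G> \<Longrightarrow> k' \<in> S (trg \<G> h') \<Longrightarrow> mul \<G> k' h' = F (k', h')"
proof -
  have "(k, h) \<in> composable \<G>" using assms by (simp add: composable_def S_iff)
  then have n: "smooth_near (prod_atlas M M) M (composable \<G>) (k, h) (\<lambda>(h, g). mul \<G> h g)"
  proof -
    have "smooth_map (prod_atlas M M) (composable \<G>) M (arrows \<G>) (\<lambda>(h, g). mul \<G> h g)"
      using lie unfolding lie_groupoid_def by (elim conjE)
    then show ?thesis using \<open>(k, h) \<in> composable \<G>\<close> unfolding smooth_map_def by (elim conjE) (erule bspec)
  qed
  obtain W F where W: "(k, h) \<in> W" "smooth_map_on (prod_atlas M M) M W F" "openin (mtopology (prod_atlas M M)) W"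
    "\<forall>z\<in>composable \<G> \<inter> W. (\<lambda>(h, g). mul \<G> h g) z = F z" by (rule smooth_near_obtain[OF n])
  show thesis
  proof (rule that[OF W(1,2)])
    fix k' h' assume "(k', h') \<in> W" "h' \<in> arrows \<G>" "k' \<in> S (trg \<G> h')"
    then have "(k', h') \<in> composable \<G> \<inter> W" by (simp add: composable_def S_iff)
    from bspec[OF W(4) this] show "mul \<G> k' h' = F (k', h')" by simp
  qed
qed

lemma include_smooth:
  assumes "h \<in> arrows \<G>"
  shows "smooth_map_on M (prod_atlas M M) (arrows \<G>) (\<lambda>k. (k, h))"
  by (intro smooth_map_on_Pair M smooth_map_on_ident arrows_open smooth_map_on_const assms)

lemma right_mul_near:
  assumes h: "h \<in> arrows \<G>" and k: "k \<in> S (trg \<G> h)"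
  shows "smooth_near M M (S (trg \<G> h)) k (\<lambda>k. mul \<G> k h)"
proof -
  obtain W F where W: "(k, h) \<in> W" "smooth_map_on (prod_atlas M M) M W F"
    and eq: "\<And>k' h'. (k', h') \<in> W \<Longrightarrow> h' \<in> arrows \<G> \<Longrightarrow> k' \<in> S (trg \<G> h') \<Longrightarrow> mul \<G> k' h' = F (k', h')"
    by (rule mul_extension[OF h k], rule that)
  show ?thesis
    by (rule smooth_nearI[OF _ smooth_map_on_compose[OF M smooth_atlas_prod[OF M M] M include_smooth[OF h] W(2)]])
      (use W(1) k h eq in \<open>auto simp: S_iff\<close>)
qed

lemma right_mul_fun:
  assumes h: "h \<in> arrows \<G>" and k: "k \<in> S (trg \<G> h)" and f: "smooth_fun M (S (src \<G> h)) (mul \<G> k h) f"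
  shows "smooth_fun M (S (trg \<G> h)) k (\<lambda>k. f (mul \<G> k h))"
  by (rule smooth_near_compose[OF M M smooth_atlas_real right_mul_near[OF h k] f _ k]) (use mul_S[OF h] in blast)

lemma dR_T:
  assumes h: "h \<in> arrows \<G>" and k: "k \<in> S (trg \<G> h)" and v: "v \<in> tangent_space M (S (trg \<G> h)) k"
  shows "dR \<G> h k v \<in> tangent_space M (S (src \<G> h)) (mul \<G> k h)"
  unfolding dR_def
  by (rule tangent_pushforward[OF M M right_mul_near[OF h k] _ v]) (use mul_S[OF h] in blast)

lemma mul_mul_inv:
  assumes h: "h \<in> arrows \<G>" and j: "j \<in> S (src \<G> h)"
  shows "mul \<G> (mul \<G> j (ginv \<G> h)) h = j"
proof -
  have "mul \<G> (mul \<G> j (ginv \<G> h)) h = mul \<G> j (mul \<G> (ginv \<G> h) h)"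
    by (rule mul_assoc) (use h j in \<open>simp_all add: S_iff inv_arr src_inv trg_inv\<close>)
  then show ?thesis using mul_invl[OF h] mul_idr[of j] j by (simp add: S_iff)
qed

text \<open>Right multiplication is a diffeomorphism, so both sides vanish when \<open>f\<close> is not smooth.\<close>

lemma dR_eval:
  assumes h: "h \<in> arrows \<G>" and k: "k \<in> S (trg \<G> h)" and v: "v \<in> tangent_space M (S (trg \<G> h)) k"
  shows "dR \<G> h k v f = v (\<lambda>k. f (mul \<G> k h))"
proof (cases "smooth_fun M (S (src \<G> h)) (mul \<G> k h) f")
  case True
  then show ?thesis by (simp add: dR_def pushforward_def o_def)
next
  case False
  have "\<not> smooth_fun M (S (trg \<G> h)) k (\<lambda>k. f (mul \<G> k h))"
  proof
    assume s: "smooth_fun M (S (trg \<G> h)) k (\<lambda>k. f (mul \<G> k h))"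
    have kh: "mul \<G> k h \<in> S (src \<G> h)" by (rule mul_S[OF h k])
    have i: "mul \<G> (mul \<G> k h) (ginv \<G> h) = k"
    proof -
      have "mul \<G> (mul \<G> k h) (ginv \<G> h) = mul \<G> k (mul \<G> h (ginv \<G> h))"
        by (rule mul_assoc) (use h k in \<open>simp_all add: S_iff inv_arr trg_inv\<close>)
      then show ?thesis using mul_invr[OF h] mul_idr[of k] k by (simp add: S_iff)
    qed
    have "smooth_fun M (S (trg \<G> (ginv \<G> h))) (mul \<G> k h) (\<lambda>j. f (mul \<G> (mul \<G> j (ginv \<G> h)) h))"
      by (rule right_mul_fun[OF inv_arr[OF h], where f="\<lambda>k. f (mul \<G> k h)"])
        (use s kh i h in \<open>simp_all add: src_inv trg_inv\<close>)
    then have "smooth_fun M (S (src \<G> h)) (mul \<G> k h) f"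
      unfolding trg_inv[OF h]
      by (rule smooth_near_cong[OF M smooth_atlas_real _ arrows_open])
        (use kh mul_mul_inv[OF h] in \<open>auto simp: S_iff\<close>)
    then show False using False by blast
  qed
  then show ?thesis using False tangent_not_smooth[OF v] by (simp add: dR_def pushforward_def)
qed

text \<open>Functoriality of right translation: associativity evaluated inside a tangent vector.
  Taking one factor to be an inverse gives the inverse maps of \<open>transport\<close>.\<close>

lemma dR_comp:
  assumes h2: "h2 \<in> arrows \<G>" and h1: "h1 \<in> S (trg \<G> h2)" and k: "k \<in> S (trg \<G> h1)"
    and v: "v \<in> tangent_space M (S (trg \<G> h1)) k"
  shows "dR \<G> h2 (mul \<G> k h1) (dR \<G> h1 k v) = dR \<G> (mul \<G> h1 h2) k v"
proof
  fix f
  have h1a: "h1 \<in> arrows \<G>" and s: "src \<G> h1 = trg \<G> h2" using h1 by (simp_all add: S_iff)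
  have m12: "mul \<G> h1 h2 \<in> arrows \<G>" "trg \<G> (mul \<G> h1 h2) = trg \<G> h1"
    using mul_S[OF h2 h1] trg_mul[OF h2 h1] by (simp_all add: S_iff)
  have "dR \<G> h2 (mul \<G> k h1) (dR \<G> h1 k v) f = v (\<lambda>k. f (mul \<G> (mul \<G> k h1) h2))"
    using dR_eval[OF h2, of "mul \<G> k h1" "dR \<G> h1 k v" f] mul_S[OF h1a k] dR_T[OF h1a k v]
      dR_eval[OF h1a k v] s by simp
  also have "\<dots> = v (\<lambda>k. f (mul \<G> k (mul \<G> h1 h2)))"
    by (rule tangent_cong[OF M v arrows_open])
      (use k mul_assoc[OF h2 h1] in \<open>auto simp: S_iff\<close>)
  also have "\<dots> = dR \<G> (mul \<G> h1 h2) k v f"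
    using dR_eval[OF m12(1), of k v f] k v m12(2) by simp
  finally show "dR \<G> h2 (mul \<G> k h1) (dR \<G> h1 k v) f = dR \<G> (mul \<G> h1 h2) k v f" .
qed

lemma dR_id:
  assumes k: "k \<in> arrows \<G>" and v: "v \<in> tangent_space M (S (src \<G> k)) k"
  shows "dR \<G> (ident \<G> (src \<G> k)) k v = v"
proof
  fix f
  note x = src_obj[OF k]
  have "dR \<G> (ident \<G> (src \<G> k)) k v f = v (\<lambda>j. f (mul \<G> j (ident \<G> (src \<G> k))))"
    by (rule dR_eval) (use v k x in \<open>simp_all add: id_arr trg_id S_iff\<close>)
  also have "\<dots> = v f"
    by (rule tangent_cong[OF M v arrows_open k]) (metis S_iff mul_idr)
  finally show "dR \<G> (ident \<G> (src \<G> k)) k v f = v f" .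
qed

lemma fibre_eq: "x \<in> objects \<G> \<Longrightarrow> algebroid_fibre \<G> x = tangent_space M (S x) (ident \<G> x)"
  by (simp add: algebroid_fibre_def src_tangent_def src_id)

text \<open>Identifies the algebroid fibre at \<open>trg g\<close> with the vertical tangent space
  at \<open>g\<close>; the inverse is \<open>dR\<close> of the inverse arrow.\<close>

definition transport :: "'g \<Rightarrow> 'g tvec \<Rightarrow> 'g tvec" where
  "transport g = dR \<G> g (ident \<G> (trg \<G> g))"

lemma transport_T:
  assumes g: "g \<in> arrows \<G>" and v: "v \<in> algebroid_fibre \<G> (trg \<G> g)"
  shows "transport g v \<in> tangent_space M (S (src \<G> g)) g"
  using dR_T[OF g id_S[OF trg_obj[OF g]]] v mul_idl[OF g] fibre_eq[OF trg_obj[OF g]]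
  by (simp add: transport_def)

lemma transport_eval:
  assumes g: "g \<in> arrows \<G>" and v: "v \<in> algebroid_fibre \<G> (trg \<G> g)"
  shows "transport g v f = v (\<lambda>k. f (mul \<G> k g))"
  using dR_eval[OF g id_S[OF trg_obj[OF g]]] v fibre_eq[OF trg_obj[OF g]] by (simp add: transport_def)

lemma dR_inv_transport:
  assumes g: "g \<in> arrows \<G>" and v: "v \<in> algebroid_fibre \<G> (trg \<G> g)"
  shows "dR \<G> (ginv \<G> g) g (transport g v) = v"
proof -
  note y = trg_obj[OF g]
  have v': "v \<in> tangent_space M (S (trg \<G> g)) (ident \<G> (trg \<G> g))" using v fibre_eq[OF y] by simp
  have "dR \<G> (ginv \<G> g) (mul \<G> (ident \<G> (trg \<G> g)) g) (dR \<G> g (ident \<G> (trg \<G> g)) v)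
      = dR \<G> (mul \<G> g (ginv \<G> g)) (ident \<G> (trg \<G> g)) v"
    by (rule dR_comp[OF inv_arr[OF g] _ id_S[OF y] v']) (use g in \<open>simp add: S_iff trg_inv\<close>)
  then show ?thesis
    using mul_idl[OF g] mul_invr[OF g] dR_id[OF id_arr[OF y], of v] v' src_id[OF y]
    by (simp add: transport_def)
qed

lemma dR_inv_fibre:
  assumes g: "g \<in> arrows \<G>" and u: "u \<in> src_tangent \<G> g"
  shows "dR \<G> (ginv \<G> g) g u \<in> algebroid_fibre \<G> (trg \<G> g)"
  using dR_T[OF inv_arr[OF g], of g u] u g mul_invr[OF g] fibre_eq[OF trg_obj[OF g]]
  by (simp add: src_tangent_def S_iff trg_inv src_inv)

lemma transport_dR_inv:
  assumes g: "g \<in> arrows \<G>" and u: "u \<in> src_tangent \<G> g"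
  shows "transport g (dR \<G> (ginv \<G> g) g u) = u"
proof -
  have "dR \<G> g (mul \<G> g (ginv \<G> g)) (dR \<G> (ginv \<G> g) g u) = dR \<G> (mul \<G> (ginv \<G> g) g) g u"
    by (rule dR_comp[OF g]) (use g u in \<open>simp_all add: S_iff inv_arr src_inv trg_inv src_tangent_def\<close>)
  then show ?thesis
    using mul_invr[OF g] mul_invl[OF g] dR_id[OF g] u by (simp add: transport_def src_tangent_def)
qed

lemma rext_transport: "rext X g = transport g (X (trg \<G> g))"
  by (simp add: right_inv_ext_def transport_def)

lemma sectionD:
  assumes "algebroid_section \<G> U X"
  shows "openin (mtopology N) U" "x \<in> U \<Longrightarrow> X x \<in> algebroid_fibre \<G> x" "x \<in> U \<Longrightarrow> x \<in> objects \<G>"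
    "x \<in> U \<Longrightarrow> smooth_fun M (arrows \<G>) (ident \<G> x) f \<Longrightarrow> smooth_fun N (objects \<G>) x (\<lambda>z. X z f)"
  using assms openin_mtopology_mcarrier[OF N] unfolding algebroid_section_def by blast+

lemma section_subset:
  "algebroid_section \<G> U X \<Longrightarrow> openin (mtopology N) V \<Longrightarrow> V \<subseteq> U \<Longrightarrow> algebroid_section \<G> V X"
  unfolding algebroid_section_def by blast

lemma rext_ident:
  assumes "algebroid_section \<G> U X" "x \<in> U" shows "rext X (ident \<G> x) = X x"
proof -
  note x = sectionD(3)[OF assms]
  have "X x \<in> tangent_space M (S (src \<G> (ident \<G> x))) (ident \<G> x)"
    using sectionD(2)[OF assms] fibre_eq[OF x] src_id[OF x] by simp
  from dR_id[OF id_arr[OF x] this] show ?thesis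
    using src_id[OF x] trg_id[OF x] by (simp add: right_inv_ext_def)
qed

definition over :: "'b set \<Rightarrow> 'g set" where "over U = {h \<in> arrows \<G>. trg \<G> h \<in> U}"

lemma over_open:
  assumes U: "openin (mtopology N) U" shows "openin (mtopology M) (over U)"
proof -
  have "\<exists>T. openin (mtopology M) T \<and> h \<in> T \<and> T \<subseteq> over U" if h: "h \<in> over U" for h
  proof -
    have ha: "h \<in> arrows \<G>" "trg \<G> h \<in> U" using h unfolding over_def by auto
    obtain W where W: "h \<in> W" "openin (mtopology M) W" "smooth_map_on M N W (trg \<G>)"
      by (rule smooth_near_carrier[OF M N trg_near[OF ha(1)]])
    have "openin (mtopology M) {q \<in> W. trg \<G> q \<in> U}" by (rule smooth_map_on_openin[OF M N W(3) U])
    moreover have "{q \<in> W. trg \<G> q \<in> U} \<subseteq> over U"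
      using openin_mtopology_mcarrier[OF M W(2)] unfolding over_def by auto
    ultimately show ?thesis using W(1) ha(2) by (intro exI[of _ "{q \<in> W. trg \<G> q \<in> U}"]) simp
  qed
  then show ?thesis by (subst openin_subopen) blast
qed

text \<open>In charts around \<open>ident (trg h)\<close> and \<open>h\<close> the value \<open>rext X h f\<close> is the partial derivative of
  \<open>(k, h) \<mapsto> f (k h)\<close> in the first variable, along the components of \<open>X\<close> at \<open>trg h\<close>.\<close>

lemma rext_vertical:
  assumes X: "algebroid_section \<G> U X"
  shows "vertical_field \<G> (over U) (rext X)"
  unfolding vertical_field_def
proof (intro conjI ballI allI impI)
  show "openin (mtopology M) (over U)" by (rule over_open[OF sectionD(1)[OF X]])
  fix h0 assume h0: "h0 \<in> over U"
  then have h0a: "h0 \<in> arrows \<G>" "trg \<G> h0 \<in> U" unfolding over_def by auto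
  note y0 = trg_obj[OF h0a(1)]
  show "rext X h0 \<in> src_tangent \<G> h0"
    using transport_T[OF h0a(1) sectionD(2)[OF X h0a(2)]] by (simp add: rext_transport src_tangent_def)
  fix f assume f: "smooth_fun M (arrows \<G>) h0 f"
  obtain W1 where W1: "h0 \<in> W1" "openin (mtopology M) W1" "smooth_real_on M W1 f"
    by (rule smooth_near_carrier[OF M smooth_atlas_real f])
  let ?k0 = "ident \<G> (trg \<G> h0)" and ?P = "prod_atlas M M"
  note PA = smooth_atlas_prod[OF M M]
  obtain W F where W: "(?k0, h0) \<in> W" "smooth_map_on ?P M W F"
    and eq: "\<And>k' h'. (k', h') \<in> W \<Longrightarrow> h' \<in> arrows \<G> \<Longrightarrow> k' \<in> S (trg \<G> h') \<Longrightarrow> mul \<G> k' h' = F (k', h')"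
    by (rule mul_extension[OF h0a(1) id_S[OF y0]], rule that)
  have F0: "F (?k0, h0) = h0" using eq[OF W(1) h0a(1) id_S[OF y0]] mul_idl[OF h0a(1)] by simp
  let ?Q = "{z \<in> W. F z \<in> W1}"
  let ?\<Phi> = "\<lambda>z. f (F z)"
  have s\<Phi>: "smooth_real_on ?P ?Q ?\<Phi>" by (rule smooth_map_on_compose[OF PA M smooth_atlas_real W(2) W1(3)])
  note oQ = smooth_map_on_domain[OF s\<Phi>]
  obtain V1 \<phi>1 where V1: "(V1, \<phi>1) \<in> M" "?k0 \<in> V1" by (rule atlas_chart_exists[OF id_arr[OF y0]])
  obtain V2 \<phi>2 where V2: "(V2, \<phi>2) \<in> M" "h0 \<in> V2" by (rule atlas_chart_exists[OF h0a(1)])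
  note c1 = chart_of_atlas[OF M V1(1)] and c2 = chart_of_atlas[OF M V2(1)]
  let ?\<pi> = "map_prod \<phi>1 \<phi>2"
  have cP: "chart_of ?P (V1 \<times> V2) ?\<pi>"
    by (rule chart_of_atlas[OF PA]) (use V1 V2 in \<open>auto simp: prod_atlas_iff\<close>)
  let ?R = "(V1 \<times> V2) \<inter> ?Q"
  have cR: "chart_of ?P ?R ?\<pi>" by (rule chart_of_restrict[OF PA cP oQ])
  have oR: "open (?\<pi> ` ?R)" by (rule chart_of_range_open[OF PA cR])
  let ?F = "?\<Phi> \<circ> inv_into (V1 \<times> V2) ?\<pi>"
  have sF: "smooth_on (?\<pi> ` ?R) ?F" by (rule smooth_real_on_chart[OF PA s\<Phi> cP])
  \<comment> \<open>Linear coordinates at the unit: their values under \<open>X\<close> are the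
    components of \<open>X\<close>, and they are smooth test functions for the section.\<close>
  define y where "y b k = \<phi>1 k \<bullet> b" for b k
  define \<Psi> where "\<Psi> b z = frechet_derivative ?F (at (?\<pi> z)) (b, 0)" for b z
  have s\<Psi>: "smooth_real_on ?P ?R (\<Psi> b)" for b
    unfolding \<Psi>_def by (rule smooth_real_on_chartI[OF PA cR smooth_on_frechet_derivative[OF sF]])
  \<comment> \<open>The point \<open>(ident (trg h), h)\<close> at which the partial derivative is
    taken; its smooth dependence on \<open>h\<close> makes the formula smooth.\<close>
  let ?j = "\<lambda>h. (ident \<G> (trg \<G> h), h)"
  have nj: "smooth_near M ?P (arrows \<G>) h0 ?j"
  proof -
    have "smooth_near M M (arrows \<G>) h0 (\<lambda>h. ident \<G> (trg \<G> h))"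
      by (rule smooth_near_compose[OF M N M trg_near[OF h0a(1)] ident_near[OF y0] _ h0a(1)])
        (use trg_obj in blast)
    then obtain V where V: "h0 \<in> V" "openin (mtopology M) V" "smooth_map_on M M V (\<lambda>h. ident \<G> (trg \<G> h))"
      by (rule smooth_near_carrier[OF M M])
    show ?thesis
      by (rule smooth_nearI[OF V(1) smooth_map_on_Pair[OF M M M V(3) smooth_map_on_ident[OF M V(2)]]]) simp
  qed
  obtain V where V: "h0 \<in> V" "openin (mtopology M) V" "smooth_map_on M ?P V ?j"
    by (rule smooth_near_carrier[OF M PA nj])
  have jR: "?j h0 \<in> ?R" using V1 V2 W F0 W1 by simp
  let ?V = "{h \<in> V. ?j h \<in> ?R} \<inter> over U"
  have oV: "openin (mtopology M) ?V"
    by (rule openin_mtopology_Int[OF smooth_map_on_openin[OF M PA V(3) chart_of_openin[OF cR]]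
          over_open[OF sectionD(1)[OF X]]])
  have val: "rext X h f = (\<Sum>b\<in>Basis. X (trg \<G> h) (y b) * \<Psi> b (?j h))" if h: "h \<in> ?V" for h
  proof -
    have ha: "h \<in> arrows \<G>" "trg \<G> h \<in> U" using h unfolding over_def by auto
    let ?x = "trg \<G> h"
    let ?k = "ident \<G> ?x"
    have x: "?x \<in> objects \<G>" by (rule trg_obj[OF ha(1)])
    have XA: "X ?x \<in> algebroid_fibre \<G> ?x" by (rule sectionD(2)[OF X ha(2)])
    have XT: "X ?x \<in> tangent_space M (S ?x) ?k" using XA fibre_eq[OF x] by simp
    have kR: "(?k, h) \<in> ?R" using h by simp
    let ?I = "{k \<in> arrows \<G>. (k, h) \<in> ?R}"
    have sI: "smooth_real_on M {k \<in> arrows \<G>. (k, h) \<in> ?Q} (\<lambda>k. ?\<Phi> (k, h))"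
      by (rule smooth_map_on_compose[OF M PA smooth_atlas_real include_smooth[OF ha(1)] s\<Phi>])
    have oI: "openin (mtopology M) ?I"
      by (rule smooth_map_on_openin[OF M PA include_smooth[OF ha(1)] chart_of_openin[OF cR]])
    have "rext X h f = X ?x (\<lambda>k. f (mul \<G> k h))"
      unfolding rext_transport by (rule transport_eval[OF ha(1) XA])
    \<comment> \<open>\<open>X ?x\<close> is tangent to the source fibre over \<open>?x\<close>, so
      it sees only arrows \<open>k\<close> composable with \<open>h\<close>, where \<open>F\<close>
      is the product.\<close>
    also have "\<dots> = X ?x (\<lambda>k. ?\<Phi> (k, h))"
    proof (rule tangent_cong[OF M XT oI])
      show "?k \<in> ?I" using kR id_arr[OF x] by simp
      fix k assume "k \<in> S ?x" "k \<in> ?I"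
      then show "f (mul \<G> k h) = ?\<Phi> (k, h)" using eq[of k h] ha(1) by auto
    qed
    finally have 1: "rext X h f = X ?x (\<lambda>k. ?\<Phi> (k, h))" .
    have kV: "?k \<in> V1" "h \<in> V2" using kR by auto
    obtain \<xi> where \<xi>: "chart_direction M (S ?x) V1 \<phi>1 ?k (X ?x) \<xi>"
      by (rule tangent_chart_direction[OF M XT c1 kV(1)])
    have 2: "X ?x (\<lambda>k. ?\<Phi> (k, h)) = frechet_derivative ((\<lambda>k. ?\<Phi> (k, h)) \<circ> inv_into V1 \<phi>1) (at (\<phi>1 ?k)) \<xi>"
      by (rule chart_directionD[OF \<xi> _ sI]) (use kR id_arr[OF x] in auto)
    have dF: "(?F has_derivative frechet_derivative ?F (at (\<phi>1 ?k, \<phi>2 h))) (at (\<phi>1 ?k, \<phi>2 h))"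
      by (rule smooth_on_has_derivative[OF sF]) (use kR in force)
    have o1: "open (\<phi>1 ` V1)" by (rule chart_of_range_open[OF M c1])
    have "((\<lambda>k. ?\<Phi> (k, h)) \<circ> inv_into V1 \<phi>1 has_derivative
        (\<lambda>\<eta>. frechet_derivative ?F (at (\<phi>1 ?k, \<phi>2 h)) (\<eta>, 0))) (at (\<phi>1 ?k))"
    proof (rule has_derivative_transform_within_open[OF frechet_derivative_partial[OF dF] o1])
      fix e assume "e \<in> \<phi>1 ` V1"
      then obtain k where "k \<in> V1" "e = \<phi>1 k" by auto
      then show "?F (e, \<phi>2 h) = ((\<lambda>k. ?\<Phi> (k, h)) \<circ> inv_into V1 \<phi>1) e"
        using inv_into_map_prod[OF chart_of_inj[OF c1] chart_of_inj[OF c2] _ kV(2)] chart_of_inv[OF c1] by simp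
    qed (use kV in auto)
    then have 3: "frechet_derivative ((\<lambda>k. ?\<Phi> (k, h)) \<circ> inv_into V1 \<phi>1) (at (\<phi>1 ?k)) \<xi>
        = frechet_derivative ?F (at (\<phi>1 ?k, \<phi>2 h)) (\<xi>, 0)" using frechet_derivative_at by metis
    have l: "linear (frechet_derivative ?F (at (\<phi>1 ?k, \<phi>2 h)))" by (rule has_derivative_linear[OF dF])
    have "(\<xi>, 0) = (\<Sum>b\<in>Basis. (\<xi> \<bullet> b) *\<^sub>R (b, 0::'e))"
      by (simp add: prod_eq_iff fst_sum snd_sum euclidean_representation)
    then have "frechet_derivative ?F (at (\<phi>1 ?k, \<phi>2 h)) (\<xi>, 0)
        = (\<Sum>b\<in>Basis. (\<xi> \<bullet> b) * frechet_derivative ?F (at (\<phi>1 ?k, \<phi>2 h)) (b, 0))"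
      by (simp only: linear_sum[OF l] linear_scale[OF l] real_scaleR_def)
    moreover have "X ?x (y b) = \<xi> \<bullet> b" for b
      unfolding y_def by (rule chart_direction_coordinate[OF M c1 \<xi> kV(1)])
    ultimately show ?thesis using 1 2 3 by (simp add: \<Psi>_def)
  qed
  \<comment> \<open>Each summand is a component of the section pulled back by \<open>trg\<close>,
    times a partial derivative pulled back by \<open>?j\<close>.\<close>
  have "smooth_fun M (arrows \<G>) h0 (\<lambda>h. \<Sum>b\<in>Basis. X (trg \<G> h) (y b) * \<Psi> b (?j h))"
  proof (intro smooth_fun_sum[OF M h0a(1)] smooth_fun_mult[OF M])
    fix b
    have "smooth_fun M (arrows \<G>) ?k0 (y b)"
      unfolding y_def by (rule smooth_nearI[OF V1(2) smooth_coordinate[OF M c1]]) simp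
    then have "smooth_fun N (objects \<G>) (trg \<G> h0) (\<lambda>z. X z (y b))" by (rule sectionD(4)[OF X h0a(2)])
    then show "smooth_fun M (arrows \<G>) h0 (\<lambda>h. X (trg \<G> h) (y b))"
      by (rule smooth_near_compose[OF M N smooth_atlas_real trg_near[OF h0a(1)] _ _ h0a(1)]) (use trg_obj in blast)
    have "smooth_fun ?P UNIV (?j h0) (\<Psi> b)" by (rule smooth_nearI[OF jR s\<Psi>]) simp
    then show "smooth_fun M (arrows \<G>) h0 (\<lambda>h. \<Psi> b (?j h))"
      by (rule smooth_near_compose[OF M PA smooth_atlas_real nj _ _ h0a(1)]) simp
  qed
  then show "smooth_fun M (arrows \<G>) h0 (\<lambda>h. rext X h f)"
    by (rule smooth_near_cong[OF M smooth_atlas_real _ oV]) (use V(1) jR h0 val in auto)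
qed

end

section \<open>The curvature of a right-invariant metric\<close>

context lie_groupoid_locale
begin

lemma rext_VF:
  assumes "algebroid_section \<G> U X" shows "vector_field M (S x) (over U \<inter> S x) (rext X)"
  by (rule vertical_field_vector_field[OF M rext_vertical[OF assms]])

lemma over_ident: "x \<in> objects \<G> \<Longrightarrow> x \<in> U \<Longrightarrow> ident \<G> x \<in> over U"
  by (simp add: over_def id_arr trg_id)

text \<open>A vertical frame around the unit, with the coefficients of \<open>v\<close> kept
  constant, is pulled back along \<open>ident\<close>. Sections therefore realise every vector of a
  fibre, which is what uniqueness arguments by testing require.\<close>

lemma section_extension:
  assumes x: "x \<in> objects \<G>" and v: "v \<in> algebroid_fibre \<G> x"
  obtains U Y where "x \<in> U" "algebroid_section \<G> U Y" "Y x = v"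
proof -
  let ?p = "ident \<G> x"
  obtain W and I :: "'e set" and E z where W: "?p \<in> W" "openin (mtopology M) W"
    "\<forall>i\<in>I. vertical_field \<G> W (E i)"
    "\<forall>y. local_frame M (S y) (W \<inter> S y) I E z"
    by (rule vertical_frame[OF lie id_arr[OF x]])
  define V where "V q = (\<lambda>f. \<Sum>i\<in>I. v (z i) * E i q f)" for q
  have VT: "V q \<in> tangent_space M (S y) q" if "q \<in> W \<inter> S y" for q y
  proof -
    have "local_frame M (S y) (W \<inter> S y) I E z" using W(4) by blast
    then have "\<forall>a. (\<lambda>f. \<Sum>i\<in>I. a i * E i q f) \<in> tangent_space M (S y) q"
      using that unfolding local_frame_def by blast
    from spec[OF this, of "\<lambda>i. v (z i)"] show ?thesis unfolding V_def .
  qed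
  have Vp: "V ?p = v"
  proof
    fix f
    show "V ?p f = v f"
      unfolding V_def
      using framed.frame_expansion[OF src_fibre_framed[OF lie], of x "W \<inter> S x" I E z ?p v f]
        W(1,4) id_S[OF x] v fibre_eq[OF x] by simp
  qed
  obtain V0 where V0: "x \<in> V0" "openin (mtopology N) V0" "smooth_map_on N M V0 (ident \<G>)"
    by (rule smooth_near_carrier[OF N M ident_near[OF x]])
  let ?U = "{y \<in> V0. ident \<G> y \<in> W}"
  have oU: "openin (mtopology N) ?U" by (rule smooth_map_on_openin[OF N M V0(3) W(2)])
  have Uo: "y \<in> objects \<G>" if "y \<in> ?U" for y by (rule openin_mtopology_mcarrier[OF N oU that])
  show thesis
  proof (rule that[of ?U "\<lambda>y. V (ident \<G> y)"])
    show "x \<in> ?U" using V0 W by simp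
    show "V (ident \<G> x) = v" by (rule Vp)
    show "algebroid_section \<G> ?U (\<lambda>y. V (ident \<G> y))"
      unfolding algebroid_section_def
    proof (intro conjI ballI allI impI)
      show "openin (mtopology N) ?U" by (rule oU)
      fix y assume y: "y \<in> ?U"
      show "V (ident \<G> y) \<in> algebroid_fibre \<G> y"
        unfolding fibre_eq[OF Uo[OF y]] by (rule VT) (use y id_S[OF Uo[OF y]] in auto)
      fix f assume f: "smooth_fun M (arrows \<G>) (ident \<G> y) f"
      have "smooth_fun M (arrows \<G>) (ident \<G> y) (\<lambda>q. V q f)"
        unfolding V_def
      proof (intro smooth_fun_sum[OF M id_arr[OF Uo[OF y]]] smooth_fun_scale[OF M])
        fix i assume "i \<in> I"
        then show "smooth_fun M (arrows \<G>) (ident \<G> y) (\<lambda>q. E i q f)"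
          using W(3) y f unfolding vertical_field_def by blast
      qed
      then show "smooth_fun N (objects \<G>) y (\<lambda>y. V (ident \<G> y) f)"
        by (rule smooth_near_compose[OF N M smooth_atlas_real ident_near[OF Uo[OF y]] _ _ Uo[OF y]])
          (use id_arr in blast)
    qed
  qed
qed

lemma ad_fibre:
  assumes X: "algebroid_section \<G> U X" and Y: "algebroid_section \<G> U Y" and x: "x \<in> U"
  shows "ad \<G> X Y x \<in> algebroid_fibre \<G> x"
proof -
  note xo = sectionD(3)[OF X x]
  interpret framed M "S x" by (rule src_fibre_framed[OF lie])
  show ?thesis
    unfolding ad_def fibre_eq[OF xo]
    by (rule br_T[OF rext_VF[OF X] rext_VF[OF Y]]) (use over_ident[OF xo x] id_S[OF xo] in simp)
qed

text \<open>The bracket at \<open>z\<close> is taken in a fibre that moves with \<open>z\<close>. A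
  function smooth on arrows is smooth along all nearby fibres, so there the bracket is the
  commutator of two vertical fields: a smooth function of arrows, pulled back by
  \<open>ident\<close>.\<close>

lemma ad_section:
  assumes X: "algebroid_section \<G> U X" and Y: "algebroid_section \<G> U Y"
  shows "algebroid_section \<G> U (ad \<G> X Y)"
  unfolding algebroid_section_def
proof (intro conjI ballI allI impI)
  show "openin (mtopology N) U" by (rule sectionD(1)[OF X])
  fix x assume x: "x \<in> U"
  note xo = sectionD(3)[OF X x]
  show "ad \<G> X Y x \<in> algebroid_fibre \<G> x" by (rule ad_fibre[OF X Y x])
  fix f assume f: "smooth_fun M (arrows \<G>) (ident \<G> x) f"
  obtain W where W: "ident \<G> x \<in> W" "openin (mtopology M) W"
    "\<And>q. q \<in> W \<Longrightarrow> smooth_fun M (arrows \<G>) q f" by (rule smooth_near_open[OF f], rule that)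
  have v: "smooth_fun M (arrows \<G>) (ident \<G> x) (\<lambda>h. rext A h f')"
    if "algebroid_section \<G> U A" "smooth_fun M (arrows \<G>) (ident \<G> x) f'" for A f'
    using rext_vertical[OF that(1)] over_ident[OF xo x] that(2) unfolding vertical_field_def by blast
  have "smooth_fun M (arrows \<G>) (ident \<G> x) (\<lambda>h. rext X h (\<lambda>q. rext Y q f) - rext Y h (\<lambda>q. rext X q f))"
    by (intro smooth_fun_diff[OF M] v X Y f)
  then have s: "smooth_fun N (objects \<G>) x
      (\<lambda>z. rext X (ident \<G> z) (\<lambda>q. rext Y q f) - rext Y (ident \<G> z) (\<lambda>q. rext X q f))"
    by (rule smooth_near_compose[OF N M smooth_atlas_real ident_near[OF xo] _ _ xo]) (use id_arr in blast)
  obtain V where V: "x \<in> V" "openin (mtopology N) V" "smooth_map_on N M V (ident \<G>)"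
    by (rule smooth_near_carrier[OF N M ident_near[OF xo]])
  show "smooth_fun N (objects \<G>) x (\<lambda>z. ad \<G> X Y z f)"
  proof (rule smooth_near_cong[OF N smooth_atlas_real s smooth_map_on_openin[OF N M V(3) W(2)]])
    fix z assume "z \<in> {z \<in> V. ident \<G> z \<in> W}"
    then have "smooth_fun M (S z) (ident \<G> z) f"
      using smooth_near_mono[OF W(3) src_fibre_subset] by blast
    then show "rext X (ident \<G> z) (\<lambda>q. rext Y q f) - rext Y (ident \<G> z) (\<lambda>q. rext X q f) = ad \<G> X Y z f"
      by (simp add: ad_def lie_bracket_def)
  qed (use V W in auto)
qed

text \<open>Right invariance of the extension, from functoriality of \<open>dR\<close> applied to
  the unit at \<open>trg k\<close>, \<open>k\<close> and \<open>h\<close>.\<close>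

lemma rext_translate:
  assumes h: "h \<in> arrows \<G>" and k: "k \<in> S (trg \<G> h)" and Y: "Y (trg \<G> k) \<in> algebroid_fibre \<G> (trg \<G> k)"
  shows "rext Y (mul \<G> k h) = dR \<G> h k (rext Y k)"
proof -
  have ka: "k \<in> arrows \<G>" using k by (simp add: S_iff)
  note y = trg_obj[OF ka]
  have "dR \<G> h (mul \<G> (ident \<G> (trg \<G> k)) k) (dR \<G> k (ident \<G> (trg \<G> k)) (Y (trg \<G> k)))
      = dR \<G> (mul \<G> k h) (ident \<G> (trg \<G> k)) (Y (trg \<G> k))"
    by (rule dR_comp[OF h k id_S[OF y]]) (use Y fibre_eq[OF y] in simp)
  then show ?thesis
    using mul_idl[OF ka] trg_mul[OF h k] by (simp add: right_inv_ext_def)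
qed

text \<open>Right-invariant fields commute with translating functions, so iterated derivatives at
  \<open>h\<close> equal those of the translated function at the unit. Where \<open>f\<close> is not
  smooth both sides are 0.\<close>

lemma bracket_rext:
  assumes X: "algebroid_section \<G> U X" and Y: "algebroid_section \<G> U Y" and h: "h \<in> over U"
  shows "lie_bracket M (S (src \<G> h)) (rext X) (rext Y) h = rext (ad \<G> X Y) h"
proof
  fix f
  have ha: "h \<in> arrows \<G>" "trg \<G> h \<in> U" using h unfolding over_def by auto
  let ?y = "trg \<G> h"
  let ?p = "ident \<G> ?y"
  note y = trg_obj[OF ha(1)]
  have p: "?p \<in> S ?y" by (rule id_S[OF y])
  have adA: "ad \<G> X Y ?y \<in> algebroid_fibre \<G> ?y" by (rule ad_fibre[OF X Y ha(2)])
  have R: "rext (ad \<G> X Y) h f = ad \<G> X Y ?y (\<lambda>k. f (mul \<G> k h))"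
    unfolding rext_transport by (rule transport_eval[OF ha(1) adA])
  have step: "rext A h (\<lambda>q. rext B q f) = rext A ?p (\<lambda>k. rext B k (\<lambda>j. f (mul \<G> j h)))"
    if A: "algebroid_section \<G> U A" and B: "algebroid_section \<G> U B" for A B
  proof -
    have AA: "A ?y \<in> algebroid_fibre \<G> ?y" by (rule sectionD(2)[OF A ha(2)])
    then have AT: "A ?y \<in> tangent_space M (S ?y) ?p" using fibre_eq[OF y] by simp
    have "rext A h (\<lambda>q. rext B q f) = A ?y (\<lambda>k. rext B (mul \<G> k h) f)"
      unfolding rext_transport[of A] by (rule transport_eval[OF ha(1) AA])
    also have "\<dots> = A ?y (\<lambda>k. rext B k (\<lambda>j. f (mul \<G> j h)))"
    proof (rule tangent_cong[OF M AT over_open[OF sectionD(1)[OF A]]])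
      show "?p \<in> over U" by (rule over_ident[OF y ha(2)])
      fix k assume k: "k \<in> S ?y" "k \<in> over U"
      then have ka: "k \<in> arrows \<G>" "trg \<G> k \<in> U" "src \<G> k = ?y" unfolding over_def S_iff by auto
      have BA: "B (trg \<G> k) \<in> algebroid_fibre \<G> (trg \<G> k)" by (rule sectionD(2)[OF B ka(2)])
      have "rext B k \<in> tangent_space M (S ?y) k"
        using transport_T[OF ka(1) BA] ka(3) by (simp add: rext_transport)
      then show "rext B (mul \<G> k h) f = rext B k (\<lambda>j. f (mul \<G> j h))"
        unfolding rext_translate[where Y=B, OF ha(1) k(1) BA] by (rule dR_eval[OF ha(1) k(1)])
    qed
    finally show ?thesis using rext_ident[OF A ha(2)] by simp
  qed
  show "lie_bracket M (S (src \<G> h)) (rext X) (rext Y) h f = rext (ad \<G> X Y) h f"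
  proof (cases "smooth_fun M (S (src \<G> h)) h f")
    case True
    have "smooth_fun M (S ?y) ?p (\<lambda>k. f (mul \<G> k h))"
      by (rule right_mul_fun[OF ha(1) p]) (simp add: mul_idl[OF ha(1)] True)
    then show ?thesis unfolding R using True by (simp add: lie_bracket_def ad_def step[OF X Y] step[OF Y X])
  next
    case False
    have "rext (ad \<G> X Y) h \<in> tangent_space M (S (src \<G> h)) h"
      unfolding rext_transport by (rule transport_T[OF ha(1) adA])
    from tangent_not_smooth[OF this False] show ?thesis using False by (simp add: lie_bracket_def)
  qed
qed

text \<open>Since \<open>trg (k h) = trg k\<close>, translation by \<open>h\<close> does not affect
  functions of the target.\<close>

lemma rext_target:
  assumes X: "X (trg \<G> h) \<in> algebroid_fibre \<G> (trg \<G> h)" and h: "h \<in> arrows \<G>"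
    and \<phi>: "smooth_fun N (objects \<G>) (trg \<G> h) \<phi>"
  shows "rext X h (\<lambda>q. \<phi> (trg \<G> q)) = anchor \<G> X (trg \<G> h) \<phi>"
proof -
  note y = trg_obj[OF h]
  have "rext X h (\<lambda>q. \<phi> (trg \<G> q)) = X (trg \<G> h) (\<lambda>k. \<phi> (trg \<G> (mul \<G> k h)))"
    unfolding rext_transport by (rule transport_eval[OF h X])
  also have "\<dots> = X (trg \<G> h) (\<lambda>k. \<phi> (trg \<G> k))"
    by (rule tangent_cong[OF M _ arrows_open id_arr[OF y]])
      (use X fibre_eq[OF y] trg_mul[OF h] in auto)
  finally show ?thesis using \<phi> by (simp add: anchor_def pushforward_def o_def)
qed

context
  fixes m assumes rim: "right_invariant_metric \<G> m"
begin

abbreviation inner where "inner \<equiv> algebroid_inner \<G> m"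

section \<open>Metric quantities of right-invariant fields\<close>

lemma sfm: "src_fibre_metric \<G> m" using rim unfolding right_invariant_metric_def by blast

lemmas riem = src_fibre_riemannian[OF lie sfm]

lemma transport_isometry:
  assumes g: "g \<in> arrows \<G>" and a: "a \<in> algebroid_fibre \<G> (trg \<G> g)" and b: "b \<in> algebroid_fibre \<G> (trg \<G> g)"
  shows "m g (transport g a) (transport g b) = m (ident \<G> (trg \<G> g)) a b"
proof -
  have "transport g a \<in> src_tangent \<G> g" "transport g b \<in> src_tangent \<G> g"
    using transport_T[OF g a] transport_T[OF g b] by (simp_all add: src_tangent_def)
  then have "m g (transport g a) (transport g b) = m (ident \<G> (trg \<G> g))
      (dR \<G> (ginv \<G> g) g (transport g a)) (dR \<G> (ginv \<G> g) g (transport g b))"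
    using rim g unfolding right_invariant_metric_def by blast
  then show ?thesis by (simp add: dR_inv_transport[OF g a] dR_inv_transport[OF g b])
qed

lemma rext_inner:
  assumes X: "algebroid_section \<G> U X" and Y: "algebroid_section \<G> U Y" and h: "h \<in> over U"
  shows "m h (rext X h) (rext Y h) = inner X Y (trg \<G> h)"
proof -
  have ha: "h \<in> arrows \<G>" "trg \<G> h \<in> U" using h unfolding over_def by auto
  show ?thesis
    unfolding rext_transport algebroid_inner_def
    by (rule transport_isometry[OF ha(1) sectionD(2)[OF X ha(2)] sectionD(2)[OF Y ha(2)]])
qed

lemma inner_smooth:
  assumes X: "algebroid_section \<G> U X" and Y: "algebroid_section \<G> U Y" and x: "x \<in> U"
  shows "smooth_fun N (objects \<G>) x (inner X Y)"
proof -
  note xo = sectionD(3)[OF X x]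
  have "smooth_fun M (arrows \<G>) (ident \<G> x) (\<lambda>h. m h (rext X h) (rext Y h))"
    by (rule src_fibre_metric_smooth[OF sfm rext_vertical[OF X] rext_vertical[OF Y] over_ident[OF xo x]])
  then have "smooth_fun N (objects \<G>) x (\<lambda>z. m (ident \<G> z) (rext X (ident \<G> z)) (rext Y (ident \<G> z)))"
    by (rule smooth_near_compose[OF N M smooth_atlas_real ident_near[OF xo] _ _ xo]) (use id_arr in blast)
  then show ?thesis
    by (rule smooth_near_cong[OF N smooth_atlas_real _ sectionD(1)[OF X] x])
      (simp add: algebroid_inner_def rext_ident[OF X] rext_ident[OF Y])
qed

lemma rext_deriv_inner:
  assumes X: "algebroid_section \<G> U X" and Y: "algebroid_section \<G> U Y" and Z: "algebroid_section \<G> U Z"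
    and h: "h \<in> over U"
  shows "rext X h (\<lambda>q. m q (rext Y q) (rext Z q)) = anchor \<G> X (trg \<G> h) (inner Y Z)"
proof -
  have ha: "h \<in> arrows \<G>" "trg \<G> h \<in> U" using h unfolding over_def by auto
  have XA: "X (trg \<G> h) \<in> algebroid_fibre \<G> (trg \<G> h)" by (rule sectionD(2)[OF X ha(2)])
  have "rext X h \<in> tangent_space M (S (src \<G> h)) h"
    unfolding rext_transport by (rule transport_T[OF ha(1) XA])
  then have "rext X h (\<lambda>q. m q (rext Y q) (rext Z q)) = rext X h (\<lambda>q. inner Y Z (trg \<G> q))"
    by (rule tangent_cong[OF M _ over_open[OF sectionD(1)[OF X]] h rext_inner[OF Y Z]])
  also have "\<dots> = anchor \<G> X (trg \<G> h) (inner Y Z)"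
    by (rule rext_target[where X=X and h=h and \<phi>="inner Y Z", OF XA ha(1) inner_smooth[OF Y Z ha(2)]])
  finally show ?thesis .
qed

lemma bracket_inner:
  assumes X: "algebroid_section \<G> U X" and Y: "algebroid_section \<G> U Y" and Z: "algebroid_section \<G> U Z"
    and h: "h \<in> over U"
  shows "m h (lie_bracket M (S (src \<G> h)) (rext X) (rext Y) h) (rext Z h) = inner (ad \<G> X Y) Z (trg \<G> h)"
  unfolding bracket_rext[OF X Y h] by (rule rext_inner[OF ad_section[OF X Y] Z h])

text \<open>Existence comes from \<open>adjoint_exists\<close> for the right-invariant extensions in
  the fibre over \<open>x\<close>; uniqueness from the fact that sections reach every vector of the
  fibre and the metric is nondegenerate.\<close>

lemma ad_dagger_spec:
  assumes X: "algebroid_section \<G> U X" and Z: "algebroid_section \<G> U Z" and x: "x \<in> U"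
  shows "ad_dagger \<G> m X Z x \<in> algebroid_fibre \<G> x \<and>
    (\<forall>V Y. x \<in> V \<and> algebroid_section \<G> V Y \<longrightarrow> m (ident \<G> x) (Y x) (ad_dagger \<G> m X Z x) =
       anchor \<G> X x (inner Y Z) - inner (ad \<G> X Y) Z x)"
proof -
  interpret riemannian M "S x" m by (rule riem)
  note xo = sectionD(3)[OF X x]
  let ?p = "ident \<G> x" and ?W = "over U \<inter> S x"
  have p: "?p \<in> ?W" using over_ident[OF xo x] id_S[OF xo] by blast
  from adjoint_exists[OF rext_VF[OF X] rext_VF[OF Z] p] obtain w where w: "w \<in> T ?p"
    and riesz: "\<forall>V A. ?p \<in> V \<longrightarrow> V \<subseteq> ?W \<longrightarrow> VF V A \<longrightarrow>
      rext X ?p (ip A (rext Z)) - m ?p (br (rext X) A ?p) (rext Z ?p) = m ?p w (A ?p)"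
    by (elim exE conjE)
  let ?P = "\<lambda>w. w \<in> algebroid_fibre \<G> x \<and> (\<forall>V Y. x \<in> V \<and> algebroid_section \<G> V Y \<longrightarrow>
      m ?p (Y x) w = anchor \<G> X x (inner Y Z) - inner (ad \<G> X Y) Z x)"
  have eq: "m ?p (Y x) w = anchor \<G> X x (inner Y Z) - inner (ad \<G> X Y) Z x"
    if V: "x \<in> V" "algebroid_section \<G> V Y" for V Y
  proof -
    have o: "openin (mtopology N) (U \<inter> V)" by (rule openin_mtopology_Int[OF sectionD(1)[OF X] sectionD(1)[OF V(2)]])
    note X' = section_subset[OF X o Int_lower1] and Z' = section_subset[OF Z o Int_lower1]
      and Y' = section_subset[OF V(2) o Int_lower2]
    have xUV: "x \<in> U \<inter> V" using x V by blast
    have pO: "?p \<in> over (U \<inter> V)" by (rule over_ident[OF xo xUV])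
    have Yp: "rext Y ?p = Y x" by (rule rext_ident[OF V(2,1)])
    have YT: "Y x \<in> T ?p" using sectionD(2)[OF V(2,1)] fibre_eq[OF xo] by simp
    have "rext X ?p (ip (rext Y) (rext Z)) - m ?p (br (rext X) (rext Y) ?p) (rext Z ?p) = m ?p w (rext Y ?p)"
      by (rule riesz[rule_format, OF _ _ rext_VF[OF Y']]) (use pO id_S[OF xo] in \<open>auto simp: over_def\<close>)
    then show ?thesis
      using rext_deriv_inner[OF X' Y' Z' pO] bracket_inner[OF X' Y' Z' pO] m_sym[OF w YT]
        trg_id[OF xo] src_id[OF xo] Yp by simp
  qed
  have "\<exists>!w. ?P w"
  proof (rule ex1I[of _ w])
    show "?P w"
    proof (intro conjI allI impI, goal_cases)
      case 1
      then show ?case using w fibre_eq[OF xo] by simp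
    next
      case (2 V Y)
      then show ?case using eq[of V Y] by simp
    qed
    fix w' assume w': "?P w'"
    have w'T: "w' \<in> T ?p" using conjunct1[OF w'] fibre_eq[OF xo] by simp
    show "w' = w"
    proof (rule m_nondegenerate[OF w'T w])
      fix u assume u: "u \<in> T ?p"
      have "u \<in> algebroid_fibre \<G> x" using u fibre_eq[OF xo] by simp
      then obtain V Y where Y: "x \<in> V" "algebroid_section \<G> V Y" "Y x = u" by (rule section_extension[OF xo])
      have "m ?p u w' = m ?p u w"
        using conjunct2[OF w', rule_format, OF conjI[OF Y(1,2)]] eq[OF Y(1,2)] Y(3) by simp
      then show "m ?p w' u = m ?p w u" using m_sym[OF u w] m_sym[OF u w'T] by simp
    qed
  qed
  from theI'[OF this] show ?thesis unfolding ad_dagger_def .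
qed

text \<open>Of the three derivatives in the Koszul formula the one along the test section vanishes
  because \<open>X\<close> and \<open>Z\<close> have constant inner product. The other two pair with
  brackets to form the two adjoints, and the last bracket is \<open>ad X Z\<close>.\<close>

lemma connection_rext:
  assumes D: "is_levi_civita M (S (src \<G> g)) m D"
    and X: "algebroid_section \<G> U X" and Z: "algebroid_section \<G> U Z" and g: "g \<in> over U"
    and const: "\<And>x. x \<in> U \<Longrightarrow> inner X Z x = c"
  defines "y \<equiv> trg \<G> g"
  defines "w \<equiv> (\<lambda>f. (ad_dagger \<G> m X Z y f + ad_dagger \<G> m Z X y f + ad \<G> X Z y f) / 2)"
  shows "w \<in> algebroid_fibre \<G> y" "D (rext X) (rext Z) g = transport g w"
proof -
  interpret y: riemannian M "S y" m by (rule riem)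
  interpret riemannian M "S (src \<G> g)" m by (rule riem)
  have ga: "g \<in> arrows \<G>" "y \<in> U" using g unfolding over_def y_def by auto
  have yo: "y \<in> objects \<G>" by (rule sectionD(3)[OF X ga(2)])
  let ?p = "ident \<G> y"
  note a = ad_dagger_spec[OF X Z ga(2)] and b = ad_dagger_spec[OF Z X ga(2)]
  let ?a = "ad_dagger \<G> m X Z y" and ?b = "ad_dagger \<G> m Z X y" and ?c = "ad \<G> X Z y"
  have aT: "?a \<in> y.T ?p" "?b \<in> y.T ?p" "?c \<in> y.T ?p"
    using a b ad_fibre[OF X Z ga(2)] fibre_eq[OF yo] by auto
  have w_eq: "w = tscale (1/2) (tadd (tadd ?a ?b) ?c)" by (simp add: w_def tadd_def tscale_def)
  have wT: "w \<in> y.T ?p" unfolding w_eq by (intro y.T_tscale y.T_tadd aT)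
  then show wA: "w \<in> algebroid_fibre \<G> y" using fibre_eq[OF yo] by simp
  note tr = ga(1) wA[unfolded y_def]
  have gW: "g \<in> over U \<inter> S (src \<G> g)" using g ga(1) by (simp add: S_iff)
  note X' = rext_VF[OF X, of "src \<G> g"] and Z' = rext_VF[OF Z, of "src \<G> g"]
  show "D (rext X) (rext Z) g = transport g w"
  proof (rule m_nondegenerate[OF D_T[OF D X' Z' gW] transport_T[OF tr]])
    fix u assume u: "u \<in> T g"
    have uS: "u \<in> src_tangent \<G> g" using u by (simp add: src_tangent_def)
    obtain V Y where Y: "y \<in> V" "algebroid_section \<G> V Y" "Y y = dR \<G> (ginv \<G> g) g u"
      by (rule section_extension[OF yo dR_inv_fibre[OF ga(1) uS, folded y_def]])
    have o: "openin (mtopology N) (U \<inter> V)" by (rule openin_mtopology_Int[OF sectionD(1)[OF X] sectionD(1)[OF Y(2)]])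
    note X1 = section_subset[OF X o Int_lower1] and Z1 = section_subset[OF Z o Int_lower1]
      and Y1 = section_subset[OF Y(2) o Int_lower2]
    have yUV: "y \<in> U \<inter> V" using ga Y by blast
    have gO: "g \<in> over (U \<inter> V)" using ga yUV by (simp add: over_def y_def)
    have gW': "g \<in> over (U \<inter> V) \<inter> S (src \<G> g)" using gO ga(1) by (simp add: S_iff)
    have Yg: "rext Y g = u" unfolding rext_transport using Y(3) transport_dR_inv[OF ga(1) uS] by (simp add: y_def)
    have YA: "Y y \<in> algebroid_fibre \<G> y" by (rule sectionD(2)[OF Y(2,1)])
    have YT: "Y y \<in> y.T ?p" using YA fibre_eq[OF yo] by simp
    note VX = rext_VF[OF X1, of "src \<G> g"] and VZ = rext_VF[OF Z1, of "src \<G> g"] and VY = rext_VF[OF Y1, of "src \<G> g"]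
    \<comment> \<open>The expression defining \<open>ad_dagger\<close>, rewritten from the base to
      the arrow \<open>g\<close>.\<close>
    have P: "anchor \<G> A y (inner Y B) - inner (ad \<G> A Y) B y =
        rext A g (ip (rext Y) (rext B)) - m g (br (rext A) (rext Y) g) (rext B g)"
      if "algebroid_section \<G> (U \<inter> V) A" "algebroid_section \<G> (U \<inter> V) B" for A B
      using rext_deriv_inner[OF that(1) Y1 that(2) gO] bracket_inner[OF that(1) Y1 that(2) gO]
      by (simp add: y_def)
    \<comment> \<open>The only place where the constant inner product enters.\<close>
    have 0: "rext Y g (ip (rext X) (rext Z)) = 0"
    proof -
      have "rext Y g (ip (rext X) (rext Z)) = rext Y g (\<lambda>q. c)"
      proof (rule T_cong[OF VF_T[OF VY gW'] VF_open[OF VY] gW'])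
        fix q assume q: "q \<in> over (U \<inter> V) \<inter> S (src \<G> g)"
        then have "q \<in> over (U \<inter> V)" "trg \<G> q \<in> U" unfolding over_def by auto
        then show "m q (rext X q) (rext Z q) = c" using rext_inner[OF X1 Z1] const by simp
      qed
      then show ?thesis using T_const[OF VF_T[OF VY gW']] by simp
    qed
    have "2 * m g (D (rext X) (rext Z) g) (rext Y g) = koszul (rext X) (rext Z) (rext Y) g"
      by (rule koszul_formula[OF D VX VZ VY gW'])
    also have "\<dots> = m ?p (Y y) ?a + m ?p (Y y) ?b + m ?p (Y y) ?c"
    proof -
      have "m ?p (Y y) ?a = rext X g (ip (rext Y) (rext Z)) - m g (br (rext X) (rext Y) g) (rext Z g)"
        using a[THEN conjunct2, rule_format, OF conjI[OF Y(1,2)]] P[OF X1 Z1] by simp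
      moreover have "m ?p (Y y) ?b = rext Z g (ip (rext Y) (rext X)) - m g (br (rext Z) (rext Y) g) (rext X g)"
        using b[THEN conjunct2, rule_format, OF conjI[OF Y(1,2)]] P[OF Z1 X1] by simp
      moreover have "m ?p (Y y) ?c = m g (br (rext X) (rext Z) g) (rext Y g)"
        using bracket_inner[OF X1 Z1 Y1 gO] y.m_sym[OF YT aT(3)] by (simp add: algebroid_inner_def y_def)
      ultimately show ?thesis
        unfolding koszul_def
        using 0 d_ip_swap[OF VX VZ VY gW'] m_br_swap[OF VX VY gW' VF_T[OF VZ gW']] by simp
    qed
    also have "\<dots> = 2 * m ?p (Y y) w"
      unfolding w_eq
      using y.m_scale_right[OF y.T_tadd[OF y.T_tadd[OF aT(1,2)] aT(3)] YT]
        y.m_add_right[OF y.T_tadd[OF aT(1,2)] aT(3) YT] y.m_add_right[OF aT(1,2) YT] by simp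
    also have "m ?p (Y y) w = m g (rext Y g) (transport g w)"
      unfolding rext_transport y_def
      by (rule transport_isometry[OF ga(1), symmetric]) (use YA wA in \<open>simp_all add: y_def\<close>)
    finally show "m g (D (rext X) (rext Z) g) u = m g (transport g w) u"
      using Yg m_sym[OF u transport_T[OF tr]] by simp
  qed
qed

theorem sectional_curvature_rext:
  assumes X: "algebroid_section \<G> U X" and Y: "algebroid_section \<G> U Y" and g: "g \<in> over U"
    and on: "\<And>x. x \<in> U \<Longrightarrow> inner X X x = 1" "\<And>x. x \<in> U \<Longrightarrow> inner Y Y x = 1"
      "\<And>x. x \<in> U \<Longrightarrow> inner X Y x = 0"
  shows "sectional_curvature M (S (src \<G> g)) m g (rext X g) (rext Y g) = curvature_formula \<G> m X Y (trg \<G> g)"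
proof -
  define y where "y = trg \<G> g"
  interpret y: riemannian M "S y" m by (rule riem)
  interpret riemannian M "S (src \<G> g)" m by (rule riem)
  have ga: "g \<in> arrows \<G>" "y \<in> U" using g unfolding over_def y_def by auto
  have yo: "y \<in> objects \<G>" by (rule sectionD(3)[OF X ga(2)])
  let ?p = "ident \<G> y" and ?W = "over U \<inter> S (src \<G> g)"
  let ?X = "rext X" and ?Y = "rext Y" and ?D = "levi_civita M (S (src \<G> g)) m"
  \<comment> \<open>Twice \<alpha>. Being again a section, it can serve as a test section for
    \<open>ad_dagger\<close>.\<close>
  define Ad where "Ad = ad \<G> X Y"
  have Ads: "algebroid_section \<G> U Ad" unfolding Ad_def by (rule ad_section[OF X Y])
  let ?A = "br ?X ?Y"
  have gW: "g \<in> ?W" using g ga(1) by (simp add: S_iff)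
  note VX = rext_VF[OF X, of "src \<G> g"] and VY = rext_VF[OF Y, of "src \<G> g"]
  note VA = VF_br[OF VX VY] and VAd = rext_VF[OF Ads, of "src \<G> g"]
  have Aeq: "?A q = rext Ad q" if "q \<in> ?W" for q
    using bracket_rext[OF X Y, of q] that unfolding Ad_def by (simp add: S_iff)
  have in_W: "q \<in> over U" "trg \<G> q \<in> U" if "q \<in> ?W" for q using that unfolding over_def by auto
  let ?a = "ad_dagger \<G> m X Y y" and ?b = "ad_dagger \<G> m Y X y" and ?c = "Ad y"
  let ?ax = "ad_dagger \<G> m X X y" and ?ay = "ad_dagger \<G> m Y Y y"
  note sp = ad_dagger_spec[OF X Y ga(2)] ad_dagger_spec[OF Y X ga(2)] ad_dagger_spec[OF X X ga(2)] ad_dagger_spec[OF Y Y ga(2)]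
  have T: "?a \<in> y.T ?p" "?b \<in> y.T ?p" "?c \<in> y.T ?p" "?ax \<in> y.T ?p" "?ay \<in> y.T ?p"
    using sp sectionD(2)[OF Ads ga(2)] fibre_eq[OF yo] by auto
  have inner_sym: "inner Y X x = inner X Y x" if x: "x \<in> U" for x
  proof -
    interpret x: riemannian M "S x" m by (rule riem)
    show ?thesis
      using x.m_sym[of "Y x" "ident \<G> x" "X x"] sectionD(2)[OF X x] sectionD(2)[OF Y x] fibre_eq[OF sectionD(3)[OF X x]]
      by (simp add: algebroid_inner_def)
  qed
  have swap: "ad \<G> Y X y = tscale (-1) ?c" "ad \<G> X X y = (\<lambda>f. 0)" "ad \<G> Y Y y = (\<lambda>f. 0)"
    by (auto simp: Ad_def ad_def lie_bracket_def tscale_def)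
  have D: "is_levi_civita M (S (src \<G> g)) m ?D" by (rule levi_civita)
  let ?s = "tadd ?a ?b"
  have sT: "?s \<in> y.T ?p" by (rule y.T_tadd[OF T(1,2)])
  have DXY: "?D ?X ?Y g = transport g (tscale (1/2) (tadd ?s ?c))"
    and DYX: "?D ?Y ?X g = transport g (tscale (1/2) (tdiff ?s ?c))"
    and DXX: "?D ?X ?X g = transport g ?ax" and DYY: "?D ?Y ?Y g = transport g ?ay"
  proof -
    have "?D ?Y ?X g = transport g (\<lambda>f. (?b f + ?a f + ad \<G> Y X y f) / 2)"
      unfolding y_def by (rule connection_rext(2)[OF D Y X g]) (simp add: inner_sym on)
    then show "?D ?Y ?X g = transport g (tscale (1/2) (tdiff ?s ?c))"
      by (simp add: swap tadd_def tscale_def add.commute)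
    show "?D ?X ?Y g = transport g (tscale (1/2) (tadd ?s ?c))"
      using connection_rext(2)[OF D X Y g on(3)] by (simp add: y_def Ad_def tadd_def tscale_def)
    \<comment> \<open>For equal arguments the bracket vanishes and the two adjoints coincide, so the
      factor 1/2 disappears.\<close>
    show "?D ?X ?X g = transport g ?ax"
      using connection_rext(2)[OF D X X g on(1)] swap(2) by (simp add: y_def)
    show "?D ?Y ?Y g = transport g ?ay"
      using connection_rext(2)[OF D Y Y g on(2)] swap(3) by (simp add: y_def)
  qed
  have iso: "m g (transport g u) (transport g v) = m ?p u v" if "u \<in> y.T ?p" "v \<in> y.T ?p" for u v
    unfolding y_def by (rule transport_isometry[OF ga(1)]) (use that fibre_eq[OF yo] in \<open>simp_all add: y_def\<close>)
  let ?q = "m ?p"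
  have "m g (?D ?X ?Y g) (?D ?Y ?X g) = ?q (tscale (1/2) (tadd ?s ?c)) (tscale (1/2) (tdiff ?s ?c))"
    unfolding DXY DYX by (intro iso y.T_tscale y.T_tadd sT T)
  \<comment> \<open>The product of half the sum and half the difference of \<open>?s\<close> and
    \<open>?c\<close>; the mixed terms cancel by symmetry.\<close>
  also have "\<dots> = 1/4 * (?q ?s ?s - ?q ?c ?c)"
    using y.m_scale_left[OF y.T_tadd[OF sT T(3)] y.T_tscale[OF y.T_tadd[OF sT y.T_tscale[OF T(3)]]]]
      y.m_scale_right[OF y.T_tadd[OF sT y.T_tscale[OF T(3)]] y.T_tadd[OF sT T(3)]]
      y.m_add_left[OF sT T(3) y.T_tadd[OF sT y.T_tscale[OF T(3)]]]
      y.m_add_right[OF sT y.T_tscale[OF T(3)] sT] y.m_add_right[OF sT y.T_tscale[OF T(3)] T(3)]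
      y.m_scale_right[OF T(3) sT] y.m_scale_right[OF T(3) T(3)] y.m_sym[OF sT T(3)] by simp
  finally have 1: "m g (?D ?X ?Y g) (?D ?Y ?X g) = 1/4 * (?q ?s ?s - ?q ?c ?c)" .
  have 2: "m g (?D ?X ?X g) (?D ?Y ?Y g) = ?q ?ax ?ay" unfolding DXX DYY by (rule iso[OF T(4,5)])
  have 3: "m g (?A g) (?A g) = ?q ?c ?c"
    unfolding Aeq[OF gW] using rext_inner[OF Ads Ads g] by (simp add: algebroid_inner_def y_def)
  have ipA: "rext Z g (ip ?A (rext B)) = anchor \<G> Z y (inner Ad B)"
    and anc: "anchor \<G> Z y (inner (\<lambda>x. tscale (1/2) (ad \<G> X Y x)) B) = 1/2 * anchor \<G> Z y (inner Ad B)"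
    if B: "algebroid_section \<G> U B" and Z: "algebroid_section \<G> U Z" for B Z
  proof -
    let ?\<alpha> = "\<lambda>x. tscale (1/2) (ad \<G> X Y x)"
    note VZ = rext_VF[OF Z, of "src \<G> g"] and VB = rext_VF[OF B, of "src \<G> g"]
    have d: "rext Z g (ip (rext Ad) (rext B)) = anchor \<G> Z y (inner Ad B)"
      using rext_deriv_inner[OF Z Ads B g] by (simp add: y_def)
    have "rext Z g (ip ?A (rext B)) = rext Z g (ip (rext Ad) (rext B))"
      by (rule T_cong[OF VF_T[OF VZ gW] VF_open[OF VX] gW]) (simp add: Aeq)
    then show "rext Z g (ip ?A (rext B)) = anchor \<G> Z y (inner Ad B)" using d by simp
    have half: "inner ?\<alpha> B x = 1/2 * inner Ad B x" if x: "x \<in> U" for x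
    proof -
      interpret x: riemannian M "S x" m by (rule riem)
      show ?thesis
        using x.m_scale_left[of "Ad x" "ident \<G> x" "B x"] sectionD(2)[OF Ads x] sectionD(2)[OF B x]
          fibre_eq[OF sectionD(3)[OF X x]] by (simp add: algebroid_inner_def Ad_def)
    qed
    \<comment> \<open>\<open>anchor\<close> returns 0 on functions that are not smooth, so
      smoothness has to be known before the factor 1/2 can be pulled out.\<close>
    have "smooth_fun N (objects \<G>) y (inner ?\<alpha> B)"
      by (rule smooth_near_cong[OF N smooth_atlas_real smooth_fun_scale[OF N inner_smooth[OF Ads B ga(2)]]
            sectionD(1)[OF X] ga(2)]) (rule half[symmetric])
    then have "anchor \<G> Z y (inner ?\<alpha> B) = rext Z g (\<lambda>q. inner ?\<alpha> B (trg \<G> q))"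
      using rext_target[of Z g "inner ?\<alpha> B"] sectionD(2)[OF Z ga(2)] ga(1) by (simp add: y_def)
    also have "\<dots> = rext Z g (\<lambda>q. 1/2 * ip (rext Ad) (rext B) q)"
    proof (rule T_cong[OF VF_T[OF VZ gW] VF_open[OF VX] gW])
      fix q assume q: "q \<in> ?W"
      show "inner ?\<alpha> B (trg \<G> q) = 1/2 * ip (rext Ad) (rext B) q"
        using half[OF in_W(2)[OF q]] rext_inner[OF Ads B in_W(1)[OF q]] by simp
    qed
    also have "\<dots> = 1/2 * anchor \<G> Z y (inner Ad B)"
      unfolding d[symmetric] by (rule T_cmult[OF VF_T[OF VZ gW] ip_C[OF VAd VB gW]])
    finally show "anchor \<G> Z y (inner ?\<alpha> B) = 1/2 * anchor \<G> Z y (inner Ad B)" .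
  qed
  \<comment> \<open>Testing \<open>ad_dagger X Y\<close> on the section \<open>[X,Y]\<close> itself
    trades the iterated bracket for a derivative and an inner product with
    \<open>?a\<close>.\<close>
  have 4: "m g (br ?X ?A g) (?Y g) = anchor \<G> X y (inner Ad Y) - ?q ?c ?a"
  proof -
    have "br ?X ?A g = br ?X (rext Ad) g" by (rule br_cong[OF VX VA gW refl Aeq])
    then have "m g (br ?X ?A g) (?Y g) = inner (ad \<G> X Ad) Y y"
      using bracket_inner[OF X Ads Y g] by (simp add: y_def)
    moreover have "?q ?c ?a = anchor \<G> X y (inner Ad Y) - inner (ad \<G> X Ad) Y y"
      using sp(1) ga(2) Ads by blast
    ultimately show ?thesis by simp
  qed
  have 5: "m g (br ?Y ?A g) (?X g) = anchor \<G> Y y (inner Ad X) - ?q ?c ?b"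
  proof -
    have "br ?Y ?A g = br ?Y (rext Ad) g" by (rule br_cong[OF VY VA gW refl Aeq])
    then have "m g (br ?Y ?A g) (?X g) = inner (ad \<G> Y Ad) X y"
      using bracket_inner[OF Y Ads X g] by (simp add: y_def)
    moreover have "?q ?c ?b = anchor \<G> Y y (inner Ad X) - inner (ad \<G> Y Ad) X y"
      using sp(2) ga(2) Ads by blast
    ultimately show ?thesis by simp
  qed
  have orth: "m q (?X q) (?X q) = 1" "m q (?Y q) (?Y q) = 1" "m q (?X q) (?Y q) = 0" if "q \<in> ?W" for q
    using rext_inner[OF X X in_W(1)[OF that]] rext_inner[OF Y Y in_W(1)[OF that]]
      rext_inner[OF X Y in_W(1)[OF that]] on in_W(2)[OF that] by simp_all
  have sc: "?q (tscale (1/2) u) (tscale (1/2) v) = 1/4 * ?q u v" if "u \<in> y.T ?p" "v \<in> y.T ?p" for u v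
    using y.m_scale_left[OF that(1) y.T_tscale[OF that(2)]] y.m_scale_right[OF that(2,1)] by simp
  have ab: "?q ?c (tdiff ?a ?b) = ?q ?c ?a - ?q ?c ?b"
    using y.m_add_right[OF T(1) y.T_tscale[OF T(2)] T(3)] y.m_scale_right[OF T(2,3)] by simp
  \<comment> \<open>At \<open>y\<close> the vectors \<open>?s\<close>, \<open>tdiff ?a ?b\<close>,
    \<open>?c\<close>, \<open>?ax\<close> and \<open>?ay\<close> are twice \<delta>, \<beta>,
    \<alpha> and the two \<open>B\<close> sections; halving both slots gives the factors
    1/4.\<close>
  have formula: "curvature_formula \<G> m X Y y = anchor \<G> X y (inner Ad Y) - anchor \<G> Y y (inner Ad X)
      + 1/4 * ?q ?s ?s + 1/2 * (?q ?c ?a - ?q ?c ?b) - 3/4 * ?q ?c ?c - ?q ?ax ?ay"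
    unfolding curvature_formula_def Let_def anc[OF Y X] anc[OF X Y]
    unfolding algebroid_inner_def[of _ _ _ _ y] Ad_def[symmetric]
      sc[OF sT sT] sc[OF T(3) y.T_tadd[OF T(1) y.T_tscale[OF T(2)]]] sc[OF T(3,3)] sc[OF T(4,5)] ab
    by simp
  have "sectional_curvature M (S (src \<G> g)) m g (?X g) (?Y g) = m g (curv ?D ?X ?Y ?X g) (?Y g)"
    by (rule sectional_curvature_eq[OF VX VY gW])
  also have "\<dots> = 3/2 * (?X g (ip ?A ?Y) - ?Y g (ip ?A ?X)) - 1/2 * m g (?A g) (?A g)
    - 1/2 * m g (br ?X ?A g) (?Y g) + 1/2 * m g (br ?Y ?A g) (?X g)
    + m g (?D ?X ?Y g) (?D ?Y ?X g) - m g (?D ?X ?X g) (?D ?Y ?Y g)"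
    by (rule curv_orthonormal[OF D VX VY gW orth])
  also have "\<dots> = curvature_formula \<G> m X Y y"
    using formula 1 2 3 4 5 ipA[OF Y X] ipA[OF X Y] by argo
  finally show ?thesis by (simp add: y_def)
qed

end

end

theorem theorem3p15:
  fixes \<G> :: "('g, 'b, 'e::euclidean_space, 'f::real_normed_vector) groupoid_data"
    and m :: "'g \<Rightarrow> 'g tvec \<Rightarrow> 'g tvec \<Rightarrow> real"
    and g :: 'g and u v :: "'g tvec"
  assumes "lie_groupoid \<G>"
    and "right_invariant_metric \<G> m"
    and "g \<in> arrows \<G>"
    and "u \<in> src_tangent \<G> g" and "v \<in> src_tangent \<G> g"
    and "m g u u = 1" and "m g v v = 1" and "m g u v = 0"
  shows "(\<forall>X Y. orthonormal_extension \<G> m g u v X Y \<longrightarrow>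
            sectional_curvature (arr \<G>) (src_fibre \<G> (src \<G> g)) m g u v
              = curvature_formula \<G> m X Y (trg \<G> g)) \<and>
         (\<forall>X Y X' Y'. orthonormal_extension \<G> m g u v X Y \<and> orthonormal_extension \<G> m g u v X' Y' \<longrightarrow>
            curvature_formula \<G> m X Y (trg \<G> g) = curvature_formula \<G> m X' Y' (trg \<G> g))"
proof -
  interpret lie_groupoid_locale \<G> by unfold_locales (rule assms(1))
  have main: "sectional_curvature (arr \<G>) (src_fibre \<G> (src \<G> g)) m g u v = curvature_formula \<G> m X Y (trg \<G> g)"
    if ext: "orthonormal_extension \<G> m g u v X Y" for X Y
  proof -
    obtain U where U: "trg \<G> g \<in> U" "algebroid_section \<G> U X" "algebroid_section \<G> U Y"
      and on: "\<And>x. x \<in> U \<Longrightarrow> algebroid_inner \<G> m X X x = 1" "\<And>x. x \<in> U \<Longrightarrow> algebroid_inner \<G> m Y Y x = 1"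
        "\<And>x. x \<in> U \<Longrightarrow> algebroid_inner \<G> m X Y x = 0"
      and XY: "X (trg \<G> g) = dR \<G> (ginv \<G> g) g u" "Y (trg \<G> g) = dR \<G> (ginv \<G> g) g v"
      using ext unfolding orthonormal_extension_def by blast
    have "rext X g = u" "rext Y g = v"
      unfolding rext_transport XY using transport_dR_inv assms(3-5) by blast+
    then show ?thesis
      using sectional_curvature_rext[OF assms(2) U(2,3) _ on, of g] U(1) assms(3) by (simp add: over_def)
  qed
  \<comment> \<open>Independence of the extensions is a consequence: both formulas equal a curvature
    that does not mention them.\<close>
  then show ?thesis by metis
qed

end
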